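(* Let $n\ge 1$ and let $d_1|d_2|\cdots|d_n$ be a polarization type such that $$d_1 d_2\cdots d_n \;\geq\; \frac{8^n}{2}\cdot\frac{n^n}{n!}.$$ (Equivalently, $h^0(A,L)\geq \frac{8^n}{2}\cdot\frac{n^n}{n!}$ for every polarized abelian variety $(A,L)$ of this type, since $h^0(A,L)=d_1\cdots d_n$.) Then a general $n$-dimensional polarized abelian variety $(A,L)$ of polarization type $(d_1,\dots,d_n)$ is projectively normal.
   Context: A polarized abelian variety $(A,L)$ of dimension $n$ is a complex abelian variety $A$ of dimension $n$ together with an ample line bundle $L$ on $A$; its polarization type is the sequence of positive integers $d_1|d_2|\cdots|d_n$ (elementary divisors of the alternating form $c_1(L)$ on the lattice), and $h^0(A,L)=\dim_{\mathbb C}H^0(A,L)=d_1\cdots d_n$. For $r\geq 1$ let $\rho_r:\mathrm{Sym}^r H^0(A,L)\to H^0(A,L^{\otimes r})$ be the multiplication map induced by $(\sigma_1,\dots,\sigma_r)\mapsto \sigma_1\cdots\sigma_r$. The pair $(A,L)$ (or simply $L$) is called projectively normal if $\rho_r$ is surjective for every $r\geq 1$. Let $\mathcal A_{(d_1,\dots,d_n)}$ be the moduli space of $n$-dimensional polarized abelian varieties of type $(d_1,\dots,d_n)$. A property holds for a general $(A,L)$ of this type if it holds for all $(A,L)$ in some nonempty Zariski open subset of $\mathcal A_{(d_1,\dots,d_n)}$. *)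

theory Defs
  imports "HOL-Analysis.Analysis" "HOL-Library.Multiset" "HOL-Library.Poly_Mapping"
begin

section \<open>Holomorphic functions of several variables\<close>

text \<open>
  Holomorphic means complex differentiable: the real Frechet derivative is complex linear with
  respect to the scalar multiplication \<open>sc\<close>. The domain \<open>S\<close> need not be open in the ambient
  type: for the Siegel space below it is open in the subspace of symmetric matrices.
\<close>

definition holomorphic_wrt ::
    "(complex \<Rightarrow> 'v \<Rightarrow> 'v) \<Rightarrow> 'v::real_normed_vector set \<Rightarrow> ('v \<Rightarrow> complex) \<Rightarrow> bool" where
  "holomorphic_wrt sc S f \<longleftrightarrow>
     (\<forall>x\<in>S. \<exists>f'. (f has_derivative f') (at x within S) \<and> (\<forall>c v. f' (sc c v) = c * f' v))"

abbreviation entire :: "(complex^'n \<Rightarrow> complex) \<Rightarrow> bool" where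
  "entire f \<equiv> holomorphic_wrt (*s) UNIV f"

definition matrix_scale :: "complex \<Rightarrow> complex^'n^'m \<Rightarrow> complex^'n^'m" where
  "matrix_scale c Z = (\<chi> i j. c * Z $ i $ j)"

section \<open>Complex tori and line bundles\<close>

definition full_rank_lattice :: "(complex^'n) set \<Rightarrow> bool" where
  "full_rank_lattice \<Lambda> \<longleftrightarrow>
     0 \<in> \<Lambda> \<and> (\<forall>l\<in>\<Lambda>. \<forall>m\<in>\<Lambda>. l - m \<in> \<Lambda>) \<and>
     (\<exists>\<epsilon>>0. \<forall>l\<in>\<Lambda>. l \<noteq> 0 \<longrightarrow> \<epsilon> \<le> norm l) \<and>
     span \<Lambda> = UNIV"

text \<open>
  Every holomorphic line bundle on the torus \<open>A = \<complex>\<^sup>n / \<Lambda>\<close> becomes trivial on the universal cover,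
  hence is the quotient of \<open>\<complex>\<^sup>n \<times> \<complex>\<close> by the action \<open>l \<cdot> (v, t) = (v + l, e l v * t)\<close> of \<open>\<Lambda>\<close> for a
  factor of automorphy \<open>e\<close>. A pair \<open>(A, L)\<close> is represented by \<open>(\<Lambda>, e)\<close>. Sections of \<open>L\<close> are the
  entire functions compatible with \<open>e\<close>, and the tensor power of exponent \<open>r\<close> has the factor \<open>e\<^sup>r\<close>.
\<close>

type_synonym 'n line_bundle = "complex^'n \<Rightarrow> complex^'n \<Rightarrow> complex"

definition factor_of_automorphy :: "(complex^'n) set \<Rightarrow> 'n line_bundle \<Rightarrow> bool" where
  "factor_of_automorphy \<Lambda> e \<longleftrightarrow>
     (\<forall>l\<in>\<Lambda>. entire (e l) \<and> (\<forall>v. e l v \<noteq> 0)) \<and>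
     (\<forall>l\<in>\<Lambda>. \<forall>m\<in>\<Lambda>. \<forall>v. e (l + m) v = e l (v + m) * e m v)"

definition tensor_power :: "'n line_bundle \<Rightarrow> nat \<Rightarrow> 'n line_bundle" where
  "tensor_power e r = (\<lambda>l v. e l v ^ r)"

definition H0 :: "(complex^'n) set \<Rightarrow> 'n line_bundle \<Rightarrow> (complex^'n \<Rightarrow> complex) set" where
  "H0 \<Lambda> e = {\<theta>. entire \<theta> \<and> (\<forall>l\<in>\<Lambda>. \<forall>v. \<theta> (v + l) = e l v * \<theta> v)}"

text \<open>
  The line bundle is very ample if finitely many sections \<open>\<theta> 0, \<dots>, \<theta> N\<close> define a holomorphic
  embedding \<open>v \<mapsto> [\<theta> 0 v : \<dots> : \<theta> N v]\<close> of \<open>\<complex>\<^sup>n / \<Lambda>\<close> into projective space. The three clauses say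
  that this map is well defined, injective, and an immersion: the kernel of the differential of
  \<open>\<complex>\<^sup>N\<^sup>+\<^sup>1 - {0} \<rightarrow> \<PP>\<^sup>N\<close> at a point is the line spanned by that point.
\<close>

definition very_ample :: "(complex^'n) set \<Rightarrow> 'n line_bundle \<Rightarrow> bool" where
  "very_ample \<Lambda> e \<longleftrightarrow>
     (\<exists>N. \<exists>\<theta>::nat \<Rightarrow> complex^'n \<Rightarrow> complex.
        (\<forall>i\<le>N. \<theta> i \<in> H0 \<Lambda> e) \<and>
        (\<forall>v. \<exists>i\<le>N. \<theta> i v \<noteq> 0) \<and>
        (\<forall>v w. (\<exists>c. \<forall>i\<le>N. \<theta> i w = c * \<theta> i v) \<longrightarrow> w - v \<in> \<Lambda>) \<and>
        (\<forall>v u. (\<exists>c. \<forall>i\<le>N. frechet_derivative (\<theta> i) (at v) u = c * \<theta> i v) \<longrightarrow> u = 0))"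

definition ample :: "(complex^'n) set \<Rightarrow> 'n line_bundle \<Rightarrow> bool" where
  "ample \<Lambda> e \<longleftrightarrow> (\<exists>r\<ge>1. very_ample \<Lambda> (tensor_power e r))"

definition polarized_abelian_variety :: "(complex^'n) set \<Rightarrow> 'n line_bundle \<Rightarrow> bool" where
  "polarized_abelian_variety \<Lambda> e \<longleftrightarrow> full_rank_lattice \<Lambda> \<and> factor_of_automorphy \<Lambda> e \<and> ample \<Lambda> e"

section \<open>Polarization type\<close>

text \<open>
  The first Chern class, as an alternating integral form on \<open>\<Lambda>\<close>: if \<open>e l = exp (2 \<pi> i g\<^sub>l)\<close> then
  \<open>c\<^sub>1(L)(l, m) = g\<^sub>m (v + l) + g\<^sub>l v - g\<^sub>l (v + m) - g\<^sub>m v\<close>. The value depends neither on \<open>v\<close> nor on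
  the choice of the logarithms, which are unique up to integer constants. With this sign
  convention \<open>c\<^sub>1(L) (i x, x)\<close> is positive for ample \<open>L\<close> and \<open>x \<noteq> 0\<close> (extending real bilinearly).
\<close>

definition chern_form :: "'n line_bundle \<Rightarrow> complex^'n \<Rightarrow> complex^'n \<Rightarrow> int" where
  "chern_form e l m =
     (THE k. \<exists>g h. entire g \<and> entire h \<and>
        (\<forall>v. e l v = exp (2 * of_real pi * \<i> * g v)) \<and>
        (\<forall>v. e m v = exp (2 * of_real pi * \<i> * h v)) \<and>
        (\<forall>v. of_int k = h (v + l) + g v - g (v + m) - h v))"

definition symplectic_basis ::
    "('n \<Rightarrow> nat) \<Rightarrow> (complex^'n) set \<Rightarrow> 'n line_bundle \<Rightarrow>
     ('n \<Rightarrow> complex^'n) \<Rightarrow> ('n \<Rightarrow> complex^'n) \<Rightarrow> bool" where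
  "symplectic_basis d \<Lambda> e a b \<longleftrightarrow>
     \<Lambda> = {(\<Sum>i\<in>UNIV. of_int (p i) *s a i + of_int (q i) *s b i) | p q. True} \<and>
     (\<forall>i j. chern_form e (a i) (a j) = 0 \<and> chern_form e (b i) (b j) = 0 \<and>
            chern_form e (a i) (b j) = (if i = j then int (d i) else 0) \<and>
            chern_form e (b j) (a i) = (if i = j then - int (d i) else 0))"

definition polarization_type ::
    "('n \<Rightarrow> nat) \<Rightarrow> (complex^'n) set \<Rightarrow> 'n line_bundle \<Rightarrow> bool" where
  "polarization_type d \<Lambda> e \<longleftrightarrow> (\<exists>a b. symplectic_basis d \<Lambda> e a b)"

section \<open>The moduli space and its Zariski topology\<close>

definition siegel :: "(complex^'n^'n) set" where
  "siegel = {Z. transpose Z = Z \<and>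
                (\<forall>x::real^'n. x \<noteq> 0 \<longrightarrow> 0 < x \<bullet> ((\<chi> i j. Im (Z $ i $ j)) *v x))}"

definition diag_matrix :: "('n \<Rightarrow> nat) \<Rightarrow> complex^'n^'n" where
  "diag_matrix d = (\<chi> i j. if i = j then of_nat (d i) else 0)"

definition integral_matrix :: "complex^'n^'n \<Rightarrow> bool" where
  "integral_matrix M \<longleftrightarrow> (\<forall>i j. M $ i $ j \<in> \<int>)"

text \<open>
  With \<open>D = diag_matrix d\<close>, these are the integral block matrices \<open>R\<close> with rows \<open>(\<alpha>, \<beta>)\<close> and
  \<open>(\<gamma>, \<delta>)\<close> satisfying \<open>R J R\<^sup>t = J\<close> for \<open>J\<close> with rows \<open>(0, D)\<close> and \<open>(-D, 0)\<close>, i.e. the changes of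
  symplectic basis for type \<open>d\<close>. Expressing the new periods in the new complex basis
  (the \<open>b i / d i\<close>) gives the action on the Siegel space.
\<close>

type_synonym 'n block_matrix =
  "(complex^'n^'n) \<times> (complex^'n^'n) \<times> (complex^'n^'n) \<times> (complex^'n^'n)"

definition paramodular_group :: "('n::finite \<Rightarrow> nat) \<Rightarrow> 'n block_matrix set" where
  "paramodular_group d = {(\<alpha>, \<beta>, \<gamma>, \<delta>).
     integral_matrix \<alpha> \<and> integral_matrix \<beta> \<and> integral_matrix \<gamma> \<and> integral_matrix \<delta> \<and>
     \<alpha> ** diag_matrix d ** transpose \<beta> = \<beta> ** diag_matrix d ** transpose \<alpha> \<and>
     \<gamma> ** diag_matrix d ** transpose \<delta> = \<delta> ** diag_matrix d ** transpose \<gamma> \<and>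
     \<alpha> ** diag_matrix d ** transpose \<delta> - \<beta> ** diag_matrix d ** transpose \<gamma> = diag_matrix d}"

definition denominator ::
    "('n::finite \<Rightarrow> nat) \<Rightarrow> 'n block_matrix \<Rightarrow> complex^'n^'n \<Rightarrow> complex^'n^'n" where
  "denominator d R Z =
     (case R of (\<alpha>, \<beta>, \<gamma>, \<delta>) \<Rightarrow> matrix_inv (diag_matrix d) ** (\<gamma> ** Z + \<delta> ** diag_matrix d))"

definition siegel_action ::
    "('n::finite \<Rightarrow> nat) \<Rightarrow> 'n block_matrix \<Rightarrow> complex^'n^'n \<Rightarrow> complex^'n^'n" where
  "siegel_action d R Z =
     (case R of (\<alpha>, \<beta>, \<gamma>, \<delta>) \<Rightarrow>
        (\<alpha> ** Z + \<beta> ** diag_matrix d) ** matrix_inv (denominator d R Z))"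

text \<open>The moduli space of polarized abelian varieties of type \<open>d\<close>, as the set of orbits.\<close>

definition moduli_space :: "('n::finite \<Rightarrow> nat) \<Rightarrow> (complex^'n^'n) set set" where
  "moduli_space d =
     siegel // {(Z, W). Z \<in> siegel \<and> W \<in> siegel \<and>
                        (\<exists>R\<in>paramodular_group d. W = siegel_action d R Z)}"

text \<open>
  The point of the moduli space given by \<open>(A, L)\<close>: the orbit of all its period matrices \<open>Z\<close>, for
  which the columns of \<open>(Z, D)\<close> are a symplectic basis in the coordinates given by the \<open>b i / d i\<close>.
\<close>

definition moduli_point ::
    "('n \<Rightarrow> nat) \<Rightarrow> (complex^'n) set \<Rightarrow> 'n line_bundle \<Rightarrow> (complex^'n^'n) set" where
  "moduli_point d \<Lambda> e =
     {Z. \<exists>a b. symplectic_basis d \<Lambda> e a b \<and>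
               (\<forall>i. a i = (\<Sum>j\<in>UNIV. (Z $ j $ i / of_nat (d j)) *s b j))}"

text \<open>
  Siegel modular forms of weight \<open>k\<close>. Boundedness at the cusp needs to be imposed only in
  dimension one (Koecher principle); there the group is conjugate to \<open>SL\<^sub>2(\<int>)\<close> and has a single
  cusp.
\<close>

definition modular_form ::
    "('n::finite \<Rightarrow> nat) \<Rightarrow> nat \<Rightarrow> (complex^'n^'n \<Rightarrow> complex) \<Rightarrow> bool" where
  "modular_form d k f \<longleftrightarrow>
     holomorphic_wrt matrix_scale siegel f \<and>
     (\<forall>R\<in>paramodular_group d. \<forall>Z\<in>siegel.
        f (siegel_action d R Z) = det (denominator d R Z) ^ k * f Z) \<and>
     (CARD('n) = 1 \<longrightarrow> bounded (f ` {Z \<in> siegel. \<forall>i. 1 \<le> Im (Z $ i $ i)}))"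

text \<open>
  By Baily and Borel, the moduli space is a Zariski open subset of \<open>Proj\<close> of the graded ring of
  modular forms; this is its structure of a quasi-projective variety. Its Zariski closed subsets
  are therefore the common zero loci of sets of modular forms, of possibly different weights.
\<close>

definition zariski_closed :: "('n::finite \<Rightarrow> nat) \<Rightarrow> (complex^'n^'n) set set \<Rightarrow> bool" where
  "zariski_closed d C \<longleftrightarrow>
     (\<exists>F. (\<forall>f\<in>F. \<exists>k. modular_form d k f) \<and>
          C = {x \<in> moduli_space d. \<forall>Z\<in>x. \<forall>f\<in>F. f Z = 0})"

definition zariski_open :: "('n::finite \<Rightarrow> nat) \<Rightarrow> (complex^'n^'n) set set \<Rightarrow> bool" where
  "zariski_open d U \<longleftrightarrow> U \<subseteq> moduli_space d \<and> zariski_closed d (moduli_space d - U)"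

definition holds_for_general ::
    "('n::finite \<Rightarrow> nat) \<Rightarrow> ((complex^'n) set \<Rightarrow> 'n line_bundle \<Rightarrow> bool) \<Rightarrow> bool" where
  "holds_for_general d P \<longleftrightarrow>
     (\<exists>U. zariski_open d U \<and> U \<noteq> {} \<and>
        (\<forall>\<Lambda> e. polarized_abelian_variety \<Lambda> e \<and> polarization_type d \<Lambda> e \<and>
                moduli_point d \<Lambda> e \<in> U \<longrightarrow> P \<Lambda> e))"

section \<open>Symmetric powers and multiplication maps\<close>

text \<open>
  The symmetric power of exponent \<open>r\<close> of a complex vector space \<open>W\<close> of functions: the free vector
  space on the multisets of \<open>r\<close> elements of \<open>W\<close> (the symbols \<open>\<sigma>\<^sub>1 \<cdots> \<sigma>\<^sub>r\<close>) modulo multilinearity.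
\<close>

definition sym_free :: "nat \<Rightarrow> ('v \<Rightarrow> complex) set \<Rightarrow> (('v \<Rightarrow> complex) multiset \<Rightarrow>\<^sub>0 complex) set" where
  "sym_free r W = {x. \<forall>M\<in>Poly_Mapping.keys x. size M = r \<and> set_mset M \<subseteq> W}"

inductive_set sym_relations ::
    "nat \<Rightarrow> ('v \<Rightarrow> complex) set \<Rightarrow> (('v \<Rightarrow> complex) multiset \<Rightarrow>\<^sub>0 complex) set"
  for r W where
  zero: "0 \<in> sym_relations r W"
| step: "x \<in> sym_relations r W \<Longrightarrow> \<sigma> \<in> W \<Longrightarrow> \<tau> \<in> W \<Longrightarrow> set_mset M \<subseteq> W \<Longrightarrow> Suc (size M) = r \<Longrightarrow>
    x + (Poly_Mapping.single (add_mset (\<lambda>v. a * \<sigma> v + b * \<tau> v) M) c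
         - Poly_Mapping.single (add_mset \<sigma> M) (c * a)
         - Poly_Mapping.single (add_mset \<tau> M) (c * b)) \<in> sym_relations r W"

definition sym_power ::
    "nat \<Rightarrow> ('v \<Rightarrow> complex) set \<Rightarrow> (('v \<Rightarrow> complex) multiset \<Rightarrow>\<^sub>0 complex) set set" where
  "sym_power r W =
     sym_free r W // {(x, y). x \<in> sym_free r W \<and> y \<in> sym_free r W \<and> x - y \<in> sym_relations r W}"

definition multiply :: "(('v \<Rightarrow> complex) multiset \<Rightarrow>\<^sub>0 complex) \<Rightarrow> 'v \<Rightarrow> complex" where
  "multiply x = (\<lambda>v. \<Sum>M\<in>Poly_Mapping.keys x. Poly_Mapping.lookup x M * (\<Prod>\<sigma>\<in>#M. \<sigma> v))"

text \<open>
  The multiplication map induced by \<open>multiply\<close> on classes; it is well defined by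
  \<open>multiplication_map_class\<close> below.
\<close>

definition multiplication_map ::
    "(('v \<Rightarrow> complex) multiset \<Rightarrow>\<^sub>0 complex) set \<Rightarrow> 'v \<Rightarrow> complex" where
  "multiplication_map X = the_elem (multiply ` X)"

definition projectively_normal :: "(complex^'n) set \<Rightarrow> 'n line_bundle \<Rightarrow> bool" where
  "projectively_normal \<Lambda> e \<longleftrightarrow>
     (\<forall>r\<ge>1. multiplication_map ` sym_power r (H0 \<Lambda> e) = H0 \<Lambda> (tensor_power e r))"

lemma multiply_add: "multiply (x + y) v = multiply x v + multiply y v"
  unfolding multiply_def
  by (rule setsum_keys_plus_distrib) (simp_all add: algebra_simps)

lemma multiply_single: "multiply (Poly_Mapping.single M c) v = c * (\<Prod>\<sigma>\<in>#M. \<sigma> v)"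
  by (simp add: multiply_def)

lemma multiply_diff: "multiply (x - y) v = multiply x v - multiply y v"
  using multiply_add[of "x - y" y v] by simp

lemma multiply_relation: "x \<in> sym_relations r W \<Longrightarrow> multiply x v = 0"
proof (induction rule: sym_relations.induct)
  case zero
  show ?case by (simp add: multiply_def)
next
  case step
  then show ?case
    by (simp add: multiply_add multiply_diff multiply_single algebra_simps)
qed

lemma multiplication_map_class:
  assumes "X \<in> sym_power r W" "x \<in> X"
  shows "multiplication_map X = multiply x"
proof -
  let ?E = "{(x, y). x \<in> sym_free r W \<and> y \<in> sym_free r W \<and> x - y \<in> sym_relations r W}"
  obtain z where z: "X = ?E `` {z}"
    using assms(1) unfolding sym_power_def by (auto elim: quotientE)
  have *: "multiply y = multiply z" if "y \<in> X" for y
  proof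
    fix v
    have "z - y \<in> sym_relations r W" using that z by simp
    then show "multiply y v = multiply z v"
      using multiply_relation[of "z - y"] by (simp add: multiply_diff)
  qed
  have "multiply ` X = {multiply x}"
    using * assms(2) by auto
  then show ?thesis
    by (simp add: multiplication_map_def)
qed

lemma range_multiplication_map:
  "multiplication_map ` sym_power r W = multiply ` sym_free r W"
proof -
  let ?E = "{(x, y). x \<in> sym_free r W \<and> y \<in> sym_free r W \<and> x - y \<in> sym_relations r W}"
  have self: "x \<in> ?E `` {x}" if "x \<in> sym_free r W" for x
    using that by (simp add: sym_relations.zero)
  have "multiplication_map (?E `` {x}) = multiply x" if "x \<in> sym_free r W" for x
  proof (rule multiplication_map_class)
    show "?E `` {x} \<in> sym_power r W"
      unfolding sym_power_def using that by (rule quotientI)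
  qed (rule self[OF that])
  moreover have "sym_power r W = (\<lambda>x. ?E `` {x}) ` sym_free r W"
    unfolding sym_power_def quotient_def by blast
  ultimately show ?thesis
    by (auto simp: image_iff)
qed

end

theory Submission
 imports Defs "HOL-Complex_Analysis.Complex_Analysis" "HOL-Real_Asymp.Real_Asymp"
begin

no_notation fps_nth (infixl "$" 75)

text \<open>
 In coordinates adapted to a symplectic basis, the theorem of Appell and Humbert identifies the
 sections of \<open>L\<^sup>r\<close> with a space of theta functions of dimension \<open>r\<^sup>n d\<^sub>1 \<dots> d\<^sub>n\<close>. By the addition
 formula for theta functions, products of sections generate these spaces for all \<open>r\<close> as soon as, for
 each class \<open>p\<close> modulo \<open>2 D\<close>, some \<open>2\<^sup>n \<times> 2\<^sup>n\<close> minor of a matrix of theta constants does not vanish.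

 This condition is Zariski open: the generators of the paramodular group permute and rescale the
 theta constants, up to finite Fourier transforms, so the transforms of the minors under all group
 elements, of which there are finitely many up to scalars, multiply to a modular form.

 It is satisfied somewhere because \<open>2 d\<^sub>1 \<dots> d\<^sub>n >= 8\<^sup>n\<close>: for \<open>Z = i t P\<^sup>T P\<close> with \<open>P\<close> unipotent and
 \<open>t \<rightarrow> \<infinity>\<close> each theta constant is governed by the shortest vector in its coset, and \<open>P\<close> is chosen such
 that a point of the coset lattice lies within \<open>1/4\<close> of any target. Then the rescaled matrix converges to a
 permutation matrix.
\<close>

section \<open>Functions of several complex variables\<close>

text \<open>The bound \<open>8 ^ n <= 2 * (\<Prod>i. d i)\<close> comes from counting ternary
  digits. If \<open>3 ^ f\<close> is the largest power of 3 not exceeding \<open>d i\<close>, then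
  \<open>d i <= 2 * 4 ^ f\<close>, so the bound forces the exponents f to add up to at least n, and
  one digit is spent on each coordinate that has to be approximated. The tolerance 1/4 is what lets
  one Gaussian dominate each row of a rescaled minor. Degree 2 decides all degrees because the
  minors stay nonzero under small shifts z: for r >= 2 certain products depending on z span the
  sections of degree r + 1, since their coordinates are linearly independent as Fourier series in z.
  The obstacle to openness is that a single minor is not a modular form: the group mixes the theta
  constants by operators that are known only up to scalars. That there are finitely many of them up
  to scalars is read off from the finite Heisenberg group, which they normalise: by Schur's lemma
  the conjugation action fixes an operator up to a scalar. The square roots in the transformation
  law are never resolved, only raised to the eighth power.\<close>

lemma holomorphic_first_order_bounds:
 fixes \<phi> :: "complex => complex"
 assumes hol: "\<phi> holomorphic_on ball 0 R" and B: "\<And>t. t \<in> ball 0 R ==> cmod (\<phi> t) <= B" and R: "R >= 4"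
 shows "cmod (deriv \<phi> 0) <= 2 * B / R"
  and "cmod (\<phi> 1 - \<phi> 0 - deriv \<phi> 0) <= 8 * B / R\<^sup>2"
  and "cmod (\<phi> 1 - \<phi> 0) <= 4 * B / R"
proof -
 have B0: "B >= 0"
  using B[of 0] R norm_ge_zero[of "\<phi> 0"] by (smt (verit) centre_in_ball)
 \<comment> \<open>R >= 4 leaves room for a disc of radius R/2 around every point of the closed unit
   disc.\<close>
 have bd: "cmod ((deriv ^^ n) \<phi> t) <= fact n * B / (R/2) ^ n" if t: "t \<in> cball 0 1" for t n
 proof -
  have sub: "cball t (R/2) \<subseteq> ball 0 R"
  proof
   fix s assume "s \<in> cball t (R/2)"
   hence "cmod s <= cmod t + R/2"
    using norm_triangle_sub[of s t] by (simp add: dist_norm norm_minus_commute)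
   thus "s \<in> ball 0 R" using t R by simp
  qed
  show ?thesis
  proof (rule Cauchy_inequality)
   show "\<phi> holomorphic_on ball t (R/2)"
    using hol sub ball_subset_cball holomorphic_on_subset by blast
   show "continuous_on (cball t (R/2)) \<phi>"
    using hol sub holomorphic_on_imp_continuous_on holomorphic_on_subset by blast
   show "cmod (\<phi> x) <= B" if "cmod (t - x) = R/2" for x
    using that sub by (intro B) (auto simp: dist_norm subset_iff)
  qed (use R in simp)
 qed
 show d: "cmod (deriv \<phi> 0) <= 2 * B / R"
  using bd[of 0 1] by (simp add: field_simps)
 have "cmod ((deriv ^^ 0) \<phi> 1 - (\<Sum>i\<le>1. (deriv ^^ i) \<phi> 0 * (1 - 0) ^ i / fact i))
   <= (8 * B / R\<^sup>2) * cmod (1 - 0) ^ Suc 1 / fact 1"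
 proof (rule complex_Taylor[where S = "cball 0 1"])
  show "((deriv ^^ i) \<phi> has_field_derivative (deriv ^^ Suc i) \<phi> x) (at x within cball 0 1)"
   if "x \<in> cball 0 1" "i <= 1" for i x
  proof (rule has_field_derivative_at_within)
   have "(deriv ^^ i) \<phi> holomorphic_on ball 0 R"
    using hol by (rule holomorphic_higher_deriv) simp
   moreover have "x \<in> ball 0 R" using that R by simp
   ultimately show "((deriv ^^ i) \<phi> has_field_derivative (deriv ^^ Suc i) \<phi> x) (at x)"
    by (simp add: holomorphic_derivI)
  qed
  show "cmod ((deriv ^^ Suc 1) \<phi> x) <= 8 * B / R\<^sup>2" if "x \<in> cball 0 1" for x
   using bd[OF that, of 2] by (simp add: power2_eq_square numeral_2_eq_2 field_simps)
 qed auto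
 thus t: "cmod (\<phi> 1 - \<phi> 0 - deriv \<phi> 0) <= 8 * B / R\<^sup>2"
  by (simp add: algebra_simps)
 have "8 * B / R\<^sup>2 <= 2 * B / R"
 proof -
  have "8 * B / R\<^sup>2 = 2 * B / R * (4 / R)" by (simp add: power2_eq_square)
  also have "\<dots> <= 2 * B / R * 1"
   by (rule mult_left_mono) (use R B0 in auto)
  finally show ?thesis by simp
 qed
 thus "cmod (\<phi> 1 - \<phi> 0) <= 4 * B / R"
  using t d norm_triangle_ineq[of "\<phi> 1 - \<phi> 0 - deriv \<phi> 0" "deriv \<phi> 0"] by simp
qed

text \<open>Holomorphy along complex lines, plus continuity. In this form sums, products, limits and
  integrals are handled by one-variable theorems; Osgood's lemma makes it equivalent to
  \<open>holomorphic_wrt\<close> on open sets.\<close>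

definition slicewise_holomorphic ::
  "(complex => 'v => 'v) => 'v::real_normed_vector set => ('v => complex) => bool" where
 "slicewise_holomorphic sc S f \<longleftrightarrow>
   continuous_on S f \<and> (\<forall>x\<in>S. \<forall>u. (%t. f (x + sc t u)) field_differentiable at 0)"

text \<open>Vectors, matrices and the complex numbers themselves share one theory by abstracting the
  complex scaling.\<close>

locale complex_scaling =
 fixes sc :: "complex => 'v::real_normed_vector => 'v"
 assumes sc_add_right: "sc c (u + v) = sc c u + sc c v"
  and sc_add_left: "sc (a + b) v = sc a v + sc b v"
  and sc_sc: "sc a (sc b v) = sc (a * b) v"
  and sc_of_real: "sc (of_real r) v = r *\<^sub>R v"
  and norm_sc: "norm (sc c v) = cmod c * norm v"
begin

lemma sc_0_left [simp]: "sc 0 v = 0"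
 using sc_of_real[of 0 v] by simp

lemma sc_1_left [simp]: "sc 1 v = v"
 using sc_of_real[of 1 v] by simp

lemma sc_0_right [simp]: "sc c 0 = 0"
 using sc_add_right[of c 0 0] by simp

lemma sc_diff_left: "sc (a - b) v = sc a v - sc b v"
 using sc_add_left[of "a - b" b v] by (simp add: algebra_simps)

lemma continuous_on_sc [continuous_intros]:
 assumes "continuous_on T g" "continuous_on T h"
 shows "continuous_on T (%t. sc (g t) (h t))"
proof -
 have "bounded_bilinear sc"
 proof
  show "\<exists>K. \<forall>a b. norm (sc a b) <= norm a * norm b * K"
   by (rule exI[of _ 1]) (simp add: norm_sc)
  show "sc (r *\<^sub>R a) b = r *\<^sub>R sc a b" for r a b
   by (metis sc_of_real sc_sc scaleR_conv_of_real)
  show "sc a (r *\<^sub>R b) = r *\<^sub>R sc a b" for r a b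
   by (metis mult.commute sc_of_real sc_sc)
 qed (simp_all add: sc_add_left sc_add_right)
 thus ?thesis using assms by (rule bounded_bilinear.continuous_on)
qed

lemma slice_holomorphic_on:
 assumes "open S" "slicewise_holomorphic sc S f" "\<And>t. t \<in> T ==> x + sc t u \<in> S"
 shows "(%t. f (x + sc t u)) holomorphic_on T"
 unfolding holomorphic_on_def
proof
 fix t assume t: "t \<in> T"
 have "(%s. f ((x + sc t u) + sc s u)) field_differentiable at (t - t)"
  using assms t by (simp add: slicewise_holomorphic_def)
 hence "((%s. f ((x + sc t u) + sc s u)) \<circ> (%s. s - t)) field_differentiable at t"
  by (intro field_differentiable_compose derivative_intros) auto
 moreover have "((%s. f ((x + sc t u) + sc s u)) \<circ> (%s. s - t)) = (%s. f (x + sc s u))"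
  by (auto simp: o_def sc_diff_left)
 ultimately show "(%t. f (x + sc t u)) field_differentiable at t within T"
  by (simp add: field_differentiable_at_within)
qed

lemma holomorphic_wrt_imp_slicewise:
 assumes "open S" and f: "holomorphic_wrt sc S f"
 shows "slicewise_holomorphic sc S f"
 unfolding slicewise_holomorphic_def
proof (intro conjI ballI allI)
 have at: "at x within S = at x" if "x \<in> S" for x
  using that assms(1) by (rule at_within_open)
 show "continuous_on S f"
  using f unfolding holomorphic_wrt_def
  by (meson continuous_on_eq_continuous_within has_derivative_continuous)
 fix x u assume x: "x \<in> S"
 then obtain f' where f': "(f has_derivative f') (at x)" and lin: "\<And>c v. f' (sc c v) = c * f' v"
  using f at unfolding holomorphic_wrt_def by metis
 have "bounded_linear (%t. sc t u)"
  by (rule bounded_linear_intro[of _ "norm u"])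
    (auto simp: sc_add_left norm_sc, metis sc_of_real sc_sc scaleR_conv_of_real)
 hence "((%t. x + sc t u) has_derivative (%t. sc t u)) (at 0)"
  by (auto intro!: derivative_eq_intros bounded_linear_imp_has_derivative)
 hence "((f \<circ> (%t. x + sc t u)) has_derivative (f' \<circ> (%t. sc t u))) (at 0)"
  using f' by (intro diff_chain_at) auto
 moreover have "f' \<circ> (%t. sc t u) = (*) (f' u)" by (auto simp: lin)
 ultimately have "((%t. f (x + sc t u)) has_field_derivative f' u) (at 0)"
  by (simp add: has_field_derivative_def o_def)
 thus "(%t. f (x + sc t u)) field_differentiable at 0"
  using field_differentiable_def by blast
qed

text \<open>
 Osgood's lemma. Cauchy estimates on the slices give a quadratic bound for the remainder of the
 first order expansion in every direction; comparing the expansions at \<open>x\<close> and at \<open>x + t u\<close> in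
 direction \<open>w\<close> yields additivity of the directional derivative.
\<close>

lemma slicewise_imp_has_derivative:
 assumes S: "open S" and f: "slicewise_holomorphic sc S f" and x: "x \<in> S"
 shows "\<exists>f'. (f has_derivative f') (at x) \<and> (\<forall>c v. f' (sc c v) = c * f' v)"
proof -
 have cont: "continuous_on S f" using f by (simp add: slicewise_holomorphic_def)
 have "isCont f x" using cont S x continuous_on_eq_continuous_at by blast
 then obtain r0 where r0: "r0 > 0" "\<And>y. dist y x < r0 ==> dist (f y) (f x) < 1"
  unfolding continuous_at_eps_delta by (meson zero_less_one)
 obtain r1 where r1: "r1 > 0" "ball x r1 \<subseteq> S" using S x open_contains_ball by blast
 define r where "r = min r0 r1 / 2"
 define B where "B = cmod (f x) + 1"
 have r: "r > 0" using r0 r1 by (simp add: r_def)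
 have B: "B > 0" using norm_ge_zero[of "f x"] unfolding B_def by linarith
 have near: "y \<in> S \<and> cmod (f y) <= B" if "dist y x < 2 * r" for y
 proof -
  have "dist (f y) (f x) < 1" using that r0 by (simp add: r_def)
  hence "cmod (f y) <= B" unfolding B_def dist_norm
   by (smt (verit) norm_triangle_sub)
  moreover have "y \<in> S" using that r1 by (auto simp: r_def dist_commute)
  ultimately show ?thesis by simp
 qed
 define D where "D y h = deriv (%t. f (y + sc t h)) 0" for y h
 have in2: "dist (y + sc t h) x < 2 * r" if y: "dist y x < r" and t: "cmod t * norm h < r" for t y h
  using y t norm_triangle_ineq[of "y - x" "sc t h"] by (simp add: dist_norm algebra_simps norm_sc)
 have bl: "cmod t * norm h < r" if "t \<in> ball 0 (r / norm h)" "h ~= 0" for t and h :: 'v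
  using that by (simp add: pos_less_divide_eq)
 have slice: "(%t. f (y + sc t h)) holomorphic_on ball 0 (r / norm h)" if y: "dist y x < r" and h: "h ~= 0" for y h
  by (rule slice_holomorphic_on[OF S f]) (use in2[OF y bl] h near in blast)
 have slice0: "(%t. f (y + sc t h)) field_differentiable at 0" if y: "dist y x < r" for y h
  using f near[of y] y r by (simp add: slicewise_holomorphic_def)
 have E: "cmod (D y h) <= 2 * B / r * norm h \<and>
    cmod (f (y + h) - f y - D y h) <= 8 * B / r\<^sup>2 * (norm h)\<^sup>2 \<and>
    cmod (f (y + h) - f y) <= 4 * B / r * norm h"
  if y: "dist y x < r" and h: "norm h <= r / 4" for y h
 proof (cases "h = 0")
  case True
  thus ?thesis by (simp add: D_def)
 next
  case False
  have R: "r / norm h >= 4" using h False r by (simp add: field_simps)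
  have bb: "cmod (f (y + sc t h)) <= B" if "t \<in> ball 0 (r / norm h)" for t
   using in2[OF y bl] near that False by blast
  show ?thesis
   using holomorphic_first_order_bounds[OF slice[OF y False] bb R] False
   unfolding D_def by (simp add: power2_eq_square)
 qed
 have hom: "D y (sc c h) = c * D y h" if y: "dist y x < r" for y c h
 proof -
  have "((%t. f (y + sc t h)) has_field_derivative D y h) (at (0 * c))"
   unfolding D_def using slice0[OF y] by (simp add: DERIV_deriv_iff_field_differentiable)
  hence "((%t. f (y + sc (t * c) h)) has_field_derivative D y h * c) (at 0)"
   by (rule DERIV_chain2) (auto intro!: derivative_eq_intros)
  thus ?thesis
   unfolding D_def[of y "sc c h"] by (simp add: sc_sc DERIV_imp_deriv mult.commute)
 qed
 have homr: "D y (s *\<^sub>R h) = of_real s * D y h" if y: "dist y x < r" for y h s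
  using hom[OF y, of "of_real s" h] by (simp add: sc_of_real)
 \<comment> \<open>For fixed k the difference of f along the two parallel lines is holomorphic in t
   and of size O(norm k) by E, so Cauchy's estimate bounds its derivative: D depends on the base
   point in a Lipschitz way.\<close>
 have DLip: "cmod (D (x + k) w - D x w) <= 8 * B / r\<^sup>2 * norm k * norm w"
  if k: "norm k <= r / 4" and w: "norm w <= r / 4" for k w
 proof (cases "w = 0")
  case True
  thus ?thesis by (simp add: D_def B r less_imp_le)
 next
  case False
  have k': "dist (x + k) x < r" using k r by (simp add: dist_norm)
  have x': "dist x x < r" using r by simp
  have R: "r / norm w >= 4" using w False r by (simp add: field_simps)
  define g where "g t = f ((x + k) + sc t w) - f (x + sc t w)" for t
  have hol: "g holomorphic_on ball 0 (r / norm w)"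
   unfolding g_def by (intro holomorphic_intros slice k' x' False)
  have bb: "cmod (g t) <= 4 * B / r * norm k" if t: "t \<in> ball 0 (r / norm w / 1)" for t
  proof -
   have "cmod t * norm w < r" using t False bl by simp
   hence "dist (x + sc t w) x < r" by (simp add: dist_norm norm_sc)
   from E[OF this k] show ?thesis by (simp add: g_def algebra_simps)
  qed
  have "deriv g 0 = D (x + k) w - D x w"
   unfolding g_def D_def using slice0 k' x' by (simp add: deriv_diff)
  moreover have "cmod (deriv g 0) <= 2 * (4 * B / r * norm k) / (r / norm w)"
   using bb by (intro holomorphic_first_order_bounds(1)[OF hol _ R]) auto
  moreover have "2 * (4 * B / r * norm k) / (r / norm w) = (8 * B / r\<^sup>2 * norm k) * norm w"
   by (simp add: power2_eq_square)
  ultimately show ?thesis by simp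
 qed
 have add: "D x (u + w) = D x u + D x w" for u w
 proof -
  define c where "c = D x (u + w) - D x u - D x w"
  define K where "K = 8 * B / r\<^sup>2 * ((norm (u + w))\<^sup>2 + (norm u)\<^sup>2 + (norm w)\<^sup>2 + norm u * norm w)"
  define M where "M = norm (u + w) + norm u + norm w + 1"
  have M: "M > 0" unfolding M_def by (smt (verit) norm_ge_zero)
  have "cmod c <= s * K" if s: "0 < s" "s * M <= r / 4" for s
  proof -
   have small: "norm (s *\<^sub>R h) <= r / 4" if "norm h <= M" for h :: 'v
    using s(1) order_trans[OF mult_left_mono[OF that, of s] s(2)] by simp
   have un: "norm u <= M" "norm w <= M" "norm (u + w) <= M" by (auto simp: M_def)
   have x': "dist x x < r" and x'': "dist (x + s *\<^sub>R u) x < r"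
    using r small[OF un(1)] by (auto simp: dist_norm)
   have sq: "(norm (s *\<^sub>R h))\<^sup>2 = s\<^sup>2 * (norm h)\<^sup>2" for h :: 'v
    using s by (simp add: power_mult_distrib)
   define e1 where "e1 = f (x + s *\<^sub>R (u + w)) - f x - of_real s * D x (u + w)"
   define e2 where "e2 = f (x + s *\<^sub>R u) - f x - of_real s * D x u"
   define e3 where "e3 = f (x + s *\<^sub>R u + s *\<^sub>R w) - f (x + s *\<^sub>R u) - of_real s * D (x + s *\<^sub>R u) w"
   define e4 where "e4 = of_real s * D (x + s *\<^sub>R u) w - of_real s * D x w"
   have "cmod e1 <= 8 * B / r\<^sup>2 * (s\<^sup>2 * (norm (u + w))\<^sup>2)"
    using E[OF x' small[OF un(3)]] by (simp only: e1_def homr[OF x'] sq)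
   moreover have "cmod e2 <= 8 * B / r\<^sup>2 * (s\<^sup>2 * (norm u)\<^sup>2)"
    using E[OF x' small[OF un(1)]] by (simp only: e2_def homr[OF x'] sq)
   moreover have "cmod e3 <= 8 * B / r\<^sup>2 * (s\<^sup>2 * (norm w)\<^sup>2)"
    using E[OF x'' small[OF un(2)]] by (simp only: e3_def homr[OF x''] sq)
   moreover have "cmod e4 <= 8 * B / r\<^sup>2 * (s\<^sup>2 * (norm u * norm w))"
   proof -
    have "e4 = D (x + s *\<^sub>R u) (s *\<^sub>R w) - D x (s *\<^sub>R w)"
     by (simp only: e4_def homr[OF x'] homr[OF x''])
    also have "cmod \<dots> <= 8 * B / r\<^sup>2 * norm (s *\<^sub>R u) * norm (s *\<^sub>R w)"
     by (intro DLip small un)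
    finally show ?thesis using s by (simp add: power2_eq_square algebra_simps)
   qed
   moreover have "of_real s * c = e2 + e3 + e4 - e1"
    by (simp add: c_def e1_def e2_def e3_def e4_def algebra_simps)
   hence "s * cmod c = cmod (e2 + e3 + e4 - e1)"
    using s by (metis abs_of_pos norm_mult norm_of_real)
   moreover have "cmod (e2 + e3 + e4 - e1) <= cmod e2 + cmod e3 + cmod e4 + cmod e1"
    by (smt (verit) norm_triangle_ineq norm_triangle_ineq4)
   ultimately have "s * cmod c <= s * (s * K)"
    unfolding K_def power2_eq_square[of s] by (simp add: algebra_simps)
   thus ?thesis using s by simp
  qed
  hence *: "\<forall>\<^sub>F s in at_right 0. cmod c <= s * K"
   using M r by (intro eventually_at_rightI[of 0 "r / 4 / M"]) (auto simp: field_simps)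
  have "((%s. s * K) \<longlongrightarrow> 0 * K) (at_right 0)"
   by (intro tendsto_intros)
  from tendsto_lowerbound[OF this *] have "c = 0" by simp
  thus ?thesis unfolding c_def by (simp add: algebra_simps)
 qed
 have xx: "dist x x < r" using r by simp
 have blin: "bounded_linear (D x)"
 proof (rule bounded_linear_intro)
  show "D x (u + w) = D x u + D x w" for u w by (rule add)
  show "D x (s *\<^sub>R u) = s *\<^sub>R D x u" for s u
   using homr[of x s u] r by (simp add: scaleR_conv_of_real)
  show "norm (D x u) <= norm u * (2 * B / r)" for u
  proof (cases "u = 0")
   case True
   thus ?thesis by (simp add: D_def)
  next
   case False
   define s where "s = r / 4 / norm u"
   have s: "s > 0" using r False by (simp add: s_def)
   have "norm (s *\<^sub>R u) <= r / 4" using s False r by (simp add: s_def)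
   with E[of x "s *\<^sub>R u"] r have "cmod (D x (s *\<^sub>R u)) <= 2 * B / r * norm (s *\<^sub>R u)" by simp
   hence "cmod (of_real s * D x u) <= 2 * B / r * (s * norm u)"
    using s homr[OF xx, of s u] by simp
   hence "s * cmod (D x u) <= s * (norm u * (2 * B / r))"
    using s by (simp add: norm_mult mult_ac)
   thus ?thesis using s mult_le_cancel_left_pos by blast
  qed
 qed
 have "(f has_derivative D x) (at x)"
  unfolding has_derivative_at
 proof (intro conjI blin)
  have "\<forall>\<^sub>F h in at 0. norm (cmod (f (x + h) - f x - D x h) / norm h) <= 8 * B / r\<^sup>2 * norm h"
   unfolding eventually_at
  proof (intro exI[of _ "r/4"] conjI ballI impI)
   fix h :: 'v assume h: "h ~= 0 \<and> dist h 0 < r / 4"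
   hence "cmod (f (x + h) - f x - D x h) <= 8 * B / r\<^sup>2 * (norm h)\<^sup>2"
    using E[of x h] r by (simp add: dist_norm)
   thus "norm (cmod (f (x + h) - f x - D x h) / norm h) <= 8 * B / r\<^sup>2 * norm h"
    using h by (simp add: divide_le_eq power2_eq_square mult.assoc)
  qed (use r in simp)
  moreover have "((%h::'v. 8 * B / r\<^sup>2 * norm h) \<longlongrightarrow> 8 * B / r\<^sup>2 * norm (0::'v)) (at 0)"
   by (intro tendsto_mult tendsto_norm tendsto_const tendsto_ident_at)
  ultimately show "(%h. norm (f (x + h) - f x - D x h) / norm h) \<midarrow>0\<rightarrow> 0"
   by (elim Lim_null_comparison) simp
 qed
 moreover have "\<forall>c v. D x (sc c v) = c * D x v"
  using hom[of x] r by simp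
 ultimately show ?thesis by blast
qed

lemma slicewise_holomorphic_iff:
 assumes "open S"
 shows "slicewise_holomorphic sc S f \<longleftrightarrow> holomorphic_wrt sc S f"
proof
 assume f: "slicewise_holomorphic sc S f"
 show "holomorphic_wrt sc S f"
  unfolding holomorphic_wrt_def
  using slicewise_imp_has_derivative[OF assms f] has_derivative_at_withinI by blast
qed (rule holomorphic_wrt_imp_slicewise[OF assms])

section \<open>Closure properties of slicewise holomorphic functions\<close>

lemma slicewise_const [simp]: "slicewise_holomorphic sc S (%x. c)"
 by (simp add: slicewise_holomorphic_def)

lemma slicewise_add:
 "slicewise_holomorphic sc S f ==> slicewise_holomorphic sc S g ==>
  slicewise_holomorphic sc S (%x. f x + g x)"
 unfolding slicewise_holomorphic_def by (auto intro!: continuous_intros derivative_intros)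

lemma slicewise_diff:
 "slicewise_holomorphic sc S f ==> slicewise_holomorphic sc S g ==>
  slicewise_holomorphic sc S (%x. f x - g x)"
 unfolding slicewise_holomorphic_def by (auto intro!: continuous_intros derivative_intros)

lemma slicewise_mult:
 "slicewise_holomorphic sc S f ==> slicewise_holomorphic sc S g ==>
  slicewise_holomorphic sc S (%x. f x * g x)"
 unfolding slicewise_holomorphic_def by (auto intro!: continuous_intros derivative_intros)

lemma slicewise_sum:
 "(\<And>i. i \<in> I ==> slicewise_holomorphic sc S (f i)) ==>
  slicewise_holomorphic sc S (%x. \<Sum>i\<in>I. f i x)"
 by (induction I rule: infinite_finite_induct) (auto intro: slicewise_add)

lemma slicewise_prod:
 "(\<And>i. i \<in> I ==> slicewise_holomorphic sc S (f i)) ==>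
  slicewise_holomorphic sc S (%x. \<Prod>i\<in>I. f i x)"
 by (induction I rule: infinite_finite_induct) (auto intro: slicewise_mult)

lemma slicewise_power:
 "slicewise_holomorphic sc S f ==> slicewise_holomorphic sc S (%x. f x ^ k)"
 by (induction k) (auto intro: slicewise_mult)

lemma slicewise_compose:
 assumes g: "g holomorphic_on UNIV" and f: "slicewise_holomorphic sc S f"
 shows "slicewise_holomorphic sc S (%x. g (f x))"
 unfolding slicewise_holomorphic_def
proof (intro conjI ballI allI)
 have "continuous_on UNIV g" using g by (rule holomorphic_on_imp_continuous_on)
 thus "continuous_on S (%x. g (f x))"
  using f by (auto simp: slicewise_holomorphic_def intro: continuous_on_compose2)
 fix x u assume "x \<in> S"
 hence "(g \<circ> (%t. f (x + sc t u))) field_differentiable at 0"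
  using f g by (intro field_differentiable_compose)
   (auto simp: slicewise_holomorphic_def holomorphic_on_def)
 thus "(%t. g (f (x + sc t u))) field_differentiable at 0" by (simp add: o_def)
qed

lemma slicewise_exp:
 "slicewise_holomorphic sc S f ==> slicewise_holomorphic sc S (%x. exp (f x))"
 by (rule slicewise_compose[of exp]) (auto intro: holomorphic_intros)

lemmas slicewise_intros = slicewise_const slicewise_add slicewise_diff slicewise_mult slicewise_sum
 slicewise_prod slicewise_power slicewise_exp

lemma slicewise_uniform_limit:
 assumes S: "open S" and F: "F ~= bot" and f: "\<And>n. slicewise_holomorphic sc S (f n)"
  and lim: "\<And>x. x \<in> S ==> \<exists>U. open U \<and> x \<in> U \<and> U \<subseteq> S \<and> uniform_limit U f g F"
 shows "slicewise_holomorphic sc S g"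
 unfolding slicewise_holomorphic_def
proof (intro conjI ballI allI)
 have "isCont g x" if x: "x \<in> S" for x
 proof -
  obtain U where U: "open U" "x \<in> U" "U \<subseteq> S" "uniform_limit U f g F" using lim[OF x] by blast
  have "continuous_on U g"
  proof (rule uniform_limit_theorem[OF _ U(4) F])
   show "\<forall>\<^sub>F n in F. continuous_on U (f n)"
    using f U(3) continuous_on_subset unfolding slicewise_holomorphic_def
    by (intro always_eventually allI) blast
  qed
  thus ?thesis using U continuous_on_eq_continuous_at by blast
 qed
 thus "continuous_on S g" by (simp add: continuous_at_imp_continuous_on)
 fix x u assume x: "x \<in> S"
 obtain U where U: "open U" "x \<in> U" "U \<subseteq> S" "uniform_limit U f g F" using lim[OF x] by blast
 have "open ((%t. x + sc t u) -` U)"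
  by (intro open_vimage U continuous_intros)
 moreover have "0 \<in> (%t. x + sc t u) -` U" using U by simp
 ultimately obtain r where r: "r > 0" "cball 0 r \<subseteq> (%t. x + sc t u) -` U"
  by (meson open_contains_cball)
 have "g' holomorphic_on ball 0 r" if g': "g' = (%t. g (x + sc t u))" for g'
 proof (rule holomorphic_uniform_limit[where f = "%n t. f n (x + sc t u)" and F = F])
  show "\<forall>\<^sub>F n in F. continuous_on (cball 0 r) (%t. f n (x + sc t u)) \<and>
       (%t. f n (x + sc t u)) holomorphic_on ball 0 r"
  proof (intro always_eventually allI)
   fix n
   have "(%t. f n (x + sc t u)) holomorphic_on cball 0 r"
    by (rule slice_holomorphic_on[OF S f]) (use r U in auto)
   thus "continuous_on (cball 0 r) (%t. f n (x + sc t u)) \<and>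
       (%t. f n (x + sc t u)) holomorphic_on ball 0 r"
    using ball_subset_cball holomorphic_on_imp_continuous_on holomorphic_on_subset by blast
  qed
  show "uniform_limit (cball 0 r) (%n t. f n (x + sc t u)) g' F"
   unfolding g'
   by (rule uniform_limit_compose'[OF U(4)]) (use r in auto)
 qed (use F in auto)
 thus "(%t. g (x + sc t u)) field_differentiable at 0"
  using r(1) by (simp add: holomorphic_on_imp_differentiable_at)
qed

lemma slicewise_infsum:
 assumes S: "open S" and f: "\<And>i. i \<in> I ==> slicewise_holomorphic sc S (f i)"
  and M: "\<And>x. x \<in> S ==> \<exists>U M. open U \<and> x \<in> U \<and> M summable_on I \<and>
        (\<forall>y\<in>U \<inter> S. \<forall>i\<in>I. cmod (f i y) <= M i)"
 shows "slicewise_holomorphic sc S (%x. \<Sum>\<^sub>\<infinity>i\<in>I. f i x)"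
proof (rule slicewise_uniform_limit[where f = "%X y. \<Sum>i\<in>X \<inter> I. f i y" and F = "finite_subsets_at_top I"])
 fix x assume x: "x \<in> S"
 obtain U M where U: "open U" "x \<in> U" "M summable_on I"
  "\<And>y i. y \<in> U \<inter> S ==> i \<in> I ==> cmod (f i y) <= M i" using M[OF x] by blast
 have A: "uniform_limit (U \<inter> S) (%X y. \<Sum>i\<in>X. f i y) (%y. \<Sum>\<^sub>\<infinity>i\<in>I. f i y) (finite_subsets_at_top I)"
  by (rule Weierstrass_m_test_general[where M = M]) (use U in auto)
 \<comment> \<open>The limit lemma wants every approximant holomorphic, also for finite sets X that
   are not contained in I; cutting down to \<open>X \<inter> I\<close> achieves this and changes
   nothing eventually.\<close>
 have "\<forall>\<^sub>F X in finite_subsets_at_top I. X \<inter> I = X"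
  by (rule eventually_finite_subsets_at_top_weakI) auto
 hence B: "\<forall>\<^sub>F X in finite_subsets_at_top I. \<forall>y\<in>U \<inter> S. (\<Sum>i\<in>X. f i y) = (\<Sum>i\<in>X \<inter> I. f i y)"
  by eventually_elim simp
 have "uniform_limit (U \<inter> S) (%X y. \<Sum>i\<in>X \<inter> I. f i y) (%y. \<Sum>\<^sub>\<infinity>i\<in>I. f i y) (finite_subsets_at_top I)"
  by (rule iffD1[OF uniform_limit_cong[OF B refl] A])
 thus "\<exists>U. open U \<and> x \<in> U \<and> U \<subseteq> S \<and>
   uniform_limit U (%X y. \<Sum>i\<in>X \<inter> I. f i y) (%y. \<Sum>\<^sub>\<infinity>i\<in>I. f i y) (finite_subsets_at_top I)"
  using U S x by (intro exI[of _ "U \<inter> S"]) auto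
qed (use S f in \<open>auto intro: slicewise_sum\<close>)

end

lemma slicewise_affine_compose:
 assumes "slicewise_holomorphic sc S f" "continuous_on T \<phi>" "\<phi> ` T \<subseteq> S"
  and "\<And>x t u. \<phi> (x + sc' t u) = \<phi> x + sc t (\<psi> u)"
 shows "slicewise_holomorphic sc' T (%x. f (\<phi> x))"
 using assms unfolding slicewise_holomorphic_def
 by (auto intro: continuous_on_compose2)

section \<open>Integrals depending on a parameter\<close>

text \<open>Morera's theorem: the integral around a triangle is exchanged with the parameter
  integral, and there Cauchy's theorem makes it vanish.\<close>

lemma holomorphic_parametric_integral:
 fixes F :: "complex => real => complex"
 assumes U: "open U" and cont: "continuous_on (U \<times> {0..1}) (%(z, t). F z t)"
  and hol: "\<And>t. t \<in> {0..1} ==> (%z. F z t) holomorphic_on U"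
 shows "(%z. integral {0..1} (F z)) holomorphic_on U"
proof -
 have c: "continuous_on U (%z. integral {0..1} (F z))"
  using integral_continuous_on_param[of U 0 1 F] cont by simp
 have comp: "continuous_on T (%p. F (f p) (g p))"
  if "continuous_on T f" "continuous_on T g" "\<And>p. p \<in> T ==> f p \<in> U \<and> g p \<in> {0..1}"
  for T :: "'b::topological_space set" and f g
  using continuous_on_compose2[OF cont, of T "%p. (f p, g p)"] that
  by (simp add: continuous_on_Pair image_subset_iff)
 \<comment> \<open>The parameter integral is itself a contour integral over [0, 1], so that
   \<open>contour_integral_swap\<close> applies.\<close>
 have I: "integral {0..1} f = contour_integral (linepath 0 1) (%w. f (Re w))" for f :: "real => complex"
  by (simp add: contour_integral_integral linepath_def)
 have swap: "contour_integral (linepath a b) (%z. integral {0..1} (F z)) =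
    integral {0..1} (%t. contour_integral (linepath a b) (%z. F z t))
   \<and> (%t. contour_integral (linepath a b) (%z. F z t)) integrable_on {0..1}"
  if sub: "closed_segment a b \<subseteq> U" for a b
 proof
  have "Re w \<in> {0..1}" if "w \<in> closed_segment 0 1" for w
   using that by (auto simp: closed_segment_def)
  thus "contour_integral (linepath a b) (%z. integral {0..1} (F z)) =
    integral {0..1} (%t. contour_integral (linepath a b) (%z. F z t))"
   unfolding I split_beta using sub
   by (intro contour_integral_swap) (auto simp: split_beta intro!: comp continuous_intros)
  have "continuous_on ({0..1} \<times> cbox 0 1) (%(t, x). F (linepath a b x) t * (b - a))"
   using sub linepath_in_path unfolding split_beta
   by (fastforce simp: linepath_def intro!: comp continuous_intros)
  hence "continuous_on {0..1} (%t. integral (cbox 0 1) (%x. F (linepath a b x) t * (b - a)))"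
   by (rule integral_continuous_on_param)
  thus "(%t. contour_integral (linepath a b) (%z. F z t)) integrable_on {0..1}"
   by (simp add: contour_integral_integral integrable_continuous_real)
 qed
 have "(%z. integral {0..1} (F z)) analytic_on U"
 proof (rule Morera_triangle[OF c U], rule impI)
  fix a b c :: complex assume sub: "convex hull {a, b, c} \<subseteq> U"
  note seg = order_trans[OF segments_subset_convex_hull(1) sub] order_trans[OF segments_subset_convex_hull(3) sub]
   order_trans[OF segments_subset_convex_hull(5) sub]
  have "contour_integral (linepath a b) (%z. F z t) + contour_integral (linepath b c) (%z. F z t)
    + contour_integral (linepath c a) (%z. F z t) = 0" if t: "t \<in> {0..1}" for t
  proof -
   have h: "(%z. F z t) holomorphic_on convex hull {a, b, c}"
    using hol[OF t] sub holomorphic_on_subset by blast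
   have "((%z. F z t) has_contour_integral 0) (linepath a b +++ linepath b c +++ linepath c a)"
    by (rule Cauchy_theorem_triangle[OF h])
   thus ?thesis by (rule has_chain_integral_chain_integral3)
  qed
  hence "integral {0..1} (%t. contour_integral (linepath a b) (%z. F z t) + contour_integral (linepath b c) (%z. F z t)
    + contour_integral (linepath c a) (%z. F z t)) = integral {0..1::real} (%t. 0)"
   by (rule Henstock_Kurzweil_Integration.integral_cong)
  thus "contour_integral (linepath a b) (%z. integral {0..1} (F z)) +
    contour_integral (linepath b c) (%z. integral {0..1} (F z)) +
    contour_integral (linepath c a) (%z. integral {0..1} (F z)) = 0"
   using swap[OF seg(1)] swap[OF seg(2)] swap[OF seg(3)]
   by (simp add: integral_add integrable_add)
 qed
 thus ?thesis by (rule analytic_imp_holomorphic)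
qed

lemma (in complex_scaling) slicewise_parametric_integral:
 fixes F :: "'v => real => complex"
 assumes S: "open S" and cont: "continuous_on (S \<times> {0..1}) (%(x, t). F x t)"
  and hol: "\<And>t. t \<in> {0..1} ==> slicewise_holomorphic sc S (%x. F x t)"
 shows "slicewise_holomorphic sc S (%x. integral {0..1} (F x))"
 unfolding slicewise_holomorphic_def
proof (intro conjI ballI allI)
 show "continuous_on S (%x. integral {0..1} (F x))"
  using integral_continuous_on_param[of S 0 1 F] cont by simp
 fix x u assume x: "x \<in> S"
 define U where "U = (%t. x + sc t u) -` S"
 have U: "open U" unfolding U_def by (intro open_vimage S continuous_intros)
 have "(%z. integral {0..1} (F (x + sc z u))) holomorphic_on U"
 proof (rule holomorphic_parametric_integral[OF U])
  show "continuous_on (U \<times> {0..1}) (%(z, t). F (x + sc z u) t)"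
  proof -
   have "continuous_on (U \<times> {0..1}) (%p. (x + sc (fst p) u, snd p :: real))" by (intro continuous_intros)
   from continuous_on_compose2[OF cont this] show ?thesis by (simp add: U_def split_beta image_subset_iff)
  qed
  show "(%z. F (x + sc z u) t) holomorphic_on U" if "t \<in> {0..1}" for t
   by (rule slice_holomorphic_on[OF S hol[OF that]]) (simp add: U_def)
 qed
 moreover have "0 \<in> U" using x by (simp add: U_def)
 ultimately show "(%z. integral {0..1} (F (x + sc z u))) field_differentiable at 0"
  using U by (simp add: holomorphic_on_imp_differentiable_at)
qed

lemma norm_vector_scalar_mult: "norm (c *s (v :: complex^'n)) = cmod c * norm v"
 by (simp add: norm_vec_def norm_mult L2_set_right_distrib)

interpretation vec: complex_scaling "(*s) :: complex => complex^'n => complex^'n"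
 by unfold_locales (simp_all add: vec_eq_iff algebra_simps norm_vector_scalar_mult, simp add: scaleR_conv_of_real)

interpretation mat: complex_scaling "matrix_scale :: complex => complex^'n^'m => complex^'n^'m"
proof
 fix c :: complex and M :: "complex^'n^'m"
 have "matrix_scale c M = (\<chi> i. c *s (M $ i))"
  by (simp add: matrix_scale_def vec_eq_iff)
 thus "norm (matrix_scale c M) = cmod c * norm M"
  by (simp add: norm_vec_def[of "M"] norm_vec_def[of "\<chi> i. c *s (M $ i)"] norm_vector_scalar_mult L2_set_right_distrib)
qed (simp_all add: matrix_scale_def vec_eq_iff algebra_simps, simp add: scaleR_conv_of_real)

lemma entire_iff_slicewise: "entire f \<longleftrightarrow> slicewise_holomorphic (*s) UNIV f"
 by (simp add: vec.slicewise_holomorphic_iff)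

lemma entire_slice:
 assumes "entire f"
 shows "(%t. f (x + t *s u)) holomorphic_on UNIV"
 using vec.slice_holomorphic_on[of UNIV f UNIV] assms by (simp add: entire_iff_slicewise)

lemma entire_continuous: "entire f ==> continuous_on A f"
 using continuous_on_subset by (fastforce simp: entire_iff_slicewise slicewise_holomorphic_def)

lemma slicewise_nth [simp]: "slicewise_holomorphic (*s) S (%x. x $ i)"
 unfolding slicewise_holomorphic_def by (auto intro!: continuous_intros derivative_intros)

lemma slicewise_entry [simp]: "slicewise_holomorphic matrix_scale S (%Z. Z $ i $ j)"
 unfolding slicewise_holomorphic_def matrix_scale_def
 by (auto intro!: continuous_intros derivative_intros)

lemmas entire_intros =
 vec.slicewise_intros[where S = UNIV, folded entire_iff_slicewise]
 slicewise_nth[where S = UNIV, folded entire_iff_slicewise]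

lemma entire_shift: "entire f ==> entire (%x. f (x + c))"
 unfolding entire_iff_slicewise
 by (rule slicewise_affine_compose[where sc = "(*s)" and S = UNIV and \<psi> = "%x. x"])
   (auto simp: algebra_simps intro!: continuous_intros)

section \<open>Fourier series of entire periodic functions\<close>

definition expi :: "complex => complex" where
 "expi z = exp (2 * of_real pi * \<i> * z)"

lemma expi_0 [simp]: "expi 0 = 1"
 by (simp add: expi_def)

lemma expi_add: "expi (a + b) = expi a * expi b"
 by (simp add: expi_def exp_add algebra_simps)

lemma expi_diff: "expi (a - b) = expi a / expi b"
 by (simp add: expi_def exp_diff algebra_simps)

lemma expi_minus: "expi (- a) = inverse (expi a)"
 by (simp add: expi_def exp_minus)

lemma expi_nz [simp]: "expi a ~= 0"
 by (simp add: expi_def)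

lemma expi_eq_1_iff: "expi z = 1 \<longleftrightarrow> z \<in> \<int>"
proof -
 have "expi z = exp 0 \<longleftrightarrow> (\<exists>n::int. 2 * of_real pi * \<i> * z = of_int (2 * n) * of_real pi * \<i>)"
  unfolding expi_def exp_eq by simp
 also have "\<dots> \<longleftrightarrow> (\<exists>n::int. z = of_int n)"
  by simp
 also have "\<dots> \<longleftrightarrow> z \<in> \<int>" by (auto elim: Ints_cases)
 finally show ?thesis by simp
qed

lemma expi_int [simp]: "z \<in> \<int> ==> expi z = 1"
 by (simp add: expi_eq_1_iff)

lemma norm_expi: "cmod (expi z) = exp (- (2 * pi * Im z))"
 by (simp add: expi_def)

lemma expi_power: "expi z ^ k = expi (of_nat k * z)"
 by (simp add: expi_def exp_of_nat_mult[symmetric] algebra_simps)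

lemma expi_sum: "expi (\<Sum>i\<in>A. f i) = (\<Prod>i\<in>A. expi (f i))"
 by (induction A rule: infinite_finite_induct) (auto simp: expi_add)

lemma expi_has_field_derivative [derivative_intros]:
 "(f has_field_derivative f') (at x within A) ==>
  ((%x. expi (f x)) has_field_derivative (2 * of_real pi * \<i> * f' * expi (f x))) (at x within A)"
 unfolding expi_def by (auto intro!: derivative_eq_intros)

lemma expi_holomorphic [holomorphic_intros]:
 "f holomorphic_on A ==> (%x. expi (f x)) holomorphic_on A"
 unfolding expi_def by (intro holomorphic_intros)

lemma expi_continuous_on [continuous_intros]:
 "continuous_on A f ==> continuous_on A (%x. expi (f x))"
 unfolding expi_def by (intro continuous_intros)

lemma expi_shift_1 [simp]: "expi (z + 1) = expi z"
 by (simp add: expi_add)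

lemma expi_int_shift: "expi (- (of_int k * (z + 1))) = expi (- (of_int k * z))"
proof -
 have "- (of_int k * (z + 1)) = - (of_int k * z) + of_int (- k)"
  by (simp add: distrib_left)
 thus ?thesis by (simp only: expi_add) simp
qed

lemma expi_int_split: "expi (- (of_int k * t)) = expi (of_int k * a) * expi (- (of_int k * (a + t)))"
 by (simp flip: expi_add add: algebra_simps)

lemma integral_expi_int: "integral {0..1} (%t. expi (of_int k * of_real t)) = (if k = 0 then 1 else 0)"
 for k :: int
proof (cases "k = 0")
 case False
 define g where "g z = expi (of_int k * z) / (2 * of_real pi * \<i> * of_int k)" for z
 have "((%t. expi (of_int k * of_real t)) has_integral (g (of_real 1) - g (of_real 0))) {0..1}"
 proof (rule fundamental_theorem_of_calculus)
  fix t :: real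
  have "(g has_field_derivative expi (of_int k * of_real t)) (at (of_real t))"
   unfolding g_def using False by (auto intro!: derivative_eq_intros)
  thus "((%t. g (of_real t)) has_vector_derivative expi (of_int k * of_real t)) (at t within {0..1})"
   by (rule has_vector_derivative_real_field)
 qed simp
 moreover have "g 1 = g 0" by (simp add: g_def)
 ultimately show ?thesis using False by (simp add: integral_unique)
qed simp

section \<open>Fourier coefficients in one variable\<close>

text \<open>With a primitive g of H the integral equals \<open>g (z + 1) - g z\<close>, whose
  derivative vanishes by periodicity. As z may be complex, this is the shift of the contour.\<close>

lemma integral_periodic_shift:
 assumes hol: "H holomorphic_on UNIV" and per: "\<And>z. H (z + 1) = H z"
 shows "integral {0..1} (%t. H (z + of_real t)) = integral {0..1} (%t. H (of_real t))"
proof -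
 obtain g where g: "\<And>x. (g has_field_derivative H x) (at x)"
  using holomorphic_convex_primitive'[OF _ _ hol] by auto
 have I: "integral {0..1} (%t. H (z + of_real t)) = g (z + 1) - g z" for z
 proof -
  have "((%t. H (z + of_real t)) has_integral (g (z + of_real 1) - g (z + of_real 0))) {0..1}"
  proof (rule fundamental_theorem_of_calculus)
   fix t :: real
   have "((%t. g (z + t)) has_field_derivative H (z + of_real t) * 1) (at (of_real t))"
    by (rule DERIV_chain2[OF g]) (auto intro!: derivative_eq_intros)
   thus "((%t. g (z + of_real t)) has_vector_derivative H (z + of_real t)) (at t within {0..1})"
    by (intro has_vector_derivative_real_field) simp
  qed simp
  thus ?thesis by (simp add: integral_unique)
 qed
 have "((%z. g (z + 1) - g z) has_field_derivative 0) (at z within UNIV)" for z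
  using g per by (auto intro!: derivative_eq_intros DERIV_chain2[OF g] simp: )
 hence "(%z. g (z + 1) - g z) constant_on UNIV"
  using has_field_derivative_0_imp_constant_on[of UNIV "%z. g (z + 1) - g z"] by auto
 hence "g (z + 1) - g z = g (0 + 1) - g 0"
  unfolding constant_on_def by (metis UNIV_I)
 thus ?thesis using I[of z] I[of 0] by simp
qed

text \<open>
 The integrals against the Fejer kernels \<open>\<bar>D n\<bar>\<^sup>2 / n\<close> vanish. As \<open>D n\<close> is a geometric sum,
 \<open>\<bar>F t - F 0\<bar> \<bar>D n t\<bar>\<close> is bounded, and AM-GM bounds the remaining factor \<open>\<bar>D n\<bar>\<close> by \<open>\<bar>D n\<bar>\<^sup>2 / m + m\<close>.
\<close>

lemma periodic_coefficients_zero_at_0: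
 assumes hol: "F holomorphic_on UNIV" and per: "\<And>z. F (z + 1) = F z"
  and z: "\<And>k::int. integral {0..1} (%t. F (of_real t) * expi (- of_int k * of_real t)) = 0"
 shows "F 0 = 0"
proof -
 define D where "D n t = (\<Sum>j<n. expi (of_real t) ^ j)" for n and t :: real
 define P where "P n t = (\<Sum>j<n. \<Sum>k<n. expi (- of_int (int k - int j) * of_real t))" for n and t :: real
 have P: "P n t = of_real ((cmod (D n t))\<^sup>2)" for n t
 proof -
  have "cnj (expi (of_nat k * of_real t)) = expi (- (of_nat k * of_real t))" for k
   by (simp add: expi_def exp_cnj)
  thus ?thesis
   unfolding complex_norm_square
   by (simp add: P_def D_def sum_product expi_power algebra_simps flip: expi_add)
 qed
 have Fc: "continuous_on A (%t. F (of_real t))" for A :: "real set"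
  using hol by (intro continuous_on_compose2[OF holomorphic_on_imp_continuous_on[of F UNIV]])
   (auto intro!: continuous_intros)
 have "integral {0..1} (%t. F (of_real t) * P n t)
   = (\<Sum>j<n. \<Sum>k<n. integral {0..1} (%t. F (of_real t) * expi (- of_int (int k - int j) * of_real t)))" for n
  unfolding P_def sum_distrib_left
  by (subst integral_sum, simp, intro integrable_continuous_real continuous_intros Fc,
   intro sum.cong refl integral_sum integrable_continuous_real continuous_intros Fc) auto
 hence FP: "integral {0..1} (%t. F (of_real t) * P n t) = 0" for n
  unfolding z by simp
 have cexp: "integral {0..1} (%t. expi (- of_int k * of_real t)) = (if k = 0 then 1 else 0)" for k
  using integral_expi_int[of "- k"] by simp
 have "integral {0..1} (P n) = (\<Sum>j<n. \<Sum>k<n. if int k - int j = 0 then 1 else 0)" for n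
  unfolding P_def[abs_def] cexp[symmetric]
  by (subst integral_sum, simp, intro integrable_continuous_real continuous_intros,
   intro sum.cong refl integral_sum integrable_continuous_real continuous_intros) auto
 hence P1: "integral {0..1} (P n) = of_nat n" for n by simp
 have Pc: "continuous_on {0..1} (P n)" for n
  unfolding P_def[abs_def] by (intro continuous_intros)
 \<comment> \<open>F is Lipschitz, and near the end point 1 periodicity allows comparing with F 1 =
   F 0. Jordan's inequality bounds the distance of t to {0, 1} by
   \<open>cmod (1 - expi t)\<close>.\<close>
 obtain K where K: "K > 0" "\<And>t. t \<in> {0..1} ==> cmod (F (of_real t) - F 0) <= K * cmod (1 - expi (of_real t))"
 proof -
  have "continuous_on (cball 0 1) (deriv F)"
   using hol by (intro holomorphic_on_imp_continuous_on holomorphic_on_subset[OF holomorphic_deriv]) auto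
  hence "bounded (deriv F ` cball 0 1)"
   by (intro compact_imp_bounded compact_continuous_image) auto
  then obtain C where C: "\<And>w. w \<in> cball 0 1 ==> cmod (deriv F w) <= C"
   unfolding bounded_iff by blast
  have "(F has_field_derivative deriv F w) (at w within cball 0 1)" for w
   by (rule has_field_derivative_at_within, rule holomorphic_derivI[OF hol]) auto
  hence L: "cmod (F x - F y) <= C * cmod (x - y)" if "x \<in> cball 0 1" "y \<in> cball 0 1" for x y
   by (rule field_differentiable_bound[OF convex_cball _ C that])
  have C0: "C >= 0" using order_trans[OF norm_ge_zero C[of 0]] by simp
  have "concave_on {0..pi/2} sin"
   by (rule f''_le0_imp_concave[where f' = cos and f'' = "%x. - sin x"])
    (auto intro!: derivative_eq_intros sin_ge_zero)
  hence J: "2 * t <= sin (pi * t)" if "0 <= t" "t <= 1/2" for t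
   using concave_onD[of "{0..pi/2}" sin "2 * t" 0 "pi/2"] that by (simp add: mult.commute)
  have e: "cmod (1 - expi (of_real t)) = 2 * \<bar>sin (pi * t)\<bar>" for t
   using dist_exp_i_1[of "2 * pi * t"] by (simp add: expi_def norm_minus_commute mult_ac)
  have "cmod (F (of_real t) - F 0) <= (C + 1) * cmod (1 - expi (of_real t))" if t: "t \<in> {0..1}" for t
  proof -
   obtain s where s: "0 <= s" "s <= 1/2" "cmod (F (of_real t) - F 0) <= C * s" "sin (pi * t) = sin (pi * s)"
   proof (cases "t <= 1/2")
    case True
    thus ?thesis using L[of "of_real t" 0] t by (intro that[of t]) auto
   next
    case False
    have "cmod (of_real t - 1) = 1 - t" using t norm_of_real[of "t - 1", where 'a = complex] by simp
    thus ?thesis using False L[of "of_real t" 1] t per[of 0]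
     by (intro that[of "1 - t"]) (auto simp: right_diff_distrib)
   qed
   have "C * s <= (C + 1) * (2 * \<bar>sin (pi * s)\<bar>)"
    using J[OF s(1,2)] s(1) C0 by (intro mult_mono) auto
   thus ?thesis unfolding e using s by simp
  qed
  thus ?thesis using C0 by (intro that[of "C + 1"]) auto
 qed
 have b: "cmod ((F (of_real t) - F 0) * P n t) <= K * ((cmod (D n t))\<^sup>2 / m + m)"
  if "t \<in> {0..1}" "m > 0" for t m n
 proof -
  have "cmod (1 - expi (of_real t)) * cmod (D n t) = cmod (1 - expi (of_real t) ^ n)"
   unfolding D_def one_diff_power_eq by (simp add: norm_mult)
  also have "\<dots> <= 2"
   using norm_triangle_ineq4[of 1 "expi (of_real t) ^ n"] by (simp add: norm_power norm_expi)
  finally have "K * (cmod (1 - expi (of_real t)) * cmod (D n t)) <= K * 2"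
   using K(1) by simp
  hence "cmod (F (of_real t) - F 0) * cmod (D n t) <= K * 2"
   using mult_right_mono[OF K(2)[OF that(1)], of "cmod (D n t)"] by (simp add: mult.assoc)
  from mult_right_mono[OF this, of "cmod (D n t)"]
  have "cmod ((F (of_real t) - F 0) * P n t) <= K * (2 * cmod (D n t))"
   by (simp add: P norm_mult power2_eq_square mult.assoc)
  also have "2 * cmod (D n t) <= (cmod (D n t))\<^sup>2 / m + m"
   using that(2) sum_squares_ge_zero[of "cmod (D n t) - m" 0] by (simp add: field_simps power2_eq_square)
  finally show ?thesis using K(1) by simp
 qed
 have "real m * cmod (F 0) <= 2 * K" if m: "m > 0" for m
 proof -
  \<comment> \<open>The kernel has integral n = m^2, while the error bound is n / m + m = 2 m; this
    choice balances the two terms and leaves a factor m to let tend to infinity.\<close>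
  let ?n = "m * m"
  have i: "(%t. F (of_real t) * P ?n t) integrable_on {0..1}" "(%t. F 0 * P ?n t) integrable_on {0..1}"
   by (intro integrable_continuous_real continuous_intros Fc Pc)+
  have "integral {0..1} (%t. (F (of_real t) - F 0) * P ?n t) = - (F 0 * of_nat ?n)"
   unfolding left_diff_distrib integral_diff[OF i] using FP P1 by simp
  moreover have "(P ?n has_integral of_nat ?n) {0..1}"
   using P1 integrable_continuous_real[OF Pc] by (simp add: has_integral_iff)
  hence "((%t. (cmod (D ?n t))\<^sup>2) has_integral real ?n) {0..1}"
   using has_integral_linear[OF _ bounded_linear_Re] by (force simp: o_def P)
  hence h: "((%t. K * ((cmod (D ?n t))\<^sup>2 / m + m)) has_integral K * (real ?n / m + m * (1 - 0))) {0..1}"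
   using has_integral_const_real[of "real m" 0 1]
   by (intro has_integral_mult_right has_integral_add has_integral_divide) auto
  have "cmod (integral {0..1} (%t. (F (of_real t) - F 0) * P ?n t)) <= K * (real ?n / m + m * (1 - 0))"
   unfolding integral_unique[OF h, symmetric]
  proof (rule integral_norm_bound_integral[OF _ has_integral_integrable[OF h]])
   show "(%t. (F (of_real t) - F 0) * P ?n t) integrable_on {0..1}"
    by (intro integrable_continuous_real continuous_intros Fc Pc)
  qed (use b m in auto)
  ultimately show ?thesis using m by (simp add: norm_mult algebra_simps)
 qed
 hence "real m * cmod (F 0) <= 2 * K" for m
  using K(1) by (cases "m = 0") auto
 thus ?thesis
  by (metis norm_eq_zero norm_ge_zero order_le_less reals_Archimedean3 not_less)
qed

lemma periodic_coefficients_zero: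
 assumes hol: "F holomorphic_on UNIV" and per: "\<And>z. F (z + 1) = F z"
  and z: "\<And>k::int. integral {0..1} (%t. F (of_real t) * expi (- of_int k * of_real t)) = 0"
 shows "F a = 0"
proof -
 have "(%z. F (a + z)) 0 = 0"
 proof (rule periodic_coefficients_zero_at_0)
  show "(%z. F (a + z)) holomorphic_on UNIV"
   using holomorphic_on_compose_gen[OF _ hol, of "%z. a + z" UNIV]
   by (simp add: o_def holomorphic_intros)
  show "F (a + (z + 1)) = F (a + z)" for z using per[of "a + z"] by (simp add: add.assoc)
  fix k :: int
  define H where "H w = F w * expi (- of_int k * w)" for w
  have Hh: "H holomorphic_on UNIV" unfolding H_def by (intro holomorphic_intros hol)
  have Hp: "H (w + 1) = H w" for w
   by (simp add: H_def per expi_int_shift)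
  have "integral {0..1} (%t. F (a + of_real t) * expi (- of_int k * of_real t))
   = integral {0..1} (%t. expi (of_int k * a) * H (a + of_real t))"
  proof (rule Henstock_Kurzweil_Integration.integral_cong)
   fix t :: real
   show "F (a + of_real t) * expi (- of_int k * of_real t) = expi (of_int k * a) * H (a + of_real t)"
    using expi_int_split[of k "of_real t" a] by (simp add: H_def)
  qed
  also have "\<dots> = 0"
   using integral_periodic_shift[OF Hh Hp, of a] z[of k] by (simp add: H_def)
  finally show "integral {0..1} (%t. F (a + of_real t) * expi (- of_int k * of_real t)) = 0" .
 qed
 thus ?thesis by simp
qed

text \<open>The projection to the functions \<open>f\<close> with \<open>f (x + s e\<^sub>i) = expi (k s) f x\<close>.\<close>

definition avg :: "'n => int => (complex^'n::finite => complex) => complex^'n => complex" where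
 "avg i k f x = integral {0..1} (%t. f (x + of_real t *s axis i 1) * expi (- of_int k * of_real t))"

lemma avg_cont:
 assumes "entire f"
 shows "continuous_on A (%t. f (x + of_real t *s axis i 1) * expi (- of_int k * of_real t))"
proof -
 have "continuous_on A (%t. f (x + of_real t *s axis i 1))"
  by (rule continuous_on_compose2[OF entire_continuous[OF assms, of UNIV]])
    (auto intro!: continuous_intros)
 thus ?thesis by (intro continuous_intros)
qed

lemma avg_integrable:
 assumes "entire f"
 shows "(%t. f (x + of_real t *s axis i 1) * expi (- of_int k * of_real t)) integrable_on {0..1}"
 by (intro integrable_continuous_real avg_cont assms)

lemma entire_avg:
 assumes f: "entire f"
 shows "entire (avg i k f)"
 unfolding entire_iff_slicewise avg_def[abs_def]
proof (rule vec.slicewise_parametric_integral)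
 have "continuous_on (UNIV \<times> {0..1}) (%p. f (fst p + of_real (snd p) *s axis i 1))"
  by (rule continuous_on_compose2[OF entire_continuous[OF f, of UNIV]])
    (auto intro!: continuous_intros)
 thus "continuous_on (UNIV \<times> {0..1})
   (%(x, t). f (x + complex_of_real t *s axis i 1) * expi (- of_int k * complex_of_real t))"
  unfolding split_beta by (intro continuous_intros)
 show "slicewise_holomorphic (*s) UNIV
   (%x. f (x + complex_of_real t *s axis i 1) * expi (- of_int k * complex_of_real t))" for t
  using entire_shift[OF f] unfolding entire_iff_slicewise by (intro vec.slicewise_mult) auto
qed simp

lemma avg_shift: "avg i k (%x. f (x + c)) x = avg i k f (x + c)"
 by (simp add: avg_def algebra_simps)

lemma avg_diff:
 assumes "entire f" "entire g"
 shows "avg i k (%x. f x - g x) x = avg i k f x - avg i k g x"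
 unfolding avg_def left_diff_distrib
 by (rule integral_diff; rule avg_integrable; fact)

text \<open>Here s is complex, by shifting the contour; the imaginary values of s are what produces
  the decay in \<open>avgs_decay\<close>.\<close>

lemma avg_axis:
 assumes f: "entire f" and per: "\<And>x. f (x + axis i 1) = f x"
 shows "avg i k f (x + s *s axis i 1) = expi (of_int k * s) * avg i k f x"
proof -
 define H where "H z = f (x + z *s axis i 1) * expi (- of_int k * z)" for z
 have Hh: "H holomorphic_on UNIV"
  unfolding H_def by (intro holomorphic_intros entire_slice f)
 have Hp: "H (z + 1) = H z" for z
  using per[of "x + z *s axis i 1"]
  by (simp add: H_def vec.sc_add_left expi_int_shift add.assoc)
 have "avg i k f (x + s *s axis i 1) = integral {0..1} (%t. expi (of_int k * s) * H (s + of_real t))"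
  unfolding avg_def
 proof (rule Henstock_Kurzweil_Integration.integral_cong)
  fix t :: real
  show "f (x + s *s axis i 1 + of_real t *s axis i 1) * expi (- of_int k * of_real t) =
    expi (of_int k * s) * H (s + of_real t)"
   using expi_int_split[of k "of_real t" s] by (simp add: H_def vec.sc_add_left add.assoc)
 qed
 also have "\<dots> = expi (of_int k * s) * avg i k f x"
  using integral_periodic_shift[OF Hh Hp, of s] by (simp add: H_def avg_def)
 finally show ?thesis .
qed

lemma avg_bound:
 assumes f: "entire f" and B: "\<And>t. t \<in> {0..1} ==> cmod (f (x + of_real t *s axis i 1)) <= B"
 shows "cmod (avg i k f x) <= B"
proof -
 have "cmod (avg i k f x) <= B * (1 - 0)"
  unfolding avg_def
  by (rule integral_bound[OF _ avg_cont[OF f]]) (use B in \<open>auto simp: norm_mult norm_expi\<close>)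
 thus ?thesis by simp
qed

lemma avg_zero:
 assumes f: "entire f" and per: "\<And>x. f (x + axis i 1) = f x" and z: "\<And>k. avg i k f x = 0"
 shows "f x = 0"
proof -
 have "f (x + 0 *s axis i 1) = 0"
 proof (rule periodic_coefficients_zero[where F = "%z. f (x + z *s axis i 1)"])
  show "(%z. f (x + z *s axis i 1)) holomorphic_on UNIV" by (rule entire_slice[OF f])
  show "f (x + (z + 1) *s axis i 1) = f (x + z *s axis i 1)" for z
   using per[of "x + z *s axis i 1"] by (simp add: vec.sc_add_left add.assoc)
 qed (use z in \<open>simp add: avg_def\<close>)
 thus ?thesis by simp
qed

lemma avg_mult:
 assumes "\<And>t::real. m (x + of_real t *s axis i 1) = expi (of_int l * of_real t) * m x"
 shows "avg i k (%x. m x * f x) x = m x * avg i (k - l) f x"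
proof -
 have "avg i k (%x. m x * f x) x =
  integral {0..1} (%t. m x * (f (x + of_real t *s axis i 1) * expi (- of_int (k - l) * of_real t)))"
  unfolding avg_def
  by (rule Henstock_Kurzweil_Integration.integral_cong)
    (simp add: assms expi_diff expi_minus left_diff_distrib divide_inverse)
 thus ?thesis by (simp add: avg_def)
qed

primrec avgs :: "'n list => ('n => int) => (complex^'n::finite => complex) => complex^'n => complex" where
 "avgs [] u f = f"
| "avgs (i # ks) u f = avg i (u i) (avgs ks u f)"

definition mode :: "('n => int) => complex^'n::finite => complex" where
 "mode u x = expi (\<Sum>i\<in>UNIV. of_int (u i) * x $ i)"

definition periodic :: "(complex^'n::finite => complex) => bool" where
 "periodic f \<longleftrightarrow> (\<forall>i x. f (x + axis i 1) = f x)"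

lemma entire_expi: "entire f ==> entire (%x. expi (f x))"
 unfolding expi_def entire_iff_slicewise by (intro vec.slicewise_intros)

lemma entire_mode: "entire (mode u)"
 unfolding mode_def[abs_def] by (intro entire_expi entire_intros)

lemma mode_shift: "mode u (x + y) = mode u x * mode u y"
 by (simp add: mode_def distrib_left sum.distrib expi_add)

lemma mode_add: "mode (%i. u i + w i) x = mode u x * mode w x"
 by (simp add: mode_def distrib_right sum.distrib expi_add)

lemma mode_0 [simp]: "mode u 0 = 1"
 by (simp add: mode_def)

lemma mode_nz [simp]: "mode u x ~= 0"
 by (simp add: mode_def)

lemma mode_scaled_axis: "mode u (s *s axis i 1) = expi (of_int (u i) * s)"
proof -
 have "(\<Sum>j\<in>UNIV. of_int (u j) * (s *s axis i 1) $ j) = (\<Sum>j\<in>UNIV. if j = i then of_int (u i) * s else 0)"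
  by (rule sum.cong) (auto simp: axis_def)
 thus ?thesis by (simp add: mode_def)
qed

lemma periodic_mode: "periodic (mode u)"
 using mode_scaled_axis[of u 1] by (simp add: periodic_def mode_shift)

lemma entire_avgs: "entire f ==> entire (avgs ks u f)"
 by (induction ks) (auto intro: entire_avg)

lemma avgs_shift: "avgs ks u (%x. f (x + c)) x = avgs ks u f (x + c)"
proof (induction ks arbitrary: x)
 case (Cons i ks)
 hence "avgs ks u (%x. f (x + c)) = (%x. avgs ks u f (x + c))" by auto
 thus ?case by (simp add: avg_shift)
qed simp

lemma periodic_avgs:
 assumes "periodic f"
 shows "periodic (avgs ks u f)"
proof -
 have "avgs ks u f (x + axis i 1) = avgs ks u f x" for i x
  using avgs_shift[of ks u f "axis i 1" x] assms by (simp add: periodic_def)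
 thus ?thesis by (simp add: periodic_def)
qed

lemma avgs_diff:
 assumes "entire f" "entire g"
 shows "avgs ks u (%x. f x - g x) x = avgs ks u f x - avgs ks u g x"
proof (induction ks arbitrary: x)
 case (Cons i ks)
 hence "avgs ks u (%x. f x - g x) = (%x. avgs ks u f x - avgs ks u g x)" by auto
 thus ?case using assms by (simp add: avg_diff entire_avgs)
qed simp

lemma avgs_axis:
 assumes f: "entire f" "periodic f" and i: "i \<in> set ks"
 shows "avgs ks u f (x + s *s axis i 1) = expi (of_int (u i) * s) * avgs ks u f x"
 using i
proof (induction ks arbitrary: x)
 case (Cons j ks)
 show ?case
 proof (cases "i = j")
  case True
  thus ?thesis
   using periodic_avgs[OF f(2), of ks u] entire_avgs[OF f(1)]
   by (simp add: avg_axis periodic_def)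
 next
  case False
  hence "avgs ks u f (y + s *s axis i 1) = expi (of_int (u i) * s) * avgs ks u f y" for y
   using Cons by auto
  thus ?thesis
   unfolding avgs.simps avg_shift[symmetric] by (simp add: avg_def mult.assoc)
 qed
qed simp

lemma avgs_mult:
 "avgs ks u (%x. mode w x * f x) x = mode w x * avgs ks (%i. u i - w i) f x"
proof (induction ks arbitrary: x)
 case (Cons i ks)
 hence "avgs ks u (%x. mode w x * f x) = (%x. mode w x * avgs ks (%i. u i - w i) f x)" by auto
 thus ?case by (simp add: avg_mult[where l = "w i"] mode_shift mode_scaled_axis mult.commute)
qed simp

lemma avgs_cong: "(\<And>i. i \<in> set ks ==> u i = w i) ==> avgs ks u f = avgs ks w f"
 by (induction ks) auto

lemma avgs_zero:
 assumes f: "entire f" "periodic f" and "distinct ks" and z: "\<And>u x. avgs ks u f x = 0"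
 shows "f x = 0"
 using \<open>distinct ks\<close> z
proof (induction ks arbitrary: x)
 case (Cons i ks)
 show ?case
 proof (rule Cons.IH)
  fix u x
  show "avgs ks u f x = 0"
  proof (rule avg_zero[where i = i])
   fix k
   \<comment> \<open>\<open>avgs ks\<close> reads u only on ks, and i is not in ks, so the
     coefficient in direction i varies independently.\<close>
   have "avgs ks (u(i := k)) f = avgs ks u f"
    by (rule avgs_cong) (use Cons.prems in auto)
   thus "avg i k (avgs ks u f) x = 0"
    using Cons.prems(2)[of "u(i := k)" x] by (simp only: avgs.simps fun_upd_same)
  qed (use periodic_avgs[OF f(2)] entire_avgs[OF f(1)] in \<open>auto simp: periodic_def\<close>)
 qed (use Cons.prems in auto)
qed simp

lemma avgs_bound:
 assumes f: "entire f" and B: "\<And>y. (\<And>i. Im (y $ i) = Im (x $ i)) ==> cmod (f y) <= B"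
 shows "cmod (avgs ks u f x) <= B"
 using B
proof (induction ks arbitrary: x)
 case (Cons i ks)
 show ?case unfolding avgs.simps
 proof (rule avg_bound[OF entire_avgs[OF f]])
  fix t :: real
  show "cmod (avgs ks u f (x + of_real t *s axis i 1)) <= B"
   by (rule Cons.IH, rule Cons.prems) (simp add: axis_def)
 qed
qed simp

text \<open>Moving the i-th coordinate into the imaginary direction multiplies the average by a
  prescribed exponential, while the moved average is still bounded on a larger ball, uniformly in
  u.\<close>

lemma avgs_decay:
 assumes f: "entire f" "periodic f"
 shows "\<exists>B. \<forall>x u. norm x <= K -->
      cmod (avgs ks u f x) <= B * exp (- (c * (\<Sum>i\<leftarrow>ks. \<bar>real_of_int (u i)\<bar>)))"
proof (induction ks arbitrary: K)
 case Nil
 have "compact (f ` cball 0 K)"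
  by (intro compact_continuous_image entire_continuous f) simp
 then obtain B where "\<And>x. x \<in> cball 0 K ==> cmod (f x) <= B"
  by (meson bounded_iff compact_imp_bounded imageI)
 thus ?case by (intro exI[of _ B]) auto
next
 case (Cons i ks)
 define Y where "Y = \<bar>c\<bar> / (2 * pi)"
 obtain B where B: "\<And>x u. norm x <= K + 1 + Y ==>
   cmod (avgs ks u f x) <= B * exp (- (c * (\<Sum>i\<leftarrow>ks. \<bar>real_of_int (u i)\<bar>)))"
  using Cons.IH[of "K + 1 + Y"] by blast
 show ?case
 proof (intro exI[of _ B] allI impI)
  fix x :: "complex^'a" and u assume x: "norm x <= K"
  define g where "g = avgs ks u f"
  have g: "entire g" "g (x + axis i 1) = g x" for x
   using entire_avgs[OF f(1)] periodic_avgs[OF f(2)] by (auto simp: g_def periodic_def)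
  \<comment> \<open>The sign makes \<open>cmod (expi (u i * z))\<close> equal to
    \<open>exp (c * \<bar>u i\<bar>)\<close> whatever the sign of u i.\<close>
  define y where "y = - sgn (real_of_int (u i)) * (c / (2 * pi))"
  define z where "z = \<i> * of_real y"
  have ya: "\<bar>y\<bar> <= Y" by (auto simp: y_def Y_def abs_mult abs_sgn_eq)
  have "cmod (avg i (u i) g (x + z *s axis i 1)) <= B * exp (- (c * (\<Sum>i\<leftarrow>ks. \<bar>real_of_int (u i)\<bar>)))"
  proof (rule avg_bound[OF g(1)])
   fix t :: real assume t: "t \<in> {0..1}"
   have "norm (x + z *s axis i 1 + of_real t *s axis i 1) <= norm x + norm (z *s axis i 1 :: complex^'a) + norm (of_real t *s axis i 1 :: complex^'a)"
    by (meson add_right_mono norm_triangle_ineq order_trans)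
   also have "\<dots> <= K + Y + 1"
    using x ya t by (simp add: norm_vector_scalar_mult norm_axis_1 z_def norm_mult)
   finally show "cmod (g (x + z *s axis i 1 + of_real t *s axis i 1))
     <= B * exp (- (c * (\<Sum>i\<leftarrow>ks. \<bar>real_of_int (u i)\<bar>)))"
    unfolding g_def by (intro B) simp
  qed
  moreover have "avg i (u i) g (x + z *s axis i 1) = expi (of_int (u i) * z) * avg i (u i) g x"
   by (rule avg_axis[OF g])
  moreover have "cmod (expi (of_int (u i) * z)) = exp (c * \<bar>real_of_int (u i)\<bar>)"
   by (simp add: norm_expi z_def y_def abs_sgn mult.commute)
  ultimately have "exp (c * \<bar>real_of_int (u i)\<bar>) * cmod (avg i (u i) g x)
    <= B * exp (- (c * (\<Sum>i\<leftarrow>ks. \<bar>real_of_int (u i)\<bar>)))"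
   by (simp add: norm_mult)
  from mult_left_mono[OF this, of "exp (- (c * \<bar>real_of_int (u i)\<bar>))"]
  have "exp (- (c * \<bar>real_of_int (u i)\<bar>)) * (exp (c * \<bar>real_of_int (u i)\<bar>) * cmod (avg i (u i) g x))
    <= exp (- (c * \<bar>real_of_int (u i)\<bar>)) * (B * exp (- (c * (\<Sum>i\<leftarrow>ks. \<bar>real_of_int (u i)\<bar>))))"
   by simp
  thus "cmod (avgs (i # ks) u f x) <= B * exp (- (c * (\<Sum>i\<leftarrow>i # ks. \<bar>real_of_int (u i)\<bar>)))"
   by (simp add: g_def distrib_left exp_diff exp_minus exp_add mult_ac divide_inverse flip: mult.assoc)
 qed
qed

lemma avgs_sum_modes:
 assumes "finite X"
 shows "avgs ks u (%x. \<Sum>w\<in>X. F w * mode w x) x = (\<Sum>w | w \<in> X \<and> (\<forall>i\<in>set ks. w i = u i). F w * mode w x)"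
proof (induction ks arbitrary: x)
 case (Cons i ks)
 define Y where "Y = {w \<in> X. \<forall>i\<in>set ks. w i = u i}"
 have Y: "finite Y" using assms by (simp add: Y_def)
 have "avgs (i # ks) u (%x. \<Sum>w\<in>X. F w * mode w x) x = avg i (u i) (%x. \<Sum>w\<in>Y. F w * mode w x) x"
  using Cons by (simp add: Y_def avg_def)
 also have "\<dots> = integral {0..1} (%t. \<Sum>w\<in>Y. F w * mode w x * expi (of_int (w i - u i) * of_real t))"
  unfolding avg_def
  by (rule Henstock_Kurzweil_Integration.integral_cong)
    (simp add: sum_distrib_right mode_shift mode_scaled_axis left_diff_distrib expi_diff expi_minus divide_inverse mult.assoc)
 also have "\<dots> = (\<Sum>w\<in>Y. integral {0..1} (%t. F w * mode w x * expi (of_int (w i - u i) * of_real t)))"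
  by (rule integral_sum[OF Y]) (intro integrable_continuous_real continuous_intros)
 also have "\<dots> = (\<Sum>w\<in>Y. F w * mode w x * (if w i - u i = 0 then 1 else 0))"
  by (rule sum.cong[OF refl], subst integral_mult_right, subst integral_expi_int) (rule refl)
 also have "\<dots> = (\<Sum>w\<in>Y. if w i = u i then F w * mode w x else 0)"
  by (rule sum.cong) auto
 also have "\<dots> = (\<Sum>w | w \<in> Y \<and> w i = u i. F w * mode w x)"
  using Y by (simp add: sum.inter_filter)
 also have "{w. w \<in> Y \<and> w i = u i} = {w. w \<in> X \<and> (\<forall>i\<in>set (i # ks). w i = u i)}"
  by (auto simp: Y_def)
 finally show ?case .
qed simp

definition coords :: "'n::finite list" where
 "coords = (SOME ks. set ks = UNIV \<and> distinct ks)"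

lemma coords: "set (coords :: 'n::finite list) = UNIV" "distinct (coords :: 'n::finite list)"
proof -
 have "\<exists>ks :: 'n list. set ks = UNIV \<and> distinct ks"
  using finite_distinct_list[of "UNIV :: 'n set"] by auto
 from someI_ex[OF this] show "set (coords :: 'n::finite list) = UNIV" "distinct (coords :: 'n::finite list)"
  by (simp_all add: coords_def)
qed

definition fcoef :: "(complex^'n::finite => complex) => ('n => int) => complex" where
 "fcoef f u = avgs coords u f 0"

text \<open>After averaging in all directions \<open>avgs_axis\<close> prescribes the behaviour
  along each axis, so the value at 0 determines the function.\<close>

lemma avgs_coords:
 assumes f: "entire f" "periodic f"
 shows "avgs coords u f x = fcoef f u * mode u x"
proof -
 have *: "avgs coords u f (\<Sum>i\<in>I. x $ i *s axis i 1) = fcoef f u * mode u (\<Sum>i\<in>I. x $ i *s axis i 1)"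
  if "finite I" for I
  using that
 proof (induction I rule: finite_induct)
  case (insert i I)
  have "avgs coords u f ((\<Sum>i\<in>I. x $ i *s axis i 1) + x $ i *s axis i 1)
    = expi (of_int (u i) * x $ i) * avgs coords u f (\<Sum>i\<in>I. x $ i *s axis i 1)"
   by (rule avgs_axis[OF f]) (simp add: coords)
  thus ?case
   using insert by (simp add: mode_shift mode_scaled_axis add.commute mult_ac)
 qed (simp add: fcoef_def)
 have "(\<Sum>i\<in>UNIV. x $ i *s axis i 1) = x" by (rule basis_expansion)
 with *[of UNIV] show ?thesis by simp
qed

lemma fcoef_unique:
 assumes "entire f" "periodic f" "entire g" "periodic g" and "\<And>u. fcoef f u = fcoef g u"
 shows "f = g"
proof
 fix x
 have "f x - g x = 0"
 proof (rule avgs_zero[where ks = coords])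
  show "entire (%x. f x - g x)"
   using assms unfolding entire_iff_slicewise by (intro vec.slicewise_diff)
  show "periodic (%x. f x - g x)" using assms by (simp add: periodic_def)
  show "avgs coords u (%x. f x - g x) x = 0" for u x
   using assms by (simp add: avgs_diff avgs_coords)
 qed (rule coords)
 thus "f x = g x" by simp
qed

lemma fcoef_shift:
 assumes "entire f" "periodic f"
 shows "fcoef (%x. f (x + c)) u = mode u c * fcoef f u"
 using avgs_shift[of coords u f c 0] avgs_coords[OF assms, of u c] by (simp add: fcoef_def)

lemma fcoef_mode_mult: "fcoef (%x. mode w x * f x) u = fcoef f (%i. u i - w i)"
 by (simp add: fcoef_def avgs_mult)

lemma fcoef_diff: "entire f ==> entire g ==> fcoef (%x. f x - g x) u = fcoef f u - fcoef g u"
 by (simp add: fcoef_def avgs_diff)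

lemma fcoef_cmult: "fcoef (%x. c * f x) u = c * fcoef f u"
proof -
 have "avgs ks u (%x. c * f x) x = c * avgs ks u f x" for ks x
 proof (induction ks arbitrary: x)
  case (Cons i ks)
  hence "avgs ks u (%x. c * f x) = (%x. c * avgs ks u f x)" by auto
  thus ?case by (simp add: avg_def mult.assoc)
 qed simp
 thus ?thesis by (simp add: fcoef_def)
qed

section \<open>Rapidly decreasing coefficients and Fourier series\<close>

definition l1 :: "('n::finite => int) => real" where
 "l1 u = (\<Sum>i\<in>UNIV. \<bar>real_of_int (u i)\<bar>)"

lemma l1_nonneg [simp]: "l1 u >= 0"
 by (simp add: l1_def sum_nonneg)

lemma l1_triangle: "l1 (%i. u i + w i) <= l1 u + l1 w"
 unfolding l1_def sum.distrib[symmetric] by (rule sum_mono) (simp add: abs_triangle_ineq)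

text \<open>Decay beyond every exponential rate characterises the Fourier coefficients of entire
  periodic functions: \<open>rapid_fcoef\<close> and \<open>entire_fser\<close> are the two
  directions.\<close>

definition rapid :: "(('n::finite => int) => complex) => bool" where
 "rapid F \<longleftrightarrow> (\<forall>c. \<exists>B. \<forall>u. cmod (F u) <= B * exp (- (c * l1 u)))"

lemma rapid_fcoef:
 assumes "entire f" "periodic f"
 shows "rapid (fcoef f)"
 unfolding rapid_def
proof
 fix c
 have "(\<Sum>i\<leftarrow>coords. \<bar>real_of_int (u i)\<bar>) = l1 u" for u :: "'a => int"
  by (simp add: l1_def sum_list_distinct_conv_sum_set coords)
 moreover obtain B where "\<And>x u. norm x <= 0 -->
   cmod (avgs coords u f x) <= B * exp (- (c * (\<Sum>i\<leftarrow>coords. \<bar>real_of_int (u i)\<bar>)))"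
  using avgs_decay[OF assms] by blast
 ultimately show "\<exists>B. \<forall>u. cmod (fcoef f u) <= B * exp (- (c * l1 u))"
  unfolding fcoef_def by (intro exI[of _ B]) auto
qed

lemma summable_exp_abs: "(%k::int. exp (- \<bar>real_of_int k\<bar>)) summable_on UNIV"
proof -
 have g: "(%n::nat. exp (- real n)) summable_on UNIV"
 proof -
  have "summable (%n. exp (- 1 :: real) ^ n)" by (rule summable_geometric) simp
  thus ?thesis
   by (subst summable_on_UNIV_nonneg_real_iff) (simp_all add: exp_of_nat_mult[symmetric])
 qed
 have "(%k::int. exp (- \<bar>real_of_int k\<bar>)) summable_on range int"
  using g by (subst summable_on_reindex) (auto simp: o_def)
 moreover have "(%k::int. exp (- \<bar>real_of_int k\<bar>)) summable_on range (%n. - int n)"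
  using g by (subst summable_on_reindex) (auto simp: o_def inj_on_def)
 ultimately have "(%k::int. exp (- \<bar>real_of_int k\<bar>)) summable_on (range int \<union> range (%n. - int n))"
  by (rule summable_on_union)
 also have "range int \<union> range (%n. - int n) = UNIV"
 proof -
  have "k \<in> range int \<union> range (%n. - int n)" for k by (cases k rule: int_cases2) auto
  thus ?thesis by blast
 qed
 finally show ?thesis .
qed

lemma summable_exp_l1: "(%u::'n::finite => int. exp (- l1 u)) summable_on UNIV"
proof (rule nonneg_bdd_above_summable_on)
 define C where "C = (\<Sum>\<^sub>\<infinity>k::int. exp (- \<bar>real_of_int k\<bar>))"
 show "bdd_above (sum (%u::'n => int. exp (- l1 u)) ` {F. F \<subseteq> UNIV \<and> finite F})"
 proof (rule bdd_aboveI2)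
  fix X :: "('n => int) set" assume "X \<in> {F. F \<subseteq> UNIV \<and> finite F}"
  hence X: "finite X" by simp
  \<comment> \<open>All entries of members of X lie in K, so X sits inside a box, and over a box the
    sum factors into one-dimensional sums.\<close>
  define K where "K = (\<Union>u\<in>X. range u)"
  have K: "finite K" using X by (simp add: K_def)
  have "sum (%u. exp (- l1 u)) X <= sum (%u. exp (- l1 u)) (PiE (UNIV :: 'n set) (%_. K))"
  proof (rule sum_mono2)
   show "X \<subseteq> PiE (UNIV :: 'n set) (%_. K)" by (auto simp: K_def)
  qed (auto intro!: finite_PiE K)
  also have "\<dots> = (\<Sum>u\<in>PiE (UNIV :: 'n set) (%_. K). \<Prod>i\<in>UNIV. exp (- \<bar>real_of_int (u i)\<bar>))"
   by (rule sum.cong) (simp_all add: l1_def exp_sum sum_negf[symmetric])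
  also have "\<dots> = (\<Prod>i\<in>(UNIV :: 'n set). \<Sum>k\<in>K. exp (- \<bar>real_of_int k\<bar>))"
   by (rule prod_sum_PiE[symmetric]) (auto simp: K)
  also have "\<dots> <= (\<Prod>i\<in>(UNIV :: 'n set). C)"
   unfolding C_def
   by (intro prod_mono conjI sum_nonneg finite_sum_le_infsum summable_exp_abs K) auto
  finally show "sum (%u. exp (- l1 u)) X <= (\<Prod>i\<in>(UNIV :: 'n set). C)" .
 qed
qed simp

lemma norm_mode_le: "cmod (mode u x) <= exp (2 * pi * norm x * l1 u)"
proof -
 have "- (2 * pi * (\<Sum>i\<in>UNIV. real_of_int (u i) * Im (x $ i))) <= 2 * pi * (\<Sum>i\<in>UNIV. \<bar>real_of_int (u i)\<bar> * norm x)"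
 proof -
  have "\<bar>\<Sum>i\<in>UNIV. real_of_int (u i) * Im (x $ i)\<bar> <= (\<Sum>i\<in>UNIV. \<bar>real_of_int (u i) * Im (x $ i)\<bar>)"
   by (rule sum_abs)
  also have "\<dots> <= (\<Sum>i\<in>UNIV. \<bar>real_of_int (u i)\<bar> * norm x)"
  proof (rule sum_mono)
   fix i
   have "\<bar>Im (x $ i)\<bar> <= norm x" using abs_Im_le_cmod[of "x $ i"] Finite_Cartesian_Product.norm_nth_le[of x i] by linarith
   thus "\<bar>real_of_int (u i) * Im (x $ i)\<bar> <= \<bar>real_of_int (u i)\<bar> * norm x"
    by (simp add: abs_mult mult_left_mono)
  qed
  finally show ?thesis
   using mult_left_mono[of "- (\<Sum>i\<in>UNIV. real_of_int (u i) * Im (x $ i))" "\<Sum>i\<in>UNIV. \<bar>real_of_int (u i)\<bar> * norm x" "2 * pi"]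
   by simp
 qed
 thus ?thesis
  by (simp add: mode_def norm_expi l1_def sum_distrib_left sum_distrib_right mult_ac)
qed

definition fser :: "(('n::finite => int) => complex) => complex^'n => complex" where
 "fser F x = (\<Sum>\<^sub>\<infinity>u. F u * mode u x)"

lemma rapid_bound:
 assumes "rapid F" "R >= 0"
 obtains B where "\<And>u x. norm x <= R ==> cmod (F u * mode u x) <= B * exp (- l1 u)" "B >= 0"
proof -
 \<comment> \<open>The rate 2 pi R absorbs the growth of the modes on the ball; the extra 1 leaves a
   summable factor.\<close>
 obtain B where B: "\<And>u. cmod (F u) <= B * exp (- ((2 * pi * R + 1) * l1 u))"
  using assms(1) unfolding rapid_def by meson
 have B0: "B >= 0"
  using order_trans[OF norm_ge_zero B[of "%_. 0"]] by (simp add: l1_def)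
 have "cmod (F u * mode u x) <= B * exp (- l1 u)" if x: "norm x <= R" for u x
 proof -
  have "cmod (mode u x) <= exp (2 * pi * R * l1 u)"
   by (rule order_trans[OF norm_mode_le]) (simp add: x mult_right_mono)
  hence "cmod (F u * mode u x) <= B * exp (- ((2 * pi * R + 1) * l1 u)) * exp (2 * pi * R * l1 u)"
   unfolding norm_mult using B0 by (intro mult_mono B) auto
  also have "\<dots> = B * exp (- l1 u)"
   by (simp add: mult.assoc flip: exp_add) (simp add: algebra_simps)
  finally show ?thesis .
 qed
 with B0 show ?thesis using that by blast
qed

lemma fser_has_sum:
 assumes "rapid F"
 shows "((%u. F u * mode u x) has_sum fser F x) UNIV" "(%u. norm (F u * mode u x)) summable_on UNIV"
proof -
 obtain B where B: "\<And>u y. norm y <= norm x ==> cmod (F u * mode u y) <= B * exp (- l1 u)"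
  using rapid_bound[OF assms norm_ge_zero] by blast
 have "(%u::'a => int. B * exp (- l1 u)) summable_on UNIV"
  by (intro summable_on_cmult_right summable_exp_l1)
 thus s: "(%u. norm (F u * mode u x)) summable_on UNIV"
  using B[OF order.refl] by (rule Infinite_Sum.abs_summable_on_comparison_test')
 show "((%u. F u * mode u x) has_sum fser F x) UNIV"
  unfolding fser_def using abs_summable_summable[OF s] by (rule has_sum_infsum)
qed

lemma entire_fser:
 assumes "rapid F"
 shows "entire (fser F)"
 unfolding entire_iff_slicewise fser_def[abs_def]
proof (rule vec.slicewise_infsum)
 show "slicewise_holomorphic (*s) UNIV (%x. F u * mode u x)" for u
  using entire_mode[of u] by (intro vec.slicewise_mult) (auto simp: entire_iff_slicewise)
 fix x :: "complex^'a"
 obtain B where B: "\<And>u y. norm y <= norm x + 1 ==> cmod (F u * mode u y) <= B * exp (- l1 u)"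
  by (rule rapid_bound[OF assms, of "norm x + 1"]) auto
 show "\<exists>U M. open U \<and> x \<in> U \<and> M summable_on UNIV \<and> (\<forall>y\<in>U \<inter> UNIV. \<forall>u\<in>UNIV. cmod (F u * mode u y) <= M u)"
 proof (intro exI[of _ "ball 0 (norm x + 1)"] exI[of _ "%u. B * exp (- l1 u)"] conjI ballI)
  show "(%u::'a => int. B * exp (- l1 u)) summable_on UNIV"
   by (intro summable_on_cmult_right summable_exp_l1)
 qed (auto intro!: B)
qed simp

lemma periodic_fser: "periodic (fser F)"
proof -
 have "mode u (x + axis i 1) = mode u x" for u i and x :: "complex^'a"
  using periodic_mode[of u] by (simp add: periodic_def)
 thus ?thesis by (simp add: periodic_def fser_def)
qed

lemma entire_sum_modes: "entire (%x. \<Sum>w\<in>X. F w * mode w x)"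
 using entire_mode unfolding entire_iff_slicewise
 by (intro vec.slicewise_sum vec.slicewise_mult) auto

text \<open>The iterated average at 0 only sees real points, where all modes have modulus 1 and
  finite partial sums converge uniformly; a partial sum containing u has the right coefficient
  exactly.\<close>

lemma fcoef_fser:
 assumes F: "rapid F"
 shows "fcoef (fser F) u = F u"
proof -
 have "cmod (fcoef (fser F) u - F u) <= e" if e: "e > 0" for e
 proof -
  obtain B where B: "\<And>w y. norm y <= 0 ==> cmod (F w * mode w y) <= B * exp (- l1 w)"
   by (rule rapid_bound[OF assms order.refl]) auto
  have "uniform_limit {y. \<forall>i. Im (y $ i) = 0} (%X y. \<Sum>w\<in>X. F w * mode w y) (fser F) (finite_subsets_at_top UNIV)"
   unfolding fser_def
  proof (rule Weierstrass_m_test_general[where M = "%w. B * exp (- l1 w)"])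
   show "norm (F w * mode w y) <= B * exp (- l1 w)" if "y \<in> {y. \<forall>i. Im (y $ i) = 0}" for w y
    using that B[of 0 w] by (simp add: norm_mult mode_def norm_expi)
  qed (intro summable_on_cmult_right summable_exp_l1)
  hence "\<forall>\<^sub>F X in finite_subsets_at_top UNIV. \<forall>y\<in>{y. \<forall>i. Im (y $ i) = 0}. dist (\<Sum>w\<in>X. F w * mode w y) (fser F y) < e"
   using e by (rule uniform_limitD)
  then obtain X0 where X0: "finite X0" "\<And>X y. finite X ==> X0 \<subseteq> X ==> (\<forall>i. Im (y $ i) = 0) ==>
    dist (\<Sum>w\<in>X. F w * mode w y) (fser F y) < e"
   unfolding eventually_finite_subsets_at_top by auto
  define X where "X = insert u X0"
  have X: "finite X" "X0 \<subseteq> X" "u \<in> X" using X0 by (auto simp: X_def)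
  have "cmod (avgs coords u (%x. fser F x - (\<Sum>w\<in>X. F w * mode w x)) 0) <= e"
  proof (rule avgs_bound)
   show "entire (%x. fser F x - (\<Sum>w\<in>X. F w * mode w x))"
    using entire_fser[OF F] entire_sum_modes[of F X] unfolding entire_iff_slicewise by (rule vec.slicewise_diff)
   fix y :: "complex^'a" assume "\<And>i. Im (y $ i) = Im (0 $ i)"
   thus "cmod (fser F y - (\<Sum>w\<in>X. F w * mode w y)) <= e"
    using X0(2)[OF X(1,2), of y] by (simp add: dist_norm norm_minus_commute)
  qed
  moreover have "{w \<in> X. \<forall>i\<in>set coords. w i = u i} = {u}"
   using X coords by auto
  ultimately show ?thesis
   using avgs_sum_modes[OF X(1), of coords u F 0]
   by (simp add: avgs_diff entire_fser[OF F] entire_sum_modes fcoef_def)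
 qed
 hence "cmod (fcoef (fser F) u - F u) <= 0" by (rule dense_ge)
 thus ?thesis by simp
qed

section \<open>Factors of automorphy\<close>

lemma has_sum_diff:
 fixes f g :: "'a => complex"
 assumes "(f has_sum a) A" "(g has_sum b) A"
 shows "((%x. f x - g x) has_sum (a - b)) A"
 using has_sum_add[OF assms(1) has_sum_uminusI[OF assms(2)]] by simp

lemma continuous_integral_constant:
 fixes f :: "'a::real_normed_vector => complex"
 assumes c: "continuous_on UNIV f" and i: "\<And>x. expi (f x) = 1"
 shows "f x = f y"
proof -
 have "f constant_on UNIV"
 proof (rule continuous_discrete_range_constant[OF _ c])
  fix x :: 'a
  show "\<exists>e>0. \<forall>y. y \<in> UNIV \<and> f y ~= f x --> e <= norm (f y - f x)"
  proof (intro exI[of _ 1] conjI allI impI)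
   fix y assume "y \<in> UNIV \<and> f y ~= f x"
   moreover obtain m where "f x = of_int m" using i[of x] by (auto simp: expi_eq_1_iff elim: Ints_cases)
   moreover obtain n where "f y = of_int n" using i[of y] by (auto simp: expi_eq_1_iff elim: Ints_cases)
   ultimately show "1 <= norm (f y - f x)"
    by (simp flip: of_int_diff)
  qed simp
 qed (rule convex_connected[OF convex_UNIV])
 thus ?thesis unfolding constant_on_def by (metis UNIV_I)
qed

text \<open>A continuous logarithm exists because the domain is contractible. On each complex line
  it differs from a holomorphic logarithm by a continuous integer-valued function, hence by a
  constant.\<close>

lemma entire_logarithm:
 assumes e: "entire e" and nz: "\<And>v. e v ~= 0"
 obtains g where "entire g" "\<And>v. e v = expi (g v)"
proof -
 obtain g0 where g0: "continuous_on UNIV g0" "\<And>x. e x = exp (g0 x)"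
  using continuous_logarithm_on_contractible[OF entire_continuous[OF e] convex_imp_contractible[OF convex_UNIV]] nz
  by auto
 define g where "g v = g0 v / (2 * of_real pi * \<i>)" for v
 have eg: "e v = expi (g v)" for v by (simp add: g_def expi_def g0)
 have gc: "continuous_on UNIV g" unfolding g_def by (intro continuous_intros g0) simp
 have "(%t. g (x + t *s u)) field_differentiable at 0" for x u
 proof -
  define \<phi> where "\<phi> t = e (x + t *s u)" for t
  have "\<phi> holomorphic_on UNIV" unfolding \<phi>_def by (rule entire_slice[OF e])
  then obtain G where G: "G holomorphic_on UNIV" "\<And>z. \<phi> z = exp (G z)"
   using simply_connected_eq_holomorphic_log nz
   by (metis \<phi>_def UNIV_I convex_UNIV convex_imp_simply_connected open_UNIV)
  define D where "D t = g (x + t *s u) - G t / (2 * of_real pi * \<i>)" for t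
  have "continuous_on UNIV (%t. g (x + t *s u))"
   by (rule continuous_on_compose2[OF gc]) (auto intro!: continuous_intros)
  hence Dc: "continuous_on UNIV D"
   unfolding D_def using holomorphic_on_imp_continuous_on[OF G(1)] by (intro continuous_intros) auto
  have D1: "expi (D t) = 1" for t
  proof -
   have "expi (G t / (2 * of_real pi * \<i>)) = \<phi> t" by (simp add: expi_def G)
   moreover have "\<phi> t ~= 0" by (simp add: \<phi>_def nz)
   ultimately show ?thesis by (simp add: D_def expi_diff eg[symmetric] \<phi>_def)
  qed
  have "g (x + t *s u) = D 0 + G t / (2 * of_real pi * \<i>)" for t
   using continuous_integral_constant[OF Dc D1, of t 0] D_def[of t] by (simp add: algebra_simps)
  hence "(%t. g (x + t *s u)) holomorphic_on UNIV"
   using G(1) by (auto intro!: holomorphic_intros)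
  thus ?thesis by (simp add: holomorphic_on_imp_differentiable_at)
 qed
 hence "entire g" using gc by (simp add: entire_iff_slicewise slicewise_holomorphic_def)
 with eg show ?thesis using that by blast
qed

text \<open>The cocycle relation makes the right-hand side integer-valued, hence constant in v.
  Other logarithms differ by constants that cancel, so the description in \<open>chern_form\<close>
  is unique and any choice of logarithms computes it.\<close>

lemma chern_form_eq:
 assumes F: "factor_of_automorphy \<Lambda> e" and lm: "l \<in> \<Lambda>" "m \<in> \<Lambda>"
  and g: "entire g" "\<And>v. e l v = expi (g v)" and h: "entire h" "\<And>v. e m v = expi (h v)"
 shows "of_int (chern_form e l m) = h (v + l) + g v - g (v + m) - h v"
proof -
 define P where "P k \<longleftrightarrow> (\<exists>g h. entire g \<and> entire h \<and>
    (\<forall>v. e l v = exp (2 * of_real pi * \<i> * g v)) \<and>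
    (\<forall>v. e m v = exp (2 * of_real pi * \<i> * h v)) \<and>
    (\<forall>v. of_int k = h (v + l) + g v - g (v + m) - h v))" for k :: int
 define c where "c v = h (v + l) + g v - g (v + m) - h v" for v
 have sc: "continuous_on UNIV (%v. f (v + y))" if "entire f" for f and y :: "complex^'a"
  using entire_continuous[OF entire_shift[OF that]] .
 have cc: "continuous_on UNIV c"
  unfolding c_def using g(1) h(1) by (intro continuous_intros sc entire_continuous)
 have c1: "expi (c v) = 1" for v
 proof -
  have "e l (v + m) * e m v = e m (v + l) * e l v"
   using F lm unfolding factor_of_automorphy_def by (metis add.commute)
  thus ?thesis
   by (simp add: c_def expi_diff expi_add g h)
 qed
 obtain k where k: "c 0 = of_int k" using c1[of 0] by (auto simp: expi_eq_1_iff elim: Ints_cases)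
 have ck: "c v = of_int k" for v
  using continuous_integral_constant[OF cc c1, of v 0] k by simp
 have "P k"
  unfolding P_def using g h ck[symmetric] unfolding c_def expi_def
  by (simp, rule_tac exI[of _ g], simp, rule_tac exI[of _ h], simp)
 moreover have "k' = k" if Pk: "P k'" for k'
 proof -
  obtain g' h' where g': "entire g'" "\<And>v. e l v = expi (g' v)" and h': "entire h'" "\<And>v. e m v = expi (h' v)"
   and k': "\<And>v. of_int k' = h' (v + l) + g' v - g' (v + m) - h' v"
   using Pk unfolding P_def expi_def by auto
  have const: "f' x - f x = f' y - f y" if "entire f" "entire f'" "\<And>v. expi (f v) = expi (f' v)" for f f' x y
  proof (rule continuous_integral_constant[of "%x. f' x - f x"])
   show "continuous_on UNIV (%x. f' x - f x)" using that by (intro continuous_intros entire_continuous)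
  qed (use that in \<open>simp add: expi_diff\<close>)
  have "g' (0 + m) - g (0 + m) = g' 0 - g 0" by (rule const) (use g g' in auto)
  moreover have "h' (0 + l) - h (0 + l) = h' 0 - h 0" by (rule const) (use h h' in auto)
  ultimately have "g' m = g m + (g' 0 - g 0)" "h' l = h l + (h' 0 - h 0)"
   by (simp_all add: algebra_simps)
  hence "of_int k' = c 0" using k'[of 0] by (simp add: c_def)
  thus ?thesis using k by simp
 qed
 ultimately have "(THE k. P k) = k" by (rule the_equality)
 hence "chern_form e l m = k" by (simp add: chern_form_def P_def)
 thus ?thesis using ck[of v] by (simp add: c_def)
qed

lemma two_pi_i_nz: "2 * of_real pi * \<i> ~= 0"
 by simp

section \<open>Guichard's theorem on difference equations\<close>

text \<open>The freedom in the radius is the point: radius 1 serves to define Taylor coefficients,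
  large radii to estimate them.\<close>

lemma taylor_coefficient_integral:
 assumes f: "f holomorphic_on UNIV" and R: "R > 0"
 shows "integral {0..1} (%t. f (of_real R * expi (of_real t)) / (of_real R * expi (of_real t)) ^ k)
    = (deriv ^^ k) f 0 / fact k"
proof -
 have "((%u. f u / (u - 0) ^ Suc k) has_contour_integral ((2 * pi * \<i>) / fact k) * (deriv ^^ k) f 0) (circlepath 0 R)"
  by (rule Cauchy_has_contour_integral_higher_derivative_circlepath)
    (use R f holomorphic_on_subset holomorphic_on_imp_continuous_on in auto)
 hence "contour_integral (circlepath 0 R) (%u. f u / (u - 0) ^ Suc k) = ((2 * pi * \<i>) / fact k) * (deriv ^^ k) f 0"
  by (rule contour_integral_unique)
 moreover have "contour_integral (circlepath 0 R) (%u. f u / (u - 0) ^ Suc k) =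
   integral {0..1} (%t. (2 * of_real pi * \<i>) * (f (of_real R * expi (of_real t)) / (of_real R * expi (of_real t)) ^ k))"
  unfolding contour_integral_integral
 proof (rule Henstock_Kurzweil_Integration.integral_cong)
  fix t :: real assume t: "t \<in> {0..1}"
  show "f (circlepath 0 R t) / (circlepath 0 R t - 0) ^ Suc k * vector_derivative (circlepath 0 R) (at t) =
    2 * of_real pi * \<i> * (f (of_real R * expi (of_real t)) / (of_real R * expi (of_real t)) ^ k)"
  proof -
   define w where "w = of_real R * expi (of_real t)"
   have "w ~= 0" using R by (simp add: w_def)
   moreover have "circlepath 0 R t = w" by (simp add: circlepath w_def expi_def)
   moreover have "vector_derivative (circlepath 0 R) (at t) = 2 * of_real pi * \<i> * w"
    by (simp add: vector_derivative_circlepath w_def expi_def)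
   ultimately show ?thesis unfolding w_def[symmetric] by simp
  qed
 qed
 ultimately have "(2 * of_real pi * \<i>) * integral {0..1} (%t. f (of_real R * expi (of_real t)) / (of_real R * expi (of_real t)) ^ k)
   = (2 * of_real pi * \<i>) * ((deriv ^^ k) f 0 / fact k)"
  unfolding integral_mult_right by simp
 thus ?thesis unfolding mult_left_cancel[OF two_pi_i_nz] .
qed

text \<open>These circles pass midway between the zeros 2 pi i m of \<open>exp s - 1\<close>. If
  \<open>\<bar>Re s\<bar> >= 1\<close>, the modulus of \<open>exp s\<close> is already away from 1;
  otherwise \<open>\<bar>Im s\<bar>\<close> is within 1 of an odd multiple of pi, where the cosine
  is not positive.\<close>

lemma norm_exp_minus_1_ge:
 assumes "cmod s = (2 * real k + 1) * pi"
 shows "cmod (exp s - 1) >= 1 / 2"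
proof (cases "\<bar>Re s\<bar> >= 1")
 case True
 have e: "exp (1::real) >= 2" using exp_ge_add_one_self[of 1] by simp
 have "\<bar>exp (Re s) - 1\<bar> >= 1 / 2"
 proof (cases "Re s >= 1")
  case True
  hence "exp (Re s) >= exp 1" by simp
  with e show ?thesis by linarith
 next
  case False
  hence "exp (Re s) <= exp (- 1)" using True by simp
  also have "exp (- 1 :: real) <= 1 / 2" using e by (simp add: exp_minus field_simps)
  finally show ?thesis by linarith
 qed
 moreover have "\<bar>cmod (exp s) - cmod 1\<bar> <= cmod (exp s - 1)" by (rule norm_triangle_ineq3)
 ultimately show ?thesis by simp
next
 case False
 define R where "R = (2 * real k + 1) * pi"
 define \<delta> where "\<delta> = R - \<bar>Im s\<bar>"
 have R: "R >= pi" unfolding R_def by simp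
 have pi3: "pi > 3" by (rule pi_gt3)
 have sq: "R\<^sup>2 = (Re s)\<^sup>2 + (Im s)\<^sup>2" using assms cmod_power2[of s] by (simp add: R_def)
 have le: "\<bar>Im s\<bar> <= R" using assms abs_Im_le_cmod[of s] by (simp add: R_def)
 have "(Re s)\<^sup>2 <= 1" using False by (simp add: abs_square_le_1)
 hence "\<delta> * (R + \<bar>Im s\<bar>) <= 1"
  using sq by (simp add: \<delta>_def power2_eq_square algebra_simps flip: abs_mult)
 moreover have "\<delta> * 1 <= \<delta> * (R + \<bar>Im s\<bar>)"
  using le R pi3 by (intro mult_left_mono) (auto simp: \<delta>_def)
 ultimately have d: "0 <= \<delta>" "\<delta> <= 1" using le by (auto simp: \<delta>_def)
 have "cos (Im s) = cos \<bar>Im s\<bar>" by (simp add: abs_if)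
 also have "\<dots> = cos (R - \<delta>)" by (simp add: \<delta>_def)
 also have "\<dots> = cos (pi - \<delta> + real k * (2 * pi))" by (simp add: R_def algebra_simps)
 also have "\<dots> = cos (pi - \<delta>)" using cos.plus_of_nat[of "pi - \<delta>" k] by simp
 also have "\<dots> = - cos \<delta>" by (simp add: cos_diff)
 also have "cos \<delta> >= 0" using d pi3 by (intro cos_ge_zero) auto
 hence "- cos \<delta> <= 0" by simp
 finally have "exp (Re s) * cos (Im s) <= 0" by (simp add: mult_nonneg_nonpos)
 hence "Re (exp s - 1) <= - 1" by (simp add: Re_exp)
 hence "\<bar>Re (exp s - 1)\<bar> >= 1" by simp
 thus ?thesis using abs_Re_le_cmod[of "exp s - 1"] by linarith
qed

lemma fact_le_self_power: "fact k <= real k ^ k"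
 by (metis fact_le_power of_nat_fact of_nat_le_iff of_nat_power order.refl)

text \<open>Guichard's contour integral of \<open>exp (z s) / ((exp s - 1) s ^ (k + 1))\<close>,
  times k! / (2 pi i). Replacing z by z + 1 cancels the factor \<open>exp s - 1\<close>, which
  leaves a Taylor coefficient of \<open>exp (z s)\<close>. Enclosing further poles only adds
  functions of period 1, so the radius may grow with k; this keeps k! / R^k below 1 and the bound
  geometric in k.\<close>

lemma guichard_basis:
 obtains \<phi> :: "nat => complex => complex"
 where "\<And>k. \<phi> k holomorphic_on UNIV" "\<And>k z. \<phi> k (z + 1) - \<phi> k z = z ^ k"
  "\<And>k z. cmod (\<phi> k z) <= 2 * exp (pi * cmod z) * exp (2 * pi * cmod z) ^ k"
proof -
 define R where "R k = (2 * real k + 1) * pi" for k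
 define s where "s k t = of_real (R k) * expi (of_real t)" for k and t :: real
 define K where "K k z t = exp (z * s k t) / ((exp (s k t) - 1) * s k t ^ k)" for k z t
 define \<phi> where "\<phi> k z = fact k * integral {0..1} (K k z)" for k z
 have Rpos: "R k > 0" for k by (simp add: R_def add_nonneg_pos)
 have ns: "cmod (s k t) = R k" for k t using Rpos[of k] by (simp add: s_def norm_mult norm_expi)
 have snz: "s k t ~= 0" for k t using ns[of k t] Rpos[of k] by auto
 have en: "cmod (exp (s k t) - 1) >= 1 / 2" for k t
  by (rule norm_exp_minus_1_ge) (simp add: ns R_def)
 have enz: "exp (s k t) - 1 ~= 0" for k t using en[of k t] by auto
 have scont: "continuous_on A (s k)" for A k unfolding s_def by (intro continuous_intros)
 have Kcont: "continuous_on (UNIV \<times> {0..1}) (%(z, t). K k z t)" for k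
 proof -
  have "continuous_on (UNIV \<times> {0..1}) (%p::complex \<times> real. s k (snd p))"
   by (rule continuous_on_compose2[OF scont[of UNIV]]) (auto intro!: continuous_intros)
  thus ?thesis
   unfolding K_def split_beta using enz snz by (intro continuous_intros) auto
 qed
 have Kcont1: "continuous_on {0..1} (K k z)" for k z
  unfolding K_def using enz snz by (intro continuous_intros scont) auto
 have hol: "\<phi> k holomorphic_on UNIV" for k
 proof -
  have "(%z. integral {0..1} (K k z)) holomorphic_on UNIV"
   by (rule holomorphic_parametric_integral[OF open_UNIV Kcont]) (unfold K_def, intro holomorphic_intros, use enz snz in auto)
  thus ?thesis unfolding \<phi>_def by (intro holomorphic_intros)
 qed
 have diff: "\<phi> k (z + 1) - \<phi> k z = z ^ k" for k z
 proof -
  have "\<phi> k (z + 1) - \<phi> k z = fact k * integral {0..1} (%t. K k (z + 1) t - K k z t)"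
   unfolding \<phi>_def using Kcont1
   by (subst integral_diff) (auto intro: integrable_continuous_real simp: right_diff_distrib)
  also have "integral {0..1} (%t. K k (z + 1) t - K k z t) =
    integral {0..1} (%t. exp (z * (of_real (R k) * expi (of_real t))) / (of_real (R k) * expi (of_real t)) ^ k)"
  proof (rule Henstock_Kurzweil_Integration.integral_cong)
   fix t :: real
   have "K k (z + 1) t - K k z t = exp (z * s k t) * (exp (s k t) - 1) / ((exp (s k t) - 1) * s k t ^ k)"
    by (simp add: K_def exp_add algebra_simps diff_divide_distrib)
   also have "\<dots> = exp (z * s k t) / s k t ^ k" using enz[of k t] by simp
   finally show "K k (z + 1) t - K k z t = exp (z * (of_real (R k) * expi (of_real t))) / (of_real (R k) * expi (of_real t)) ^ k"
    by (simp add: s_def)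
  qed
  also have "\<dots> = (deriv ^^ k) (%s. exp (z * s)) 0 / fact k"
   by (rule taylor_coefficient_integral[OF _ Rpos]) (intro holomorphic_intros)
  also have "(deriv ^^ k) (%s. exp (z * s)) = (%s. z ^ k * exp (z * s))"
  proof (induction k)
   case (Suc k)
   thus ?case
    by (auto intro!: ext DERIV_imp_deriv derivative_eq_intros)
  qed simp
  finally show ?thesis by simp
 qed
 have bd: "cmod (\<phi> k z) <= 2 * exp (pi * cmod z) * exp (2 * pi * cmod z) ^ k" for k z
 proof -
  have "cmod (integral {0..1} (K k z)) <= exp (cmod z * R k) / (1 / 2 * R k ^ k) * (1 - 0)"
  proof (rule integral_bound[OF _ Kcont1])
   fix t :: real
   have "cmod (exp (z * s k t)) <= exp (cmod z * R k)"
    using norm_exp[of "z * s k t"] by (simp add: norm_mult ns)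
   moreover have "1 / 2 * R k ^ k <= cmod ((exp (s k t) - 1) * s k t ^ k)"
    unfolding norm_mult norm_power ns using en[of k t] Rpos[of k] by (intro mult_right_mono) auto
   ultimately show "cmod (K k z t) <= exp (cmod z * R k) / (1 / 2 * R k ^ k)"
    unfolding K_def norm_divide using Rpos[of k] by (intro frac_le) auto
  qed simp
  hence "cmod (\<phi> k z) <= fact k * (exp (cmod z * R k) / (1 / 2 * R k ^ k))"
   unfolding \<phi>_def norm_mult norm_fact by (intro mult_left_mono) simp_all
  also have "\<dots> = 2 * exp (cmod z * R k) * (fact k / R k ^ k)" by simp
  also have "\<dots> <= 2 * exp (cmod z * R k) * 1"
  proof (rule mult_left_mono)
   have "real k <= R k"
    using pi_gt3 mult_mono[of "real k" "2 * real k + 1" 1 pi] by (simp add: R_def)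
   hence "fact k <= R k ^ k"
    using fact_le_self_power[of k] power_mono[of "real k" "R k" k] by linarith
   thus "fact k / R k ^ k <= 1" using Rpos[of k] by simp
  qed simp
  also have "exp (cmod z * R k) = exp (pi * cmod z) * exp (2 * pi * cmod z) ^ k"
   by (simp add: R_def exp_of_nat_mult[symmetric] flip: exp_add) (simp add: algebra_simps)
  finally show ?thesis by simp
 qed
 show ?thesis using that[OF hol diff bd] .
qed

text \<open>\<open>T\<close> applies Guichard's solutions for the right hand sides \<open>z ^ k\<close> termwise to the Taylor series.\<close>

lemma difference_equation_operator:
 fixes i :: "'n::finite"
 obtains T :: "(complex^'n => complex) => complex^'n => complex"
 where "\<And>g. entire g ==> entire (T g)"
  "\<And>g v. entire g ==> T g (v + axis i 1) - T g v = g v"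
  "\<And>g c v. c $ i = 0 ==> T g (v + c) = T (%x. g (x + c)) v"
proof -
 obtain \<phi> :: "nat => complex => complex" where hol: "\<And>k. \<phi> k holomorphic_on UNIV"
  and diff: "\<And>k z. \<phi> k (z + 1) - \<phi> k z = z ^ k"
  and bd: "\<And>k z. cmod (\<phi> k z) <= 2 * exp (pi * cmod z) * exp (2 * pi * cmod z) ^ k"
  using guichard_basis by blast
 define E :: "complex^'n" where "E = axis i 1"
 \<comment> \<open>\<open>base\<close> removes the i-th coordinate, so \<open>a g k v\<close> is the
   k-th Taylor coefficient of g in that coordinate; the integral form shows that it is entire in
   v.\<close>
 define base where "base v = v - v $ i *s E" for v
 define a where "a g k v = integral {0..1} (%t. g (base v + (of_real 1 * expi (of_real t)) *s E)
           / (of_real 1 * expi (of_real t)) ^ k)" for g k v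
 define T where "T g v = (\<Sum>\<^sub>\<infinity>k. a g k v * \<phi> k (v $ i))" for g v
 have Ei: "E $ i = 1" by (simp add: E_def)
 have base: "base (v + E) = base v" for v
  by (simp add: base_def Ei vec.sc_add_left algebra_simps)
 have slice: "(%z. g (base v + z *s E)) holomorphic_on UNIV" if "entire g" for g v
  by (rule entire_slice[OF that])
 have a_R: "a g k v = integral {0..1} (%t. g (base v + (of_real R * expi (of_real t)) *s E)
           / (of_real R * expi (of_real t)) ^ k)" if "entire g" "R > 0" for g k v R
  unfolding a_def
  using taylor_coefficient_integral[OF slice[OF that(1)] zero_less_one]
   taylor_coefficient_integral[OF slice[OF that(1)] that(2)] by simp
 have a_der: "a g k v = (deriv ^^ k) (%z. g (base v + z *s E)) 0 / fact k" if "entire g" for g k v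
  unfolding a_def using taylor_coefficient_integral[OF slice[OF that] zero_less_one] by simp
 have cont2: "continuous_on UNIV (%p::(complex^'n) \<times> real. g (base (fst p) + (of_real R * expi (of_real (snd p))) *s E))"
  if "entire g" for g R
  unfolding base_def
  by (rule continuous_on_compose2[OF entire_continuous[OF that, of UNIV]]) (auto intro!: continuous_intros)
 have a_ent: "entire (a g k)" if g: "entire g" for g k
  unfolding entire_iff_slicewise a_def[abs_def]
 proof (rule vec.slicewise_parametric_integral)
  show "continuous_on (UNIV \<times> {0..1}) (%(v, t). g (base v + (of_real 1 * expi (of_real t)) *s E)
           / (of_real 1 * expi (of_real t)) ^ k)"
   unfolding split_beta using continuous_on_subset[OF cont2[OF g, of 1]] by (intro continuous_intros) auto
  fix t :: real
  have "slicewise_holomorphic (*s) UNIV (%v. g (base v + (of_real 1 * expi (of_real t)) *s E))"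
   by (rule slicewise_affine_compose[where sc = "(*s)" and S = UNIV and \<psi> = "%u. u - u $ i *s E"])
     (use g in \<open>auto simp: entire_iff_slicewise base_def vec.sc_add_left vec.sc_sc vec_eq_iff algebra_simps intro!: continuous_intros\<close>)
  hence "slicewise_holomorphic (*s) UNIV (%v. inverse ((of_real 1 * expi (of_real t)) ^ k) * g (base v + (of_real 1 * expi (of_real t)) *s E))"
   by (intro vec.slicewise_mult vec.slicewise_const)
  thus "slicewise_holomorphic (*s) UNIV (%v. g (base v + (of_real 1 * expi (of_real t)) *s E)
           / (of_real 1 * expi (of_real t)) ^ k)"
   by (simp add: divide_inverse mult.commute)
 qed simp
 have bound: "\<exists>C. \<forall>k v. norm v <= K --> cmod (a g k v * \<phi> k (v $ i)) <= C * (1/2) ^ k" if g: "entire g" and K: "K >= 0" for g K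
 proof -
  \<comment> \<open>Twice the growth rate of \<open>\<phi> k\<close> in k on the ball, so the series
    is dominated by a geometric one of ratio 1/2.\<close>
  define R where "R = 2 * exp (2 * pi * K)"
  have R: "R > 0" by (simp add: R_def)
  have "compact (g ` cball 0 (2 * K + R))"
   by (intro compact_continuous_image entire_continuous g) simp
  then obtain B where B: "\<And>x. x \<in> cball 0 (2 * K + R) ==> cmod (g x) <= B"
   by (meson bounded_iff compact_imp_bounded imageI)
  have B0: "B >= 0" using order_trans[OF norm_ge_zero B[of 0]] K R by simp
  show ?thesis
  proof (intro exI[of _ "B * (2 * exp (pi * K))"] allI impI)
   fix k v assume v: "norm (v :: complex^'n) <= K"
   have vi: "cmod (v $ i) <= K" using v Finite_Cartesian_Product.norm_nth_le[of v i] by linarith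
   have nE: "norm E = 1" by (simp add: E_def norm_axis_1)
   have "norm (base v) <= norm v + cmod (v $ i)"
    using norm_triangle_ineq4[of v "v $ i *s E"] by (simp add: base_def norm_vector_scalar_mult nE)
   hence nb: "norm (base v) <= 2 * K" using v vi by simp
   have "cmod (a g k v) <= B / R ^ k * (1 - 0)"
    unfolding a_R[OF g R]
   proof (rule integral_bound)
    have "continuous_on {0..1} (%t. g (base v + (of_real R * expi (of_real t)) *s E))"
     by (rule continuous_on_compose2[OF entire_continuous[OF g, of UNIV]]) (auto intro!: continuous_intros)
    thus "continuous_on {0..1} (%t. g (base v + (of_real R * expi (of_real t)) *s E) / (of_real R * expi (of_real t)) ^ k)"
     using R by (intro continuous_intros) auto
    fix t :: real
    have "norm (base v + (of_real R * expi (of_real t)) *s E) <= 2 * K + R"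
     using norm_triangle_ineq[of "base v" "(of_real R * expi (of_real t)) *s E"] nb R
     by (simp add: norm_vector_scalar_mult nE norm_mult norm_expi)
    hence "cmod (g (base v + (of_real R * expi (of_real t)) *s E)) <= B"
     by (intro B) simp
    thus "cmod (g (base v + (of_real R * expi (of_real t)) *s E) / (of_real R * expi (of_real t)) ^ k) <= B / R ^ k"
     using R by (simp add: norm_divide norm_power norm_mult norm_expi divide_right_mono)
   qed simp
   moreover have "cmod (\<phi> k (v $ i)) <= 2 * exp (pi * K) * exp (2 * pi * K) ^ k"
    by (rule order_trans[OF bd]) (use vi in \<open>auto intro!: mult_mono power_mono\<close>)
   ultimately have "cmod (a g k v * \<phi> k (v $ i)) <= B / R ^ k * (2 * exp (pi * K) * exp (2 * pi * K) ^ k)"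
    unfolding norm_mult using B0 R by (intro mult_mono) auto
   also have "\<dots> = B * (2 * exp (pi * K)) * (1/2) ^ k"
    by (simp add: R_def power_mult_distrib power_divide)
   finally show "cmod (a g k v * \<phi> k (v $ i)) <= B * (2 * exp (pi * K)) * (1/2) ^ k" .
  qed
 qed
 have geo: "(%k::nat. C * (1/2) ^ k) summable_on UNIV" for C :: real
 proof (rule summable_on_cmult_right)
  show "(%k::nat. (1/2::real) ^ k) summable_on UNIV"
   by (subst summable_on_UNIV_nonneg_real_iff) (simp_all add: summable_geometric)
 qed
 have summ: "(%k. a g k v * \<phi> k (v $ i)) summable_on UNIV" if g: "entire g" for g v
 proof -
  obtain C where "\<And>k w. norm w <= norm v ==> cmod (a g k w * \<phi> k (w $ i)) <= C * (1/2) ^ k"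
   using bound[OF g norm_ge_zero] by blast
  hence "(%k. norm (a g k v * \<phi> k (v $ i))) summable_on UNIV"
   by (intro Infinite_Sum.abs_summable_on_comparison_test'[OF geo[of C]]) simp
  thus ?thesis by (rule abs_summable_summable)
 qed
 have 1: "entire (T g)" if g: "entire g" for g
  unfolding entire_iff_slicewise T_def[abs_def]
 proof (rule vec.slicewise_infsum)
  show "slicewise_holomorphic (*s) UNIV (%v. a g k v * \<phi> k (v $ i))" for k
   using a_ent[OF g] hol by (intro vec.slicewise_mult vec.slicewise_compose[of "\<phi> k"]) (auto simp: entire_iff_slicewise)
  fix x :: "complex^'n"
  obtain C where C: "\<And>k w. norm w <= norm x + 1 ==> cmod (a g k w * \<phi> k (w $ i)) <= C * (1/2) ^ k"
   using bound[OF g, of "norm x + 1"] by auto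
  show "\<exists>U M. open U \<and> x \<in> U \<and> M summable_on UNIV \<and> (\<forall>y\<in>U \<inter> UNIV. \<forall>k\<in>UNIV. cmod (a g k y * \<phi> k (y $ i)) <= M k)"
   by (intro exI[of _ "ball 0 (norm x + 1)"] exI[of _ "%k. C * (1/2) ^ k"] conjI ballI geo) (auto intro!: C)
 qed simp
 have 2: "T g (v + axis i 1) - T g v = g v" if g: "entire g" for g v
 proof -
  have aE: "a g k (v + E) = a g k v" for k by (simp add: a_def base)
  have "((%k. a g k (v + E) * \<phi> k ((v + E) $ i) - a g k v * \<phi> k (v $ i)) has_sum (T g (v + E) - T g v)) UNIV"
   unfolding T_def using summ[OF g, of v] summ[OF g, of "v + E"]
   by (intro has_sum_diff has_sum_infsum)
  moreover have "a g k (v + E) * \<phi> k ((v + E) $ i) - a g k v * \<phi> k (v $ i) = a g k v * (v $ i) ^ k" for k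
   using diff[of k "v $ i"] by (simp add: aE Ei flip: right_diff_distrib)
  ultimately have "((%k. a g k v * (v $ i) ^ k) has_sum (T g (v + E) - T g v)) UNIV" by simp
  hence "(%k. a g k v * (v $ i) ^ k) sums (T g (v + E) - T g v)" by (rule has_sum_imp_sums)
  moreover have "(%k. a g k v * (v $ i) ^ k) sums g v"
  proof -
   have "(%k. (deriv ^^ k) (%z. g (base v + z *s E)) 0 / fact k * (v $ i - 0) ^ k) sums g (base v + v $ i *s E)"
    by (rule holomorphic_power_series[where r = "cmod (v $ i) + 1"])
      (auto intro: holomorphic_on_subset[OF slice[OF g]])
   thus ?thesis by (simp add: a_der[OF g] base_def)
  qed
  ultimately show ?thesis unfolding E_def[symmetric] by (rule sums_unique2)
 qed
 have 3: "T g (v + c) = T (%x. g (x + c)) v" if "c $ i = 0" for g c v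
  using that by (simp add: T_def a_def base_def algebra_simps)
 show ?thesis using that[OF 1 2 3] .
qed

section \<open>Systems of difference equations\<close>

text \<open>The directions are treated one at a time. By compatibility the remaining defect in
  direction j is invariant under the directions already solved, and since the operator T commutes
  with translations in the other coordinates, so is the correction.\<close>

lemma solve_difference_equations:
 fixes g :: "'n::finite => complex^'n => complex"
 assumes g: "\<And>i. entire (g i)" and c: "\<And>i j x. g j (x + axis i 1) + g i x = g i (x + axis j 1) + g j x"
 obtains H where "entire H" "\<And>i x. H (x + axis i 1) - H x = g i x"
proof -
 have "\<exists>H. entire H \<and> (\<forall>i\<in>I. \<forall>x. H (x + axis i 1) - H x = g i x)" if "finite I" for I
  using that
 proof (induction I rule: finite_induct)
  case empty
  have "entire (%x::complex^'n. 0)" by (simp add: entire_iff_slicewise)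
  thus ?case by auto
 next
  case (insert j I)
  then obtain H where H: "entire H" "\<And>i x. i \<in> I ==> H (x + axis i 1) - H x = g i x" by blast
  obtain T :: "(complex^'n => complex) => complex^'n => complex"
   where T: "\<And>g. entire g ==> entire (T g)" "\<And>g v. entire g ==> T g (v + axis j 1) - T g v = g v"
    "\<And>g c v. c $ j = 0 ==> T g (v + c) = T (%x. g (x + c)) v"
   using difference_equation_operator[of j] by blast
  define g' where "g' x = g j x - (H (x + axis j 1) - H x)" for x
  have g': "entire g'" unfolding g'_def using g H(1) entire_shift[OF H(1)]
   unfolding entire_iff_slicewise by (auto intro!: vec.slicewise_diff)
  have per: "g' (x + axis i 1) = g' x" if i: "i \<in> I" for i x
  proof -
   have "H (x + axis i 1 + axis j 1) - H (x + axis j 1) = g i (x + axis j 1)"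
    using H(2)[OF i, of "x + axis j 1"] by (simp add: add_ac)
   moreover have "H (x + axis i 1) - H x = g i x" by (rule H(2)[OF i])
   ultimately show ?thesis
    using c[of j x i] unfolding g'_def by (simp add: algebra_simps)
  qed
  have Tper: "T g' (x + axis i 1) = T g' x" if i: "i \<in> I" for i x
  proof -
   have "(axis i 1 :: complex^'n) $ j = 0" using i insert.hyps by (auto simp: axis_def)
   from T(3)[OF this, of g' x] show ?thesis by (simp add: per[OF i])
  qed
  show ?case
  proof (intro exI[of _ "%x. H x + T g' x"] conjI ballI allI)
   show "entire (%x. H x + T g' x)"
    using H(1) T(1)[OF g'] unfolding entire_iff_slicewise by (rule vec.slicewise_add)
   fix i x assume "i \<in> insert j I"
   then consider "i = j" | "i \<in> I" by auto
   thus "H (x + axis i 1) + T g' (x + axis i 1) - (H x + T g' x) = g i x"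
   proof cases
    case 1
    thus ?thesis using T(2)[OF g', of x] by (simp add: g'_def algebra_simps)
   next
    case 2
    thus ?thesis using H(2)[OF 2, of x] Tper[OF 2, of x] by simp
   qed
  qed
 qed
 from this[of UNIV] show ?thesis using that by auto
qed

lemma fcoef_const: "fcoef (%x. c) u = (if u = (%_. 0) then c else 0)"
proof -
 have m: "mode (%_. 0) x = 1" for x :: "complex^'a" by (simp add: mode_def)
 have "fcoef (%x. c) u = avgs coords u (%x. \<Sum>w\<in>{%_. 0}. c * mode w x) 0"
  by (simp add: fcoef_def m)
 also have "\<dots> = (\<Sum>w | w \<in> {%_. 0} \<and> (\<forall>i\<in>set coords. w i = u i). c * mode w 0)"
  by (rule avgs_sum_modes) simp
 also have "{w. w \<in> {%_. 0} \<and> (\<forall>i\<in>set coords. w i = u i)} = (if u = (%_. 0) then {%_. 0} else {})"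
  by (cases "u = (%_. 0)") (auto simp: coords(1) fun_eq_iff)
 finally show ?thesis by simp
qed

text \<open>On Fourier coefficients the equation reads
  \<open>(mode u (\<tau> j) - 1) * h u = P j u\<close>. Compatibility makes the quotient independent
  of j, and \<epsilon> excludes small divisors for u other than 0. The zero mode cannot be solved
  and remains as the constant c j.\<close>

lemma solve_periodic_difference_equations:
 fixes p :: "'n::finite => complex^'n => complex" and \<tau> :: "'n => complex^'n"
 assumes p: "\<And>j. entire (p j)" "\<And>j. periodic (p j)"
  and comm: "\<And>i j x. p j (x + \<tau> i) - p j x = p i (x + \<tau> j) - p i x"
  and \<epsilon>: "\<epsilon> > 0" "\<And>u. u ~= (%_. 0) ==> \<exists>j. \<epsilon> <= \<bar>Im (\<Sum>k\<in>UNIV. of_int (u k) * \<tau> j $ k)\<bar>"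
 obtains H c where "entire H" "periodic H" "\<And>j x. p j x = H (x + \<tau> j) - H x + c j"
proof -
 define P where "P j = fcoef (p j)" for j
 define m where "m u j = mode u (\<tau> j) - 1" for u j
 have ent: "entire (%x. f (x + y) - f x)" if "entire f" for f and y :: "complex^'n"
  using that entire_shift[OF that] unfolding entire_iff_slicewise by (auto intro!: vec.slicewise_diff)
 have per: "periodic (%x. f (x + y) - f x)" if "periodic f" for f and y :: "complex^'n"
 proof -
  have "f (x + axis i 1 + y) = f (x + y)" for x i
   using that unfolding periodic_def by (metis add.assoc add.commute)
  thus ?thesis using that by (simp add: periodic_def)
 qed
 have fd: "fcoef (%x. f (x + y) - f x) u = (mode u y - 1) * fcoef f u" if "entire f" "periodic f" for f u and y :: "complex^'n"
  using that by (simp add: fcoef_diff entire_shift fcoef_shift left_diff_distrib)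
 have PP: "m u i * P j u = m u j * P i u" for u i j
 proof -
  have "(%x. p j (x + \<tau> i) - p j x) = (%x. p i (x + \<tau> j) - p i x)" using comm by blast
  hence "fcoef (%x. p j (x + \<tau> i) - p j x) u = fcoef (%x. p i (x + \<tau> j) - p i x) u" by simp
  thus ?thesis using p by (simp add: fd m_def P_def)
 qed
 \<comment> \<open>A lower bound for \<open>\<bar>exp (- 2 pi y) - 1\<bar>\<close> when y lies at
   distance at least \<epsilon> from 0, on either side.\<close>
 define K where "K = min (exp (2 * pi * \<epsilon>) - 1) (1 - exp (- (2 * pi * \<epsilon>)))"
 have K: "K > 0" using \<epsilon>(1) by (simp add: K_def)
 have "\<exists>j. K <= cmod (m u j)" if u: "u ~= (%_. 0)" for u
 proof -
  obtain j where j: "\<epsilon> <= \<bar>Im (\<Sum>k\<in>UNIV. of_int (u k) * \<tau> j $ k)\<bar>" using \<epsilon>(2)[OF u] by blast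
  define y where "y = Im (\<Sum>k\<in>UNIV. of_int (u k) * \<tau> j $ k)"
  have "K <= \<bar>exp (- (2 * pi * y)) - 1\<bar>"
  proof (cases "y > 0")
   case True
   hence "exp (- (2 * pi * y)) <= exp (- (2 * pi * \<epsilon>))" using j by (simp add: y_def)
   thus ?thesis unfolding K_def by linarith
  next
   case False
   hence "\<epsilon> <= - y" using j by (simp add: y_def)
   hence "2 * pi * \<epsilon> <= 2 * pi * - y" by (intro mult_left_mono) auto
   hence "exp (- (2 * pi * y)) >= exp (2 * pi * \<epsilon>)" by simp
   thus ?thesis unfolding K_def by linarith
  qed
  also have "\<dots> = \<bar>cmod (mode u (\<tau> j)) - cmod 1\<bar>" by (simp add: mode_def norm_expi y_def)
  also have "\<dots> <= cmod (m u j)" unfolding m_def by (rule norm_triangle_ineq3)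
  finally show ?thesis by blast
 qed
 then obtain J where J: "\<And>u. u ~= (%_. 0) ==> K <= cmod (m u (J u))" by metis
 define h where "h u = (if u = (%_. 0) then 0 else P (J u) u / m u (J u))" for u
 have mh: "m u j * h u = P j u" if "u ~= (%_. 0)" for u j
 proof -
  have "m u (J u) ~= 0" using J[OF that] K by auto
  thus ?thesis using PP[of u j "J u"] that by (simp add: h_def field_simps)
 qed
 have rapid: "rapid h"
  unfolding rapid_def
 proof
  fix c
  have "\<forall>j. \<exists>B. \<forall>u. cmod (P j u) <= B * exp (- (c * l1 u))"
   using rapid_fcoef[OF p] unfolding rapid_def P_def by blast
  then obtain B where B: "\<And>j u. cmod (P j u) <= B j * exp (- (c * l1 u))" by metis
  have B0: "B j >= 0" for j
   using order_trans[OF norm_ge_zero B[of j "%_. 0"]] by (simp add: l1_def)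
  show "\<exists>B. \<forall>u. cmod (h u) <= B * exp (- (c * l1 u))"
  proof (intro exI[of _ "(\<Sum>j\<in>UNIV. B j) / K"] allI)
   fix u
   show "cmod (h u) <= (\<Sum>j\<in>UNIV. B j) / K * exp (- (c * l1 u))"
   proof (cases "u = (%_. 0)")
    case True
    thus ?thesis using B0 K by (simp add: h_def sum_nonneg)
   next
    case False
    have "cmod (h u) = cmod (P (J u) u) / cmod (m u (J u))" using False by (simp add: h_def norm_divide)
    also have "\<dots> <= (B (J u) * exp (- (c * l1 u))) / K"
     using B J[OF False] K B0 by (intro frac_le) auto
    also have "\<dots> <= ((\<Sum>j\<in>UNIV. B j) * exp (- (c * l1 u))) / K"
     using K B0 by (intro divide_right_mono mult_right_mono member_le_sum) auto
    finally show ?thesis by simp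
   qed
  qed
 qed
 define H where "H = fser h"
 have H: "entire H" "periodic H" by (simp_all add: H_def entire_fser[OF rapid] periodic_fser)
 have "p j x = H (x + \<tau> j) - H x + P j (%_. 0)" for j x
 proof -
  have "p j = (%x. (H (x + \<tau> j) - H x) - (- P j (%_. 0)))"
  proof (rule fcoef_unique[OF p])
   show "entire (%x. (H (x + \<tau> j) - H x) - (- P j (%_. 0)))"
    using ent[OF H(1)] unfolding entire_iff_slicewise by (rule vec.slicewise_diff[OF _ vec.slicewise_const])
   show "periodic (%x. (H (x + \<tau> j) - H x) - (- P j (%_. 0)))"
    using per[OF H(2)] unfolding periodic_def by simp
   fix u
   have "fcoef (%x. (H (x + \<tau> j) - H x) - (- P j (%_. 0))) u
     = (mode u (\<tau> j) - 1) * h u - (if u = (%_. 0) then - P j (%_. 0) else 0)"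
    using ent[OF H(1)] H
    by (subst fcoef_diff) (auto simp: fd fcoef_const entire_iff_slicewise H_def fcoef_fser[OF rapid])
   thus "fcoef (p j) u = fcoef (%x. (H (x + \<tau> j) - H x) - (- P j (%_. 0))) u"
    using mh[of u j] by (auto simp: P_def m_def h_def)
  qed
  thus ?thesis by (metis diff_minus_eq_add)
 qed
 thus ?thesis using that[OF H, of "%j. P j (%_. 0)"] by blast
qed

section \<open>Normal form of a polarization of given type\<close>

text \<open>The lattice vector a j of a symplectic basis, in the coordinates given by the b i; in
  these coordinates b i itself becomes \<open>axis i 1\<close>.\<close>

definition tau :: "('n::finite => nat) => complex^'n^'n => 'n => complex^'n" where
 "tau d Z j = (\<chi> k. Z $ k $ j / of_nat (d k))"

text \<open>Sections of the \<open>r\<close>-th power, in the coordinates given by the \<open>b i\<close>.\<close>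

definition theta_space ::
  "('n::finite => nat) => complex^'n^'n => nat => (complex^'n => complex) set" where
 "theta_space d Z r = {f. entire f \<and> periodic f \<and>
   (\<forall>j x. f (x + tau d Z j) = expi (- (of_nat r * (of_nat (d j) * x $ j + Z $ j $ j / 2))) * f x)}"

lemma siegel_Im_lower_bound:
 assumes Z: "Z \<in> siegel"
 obtains c where "c > 0"
  "\<And>q::real^'n. c * (norm q)\<^sup>2 <= q \<bullet> ((\<chi> i j. Im (Z $ i $ j)) *v q)"
proof -
 define Y :: "real^'n^'n" where "Y = (\<chi> i j. Im (Z $ i $ j))"
 have pos: "q \<bullet> (Y *v q) > 0" if "q ~= 0" for q
  using Z that by (simp add: siegel_def Y_def)
 have "\<exists>q0\<in>sphere 0 1. \<forall>q\<in>sphere 0 1. q0 \<bullet> (Y *v q0) <= q \<bullet> (Y *v q)"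
  by (rule continuous_attains_inf) (auto intro!: continuous_intros matrix_vector_mult_linear_continuous_on)
 then obtain q0 where q0: "q0 \<in> sphere 0 1" "\<And>q. q \<in> sphere 0 1 ==> q0 \<bullet> (Y *v q0) <= q \<bullet> (Y *v q)"
  by blast
 define c where "c = q0 \<bullet> (Y *v q0)"
 have c: "c > 0" unfolding c_def by (rule pos) (use q0 in auto)
 have "c * (norm q)\<^sup>2 <= q \<bullet> (Y *v q)" for q
 proof (cases "q = 0")
  case False
  define s where "s = inverse (norm q) *\<^sub>R q"
  have "c <= s \<bullet> (Y *v s)" unfolding c_def by (rule q0) (use False in \<open>simp add: s_def\<close>)
  also have "\<dots> = (q \<bullet> (Y *v q)) / (norm q)\<^sup>2"
   by (simp add: s_def matrix_vector_mult_scaleR power2_eq_square divide_inverse)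
  finally show ?thesis using False by (simp add: field_simps)
 qed simp
 with c show ?thesis using that unfolding Y_def by blast
qed

text \<open>Excludes small divisors. With q = u / D these imaginary parts are the components of Im Z
  q; if all of them were small, the inner product with q would contradict the positivity of Im Z,
  because q has norm at least \<delta>.\<close>

lemma tau_Im_lower_bound:
 assumes Z: "Z \<in> siegel" and d: "\<And>i. 0 < d i"
 obtains \<epsilon> where "\<epsilon> > 0"
  "\<And>u. u ~= (%_. 0) ==> \<exists>j. \<epsilon> <= \<bar>Im (\<Sum>k\<in>UNIV. of_int (u k) * tau d Z j $ k)\<bar>"
proof -
 obtain c where c: "c > 0" "\<And>q::real^'a. c * (norm q)\<^sup>2 <= q \<bullet> ((\<chi> i j. Im (Z $ i $ j)) *v q)"
  using siegel_Im_lower_bound[OF Z] by blast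
 define \<delta> where "\<delta> = 1 / Max (range (%i. real (d i)))"
 have Mpos: "Max (range (%i. real (d i))) > 0"
  using d by (subst Max_gr_iff) auto
 hence \<delta>: "\<delta> > 0" by (simp add: \<delta>_def)
 have \<delta>d: "\<delta> <= 1 / real (d i)" for i
  unfolding \<delta>_def
 proof (rule divide_left_mono)
  show "real (d i) <= Max (range (%i. real (d i)))" by (rule Max_ge) auto
  show "0 < Max (range (%i. real (d i))) * real (d i)" using Mpos d[of i] by simp
 qed simp
 define N where "N = real CARD('a)"
 have N: "N > 0" by (simp add: N_def)
 show ?thesis
 proof (rule that[of "c * \<delta> / N"])
  show "c * \<delta> / N > 0" using c \<delta> N by simp
  fix u :: "'a => int" assume u: "u ~= (%_. 0)"
  define q :: "real^'a" where "q = (\<chi> i. real_of_int (u i) / real (d i))"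
  define y where "y j = Im (\<Sum>k\<in>UNIV. of_int (u k) * tau d Z j $ k)" for j
  have sym: "Z $ i $ j = Z $ j $ i" for i j
   using Z by (auto simp: siegel_def transpose_def vec_eq_iff)
  have yq: "((\<chi> i j. Im (Z $ i $ j)) *v q) $ j = y j" for j
   unfolding y_def q_def tau_def matrix_vector_mult_def
   by (simp add: sym[of j] mult.commute)
  obtain i where i: "u i ~= 0" using u by auto
  have "\<delta> <= \<bar>q $ i\<bar>"
  proof -
   have "1 / real (d i) <= \<bar>real_of_int (u i)\<bar> / real (d i)"
    using i by (intro divide_right_mono) auto
   thus ?thesis using \<delta>d[of i] by (simp add: q_def)
  qed
  hence qn: "\<delta> <= norm q" using component_le_norm_cart[of q i] by linarith
  show "\<exists>j. c * \<delta> / N <= \<bar>Im (\<Sum>k\<in>UNIV. of_int (u k) * tau d Z j $ k)\<bar>"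
  proof (rule ccontr)
   assume "\<not> ?thesis"
   hence less: "\<bar>y j\<bar> < c * \<delta> / N" for j by (auto simp: y_def not_le)
   have "c * (norm q)\<^sup>2 <= (\<Sum>j\<in>UNIV. q $ j * y j)"
    using c(2)[of q] by (simp add: inner_vec_def yq)
   also have "\<dots> <= (\<Sum>j\<in>(UNIV::'a set). norm q * (c * \<delta> / N))"
   proof (rule sum_mono)
    fix j
    have "q $ j * y j <= \<bar>q $ j\<bar> * \<bar>y j\<bar>" by (metis abs_ge_self abs_mult)
    also have "\<dots> <= norm q * (c * \<delta> / N)"
     using less[of j] by (intro mult_mono component_le_norm_cart) auto
    finally show "q $ j * y j <= norm q * (c * \<delta> / N)" .
   qed
   also have "\<dots> = norm q * (c * \<delta>)" using N by (simp add: N_def)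
   finally have le: "norm q * (c * norm q) <= norm q * (c * \<delta>)" by (simp add: power2_eq_square mult_ac)
   have nq: "norm q > 0" using qn \<delta> by linarith
   have "c * norm q <= c * \<delta>" using le nq by simp
   hence eq: "norm q = \<delta>" using qn c(1) by simp
   \<comment> \<open>The weak estimate only forces norm q = \<delta>; this borderline case is
     excluded by strictness.\<close>
   have "(\<Sum>j\<in>UNIV. q $ j * y j) < (\<Sum>j\<in>(UNIV::'a set). norm q * (c * \<delta> / N))"
   proof (rule sum_strict_mono)
    fix j
    have "q $ j * y j <= \<bar>q $ j\<bar> * \<bar>y j\<bar>" by (metis abs_ge_self abs_mult)
    also have "\<dots> <= norm q * \<bar>y j\<bar>" by (intro mult_right_mono component_le_norm_cart) auto
    also have "\<dots> < norm q * (c * \<delta> / N)" by (rule mult_strict_left_mono[OF less nq])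
    finally show "q $ j * y j < norm q * (c * \<delta> / N)" .
   qed auto
   also have "\<dots> = norm q * (c * \<delta>)" using N by (simp add: N_def)
   finally show False
    using c(2)[of q] eq by (simp add: inner_vec_def yq power2_eq_square mult_ac)
  qed
 qed
qed

lemma lattice_basis_mem:
 fixes a b :: "'n::finite => complex^'n"
 assumes \<Lambda>: "\<Lambda> = {(\<Sum>i\<in>UNIV. of_int (p i) *s a i + of_int (q i) *s b i) | p q. True}"
 shows "a i \<in> \<Lambda>" "b i \<in> \<Lambda>"
proof -
 have mem: "(\<Sum>i\<in>UNIV. of_int (p i) *s a i + of_int (q i) *s b i) \<in> \<Lambda>" for p q
  using \<Lambda> by blast
 have "(\<Sum>j\<in>UNIV. of_int (if j = i then 1 else 0) *s a j + of_int 0 *s b j) = (\<Sum>j\<in>UNIV. if j = i then a j else 0)"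
  by (rule sum.cong) auto
 thus "a i \<in> \<Lambda>" using mem[of "%j. if j = i then 1 else 0" "%_. 0"] by simp
 have "(\<Sum>j\<in>UNIV. of_int 0 *s a j + of_int (if j = i then 1 else 0) *s b j) = (\<Sum>j\<in>UNIV. if j = i then b j else 0)"
  by (rule sum.cong) auto
 thus "b i \<in> \<Lambda>" using mem[of "%_. 0" "%j. if j = i then 1 else 0"] by simp
qed

lemma factor_of_automorphy_tensor_power:
 assumes "factor_of_automorphy \<Lambda> e"
 shows "factor_of_automorphy \<Lambda> (tensor_power e r)"
 using assms unfolding factor_of_automorphy_def tensor_power_def entire_iff_slicewise
 by (auto simp: power_mult_distrib intro: vec.slicewise_power)

text \<open>By the cocycle relation the vectors l with this property form a group, so the generators
  suffice.\<close>

lemma automorphy_relation_lattice: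
 fixes a b :: "'n::finite => complex^'n"
 assumes \<Lambda>: "\<Lambda> = {(\<Sum>i\<in>UNIV. of_int (p i) *s a i + of_int (q i) *s b i) | p q. True}"
  and F: "factor_of_automorphy \<Lambda> e"
  and a: "\<And>i v. \<theta> (v + a i) = e (a i) v * \<theta> v" and b: "\<And>i v. \<theta> (v + b i) = e (b i) v * \<theta> v"
  and l: "l \<in> \<Lambda>"
 shows "\<theta> (v + l) = e l v * \<theta> v"
proof -
 define S where "S = {l \<in> \<Lambda>. \<forall>v. \<theta> (v + l) = e l v * \<theta> v}"
 have mem: "(\<Sum>i\<in>UNIV. of_int (p i) *s a i + of_int (q i) *s b i) \<in> \<Lambda>" for p q
  using \<Lambda> by blast
 have add: "x + y \<in> \<Lambda>" if xy: "x \<in> \<Lambda>" "y \<in> \<Lambda>" for x y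
 proof -
  obtain p q p' q' where "x = (\<Sum>i\<in>UNIV. of_int (p i) *s a i + of_int (q i) *s b i)"
   "y = (\<Sum>i\<in>UNIV. of_int (p' i) *s a i + of_int (q' i) *s b i)"
   using xy unfolding \<Lambda> by blast
  hence "x + y = (\<Sum>i\<in>UNIV. of_int (p i + p' i) *s a i + of_int (q i + q' i) *s b i)"
   by (simp add: vec.sc_add_left sum.distrib)
  thus ?thesis using mem[of "%i. p i + p' i" "%i. q i + q' i"] by simp
 qed
 have neg: "- x \<in> \<Lambda>" if xy: "x \<in> \<Lambda>" for x
 proof -
  obtain p q where "x = (\<Sum>i\<in>UNIV. of_int (p i) *s a i + of_int (q i) *s b i)"
   using xy unfolding \<Lambda> by blast
  hence "- x = (\<Sum>i\<in>UNIV. of_int (- p i) *s a i + of_int (- q i) *s b i)"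
   by (simp add: sum_negf[symmetric])
  thus ?thesis using mem[of "%i. - p i" "%i. - q i"] by simp
 qed
 have coc: "e (x + y) v = e x (v + y) * e y v" and nz: "e x v ~= 0" if "x \<in> \<Lambda>" "y \<in> \<Lambda>" for x y v
  using F that unfolding factor_of_automorphy_def by auto
 have zero: "0 \<in> \<Lambda>" using mem[of "%_. 0" "%_. 0"] by simp
 have e0: "e 0 v = 1" for v using coc[OF zero zero, of v] nz[OF zero zero, of v] by simp
 have S0: "0 \<in> S" using zero by (simp add: S_def e0)
 have Sadd: "x + y \<in> S" if xy: "x \<in> S" "y \<in> S" for x y
 proof -
  have xyL: "x \<in> \<Lambda>" "y \<in> \<Lambda>" using xy by (auto simp: S_def)
  have "\<theta> (v + (x + y)) = e (x + y) v * \<theta> v" for v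
  proof -
   have "\<theta> (v + (x + y)) = \<theta> ((v + y) + x)" by (simp add: add_ac)
   also have "\<dots> = e x (v + y) * (e y v * \<theta> v)" using xy by (simp add: S_def)
   finally show ?thesis by (simp add: coc[OF xyL])
  qed
  thus ?thesis using add[OF xyL] by (simp add: S_def)
 qed
 have Sneg: "- x \<in> S" if x: "x \<in> S" for x
 proof -
  have xL: "x \<in> \<Lambda>" using x by (simp add: S_def)
  have "\<theta> (v + - x) = e (- x) v * \<theta> v" for v
  proof -
   have "\<theta> v = e x (v + - x) * \<theta> (v + - x)"
    using x unfolding S_def by (metis (mono_tags, lifting) add.assoc add.left_inverse add.right_neutral mem_Collect_eq)
   moreover have "e x (v + - x) * e (- x) v = 1"
    using coc[OF xL neg[OF xL], of v] by (simp add: e0)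
   ultimately show ?thesis
    by (metis mult.assoc mult.commute mult.left_neutral)
  qed
  thus ?thesis using neg[OF xL] by (simp add: S_def)
 qed
 have Sint: "of_int k *s x \<in> S" if x: "x \<in> S" for k x
 proof (induction k rule: int_induct[where k = 0])
  case (step1 i)
  thus ?case using Sadd[OF step1(2) x] by (simp add: vec.sc_add_left)
 next
  case (step2 i)
  thus ?case using Sadd[OF step2(2) Sneg[OF x]] by (simp add: vec.sc_diff_left)
 qed (use S0 in simp)
 note mem1 = lattice_basis_mem[OF \<Lambda>]
 have ab: "a i \<in> S" "b i \<in> S" for i using a b mem1 by (auto simp: S_def)
 have Ssum: "(\<Sum>i\<in>I. f i) \<in> S" if "\<And>i. f i \<in> S" for f and I :: "'n set"
  by (induction I rule: infinite_finite_induct) (use S0 Sadd that in auto)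
 obtain p q where "l = (\<Sum>i\<in>UNIV. of_int (p i) *s a i + of_int (q i) *s b i)"
  using l unfolding \<Lambda> by blast
 hence "l \<in> S" using Ssum[of "%i. of_int (p i) *s a i + of_int (q i) *s b i" UNIV] Sadd Sint ab by blast
 thus ?thesis by (simp add: S_def)
qed

text \<open>The theorem of Appell and Humbert for a fixed basis. A first correction H removes the
  factors of the b i; a periodic one, H2, makes the logarithms of the factors of the a j affine with
  slope determined by the Chern form; a translation then fixes the constants. The same E and A serve
  every r, so multiplication of sections becomes multiplication of theta functions.\<close>

theorem sections_normal_form:
 fixes a b :: "'n::finite => complex^'n"
 assumes full: "full_rank_lattice \<Lambda>" and F: "factor_of_automorphy \<Lambda> e"
  and sb: "symplectic_basis d \<Lambda> e a b" and Z: "Z \<in> siegel" and d: "\<And>i. 0 < d i"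
  and aZ: "\<And>i. a i = (\<Sum>j\<in>UNIV. (Z $ j $ i / of_nat (d j)) *s b j)"
 obtains E A where "\<And>v. E v ~= 0"
  "\<And>r. H0 \<Lambda> (tensor_power e r) = (%f v. E v ^ r * f (A v)) ` theta_space d Z r"
proof -
 have \<Lambda>: "\<Lambda> = {(\<Sum>i\<in>UNIV. of_int (p i) *s a i + of_int (q i) *s b i) | p q. True}"
  and ch: "\<And>i j. chern_form e (a i) (a j) = 0" "\<And>i j. chern_form e (b i) (b j) = 0"
   "\<And>i j. chern_form e (a i) (b j) = (if i = j then int (d i) else 0)"
  using sb by (auto simp: symplectic_basis_def)
 have sym: "Z $ i $ j = Z $ j $ i" for i j
  using Z by (auto simp: siegel_def transpose_def vec_eq_iff)
 define M :: "complex^'n^'n" where "M = (\<chi> k i. b i $ k)"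
 have Mv: "M *v x = (\<Sum>i\<in>UNIV. x $ i *s b i)" for x
  by (simp add: M_def matrix_vector_mult_def vec_eq_iff mult.commute)
 have Mb: "M *v axis i 1 = b i" for i
 proof -
  have "M *v axis i 1 = (\<Sum>j\<in>UNIV. if j = i then b j else 0)"
   unfolding Mv by (rule sum.cong) (auto simp: axis_def)
  thus ?thesis by simp
 qed
 have Ma: "M *v tau d Z j = a j" for j by (simp add: Mv aZ tau_def)
 have Madd: "M *v (x + y) = M *v x + M *v y" for x y by (rule matrix_vector_right_distrib)
 have Msc: "M *v (c *s x) = c *s (M *v x)" for c x by (rule vector_scalar_commute)
 \<comment> \<open>The range of M is a subspace that contains the lattice, hence everything: the b i
   form a complex basis.\<close>
 have "surj ((*v) M)"
 proof -
  have "\<Lambda> \<subseteq> range ((*v) M)"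
  proof
   fix l assume "l \<in> \<Lambda>"
   then obtain p q where l: "l = (\<Sum>i\<in>UNIV. of_int (p i) *s a i + of_int (q i) *s b i)" unfolding \<Lambda> by blast
   have "l = M *v (\<Sum>i\<in>UNIV. of_int (p i) *s tau d Z i + of_int (q i) *s axis i 1)"
    by (simp add: l linear_sum[OF matrix_vector_mul_linear] Madd Msc Ma Mb)
   thus "l \<in> range ((*v) M)" by blast
  qed
  moreover have "subspace (range ((*v) M))"
  proof (rule linear_subspace_image)
   show "linear ((*v) M)" by (rule matrix_vector_mul_linear)
  qed simp
  ultimately have "span \<Lambda> \<subseteq> range ((*v) M)" by (rule span_minimal)
  thus ?thesis using full by (auto simp: full_rank_lattice_def)
 qed
 then obtain N where MN: "M ** N = mat 1" using matrix_right_invertible_surjective by blast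
 hence NM: "N ** M = mat 1" by (simp add: matrix_left_right_inverse)
 have MNv: "M *v (N *v v) = v" and NMv: "N *v (M *v v) = v" for v
  by (simp_all add: matrix_vector_mul_assoc MN NM)
 have entM: "entire (%x. f (L *v x))" if "entire f" for f and L :: "complex^'n^'n"
  using that unfolding entire_iff_slicewise
  by (elim slicewise_affine_compose[where \<psi> = "%u. L *v u"])
    (auto intro: matrix_vector_mult_linear_continuous_on simp: matrix_vector_right_distrib vector_scalar_commute)
 note mem = lattice_basis_mem[OF \<Lambda>]
 have ent_e: "entire (e l)" "\<And>v. e l v ~= 0" if "l \<in> \<Lambda>" for l
  using F that by (auto simp: factor_of_automorphy_def)
 have "\<exists>g. entire g \<and> (\<forall>v. e l v = expi (g v))" if "l \<in> \<Lambda>" for l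
  using entire_logarithm[OF ent_e[OF that]] by blast
 then obtain L where L: "\<And>l. l \<in> \<Lambda> ==> entire (L l)" "\<And>l v. l \<in> \<Lambda> ==> e l v = expi (L l v)"
  by metis
 have chern: "of_int (chern_form e l m) = L m (v + l) + L l v - L l (v + m) - L m v"
  if "l \<in> \<Lambda>" "m \<in> \<Lambda>" for l m v
  using that by (intro chern_form_eq[OF F that]) (auto intro: L)
 obtain H where H: "entire H" "\<And>i x. H (x + axis i 1) - H x = L (b i) (M *v x)"
 proof (rule solve_difference_equations[where g = "%i x. L (b i) (M *v x)"])
  show "entire (%x. L (b i) (M *v x))" for i by (intro entM L mem)
  fix i j x
  show "L (b j) (M *v (x + axis i 1)) + L (b i) (M *v x) = L (b i) (M *v (x + axis j 1)) + L (b j) (M *v x)"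
   using chern[OF mem(2) mem(2), of i j "M *v x"] by (simp add: ch Madd Mb algebra_simps)
 qed blast
 \<comment> \<open>The term \<open>d j * x j\<close> cancels the jump of L (a j) that the Chern
   number of (a j, b j) prescribes, which makes p j periodic. The vanishing Chern numbers among the
   a j and the symmetry of Z give the compatibility of the p j.\<close>
 define p where "p j x = L (a j) (M *v x) - (H (x + tau d Z j) - H x) + of_nat (d j) * x $ j" for j x
 have tj: "of_nat (d j) * tau d Z i $ j = Z $ j $ i" for i j
  using d[of j] by (simp add: tau_def)
 obtain \<epsilon> where \<epsilon>: "\<epsilon> > 0"
  "\<And>u. u ~= (%_. 0) ==> \<exists>j. \<epsilon> <= \<bar>Im (\<Sum>k\<in>UNIV. of_int (u k) * tau d Z j $ k)\<bar>"
  by (rule tau_Im_lower_bound[where d = d, OF Z]) (use d in auto)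
 have p_entire: "entire (p j)" for j
   using entM[OF L(1)[OF mem(1)[of j]], of M] entire_shift[OF H(1), of "tau d Z j"] H(1)
   unfolding p_def[abs_def] entire_iff_slicewise
   by (intro vec.slicewise_add vec.slicewise_diff vec.slicewise_mult vec.slicewise_const slicewise_nth)
 have p_periodic: "periodic (p j)" for j
   unfolding periodic_def
  proof (intro allI)
   fix i x
   have 1: "H (x + axis i 1 + tau d Z j) = H (x + tau d Z j) + L (b i) (M *v x + a j)"
    using H(2)[where i = i and x = "x + tau d Z j"] by (simp add: Madd Ma algebra_simps)
   have 2: "H (x + axis i 1) = H x + L (b i) (M *v x)"
    using H(2)[where i = i and x = x] by (simp add: algebra_simps)
   have 3: "L (a j) (M *v x + b i) = L (b i) (M *v x + a j) + L (a j) (M *v x) - L (b i) (M *v x)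
      - (if j = i then of_nat (d j) else 0)"
    using chern[OF mem(1)[of j] mem(2)[of i], of "M *v x"] by (auto simp: ch algebra_simps)
   show "p j (x + axis i 1) = p j x"
    unfolding p_def Madd Mb 1 2 3 by (auto simp: axis_def algebra_simps)
  qed
 have p_comm: "p j (x + tau d Z i) - p j x = p i (x + tau d Z j) - p i x" for i j x
 proof -
  have 1: "L (a j) (M *v x + a i) = L (a i) (M *v x + a j) + L (a j) (M *v x) - L (a i) (M *v x)"
   using chern[OF mem(1)[of i] mem(1)[of j], of "M *v x"] by (simp add: ch algebra_simps)
  have 2: "of_nat (d j) * (x + tau d Z i) $ j = of_nat (d j) * x $ j + Z $ i $ j"
   "of_nat (d i) * (x + tau d Z j) $ i = of_nat (d i) * x $ i + Z $ i $ j"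
   by (simp_all add: distrib_left tj sym)
  have 3: "x + tau d Z i + tau d Z j = x + tau d Z j + tau d Z i" by (simp add: add_ac)
  show ?thesis
   unfolding p_def Madd Ma 1 2 3 by (simp add: algebra_simps)
 qed
 have "\<exists>H2 c. entire H2 \<and> periodic H2 \<and> (\<forall>j x. p j x = H2 (x + tau d Z j) - H2 x + c j)"
  by (rule solve_periodic_difference_equations[where p = p and \<tau> = "tau d Z", OF p_entire p_periodic p_comm \<epsilon>]) auto
 then obtain H2 c where H2: "entire H2" "periodic H2" "\<And>j x. p j x = H2 (x + tau d Z j) - H2 x + c j"
  by blast
 define Hs where "Hs x = H x + H2 x" for x
 have Hs: "entire Hs" unfolding Hs_def[abs_def] using H(1) H2(1) unfolding entire_iff_slicewise by (rule vec.slicewise_add)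
 have Hb: "Hs (x + axis i 1) = Hs x + L (b i) (M *v x)" for i x
  using H(2)[where i = i and x = x] H2(2) by (simp add: Hs_def periodic_def algebra_simps)
 have Hta: "Hs (x + tau d Z j) = Hs x + L (a j) (M *v x) + of_nat (d j) * x $ j - c j" for j x
  using H2(3)[where j = j and x = x] by (simp add: Hs_def p_def algebra_simps)
 \<comment> \<open>The translation that absorbs the constants c j and creates the term
   \<open>Z $ j $ j / 2\<close> of the normal form.\<close>
 define s :: "complex^'n" where "s = (\<chi> j. (c j + Z $ j $ j / 2) / of_nat (d j))"
 have ds: "of_nat (d j) * s $ j = c j + Z $ j $ j / 2" for j using d[of j] by (simp add: s_def)
 have dx: "of_nat (d j) * (x + s) $ j = of_nat (d j) * x $ j + (c j + Z $ j $ j / 2)"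
   "of_nat (d j) * (x - s) $ j = of_nat (d j) * x $ j - (c j + Z $ j $ j / 2)" for j x
  by (simp_all add: distrib_left right_diff_distrib ds)
 define E where "E v = expi (Hs (N *v v))" for v
 define A where "A v = N *v v - s" for v
 have Nb: "N *v (v + b i) = N *v v + axis i 1" for v i
  using NMv[of "axis i 1"] by (simp add: matrix_vector_right_distrib Mb)
 have Na: "N *v (v + a j) = N *v v + tau d Z j" for v j
  using NMv[of "tau d Z j"] by (simp add: matrix_vector_right_distrib Ma)
 have "H0 \<Lambda> (tensor_power e r) = (%f v. E v ^ r * f (A v)) ` theta_space d Z r" for r
 proof
  show "(%f v. E v ^ r * f (A v)) ` theta_space d Z r \<subseteq> H0 \<Lambda> (tensor_power e r)"
  proof
   fix \<theta> assume "\<theta> \<in> (%f v. E v ^ r * f (A v)) ` theta_space d Z r"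
   then obtain f where f: "entire f" "periodic f"
     "\<And>j x. f (x + tau d Z j) = expi (- (of_nat r * (of_nat (d j) * x $ j + Z $ j $ j / 2))) * f x"
    and \<theta>: "\<theta> = (%v. E v ^ r * f (A v))"
    by (auto simp: theta_space_def)
   have "entire (%v. f (N *v v + (- s)))"
    using entM[OF entire_shift[OF f(1), of "- s"], of N] by simp
   moreover have "entire (%v. Hs (N *v v))" by (rule entM[OF Hs])
   ultimately have "entire \<theta>"
    unfolding \<theta> E_def A_def expi_def entire_iff_slicewise
    by (intro vec.slicewise_mult vec.slicewise_power vec.slicewise_exp vec.slicewise_const) simp_all
   moreover have "\<theta> (v + l) = tensor_power e r l v * \<theta> v" if "l \<in> \<Lambda>" for l v
   proof (rule automorphy_relation_lattice[OF \<Lambda> factor_of_automorphy_tensor_power[OF F] _ _ that])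
    fix i v
    have "f (N *v v + axis i 1 - s) = f (N *v v - s)"
     using f(2) unfolding periodic_def by (metis add_diff_eq diff_add_eq)
    thus "\<theta> (v + b i) = tensor_power e r (b i) v * \<theta> v"
     unfolding \<theta> E_def A_def tensor_power_def L(2)[OF mem(2)] Nb Hb expi_add MNv
     by (simp add: power_mult_distrib)
    have "f (N *v v + tau d Z i - s) = f ((N *v v - s) + tau d Z i)" by (simp add: algebra_simps)
    hence 1: "f (N *v v + tau d Z i - s) = expi (- (of_nat r * (of_nat (d i) * (N *v v - s) $ i + Z $ i $ i / 2))) * f (N *v v - s)"
     by (simp only: f(3))
    have 2: "expi (of_nat r * (Hs (N *v v) + L (a i) v + of_nat (d i) * (N *v v) $ i - c i)) *
      expi (- (of_nat r * (of_nat (d i) * (N *v v - s) $ i + Z $ i $ i / 2)))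
      = expi (of_nat r * L (a i) v) * expi (of_nat r * Hs (N *v v))"
     unfolding expi_add[symmetric] by (rule arg_cong[where f = expi]) (simp only: dx, simp add: algebra_simps)
    show "\<theta> (v + a i) = tensor_power e r (a i) v * \<theta> v"
     unfolding \<theta> E_def A_def tensor_power_def L(2)[OF mem(1)] Na Hta MNv expi_power 1
     using 2 by (simp only: mult.assoc[symmetric])
   qed
   ultimately show "\<theta> \<in> H0 \<Lambda> (tensor_power e r)" by (simp add: H0_def)
  qed
  show "H0 \<Lambda> (tensor_power e r) \<subseteq> (%f v. E v ^ r * f (A v)) ` theta_space d Z r"
  proof
   fix \<theta> assume "\<theta> \<in> H0 \<Lambda> (tensor_power e r)"
   hence \<theta>: "entire \<theta>" "\<And>l v. l \<in> \<Lambda> ==> \<theta> (v + l) = e l v ^ r * \<theta> v"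
    by (auto simp: H0_def tensor_power_def)
   define f where "f y = expi (- (of_nat r * Hs (y + s))) * \<theta> (M *v (y + s))" for y
   have "entire f"
    using entire_shift[OF Hs, of s] entire_shift[OF entM[OF \<theta>(1), of M], of s]
    unfolding f_def expi_def minus_mult_right[of "of_nat r"] mult_minus1_right[of "Hs _", symmetric] entire_iff_slicewise
    by (intro vec.slicewise_mult vec.slicewise_exp vec.slicewise_const) simp_all
   moreover have "periodic f"
    unfolding periodic_def
   proof (intro allI)
    fix i y
    have 1: "y + axis i 1 + s = (y + s) + axis i 1" by (simp add: add_ac)
    have 2: "expi (- (of_nat r * (Hs (y + s) + L (b i) (M *v (y + s))))) * expi (of_nat r * L (b i) (M *v (y + s)))
      = expi (- (of_nat r * Hs (y + s)))"
     unfolding expi_add[symmetric] by (rule arg_cong[where f = expi]) (simp add: algebra_simps)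
    show "f (y + axis i 1) = f y"
     unfolding f_def 1 Hb Madd[of "y + s"] Mb \<theta>(2)[OF mem(2)] L(2)[OF mem(2)] expi_power
     using 2 by (simp only: mult.assoc[symmetric])
   qed
   moreover have "f (y + tau d Z j) = expi (- (of_nat r * (of_nat (d j) * y $ j + Z $ j $ j / 2))) * f y" for y j
   proof -
    have 1: "y + tau d Z j + s = (y + s) + tau d Z j" by (simp add: add_ac)
    have 2: "expi (- (of_nat r * (Hs (y + s) + L (a j) (M *v (y + s)) + of_nat (d j) * (y + s) $ j - c j))) * expi (of_nat r * L (a j) (M *v (y + s)))
      = expi (- (of_nat r * (of_nat (d j) * y $ j + Z $ j $ j / 2))) * expi (- (of_nat r * Hs (y + s)))"
     unfolding expi_add[symmetric] by (rule arg_cong[where f = expi]) (simp only: dx, simp add: algebra_simps)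
    show ?thesis
     unfolding f_def 1 Hta Madd[of "y + s"] Ma \<theta>(2)[OF mem(1)] L(2)[OF mem(1)] expi_power
     using 2 by (simp only: mult.assoc[symmetric])
   qed
   ultimately have "f \<in> theta_space d Z r" by (simp add: theta_space_def)
   moreover have "\<theta> = (%v. E v ^ r * f (A v))"
    by (rule ext) (simp add: f_def E_def A_def expi_power MNv expi_minus)
   ultimately show "\<theta> \<in> (%f v. E v ^ r * f (A v)) ` theta_space d Z r" by blast
  qed
 qed
 moreover have "E v ~= 0" for v by (simp add: E_def)
 ultimately show ?thesis using that by blast
qed

section \<open>Theta functions\<close>

definition qf :: "complex^'n^'n => ('n::finite => int) => complex" where
 "qf W u = (\<Sum>i\<in>UNIV. \<Sum>j\<in>UNIV. W $ i $ j * of_int (u i) * of_int (u j))"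

definition bf :: "complex^'n^'n => ('n::finite => int) => ('n => int) => complex" where
 "bf W u w = (\<Sum>i\<in>UNIV. \<Sum>j\<in>UNIV. W $ i $ j * of_int (u i) * of_int (w j))"

lemma qf_bf: "qf W u = bf W u u"
 by (simp add: qf_def bf_def)

lemma bf_add_left: "bf W (%i. u i + v i) w = bf W u w + bf W v w"
 and bf_add_right: "bf W w (%i. u i + v i) = bf W w u + bf W w v"
 and bf_diff_left: "bf W (%i. u i - v i) w = bf W u w - bf W v w"
 and bf_diff_right: "bf W w (%i. u i - v i) = bf W w u - bf W w v"
 and bf_scale_left: "bf W (%i. k * u i) w = of_int k * bf W u w"
 and bf_scale_right: "bf W w (%i. k * u i) = of_int k * bf W w u"
 by (simp_all add: bf_def algebra_simps sum.distrib sum_subtractf sum_distrib_left)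

lemma bf_sym: "transpose W = W ==> bf W u w = bf W w u"
 unfolding bf_def by (subst sum.swap) (auto simp: transpose_def vec_eq_iff intro!: sum.cong)

section \<open>Congruence classes modulo multiples of the type\<close>

definition dcong :: "('n => nat) => nat => ('n => int) => ('n => int) => bool" where
 "dcong d k u w \<longleftrightarrow> (\<forall>i. int (k * d i) dvd u i - w i)"

lemma dcong_refl [simp]: "dcong d k u u"
 by (simp add: dcong_def)

lemma dcong_sym: "dcong d k u w ==> dcong d k w u"
 unfolding dcong_def by (metis dvd_minus_iff minus_diff_eq)

lemma dcong_trans: "dcong d k u v ==> dcong d k v w ==> dcong d k u w"
proof -
 assume *: "dcong d k u v" "dcong d k v w"
 have "int (k * d i) dvd (u i - v i) + (v i - w i)" for i
  using * by (intro dvd_add) (auto simp: dcong_def)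
 thus ?thesis by (simp add: dcong_def)
qed

lemma dcong_add: "dcong d k u w ==> dcong d k u' w' ==> dcong d k (%i. u i + u' i) (%i. w i + w' i)"
 unfolding dcong_def add_diff_add by (simp add: dvd_add)

definition residues :: "('n::finite => nat) => nat => ('n => int) set" where
 "residues d k = (\<Pi>\<^sub>E i\<in>UNIV. {0..<int (k * d i)})"

definition residue_of :: "('n => nat) => nat => ('n => int) => ('n => int)" where
 "residue_of d k u = (%i. u i mod int (k * d i))"

lemma finite_residues [simp]: "finite (residues d k)"
 by (simp add: residues_def finite_PiE)

lemma residues_unique:
 assumes "p \<in> residues d k" "q \<in> residues d k" "dcong d k p q"
 shows "p = q"
proof
 fix i
 have "0 <= p i" "p i < int (k * d i)" "0 <= q i" "q i < int (k * d i)"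
  using assms(1,2) by (auto simp: residues_def PiE_iff)
 moreover have "p i mod int (k * d i) = q i mod int (k * d i)"
  using assms(3) by (simp add: dcong_def mod_eq_dvd_iff)
 ultimately show "p i = q i" by simp
qed

lemma residue_of_mem:
 assumes "k > 0" "\<And>i. 0 < d i"
 shows "residue_of d k u \<in> residues d k"
 using assms by (auto simp: residue_of_def residues_def)

lemma dcong_residue_of: "dcong d k u (residue_of d k u)"
 by (simp add: residue_of_def dcong_def minus_mod_eq_mult_div)

lemma dcong_periodic:
 fixes t :: "('n::finite => int) => 'a"
 assumes t: "\<And>j u. t (u(j := u j + int (k * d j))) = t u" and uw: "dcong d k u w"
 shows "t u = t w"
proof -
 have mult: "t (u(j := u j + int (k * d j) * s)) = t u" for u j s
 proof -
  define g where "g s = u(j := u j + int (k * d j) * s)" for s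
  have g: "g (s + 1) = (g s)(j := g s j + int (k * d j))" for s
   by (simp add: g_def fun_eq_iff distrib_left)
  have "t (g s) = t u"
  proof (induction s rule: int_induct[where k = 0])
   case base
   thus ?case by (simp add: g_def)
  next
   case (step1 i)
   thus ?case unfolding g t by simp
  next
   case (step2 i)
   have "t (g i) = t (g (i - 1))" using g[of "i - 1"] t[of "g (i - 1)" j] by simp
   thus ?case using step2 by simp
  qed
  thus ?thesis by (simp add: g_def)
 qed
 have "t (%i. if i \<in> I then u i else w i) = t w" if "finite I" for I
  using that
 proof (induction I rule: finite_induct)
  case (insert j I)
  obtain s where s: "u j - w j = int (k * d j) * s" using uw unfolding dcong_def by (meson dvdE)
  define v where "v = (%i. if i \<in> I then u i else w i)"
  have "(%i. if i \<in> insert j I then u i else w i) = v(j := v j + int (k * d j) * s)"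
   using insert.hyps s by (auto simp: v_def fun_eq_iff algebra_simps)
  thus ?case using mult[of v j s] insert.IH by (simp add: v_def)
 qed simp
 from this[of UNIV] show ?thesis by simp
qed

section \<open>Sums and products of Fourier series\<close>

lemma has_sum_finite_sum:
 fixes f :: "'i => 'a => complex"
 assumes "finite I" "\<And>i. i \<in> I ==> (f i has_sum s i) A"
 shows "((%x. \<Sum>i\<in>I. f i x) has_sum (\<Sum>i\<in>I. s i)) A"
 using assms by (induction I rule: finite_induct) (auto intro: has_sum_add)

lemma rapid_sum:
 assumes "\<And>i. i \<in> I ==> rapid (F i)"
 shows "rapid (%u. \<Sum>i\<in>I. c i * F i u)"
proof (cases "finite I")
 case True
 show ?thesis
  unfolding rapid_def
 proof
  fix k
  have "\<forall>i\<in>I. \<exists>B. \<forall>u. cmod (F i u) <= B * exp (- (k * l1 u))"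
   using assms unfolding rapid_def by blast
  then obtain B where B: "\<And>i u. i \<in> I ==> cmod (F i u) <= B i * exp (- (k * l1 u))" by metis
  have "cmod (\<Sum>i\<in>I. c i * F i u) <= (\<Sum>i\<in>I. cmod (c i) * B i) * exp (- (k * l1 u))" for u
   unfolding sum_distrib_right
   by (intro order_trans[OF norm_sum] sum_mono) (simp add: norm_mult mult.assoc mult_left_mono B)
  thus "\<exists>B. \<forall>u. cmod (\<Sum>i\<in>I. c i * F i u) <= B * exp (- (k * l1 u))" by blast
 qed
qed (auto simp: rapid_def intro!: exI[of _ 0])

lemma fser_sum:
 assumes "\<And>i. i \<in> I ==> rapid (F i)" "finite I"
 shows "fser (%u. \<Sum>i\<in>I. c i * F i u) x = (\<Sum>i\<in>I. c i * fser (F i) x)"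
proof -
 have "((%u. \<Sum>i\<in>I. c i * (F i u * mode u x)) has_sum (\<Sum>i\<in>I. c i * fser (F i) x)) UNIV"
  by (intro has_sum_finite_sum has_sum_cmult_right fser_has_sum assms)
 hence "((%u. (\<Sum>i\<in>I. c i * F i u) * mode u x) has_sum (\<Sum>i\<in>I. c i * fser (F i) x)) UNIV"
  by (simp add: sum_distrib_right mult.assoc)
 moreover have "((%u. (\<Sum>i\<in>I. c i * F i u) * mode u x) has_sum fser (%u. \<Sum>i\<in>I. c i * F i u) x) UNIV"
  by (intro fser_has_sum rapid_sum assms)
 ultimately show ?thesis by (rule has_sum_unique[symmetric])
qed

lemma rapid_convolution:
 assumes F: "rapid F" and G: "rapid G"
 shows "rapid (%N. \<Sum>\<^sub>\<infinity>u. F u * G (%i. N i - u i))"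
  and "(%u. norm (F u * G (%i. N i - u i))) summable_on UNIV"
proof -
 have *: "\<exists>B\<ge>0. \<forall>N u. cmod (F u * G (%i. N i - u i)) <= B * exp (- (c * l1 N)) * exp (- l1 u)" if c: "c >= 0" for c
 proof -
  \<comment> \<open>F is given one unit of decay more than G: the triangle inequality turns the
    common rate c into decay in N, and the surplus keeps the sum over u convergent.\<close>
  obtain B1 where B1: "\<And>u. cmod (F u) <= B1 * exp (- ((c + 1) * l1 u))" using F unfolding rapid_def by meson
  obtain B2 where B2: "\<And>u. cmod (G u) <= B2 * exp (- (c * l1 u))" using G unfolding rapid_def by meson
  have B0: "B1 >= 0" "B2 >= 0"
   using order_trans[OF norm_ge_zero B1[of "%_. 0"]] order_trans[OF norm_ge_zero B2[of "%_. 0"]] by (simp_all add: l1_def)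
  have "cmod (F u * G (%i. N i - u i)) <= B1 * B2 * exp (- (c * l1 N)) * exp (- l1 u)" for N u
  proof -
   have "c * l1 N <= c * (l1 u + l1 (%i. N i - u i))"
    using l1_triangle[of u "%i. N i - u i"] c by (intro mult_left_mono) auto
   hence "exp (- ((c + 1) * l1 u)) * exp (- (c * l1 (%i. N i - u i))) <= exp (- (c * l1 N)) * exp (- l1 u)"
    by (simp flip: exp_add add: algebra_simps)
   hence "B1 * B2 * (exp (- ((c + 1) * l1 u)) * exp (- (c * l1 (%i. N i - u i)))) <= B1 * B2 * (exp (- (c * l1 N)) * exp (- l1 u))"
    using B0 by (intro mult_left_mono) auto
   moreover have "cmod (F u * G (%i. N i - u i)) <= (B1 * exp (- ((c + 1) * l1 u))) * (B2 * exp (- (c * l1 (%i. N i - u i))))"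
    unfolding norm_mult using B0 by (intro mult_mono B1 B2) auto
   ultimately show ?thesis by (simp add: mult_ac)
  qed
  thus ?thesis using B0 by (intro exI[of _ "B1 * B2"]) auto
 qed
 show s: "(%u. norm (F u * G (%i. N i - u i))) summable_on UNIV" for N
 proof -
  obtain B where "\<And>u. cmod (F u * G (%i. N i - u i)) <= B * exp (- (0 * l1 N)) * exp (- l1 u)"
   using *[of 0] by blast
  thus ?thesis
   by (intro Infinite_Sum.abs_summable_on_comparison_test'[where g = "%u. B * exp (- l1 u)"] summable_on_cmult_right summable_exp_l1) simp
 qed
 show "rapid (%N. \<Sum>\<^sub>\<infinity>u. F u * G (%i. N i - u i))"
  unfolding rapid_def
 proof
  fix c :: real
  obtain B where B: "B >= 0" "\<And>N u. cmod (F u * G (%i. N i - u i)) <= B * exp (- (max c 0 * l1 N)) * exp (- l1 u)"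
   using *[of "max c 0"] by auto
  define S where "S = (\<Sum>\<^sub>\<infinity>u::'a => int. exp (- l1 u))"
  have S0: "S >= 0" unfolding S_def by (rule infsum_nonneg) simp
  have "cmod (\<Sum>\<^sub>\<infinity>u. F u * G (%i. N i - u i)) <= (B * S) * exp (- (c * l1 N))" for N
  proof -
   have "cmod (\<Sum>\<^sub>\<infinity>u. F u * G (%i. N i - u i)) <= (\<Sum>\<^sub>\<infinity>u. cmod (F u * G (%i. N i - u i)))"
    by (rule norm_infsum_bound[OF s])
   also have "\<dots> <= (\<Sum>\<^sub>\<infinity>u::'a => int. B * exp (- (max c 0 * l1 N)) * exp (- l1 u))"
    by (intro infsum_mono s summable_on_cmult_right summable_exp_l1 B)
   also have "\<dots> = B * exp (- (max c 0 * l1 N)) * S"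
    unfolding S_def by (rule infsum_cmult_right) (use summable_exp_l1 in simp)
   also have "\<dots> <= B * exp (- (c * l1 N)) * S"
    using B(1) S0 by (intro mult_right_mono mult_left_mono) (auto simp: mult_right_mono)
   finally show ?thesis by (simp add: mult_ac)
  qed
  thus "\<exists>B. \<forall>N. cmod (\<Sum>\<^sub>\<infinity>u. F u * G (%i. N i - u i)) <= B * exp (- (c * l1 N))" by blast
 qed
qed

text \<open>Cauchy product: absolute convergence of the double series allows summation along u + w =
  N.\<close>

lemma fcoef_mult:
 assumes F: "rapid F" and G: "rapid G"
 shows "fcoef (%x. fser F x * fser G x) N = (\<Sum>\<^sub>\<infinity>u. F u * G (%i. N i - u i))"
proof -
 define C where "C N = (\<Sum>\<^sub>\<infinity>u. F u * G (%i. N i - u i))" for N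
 have C: "rapid C" unfolding C_def by (rule rapid_convolution[OF F G])
 have "fser F x * fser G x = fser C x" for x
 proof -
  define a where "a u = F u * mode u x" for u
  define b where "b u = G u * mode u x" for u
  have sa: "(%u. norm (a u)) summable_on UNIV" "(a has_sum fser F x) UNIV"
   and sb: "(%u. norm (b u)) summable_on UNIV" "(b has_sum fser G x) UNIV"
   unfolding a_def b_def using fser_has_sum[OF F] fser_has_sum[OF G] by auto
  have sp: "(%p. norm (case p of (u, w) => a u * b w)) summable_on UNIV \<times> UNIV"
   unfolding Infinite_Sum.abs_summable_on_Sigma_iff
   using summable_on_cmult_right[OF sb(1)] summable_on_cmult_left[OF sa(1)]
   by (simp add: norm_mult infsum_cmult_right' abs_mult)
  have "((%(u, w). a u * b w) has_sum (fser F x * fser G x)) (UNIV \<times> UNIV)"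
  proof (rule has_sum_SigmaI)
   show "((%w. case (u, w) of (u, w) => a u * b w) has_sum a u * fser G x) UNIV" for u
    using has_sum_cmult_right[OF sb(2), of "a u"] by simp
   show "((%u. a u * fser G x) has_sum fser F x * fser G x) UNIV"
    by (rule has_sum_cmult_left[OF sa(2)])
   show "(%(u, w). a u * b w) summable_on UNIV \<times> UNIV"
    using sp by (rule abs_summable_summable)
  qed
  also have "?this \<longleftrightarrow> ((%(N, u). F u * G (%i. N i - u i) * mode N x) has_sum (fser F x * fser G x)) (UNIV \<times> UNIV)"
  proof (rule has_sum_reindex_bij_witness[where i = "%(N, u). (u, %i. N i - u i)" and j = "%(u, w). (%i. u i + w i, u)"])
   fix p :: "('a => int) \<times> ('a => int)"
   show "(case case p of (u, w) => (%i. u i + w i, u) of (N, u) => F u * G (%i. N i - u i) * mode N x) = (case p of (u, w) => a u * b w)"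
    by (cases p) (simp add: a_def b_def mode_add)
  qed auto
  finally have h: "((%(N, u). F u * G (%i. N i - u i) * mode N x) has_sum (fser F x * fser G x)) (UNIV \<times> UNIV)" .
  have "((%N. C N * mode N x) has_sum (fser F x * fser G x)) UNIV"
  proof (rule has_sum_SigmaD[OF h])
   fix N
   have "(%u. F u * G (%i. N i - u i)) summable_on UNIV"
    by (rule abs_summable_summable[OF rapid_convolution(2)[OF F G]])
   thus "((%u. case (N, u) of (N, u) => F u * G (%i. N i - u i) * mode N x) has_sum C N * mode N x) UNIV"
    unfolding C_def using has_sum_cmult_left[OF has_sum_infsum] by auto
  qed
  thus ?thesis using fser_has_sum(1)[OF C] has_sum_unique by blast
 qed
 hence "(%x. fser F x * fser G x) = fser C" by blast
 thus ?thesis using fcoef_fser[OF C] by (simp add: C_def)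
qed

lemma entire_zero_on_ball:
 assumes f: "entire f" and "\<delta> > 0" and z: "\<And>x. norm x < \<delta> ==> f x = 0"
 shows "f x = 0"
proof -
 have "f (0 + 1 *s x) = 0"
 proof (rule analytic_continuation_open[where f = "%t. f (0 + t *s x)" and s = "ball 0 (\<delta> / (norm x + 1))" and s' = UNIV and g = "%_. 0" and z = 1])
  show "(%t. f (0 + t *s x)) holomorphic_on UNIV" by (rule entire_slice[OF f])
  have pos: "norm x + 1 > 0" by (simp add: add_nonneg_pos)
  thus "ball 0 (\<delta> / (norm x + 1)) ~= ({} :: complex set)"
   using \<open>\<delta> > 0\<close> by (metis centre_in_ball divide_pos_pos empty_iff)
  fix t :: complex assume "t \<in> ball 0 (\<delta> / (norm x + 1))"
  hence "cmod t * (norm x + 1) < \<delta>" using pos by (simp add: pos_less_divide_eq)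
  moreover have "cmod t * norm x <= cmod t * (norm x + 1)" by (intro mult_left_mono) auto
  ultimately show "f (0 + t *s x) = 0" by (intro z) (simp add: norm_vector_scalar_mult)
 qed (auto simp: convex_connected)
 thus ?thesis by simp
qed

text \<open>Gaussian elimination: linear independence of the coefficient functions isolates the vectors \<open>\<theta> j\<close>.\<close>

lemma independent_coefficients_span:
 fixes D :: "'j => 'y => complex" and \<theta> :: "'j => 'x => complex"
 assumes J: "finite J"
  and add: "\<And>f g. f \<in> S ==> g \<in> S ==> (%x. f x + g x) \<in> S"
  and scale: "\<And>f c. f \<in> S ==> (%x. c * f x) \<in> S"
  and ind: "\<And>l. (\<And>y. y \<in> Y ==> (\<Sum>j\<in>J. l j * D j y) = 0) ==> (\<And>j. j \<in> J ==> l j = 0)"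
  and mem: "\<And>y. y \<in> Y ==> (%x. \<Sum>j\<in>J. D j y * \<theta> j x) \<in> S"
  and j: "j \<in> J"
 shows "\<theta> j \<in> S"
 using J ind mem j
proof (induction J arbitrary: D j rule: finite_induct)
 case (insert k J)
 note ind = insert.prems(1) and mem = insert.prems(2)
 have "\<exists>y\<in>Y. D k y ~= 0"
 proof (rule ccontr)
  assume n: "\<not> (\<exists>y\<in>Y. D k y ~= 0)"
  have "(\<Sum>j\<in>insert k J. (if j = k then 1 else 0) * D j y) = 0" if "y \<in> Y" for y
  proof -
   have "D k y = 0" using n that by blast
   moreover have "(\<Sum>j\<in>J. (if j = k then 1 else 0) * D j y) = 0"
    using insert.hyps by (intro sum.neutral) auto
   ultimately show ?thesis using insert.hyps by simp
  qed
  from ind[OF this, of k] show False by simp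
 qed
 then obtain y0 where y0: "y0 \<in> Y" "D k y0 ~= 0" by blast
 define D' where "D' j y = D j y - D k y * D j y0 / D k y0" for j y
 have IH: "\<theta> j \<in> S" if jJ: "j \<in> J" for j
 proof (rule insert.IH[of D'])
  fix l j assume l: "\<And>y. y \<in> Y ==> (\<Sum>j\<in>J. l j * D' j y) = 0" and j: "j \<in> J"
  \<comment> \<open>A relation among the reduced D' extends to the D by this coefficient at the
    pivot k.\<close>
  define l' where "l' i = (if i = k then - (\<Sum>j\<in>J. l j * D j y0) / D k y0 else l i)" for i
  have "l' j = 0"
  proof (rule ind)
   fix y assume y: "y \<in> Y"
   have "(\<Sum>i\<in>insert k J. l' i * D i y) = l' k * D k y + (\<Sum>i\<in>J. l i * D i y)"
    using insert.hyps by (simp, intro sum.cong) (auto simp: l'_def)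
   also have "\<dots> = (\<Sum>i\<in>J. l i * D' i y)"
    by (simp add: l'_def D'_def right_diff_distrib sum_subtractf sum_distrib_left sum_distrib_right sum_divide_distrib sum_negf mult_ac)
   finally show "(\<Sum>i\<in>insert k J. l' i * D i y) = 0" using l[OF y] by simp
  qed (use j in simp)
  thus "l j = 0" using j insert.hyps by (auto simp: l'_def split: if_splits)
 next
  fix y assume y: "y \<in> Y"
  have "(%x. (\<Sum>j\<in>insert k J. D j y * \<theta> j x) + (- (D k y / D k y0)) * (\<Sum>j\<in>insert k J. D j y0 * \<theta> j x)) \<in> S"
   by (intro add scale mem y y0)
  also have "(%x. (\<Sum>j\<in>insert k J. D j y * \<theta> j x) + (- (D k y / D k y0)) * (\<Sum>j\<in>insert k J. D j y0 * \<theta> j x))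
    = (%x. \<Sum>j\<in>J. D' j y * \<theta> j x)"
   using insert.hyps y0(2)
   by (auto simp: D'_def algebra_simps sum_subtractf sum_distrib_left sum_divide_distrib sum_negf)
  finally show "(%x. \<Sum>j\<in>J. D' j y * \<theta> j x) \<in> S" .
 qed (rule jJ)
 have zero: "(%x. 0) \<in> S" using scale[OF mem[OF y0(1)], of 0] by simp
 have sums: "(%x. \<Sum>j\<in>I. c j * \<theta> j x) \<in> S" if "I \<subseteq> J" for I c
  using finite_subset[OF that insert.hyps(1)] that
  by (induction I rule: finite_induct) (auto simp: zero intro!: add scale IH)
 have "(%x. (1 / D k y0) * ((\<Sum>j\<in>insert k J. D j y0 * \<theta> j x) + (\<Sum>j\<in>J. (- D j y0) * \<theta> j x))) \<in> S"
  by (rule scale, rule add, rule mem[OF y0(1)], rule sums[OF order.refl])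
 also have "(%x. (1 / D k y0) * ((\<Sum>j\<in>insert k J. D j y0 * \<theta> j x) + (\<Sum>j\<in>J. (- D j y0) * \<theta> j x))) = \<theta> k"
  using insert.hyps y0(2) by (auto simp: sum_negf)
 finally have "\<theta> k \<in> S" .
 with IH insert.prems(3) show ?case by blast
qed simp

lemma fser_shift: "fser F (x + c) = fser (%u. F u * mode u c) x"
 by (simp add: fser_def mode_shift mult_ac)

lemma rapid_mode:
 assumes "rapid F"
 shows "rapid (%u. F u * mode u c)"
proof -
 have "rapid (fcoef (%x. fser F (x + c)))"
  using entire_shift[OF entire_fser[OF assms]] periodic_fser[of F]
  by (intro rapid_fcoef) (auto simp: fser_shift periodic_fser)
 moreover have "fcoef (%x. fser F (x + c)) = (%u. F u * mode u c)"
  by (simp add: fun_eq_iff fcoef_shift entire_fser[OF assms] periodic_fser fcoef_fser[OF assms] mult.commute)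
 ultimately show ?thesis by simp
qed

section \<open>Theta series and the spaces they span\<close>

definition scaled :: "('n::finite => nat) => complex^'n^'n => complex^'n^'n" where
 "scaled d Z = (\<chi> i j. Z $ i $ j / (of_nat (d i) * of_nat (d j)))"

definition gauss :: "('n::finite => nat) => complex^'n^'n => nat => ('n => int) => ('n => int) => complex" where
 "gauss d W r p u = (if dcong d r u p then expi (qf W u / (2 * of_nat r)) else 0)"

text \<open>With u = p + r D m this is the classical theta series of rational characteristic p / (r
  D), written as a Fourier series in u.\<close>

definition theta :: "('n::finite => nat) => complex^'n^'n => nat => ('n => int) => complex^'n => complex" where
 "theta d W r p = fser (gauss d W r p)"

text \<open>The vectors D \<eta> for 0/1-vectors \<eta>: the classes modulo 2 D lying over the zero
  class modulo D.\<close>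

definition subset_shift :: "('n => nat) => 'n set => 'n => int" where
 "subset_shift d \<eta> i = (if i \<in> \<eta> then int (d i) else 0)"

text \<open>
 The determinants below are maximal minors of the multiplication map on the products
 \<open>\<theta>\<^sub>\<kappa> \<theta>\<^sub>%\<close> with \<open>\<kappa> + % = p\<close>.
\<close>

definition minor :: "('n::finite => nat) => (('n => int) => complex) => ('n => int) => ('n set => 'n => int) => complex" where
 "minor d c p \<kappa> = det (\<chi> \<eta> \<eta>'. c (%i. 2 * \<kappa> \<eta> i - p i - subset_shift d \<eta>' i) :: complex^('n set)^('n set))"

lemma Max_degree_pos:
 fixes d :: "'n::finite => nat"
 assumes d: "\<And>i. 0 < d i"
 shows "Max (range (%i. real (d i))) > 0"
proof -
 have "real (d undefined) <= Max (range (%i. real (d i)))" by (rule Max_ge) auto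
 thus ?thesis using d[of undefined] by linarith
qed

lemma Im_qf_scaled_lower_bound:
 fixes d :: "'n::finite => nat"
 assumes d: "\<And>i. 0 < d i" and c: "c > 0"
  "\<And>q::real^'n. c * (norm q)\<^sup>2 <= q \<bullet> ((\<chi> i j. Im (Z $ i $ j)) *v q)"
 shows "c / (Max (range (%i. real (d i))))\<^sup>2 * (\<Sum>i\<in>UNIV. (real_of_int (u i))\<^sup>2) <= Im (qf (scaled d Z) u)"
proof -
 define M where "M = Max (range (%i. real (d i)))"
 have dM: "real (d i) <= M" for i unfolding M_def by (rule Max_ge) auto
 have M: "M > 0" unfolding M_def by (rule Max_degree_pos[where d = d, OF d])
 define q :: "real^'n" where "q = (\<chi> i. real_of_int (u i) / real (d i))"
 have "Im (qf (scaled d Z) u) = q \<bullet> ((\<chi> i j. Im (Z $ i $ j)) *v q)"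
 proof -
  have "qf (scaled d Z) u = (\<Sum>i\<in>UNIV. \<Sum>j\<in>UNIV. of_real (q $ i * q $ j) * Z $ i $ j)"
   unfolding qf_def by (intro sum.cong refl) (simp add: scaled_def q_def)
  thus ?thesis
   by (simp add: inner_vec_def matrix_vector_mult_def sum_distrib_left mult_ac)
 qed
 moreover have "(\<Sum>i\<in>UNIV. (real_of_int (u i))\<^sup>2) / M\<^sup>2 <= (norm q)\<^sup>2"
 proof -
  have "(norm q)\<^sup>2 = (\<Sum>i\<in>UNIV. (q $ i)\<^sup>2)" by (simp add: norm_vec_def L2_set_def sum_nonneg)
  moreover have "(real_of_int (u i))\<^sup>2 / M\<^sup>2 <= (q $ i)\<^sup>2" for i
   unfolding q_def vec_lambda_beta power_divide using dM[of i] d[of i] M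
   by (intro divide_left_mono power_mono mult_pos_pos) auto
  ultimately show ?thesis by (simp add: sum_divide_distrib sum_mono)
 qed
 hence "c * ((\<Sum>i\<in>UNIV. (real_of_int (u i))\<^sup>2) / M\<^sup>2) <= c * (norm q)\<^sup>2"
  using c by (intro mult_left_mono) auto
 ultimately show ?thesis
  using c(2)[of q] by (simp add: M_def)
qed

text \<open>Completing the square: \<open>k * t <= k^2 / (4 * \<gamma>) + \<gamma> * t^2\<close> in
  each coordinate.\<close>

lemma exp_neg_squares_le:
 fixes u :: "'n::finite => int"
 assumes \<gamma>: "\<gamma> > 0"
 shows "exp (- (\<gamma> * (\<Sum>i\<in>UNIV. (real_of_int (u i))\<^sup>2))) <= exp (\<Sum>i\<in>(UNIV::'n set). k\<^sup>2 / (4 * \<gamma>)) * exp (- (k * l1 u))"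
proof -
 have "k * \<bar>real_of_int (u i)\<bar> <= k\<^sup>2 / (4 * \<gamma>) + \<gamma> * (real_of_int (u i))\<^sup>2" for i
 proof -
  have "0 <= (k / (2 * \<gamma>) - \<bar>real_of_int (u i)\<bar>)\<^sup>2 * \<gamma>" using \<gamma> by simp
  also have "\<dots> = k\<^sup>2 / (4 * \<gamma>) - k * \<bar>real_of_int (u i)\<bar> + \<gamma> * (real_of_int (u i))\<^sup>2"
   using \<gamma> by (simp add: power2_eq_square field_simps)
  finally show ?thesis by simp
 qed
 hence "(\<Sum>i\<in>UNIV. k * \<bar>real_of_int (u i)\<bar>) <= (\<Sum>i\<in>UNIV. k\<^sup>2 / (4 * \<gamma>) + \<gamma> * (real_of_int (u i))\<^sup>2)"
  by (rule sum_mono)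
 hence "- (\<gamma> * (\<Sum>i\<in>UNIV. (real_of_int (u i))\<^sup>2)) <= (\<Sum>i\<in>(UNIV::'n set). k\<^sup>2 / (4 * \<gamma>)) - k * l1 u"
  by (simp add: l1_def sum.distrib sum_distrib_left)
 thus ?thesis by (simp flip: exp_add)
qed

lemma product_exponent:
 fixes A B q m n :: complex
 assumes "A ~= 0" "B ~= 0" "A + B ~= 0"
 shows "q / (2 * A) + (n - 2 * m + q) / (2 * B) + - (n / (2 * (A + B)))
    = ((A + B)\<^sup>2 * q - 2 * (A + B) * A * m + A\<^sup>2 * n) / (2 * (A * B * (A + B)))"
proof -
 have "q / (2 * A) = q * B * (A + B) / (2 * (A * B * (A + B)))"
  "(n - 2 * m + q) / (2 * B) = (n - 2 * m + q) * A * (A + B) / (2 * (A * B * (A + B)))"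
  "n / (2 * (A + B)) = n * A * B / (2 * (A * B * (A + B)))"
  using assms by simp_all
 thus ?thesis
  by (simp only: add_divide_distrib[symmetric] diff_divide_distrib[symmetric] minus_divide_left)
    (simp add: algebra_simps power2_eq_square)
qed

locale siegel_point =
 fixes d :: "'n::finite => nat" and Z :: "complex^'n^'n"
 assumes d_pos: "0 < d i" and Z: "Z \<in> siegel"
begin

abbreviation "W \<equiv> scaled d Z"

abbreviation "V \<equiv> theta_space d Z"

lemma Z_sym: "Z $ i $ j = Z $ j $ i"
 using Z by (auto simp: siegel_def transpose_def vec_eq_iff)

lemma bf_W_sym: "bf W u w = bf W w u"
 by (rule bf_sym) (simp add: scaled_def transpose_def vec_eq_iff Z_sym mult.commute)

lemma qf_add: "qf W (%i. u i + w i) = qf W u + 2 * bf W u w + qf W w"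
 by (simp add: qf_bf bf_add_left bf_add_right bf_W_sym[of w u])

lemma Im_qf_lower_bound:
 obtains c where "c > 0" "\<And>u. c * (\<Sum>i\<in>UNIV. (real_of_int (u i))\<^sup>2) <= Im (qf W u)"
proof -
 obtain c where c: "c > 0" "\<And>q::real^'n. c * (norm q)\<^sup>2 <= q \<bullet> ((\<chi> i j. Im (Z $ i $ j)) *v q)"
  using siegel_Im_lower_bound[OF Z] by blast
 show ?thesis
  using that[OF _ Im_qf_scaled_lower_bound[where d = d, OF d_pos c]] c(1) Max_degree_pos[where d = d, OF d_pos] by simp
qed

lemma rapid_gaussian:
 assumes s: "s > 0" and t: "\<And>u. cmod (t u) <= T"
 shows "rapid (%u. t u * expi (of_real s * qf W u))"
proof -
 obtain c where c: "c > 0" "\<And>u. c * (\<Sum>i\<in>UNIV. (real_of_int (u i))\<^sup>2) <= Im (qf W u)"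
  using Im_qf_lower_bound by blast
 define \<gamma> where "\<gamma> = 2 * pi * s * c"
 have \<gamma>: "\<gamma> > 0" using s c by (simp add: \<gamma>_def)
 have T: "T >= 0" using order_trans[OF norm_ge_zero t] .
 show ?thesis
  unfolding rapid_def
 proof
  fix k
  define B where "B = T * exp (\<Sum>i\<in>(UNIV::'n set). k\<^sup>2 / (4 * \<gamma>))"
  have "cmod (t u * expi (of_real s * qf W u)) <= B * exp (- (k * l1 u))" for u
  proof -
   have "cmod (expi (of_real s * qf W u)) <= exp (- (\<gamma> * (\<Sum>i\<in>UNIV. (real_of_int (u i))\<^sup>2)))"
   proof -
    have "2 * pi * s * (c * (\<Sum>i\<in>UNIV. (real_of_int (u i))\<^sup>2)) <= 2 * pi * s * Im (qf W u)"
     using c(2)[of u] s by (intro mult_left_mono) auto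
    thus ?thesis by (simp add: norm_expi \<gamma>_def mult_ac)
   qed
   hence "cmod (expi (of_real s * qf W u)) <= exp (\<Sum>i\<in>(UNIV::'n set). k\<^sup>2 / (4 * \<gamma>)) * exp (- (k * l1 u))"
    by (rule order_trans) (rule exp_neg_squares_le[OF \<gamma>])
   hence "cmod (t u) * cmod (expi (of_real s * qf W u)) <= T * (exp (\<Sum>i\<in>(UNIV::'n set). k\<^sup>2 / (4 * \<gamma>)) * exp (- (k * l1 u)))"
    using T by (intro mult_mono t) auto
   thus ?thesis by (simp add: norm_mult B_def mult.assoc)
  qed
  thus "\<exists>B. \<forall>u. cmod (t u * expi (of_real s * qf W u)) <= B * exp (- (k * l1 u))" by blast
 qed
qed

lemma rapid_gauss:
 assumes "r > 0"
 shows "rapid (gauss d W r p)"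
proof -
 have "rapid (%u. (if dcong d r u p then 1 else 0) * expi (of_real (1 / (2 * real r)) * qf W u))"
  using assms by (intro rapid_gaussian[where T = 1]) auto
 moreover have "(%u. (if dcong d r u p then 1 else 0) * expi (of_real (1 / (2 * real r)) * qf W u)) = gauss d W r p"
  by (auto simp: gauss_def)
 ultimately show ?thesis by simp
qed

text \<open>The functional equation on the level of coefficients. It is used both ways: to see that
  theta series lie in V r, and to see that every element of V r has Gaussian coefficients up to a
  periodic factor.\<close>

lemma expi_qf_step:
 assumes "r > 0"
 shows "expi (qf W (u(j := u j + int (r * d j))) / (2 * of_nat r)) =
   expi (qf W u / (2 * of_nat r)) * mode u (tau d Z j) * expi (of_nat r * Z $ j $ j / 2)"
proof -
 define v where "v i = (if i = j then int (r * d j) else 0)" for i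
 have u: "u(j := u j + int (r * d j)) = (%i. u i + v i)" by (auto simp: v_def)
 have dj: "of_nat (d j) ~= (0::complex)" using d_pos[of j] by simp
 have 1: "bf W u v = of_nat r * (\<Sum>i\<in>UNIV. of_int (u i) * tau d Z j $ i)"
 proof -
  have "(\<Sum>k\<in>UNIV. W $ i $ k * of_int (u i) * of_int (v k)) = of_nat r * (of_int (u i) * tau d Z j $ i)" for i
  proof -
   have "(\<Sum>k\<in>UNIV. W $ i $ k * of_int (u i) * of_int (v k)) = (\<Sum>k\<in>UNIV. if k = j then W $ i $ j * of_int (u i) * of_nat (r * d j) else 0)"
    by (rule sum.cong) (auto simp: v_def)
   thus ?thesis using dj by (simp add: scaled_def tau_def)
  qed
  thus ?thesis by (simp add: bf_def sum_distrib_left)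
 qed
 have 2: "qf W v = (of_nat r)\<^sup>2 * Z $ j $ j"
 proof -
  have "qf W v = (\<Sum>i\<in>UNIV. if i = j then (\<Sum>k\<in>UNIV. if k = j then W $ j $ j * of_nat (r * d j) * of_nat (r * d j) else 0) else 0)"
   unfolding qf_def
  proof (rule sum.cong[OF refl])
   fix i
   have "(\<Sum>k\<in>UNIV. W $ i $ k * of_int (v i) * of_int (v k)) = (\<Sum>k\<in>UNIV. if k = j then W $ i $ j * of_int (v i) * of_nat (r * d j) else 0)"
    by (rule sum.cong) (auto simp: v_def)
   thus "(\<Sum>k\<in>UNIV. W $ i $ k * of_int (v i) * of_int (v k)) =
     (if i = j then (\<Sum>k\<in>UNIV. if k = j then W $ j $ j * of_nat (r * d j) * of_nat (r * d j) else 0) else 0)"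
    by (simp add: v_def)
  qed
  thus ?thesis using dj by (simp add: scaled_def power2_eq_square)
 qed
 show ?thesis
  unfolding u qf_add 1 2 mode_def expi_add[symmetric] using assms
  by (intro arg_cong[where f = expi]) (simp add: field_simps power2_eq_square)
qed

lemma series_mem_theta_space:
 assumes r: "r > 0" and t: "\<And>j u. t (u(j := u j + int (r * d j))) = t u" and T: "\<And>u. cmod (t u) <= T"
 shows "fser (%u. t u * expi (qf W u / (2 * of_nat r))) \<in> V r"
proof -
 define F where "F u = t u * expi (qf W u / (2 * of_nat r))" for u
 have "rapid (%u. t u * expi (of_real (1 / (2 * real r)) * qf W u))"
  using r T by (intro rapid_gaussian) auto
 hence F: "rapid F" by (simp add: F_def[abs_def])
 have "fser F (x + tau d Z j) = expi (- (of_nat r * (of_nat (d j) * x $ j + Z $ j $ j / 2))) * fser F x" for j x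
 proof -
  define \<phi> where "\<phi> u = u(j := u j + int (r * d j))" for u :: "'n => int"
  have bij: "bij \<phi>"
   by (rule o_bij[where g = "%u. u(j := u j - int (r * d j))"]) (auto simp: \<phi>_def)
  have m: "mode (\<phi> u) x = mode u x * expi (of_nat r * of_nat (d j) * x $ j)" for u
  proof -
   have "(\<Sum>i\<in>UNIV. of_int (\<phi> u i) * x $ i) = (\<Sum>i\<in>UNIV. of_int (u i) * x $ i + (if i = j then of_nat (r * d j) * x $ j else 0))"
    by (rule sum.cong) (auto simp: \<phi>_def distrib_right)
   thus ?thesis by (simp add: mode_def sum.distrib expi_add)
  qed
  have "fser F x = (\<Sum>\<^sub>\<infinity>u. F (\<phi> u) * mode (\<phi> u) x)"
   unfolding fser_def by (rule infsum_reindex_bij_betw[OF bij, symmetric])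
  also have "\<dots> = (\<Sum>\<^sub>\<infinity>u. expi (of_nat r * (of_nat (d j) * x $ j + Z $ j $ j / 2)) * (F u * mode u (x + tau d Z j)))"
  proof (rule infsum_cong)
   fix u
   have "F (\<phi> u) = F u * mode u (tau d Z j) * expi (of_nat r * Z $ j $ j / 2)"
    unfolding F_def \<phi>_def t expi_qf_step[OF r] by simp
   thus "F (\<phi> u) * mode (\<phi> u) x =
     expi (of_nat r * (of_nat (d j) * x $ j + Z $ j $ j / 2)) * (F u * mode u (x + tau d Z j))"
    by (simp add: m mode_shift distrib_left expi_add mult_ac)
  qed
  also have "\<dots> = expi (of_nat r * (of_nat (d j) * x $ j + Z $ j $ j / 2)) * fser F (x + tau d Z j)"
   by (simp add: fser_def infsum_cmult_right')
  finally show ?thesis by (simp add: expi_minus)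
 qed
 thus ?thesis
  using entire_fser[OF F] periodic_fser[of F] unfolding F_def theta_space_def by blast
qed

lemma theta_mem:
 assumes "r > 0"
 shows "theta d W r p \<in> V r"
proof -
 define t where "t u = (if dcong d r u p then 1 else 0 :: complex)" for u
 have "t (u(j := u j + int (r * d j))) = t u" for u j
 proof -
  have "dcong d r (u(j := u j + int (r * d j))) u" by (simp add: dcong_def)
  hence "dcong d r (u(j := u j + int (r * d j))) p \<longleftrightarrow> dcong d r u p"
   using dcong_trans dcong_sym by blast
  thus ?thesis by (simp add: t_def)
 qed
 hence "fser (%u. t u * expi (qf W u / (2 * of_nat r))) \<in> V r"
  by (intro series_mem_theta_space[OF assms, where T = 1]) (auto simp: t_def)
 moreover have "(%u. t u * expi (qf W u / (2 * of_nat r))) = gauss d W r p"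
  by (auto simp: t_def gauss_def)
 ultimately show ?thesis by (simp add: theta_def)
qed

lemma theta_cong: "dcong d r p q ==> theta d W r p = theta d W r q"
proof -
 assume pq: "dcong d r p q"
 have "dcong d r u p \<longleftrightarrow> dcong d r u q" for u using pq dcong_trans dcong_sym by blast
 thus ?thesis by (simp add: theta_def gauss_def[abs_def])
qed

text \<open>Dividing by the Gaussian weight leaves a function of the class of u modulo r D; its
  values are the coordinates with respect to the theta functions, see
  \<open>theta_expansion\<close>.\<close>

definition coordinate :: "nat => (complex^'n => complex) => ('n => int) => complex" where
 "coordinate r f u = fcoef f u * expi (- (qf W u / (2 * of_nat r)))"

lemma coordinate_periodic:
 assumes r: "r > 0" and f: "f \<in> V r"
 shows "coordinate r f (u(j := u j + int (r * d j))) = coordinate r f u"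
proof -
 have fe: "entire f" "periodic f"
  and fq: "\<And>x. f (x + tau d Z j) = expi (- (of_nat r * (of_nat (d j) * x $ j + Z $ j $ j / 2))) * f x"
  using f by (auto simp: theta_space_def)
 define w where "w i = (if i = j then - int (r * d j) else 0)" for i
 have mw: "mode w x = expi (- (of_nat r * of_nat (d j) * x $ j))" for x
 proof -
  have "(\<Sum>i\<in>UNIV. of_int (w i) * x $ i) = (\<Sum>i\<in>UNIV. if i = j then - (of_nat (r * d j) * x $ j) else 0)"
   by (rule sum.cong) (auto simp: w_def)
  thus ?thesis by (simp add: mode_def)
 qed
 have "(%x. f (x + tau d Z j)) = (%x. expi (- (of_nat r * Z $ j $ j / 2)) * (mode w x * f x))"
  unfolding fq mw mult.assoc[symmetric] expi_add[symmetric] by (simp add: algebra_simps)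
 hence "fcoef (%x. f (x + tau d Z j)) u = expi (- (of_nat r * Z $ j $ j / 2)) * fcoef f (%i. u i - w i)"
  by (simp add: fcoef_cmult fcoef_mode_mult)
 moreover have "(%i. u i - w i) = u(j := u j + int (r * d j))" by (auto simp: w_def)
 ultimately have "fcoef f (u(j := u j + int (r * d j))) = expi (of_nat r * Z $ j $ j / 2) * mode u (tau d Z j) * fcoef f u"
  by (simp add: fcoef_shift[OF fe] expi_minus field_simps)
 thus ?thesis
  unfolding coordinate_def expi_minus expi_qf_step[OF r] by (simp add: field_simps)
qed

lemma coordinate_cong:
 assumes "r > 0" "f \<in> V r" "dcong d r u w"
 shows "coordinate r f u = coordinate r f w"
 by (rule dcong_periodic[OF coordinate_periodic[OF assms(1,2)] assms(3)])

lemma theta_expansion: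
 assumes r: "r > 0" and f: "f \<in> V r"
 shows "f x = (\<Sum>p\<in>residues d r. coordinate r f p * theta d W r p x)"
proof -
 have fe: "entire f" "periodic f" using f by (auto simp: theta_space_def)
 define G where "G u = (\<Sum>p\<in>residues d r. coordinate r f p * gauss d W r p u)" for u
 have G: "rapid G" unfolding G_def by (intro rapid_sum rapid_gauss r)
 have "G u = fcoef f u" for u
 proof -
  define q where "q = residue_of d r u"
  have q: "q \<in> residues d r" "dcong d r u q"
   unfolding q_def by (rule residue_of_mem[OF r d_pos], rule dcong_residue_of)
  have "G u = (\<Sum>p\<in>residues d r. if p = q then coordinate r f q * expi (qf W u / (2 * of_nat r)) else 0)"
   unfolding G_def
  proof (rule sum.cong[OF refl])
   fix p assume p: "p \<in> residues d r"
   have "dcong d r u p \<longleftrightarrow> p = q"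
    using residues_unique[OF p q(1)] q(2) dcong_trans dcong_sym by blast
   thus "coordinate r f p * gauss d W r p u = (if p = q then coordinate r f q * expi (qf W u / (2 * of_nat r)) else 0)"
    by (simp add: gauss_def)
  qed
  also have "\<dots> = coordinate r f u * expi (qf W u / (2 * of_nat r))"
   using q coordinate_cong[OF r f q(2)] by simp
  finally show ?thesis by (simp add: coordinate_def expi_minus)
 qed
 hence "f = fser G"
  by (intro fcoef_unique fe entire_fser[OF G] periodic_fser) (simp add: fcoef_fser[OF G])
 hence "f x = fser G x" by simp
 also have "\<dots> = (\<Sum>p\<in>residues d r. coordinate r f p * theta d W r p x)"
  unfolding G_def theta_def by (rule fser_sum) (simp_all add: rapid_gauss r)
 finally show ?thesis .
qed

section \<open>Products of theta functions and the addition formula\<close>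

text \<open>The shift by b z enters the automorphy factor with weight a and the shift by - a z with
  weight b, so z cancels.\<close>

lemma shifted_product_mem:
 assumes f: "f \<in> V a" and g: "g \<in> V b"
 shows "(%x. f (x + of_nat b *s z) * g (x + (- of_nat a) *s z)) \<in> V (a + b)"
proof -
 have fe: "entire f" "periodic f" "\<And>j x. f (x + tau d Z j) = expi (- (of_nat a * (of_nat (d j) * x $ j + Z $ j $ j / 2))) * f x"
  and ge: "entire g" "periodic g" "\<And>j x. g (x + tau d Z j) = expi (- (of_nat b * (of_nat (d j) * x $ j + Z $ j $ j / 2))) * g x"
  using f g by (auto simp: theta_space_def)
 have sw: "x + y + c = (x + c) + y" for x y c :: "complex^'n" by (simp add: add_ac)
 have "entire (%x. f (x + of_nat b *s z) * g (x + (- of_nat a) *s z))"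
  using entire_shift[OF fe(1), of "of_nat b *s z"] entire_shift[OF ge(1), of "(- of_nat a) *s z"]
  unfolding entire_iff_slicewise by (rule vec.slicewise_mult)
 moreover have "periodic (%x. f (x + of_nat b *s z) * g (x + (- of_nat a) *s z))"
  using fe(2) ge(2) unfolding periodic_def sw[of _ "axis _ 1"] by simp
 moreover have "f (x + tau d Z j + of_nat b *s z) * g (x + tau d Z j + (- of_nat a) *s z) =
   expi (- (of_nat (a + b) * (of_nat (d j) * x $ j + Z $ j $ j / 2))) * (f (x + of_nat b *s z) * g (x + (- of_nat a) *s z))" for j x
 proof -
  have "expi (- (of_nat a * (of_nat (d j) * (x + of_nat b *s z) $ j + Z $ j $ j / 2))) *
    expi (- (of_nat b * (of_nat (d j) * (x + (- of_nat a) *s z) $ j + Z $ j $ j / 2)))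
   = expi (- (of_nat (a + b) * (of_nat (d j) * x $ j + Z $ j $ j / 2)))"
   unfolding expi_add[symmetric] by (rule arg_cong[where f = expi]) (simp add: algebra_simps)
  thus ?thesis
   unfolding sw[of _ "tau d Z j"] fe(3) ge(3) by (simp add: mult_ac flip: mult.assoc)
 qed
 ultimately show ?thesis by (simp add: theta_space_def)
qed

text \<open>For given N the index u is determined by w, so a sum over u turns into a Fourier series
  in z.\<close>

definition product_coefficient :: "nat => nat => ('n => int) => ('n => int) => ('n => int) => ('n => int) => complex" where
 "product_coefficient a b p q N w =
   (if \<exists>u. w = (%i. int (a + b) * u i - int a * N i) \<and> dcong d a u p \<and> dcong d b (%i. N i - u i) q
   then expi (qf W w / (2 * of_nat (a * b * (a + b)))) else 0)"

lemma rapid_product_coefficient: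
 assumes "a > 0" "b > 0"
 shows "rapid (product_coefficient a b p q N)"
proof -
 define C where "C w \<longleftrightarrow> (\<exists>u. w = (%i. int (a + b) * u i - int a * N i) \<and> dcong d a u p \<and> dcong d b (%i. N i - u i) q)" for w
 define t where "t w = (if C w then 1 else 0 :: complex)" for w
 define m where "m = a * b * (a + b)"
 have "rapid (%w. t w * expi (of_real (1 / (2 * real m)) * qf W w))"
  using assms by (intro rapid_gaussian[where T = 1]) (auto simp: t_def m_def)
 moreover have "(%w. t w * expi (of_real (1 / (2 * real m)) * qf W w)) = product_coefficient a b p q N"
  unfolding product_coefficient_def m_def[symmetric] C_def[symmetric] by (rule ext) (simp add: t_def)
 ultimately show ?thesis by simp
qed

text \<open>
 The exponents obey \<open>qf u / a + qf (N - u) / b = qf N / (a + b) + qf w / (a b (a + b))\<close> for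
 \<open>w = (a + b) u - a N\<close>.
\<close>

lemma coordinate_product:
 assumes a: "a > 0" and b: "b > 0"
 shows "coordinate (a + b) (%x. theta d W a p (x + of_nat b *s z) * theta d W b q (x + (- of_nat a) *s z)) N
    = fser (product_coefficient a b p q N) z"
proof -
 define F where "F u = gauss d W a p u * mode u (of_nat b *s z)" for u
 define G where "G u = gauss d W b q u * mode u ((- of_nat a) *s z)" for u
 define w where "w u = (%i. int (a + b) * u i - int a * N i)" for u :: "'n => int"
 have FG: "rapid F" "rapid G" unfolding F_def G_def by (intro rapid_mode rapid_gauss a b)+
 have "coordinate (a + b) (%x. theta d W a p (x + of_nat b *s z) * theta d W b q (x + (- of_nat a) *s z)) N
   = (\<Sum>\<^sub>\<infinity>u. F u * G (%i. N i - u i)) * expi (- (qf W N / (2 * of_nat (a + b))))"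
  using fcoef_mult[OF FG, of N] unfolding coordinate_def theta_def fser_shift F_def G_def by simp
 also have "\<dots> = (\<Sum>\<^sub>\<infinity>u. F u * G (%i. N i - u i) * expi (- (qf W N / (2 * of_nat (a + b)))))"
  by (rule infsum_cmult_left'[symmetric])
 also have "\<dots> = (\<Sum>\<^sub>\<infinity>u. product_coefficient a b p q N (w u) * mode (w u) z)"
 proof (rule infsum_cong)
  fix u
  have inj: "w u' = w u \<longleftrightarrow> u' = u" for u' using a by (auto simp: w_def fun_eq_iff)
  show "F u * G (%i. N i - u i) * expi (- (qf W N / (2 * of_nat (a + b)))) = product_coefficient a b p q N (w u) * mode (w u) z"
  proof (cases "dcong d a u p \<and> dcong d b (%i. N i - u i) q")
   case False
   hence "product_coefficient a b p q N (w u) = 0"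
    using inj unfolding product_coefficient_def w_def[symmetric] by metis
   thus ?thesis using False by (auto simp: F_def G_def gauss_def)
  next
   case True
   have qw: "qf W (w u) = (of_nat (a + b))\<^sup>2 * qf W u - 2 * of_nat (a + b) * of_nat a * bf W u N + (of_nat a)\<^sup>2 * qf W N"
    unfolding w_def qf_bf bf_diff_left bf_diff_right bf_scale_left bf_scale_right bf_W_sym[of N u]
    by (simp add: power2_eq_square algebra_simps)
   have qN: "qf W (%i. N i - u i) = qf W N - 2 * bf W u N + qf W u"
    unfolding qf_bf bf_diff_left bf_diff_right bf_W_sym[of N u] by simp
   have A: "(of_nat a :: complex) ~= 0" "(of_nat b :: complex) ~= 0" "(of_nat a + of_nat b :: complex) ~= 0"
    using a b by (simp_all flip: of_nat_add)
   have e: "qf W u / (2 * of_nat a) + qf W (%i. N i - u i) / (2 * of_nat b) + - (qf W N / (2 * of_nat (a + b)))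
     = qf W (w u) / (2 * of_nat (a * b * (a + b)))"
    unfolding qw qN of_nat_add of_nat_mult by (rule product_exponent[OF A])
   have m: "mode u (of_nat b *s z) * mode (%i. N i - u i) ((- of_nat a) *s z) = mode (w u) z"
   proof -
    have "(\<Sum>i\<in>UNIV. of_int (u i) * (of_nat b *s z) $ i) + (\<Sum>i\<in>UNIV. of_int (N i - u i) * ((- of_nat a) *s z) $ i)
      = (\<Sum>i\<in>UNIV. of_int (w u i) * z $ i)"
     unfolding sum.distrib[symmetric] by (rule sum.cong) (simp_all add: w_def algebra_simps)
    thus ?thesis unfolding mode_def expi_add[symmetric] by simp
   qed
   have "F u * G (%i. N i - u i) * expi (- (qf W N / (2 * of_nat (a + b))))
    = expi (qf W u / (2 * of_nat a) + qf W (%i. N i - u i) / (2 * of_nat b) + - (qf W N / (2 * of_nat (a + b))))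
     * (mode u (of_nat b *s z) * mode (%i. N i - u i) ((- of_nat a) *s z))"
    unfolding expi_add using True by (simp add: F_def G_def gauss_def mult_ac)
   also have "\<dots> = product_coefficient a b p q N (w u) * mode (w u) z"
   proof -
    have "\<exists>u'. w u = (%i. int (a + b) * u' i - int a * N i) \<and> dcong d a u' p \<and> dcong d b (%i. N i - u' i) q"
     using True by (intro exI[of _ u]) (simp add: w_def)
    thus ?thesis unfolding e m product_coefficient_def by simp
   qed
   finally show ?thesis .
  qed
 qed
 also have "\<dots> = infsum (%v. product_coefficient a b p q N v * mode v z) (range w)"
 proof -
  have "inj w" using a by (auto simp: w_def fun_eq_iff inj_on_def)
  from infsum_reindex[OF this, of "%v. product_coefficient a b p q N v * mode v z"] show ?thesis by (simp add: o_def)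
 qed
 also have "\<dots> = fser (product_coefficient a b p q N) z"
  unfolding fser_def
  by (rule infsum_cong_neutral) (auto simp: product_coefficient_def w_def)
 finally show ?thesis .
qed

lemma coordinate_product_1:
 "coordinate 2 (%x. theta d W 1 p (x + z) * theta d W 1 q (x + - z)) N
   = (if dcong d 1 N (%i. p i + q i) then theta d W 2 (%i. 2 * p i - N i) z else 0)"
proof -
 have *: "coordinate 2 (%x. theta d W 1 p (x + z) * theta d W 1 q (x + - z)) N = fser (product_coefficient 1 1 p q N) z"
  using coordinate_product[of 1 1 p z q N] by (simp add: numeral_2_eq_2)
 show ?thesis
 proof (cases "dcong d 1 N (%i. p i + q i)")
  case True
  have "product_coefficient 1 1 p q N w = gauss d W 2 (%i. 2 * p i - N i) w" for w
  proof -
   have "(\<exists>u. w = (%i. 2 * u i - N i) \<and> dcong d 1 u p \<and> dcong d 1 (%i. N i - u i) q) \<longleftrightarrow> dcong d 2 w (%i. 2 * p i - N i)"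
   proof
    assume "\<exists>u. w = (%i. 2 * u i - N i) \<and> dcong d 1 u p \<and> dcong d 1 (%i. N i - u i) q"
    then obtain u where u: "w = (%i. 2 * u i - N i)" "dcong d 1 u p" by blast
    have "int (2 * d i) dvd w i - (2 * p i - N i)" for i
    proof -
     have "int (d i) dvd u i - p i" using u(2) by (simp add: dcong_def)
     hence "2 * int (d i) dvd 2 * (u i - p i)" by (rule mult_dvd_mono[OF dvd_refl])
     thus ?thesis by (simp add: u(1) algebra_simps)
    qed
    thus "dcong d 2 w (%i. 2 * p i - N i)" by (simp add: dcong_def)
   next
    assume w: "dcong d 2 w (%i. 2 * p i - N i)"
    have "\<forall>i. \<exists>s. w i = 2 * p i - N i + 2 * (int (d i) * s)"
    proof
     fix i
     have "2 * int (d i) dvd w i - (2 * p i - N i)" using w by (simp add: dcong_def)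
     then obtain s where "w i - (2 * p i - N i) = 2 * int (d i) * s" unfolding dvd_def by blast
     thus "\<exists>s. w i = 2 * p i - N i + 2 * (int (d i) * s)" by (intro exI[of _ s]) (simp add: algebra_simps)
    qed
    then obtain s where s: "\<And>i. w i = 2 * p i - N i + 2 * (int (d i) * s i)" by metis
    define u where "u i = p i + int (d i) * s i" for i
    have "w = (%i. 2 * u i - N i)" by (auto simp: s u_def)
    moreover have "dcong d 1 u p" by (simp add: dcong_def u_def)
    moreover have "dcong d 1 (%i. N i - u i) q"
     unfolding dcong_def
    proof
     fix i
     have "int (1 * d i) dvd N i - (p i + q i)" using True by (simp add: dcong_def)
     hence "int (1 * d i) dvd (N i - (p i + q i)) - int (d i) * s i"
      by (rule dvd_diff) simp
     thus "int (1 * d i) dvd N i - u i - q i" by (simp add: u_def algebra_simps)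
    qed
    ultimately show "\<exists>u. w = (%i. 2 * u i - N i) \<and> dcong d 1 u p \<and> dcong d 1 (%i. N i - u i) q" by blast
   qed
   thus ?thesis by (simp add: product_coefficient_def gauss_def)
  qed
  hence "product_coefficient 1 1 p q N = gauss d W 2 (%i. 2 * p i - N i)" by blast
  thus ?thesis using * True by (simp add: theta_def)
 next
  case False
  have "product_coefficient 1 1 p q N w = 0" for w
  proof -
   have "\<not> (dcong d 1 u p \<and> dcong d 1 (%i. N i - u i) q)" for u
    using dcong_add[of d 1 u p "%i. N i - u i" q] False by auto
   thus ?thesis by (auto simp: product_coefficient_def)
  qed
  thus ?thesis using * False by (simp add: fser_def)
 qed
qed

lemma sum_residues_2:
 fixes h :: "('n => int) => complex"
 assumes h: "\<And>N N'. dcong d 2 N N' ==> h N = h N'"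
 shows "(\<Sum>N\<in>residues d 2. if dcong d 1 N p then h N else 0)
    = (\<Sum>\<eta>\<in>UNIV. h (%i. p i + subset_shift d \<eta> i))"
proof -
 define R where "R = {N \<in> residues d 2. dcong d 1 N p}"
 define \<phi> where "\<phi> \<eta> = residue_of d 2 (%i. p i + subset_shift d \<eta> i)" for \<eta>
 have \<phi>R: "\<phi> \<eta> \<in> R" for \<eta>
 proof -
  have "int (1 * d i) dvd \<phi> \<eta> i - p i" for i
  proof -
   have "2 * int (d i) dvd (p i + subset_shift d \<eta> i) - \<phi> \<eta> i"
    using dcong_residue_of[of d 2 "%i. p i + subset_shift d \<eta> i"] by (simp add: dcong_def \<phi>_def)
   hence "int (d i) dvd (p i + subset_shift d \<eta> i) - \<phi> \<eta> i" by (rule dvd_mult_right)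
   moreover have "int (d i) dvd subset_shift d \<eta> i" by (simp add: subset_shift_def)
   ultimately have "int (d i) dvd subset_shift d \<eta> i - ((p i + subset_shift d \<eta> i) - \<phi> \<eta> i)" by (rule dvd_diff[rotated])
   thus ?thesis by simp
  qed
  thus ?thesis using residue_of_mem[of 2 d] d_pos by (simp add: R_def \<phi>_def dcong_def)
 qed
 have "bij_betw \<phi> UNIV R"
 proof (rule bij_betwI')
  fix \<eta> \<eta>' :: "'n set"
  show "\<phi> \<eta> = \<phi> \<eta>' \<longleftrightarrow> \<eta> = \<eta>'"
  proof
   assume "\<phi> \<eta> = \<phi> \<eta>'"
   moreover have "dcong d 2 (%i. p i + subset_shift d \<eta> i) (\<phi> \<eta>)" for \<eta>
    unfolding \<phi>_def by (rule dcong_residue_of)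
   ultimately have "dcong d 2 (%i. p i + subset_shift d \<eta> i) (%i. p i + subset_shift d \<eta>' i)"
    by (metis dcong_trans dcong_sym)
   hence dv: "2 * int (d i) dvd subset_shift d \<eta> i - subset_shift d \<eta>' i" for i by (simp add: dcong_def)
   have "i \<in> \<eta> \<longleftrightarrow> i \<in> \<eta>'" for i
   proof (rule ccontr)
    assume "\<not> (i \<in> \<eta> \<longleftrightarrow> i \<in> \<eta>')"
    hence "\<bar>subset_shift d \<eta> i - subset_shift d \<eta>' i\<bar> = int (d i)" by (auto simp: subset_shift_def)
    hence "2 * int (d i) dvd int (d i)" using dv[of i] by (metis dvd_abs_iff)
    thus False using d_pos[of i] zdvd_imp_le by fastforce
   qed
   thus "\<eta> = \<eta>'" by blast
  qed simp
 next
  fix \<eta> show "\<phi> \<eta> \<in> R" by (rule \<phi>R)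
 next
  fix N assume N: "N \<in> R"
  have "\<forall>i. \<exists>s. N i = p i + int (d i) * s"
  proof
   fix i
   have "int (d i) dvd N i - p i" using N by (simp add: R_def dcong_def)
   then obtain s where "N i - p i = int (d i) * s" unfolding dvd_def by blast
   thus "\<exists>s. N i = p i + int (d i) * s" by (intro exI[of _ s]) simp
  qed
  then obtain s where s: "\<And>i. N i = p i + int (d i) * s i" by metis
  define \<eta> where "\<eta> = {i. odd (s i)}"
  have "dcong d 2 (%i. p i + subset_shift d \<eta> i) N"
   unfolding dcong_def
  proof
   fix i
   have "even (s i - (if i \<in> \<eta> then 1 else 0))" by (auto simp: \<eta>_def)
   then obtain k where k: "s i = 2 * k + (if i \<in> \<eta> then 1 else 0)" by (metis diff_add_cancel evenE)
   have "p i + subset_shift d \<eta> i - N i = int (2 * d i) * (- k)"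
    unfolding s k subset_shift_def by (simp add: algebra_simps)
   thus "int (2 * d i) dvd p i + subset_shift d \<eta> i - N i" by (metis dvd_triv_left)
  qed
  hence "dcong d 2 (\<phi> \<eta>) N" unfolding \<phi>_def using dcong_residue_of dcong_sym dcong_trans by blast
  hence "N = \<phi> \<eta>" using residues_unique[of "\<phi> \<eta>" d 2 N] \<phi>R[of \<eta>] N by (simp add: R_def)
  thus "\<exists>\<eta>\<in>UNIV. N = \<phi> \<eta>" by blast
 qed
 hence "(\<Sum>\<eta>\<in>UNIV. h (\<phi> \<eta>)) = (\<Sum>N\<in>R. h N)" by (rule sum.reindex_bij_betw)
 moreover have "h (\<phi> \<eta>) = h (%i. p i + subset_shift d \<eta> i)" for \<eta>
  unfolding \<phi>_def by (rule h[symmetric, OF dcong_residue_of])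
 ultimately show ?thesis by (simp add: R_def sum.inter_filter)
qed

text \<open>As a function of x the product lies in V 2. By \<open>coordinate_product_1\<close> its
  coordinates are theta values at z and vanish outside the 2^n classes modulo 2 D over the class of
  p modulo D.\<close>

lemma addition_formula:
 "theta d W 1 \<kappa> (x + z) * theta d W 1 (%i. p i - \<kappa> i) (x + - z) =
   (\<Sum>\<eta>\<in>UNIV. theta d W 2 (%i. 2 * \<kappa> i - p i - subset_shift d \<eta> i) z * theta d W 2 (%i. p i + subset_shift d \<eta> i) x)"
proof -
 define f where "f x = theta d W 1 \<kappa> (x + z) * theta d W 1 (%i. p i - \<kappa> i) (x + - z)" for x
 define h where "h N = theta d W 2 (%i. 2 * \<kappa> i - N i) z * theta d W 2 N x" for N
 have f: "f \<in> V 2"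
  using shifted_product_mem[OF theta_mem[of 1 \<kappa>] theta_mem[of 1 "%i. p i - \<kappa> i"], of z] unfolding f_def
  by (simp add: numeral_2_eq_2)
 have "f x = (\<Sum>N\<in>residues d 2. coordinate 2 f N * theta d W 2 N x)" by (rule theta_expansion[OF _ f]) simp
 also have "\<dots> = (\<Sum>N\<in>residues d 2. if dcong d 1 N p then h N else 0)"
  unfolding f_def coordinate_product_1 by (intro sum.cong) (auto simp: h_def)
 also have "\<dots> = (\<Sum>\<eta>\<in>UNIV. h (%i. p i + subset_shift d \<eta> i))"
 proof (rule sum_residues_2)
  fix N N' assume NN: "dcong d 2 N N'"
  have "dcong d 2 (%i. 2 * \<kappa> i - N i) (%i. 2 * \<kappa> i - N' i)"
   using dcong_sym[OF NN] by (simp add: dcong_def)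
  thus "h N = h N'" by (simp add: h_def theta_cong[OF NN] theta_cong[of 2 "%i. 2 * \<kappa> i - N i"])
 qed
 finally show ?thesis by (simp add: f_def h_def algebra_simps)
qed

section \<open>Generation by sections of degree one\<close>

definition products :: "nat => (complex^'n => complex) set" where
 "products r = {%x. \<Sum>k\<in>K. f k x * g k x | (K :: nat set) f g. finite K \<and> (\<forall>k\<in>K. f k \<in> V 1 \<and> g k \<in> V r)}"

lemma theta_space_scale: "f \<in> V r ==> (%x. c * f x) \<in> V r"
 unfolding theta_space_def periodic_def entire_iff_slicewise
 by (auto intro!: vec.slicewise_mult)

lemma products_mult: "f \<in> V 1 ==> g \<in> V r ==> (%x. f x * g x) \<in> products r"
 unfolding products_def
 by (rule CollectI, rule exI[of _ "{0}"], rule exI[of _ "%_. f"], rule exI[of _ "%_. g"]) auto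

lemma products_scale: "f \<in> products r ==> (%x. c * f x) \<in> products r"
proof -
 assume "f \<in> products r"
 then obtain K :: "nat set" and g h where *: "f = (%x. \<Sum>k\<in>K. g k x * h k x)" "finite K" "\<forall>k\<in>K. g k \<in> V 1 \<and> h k \<in> V r"
  unfolding products_def by blast
 have "(%x. c * f x) = (%x. \<Sum>k\<in>K. (c * g k x) * h k x)"
  by (simp add: *(1) sum_distrib_left mult.assoc)
 thus ?thesis
  unfolding products_def using *(2,3) theta_space_scale[of _ 1 c]
  by (intro CollectI, rule_tac exI[of _ K], rule_tac exI[of _ "%k x. c * g k x"], rule_tac exI[of _ h]) auto
qed

lemma products_add:
 assumes "f \<in> products r" "g \<in> products r"
 shows "(%x. f x + g x) \<in> products r"
proof -
 obtain K1 :: "nat set" and f1 g1 where 1: "f = (%x. \<Sum>k\<in>K1. f1 k x * g1 k x)" "finite K1" "\<forall>k\<in>K1. f1 k \<in> V 1 \<and> g1 k \<in> V r"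
  using assms(1) unfolding products_def by blast
 obtain K2 :: "nat set" and f2 g2 where 2: "g = (%x. \<Sum>k\<in>K2. f2 k x * g2 k x)" "finite K2" "\<forall>k\<in>K2. f2 k \<in> V 1 \<and> g2 k \<in> V r"
  using assms(2) unfolding products_def by blast
 obtain m where m: "\<forall>k\<in>K1. k < m" using 1(2) finite_nat_set_iff_bounded by blast
 define K where "K = K1 \<union> (%k. m + k) ` K2"
 define f3 where "f3 k = (if k < m then f1 k else f2 (k - m))" for k
 define g3 where "g3 k = (if k < m then g1 k else g2 (k - m))" for k
 have "(\<Sum>k\<in>K. f3 k x * g3 k x) = f x + g x" for x
 proof -
  have "(\<Sum>k\<in>K. f3 k x * g3 k x) = (\<Sum>k\<in>K1. f3 k x * g3 k x) + (\<Sum>k\<in>(%k. m + k) ` K2. f3 k x * g3 k x)"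
   unfolding K_def using 1(2) 2(2) m by (intro sum.union_disjoint) auto
  also have "(\<Sum>k\<in>K1. f3 k x * g3 k x) = f x"
   unfolding 1(1) using m by (intro sum.cong) (auto simp: f3_def g3_def)
  also have "(\<Sum>k\<in>(%k. m + k) ` K2. f3 k x * g3 k x) = g x"
   unfolding 2(1) by (subst sum.reindex) (auto simp: f3_def g3_def)
  finally show ?thesis .
 qed
 hence "(%x. f x + g x) = (%x. \<Sum>k\<in>K. f3 k x * g3 k x)" by simp
 moreover have "finite K" using 1(2) 2(2) by (simp add: K_def)
 moreover have "\<forall>k\<in>K. f3 k \<in> V 1 \<and> g3 k \<in> V r"
  using 1(3) 2(3) m by (auto simp: K_def f3_def g3_def)
 ultimately show ?thesis unfolding products_def by blast
qed

lemma products_zero: "(%x. 0) \<in> products r"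
 unfolding products_def by (intro CollectI exI[of _ "{}"] exI) auto

lemma products_sum:
 assumes "\<And>i. i \<in> I ==> f i \<in> products r"
 shows "(%x. \<Sum>i\<in>I. f i x) \<in> products r"
 using assms by (induction I rule: infinite_finite_induct) (auto intro: products_zero products_add)

text \<open>For the 2^n choices of \<kappa> the addition formula is a square linear system for the
  theta functions of degree 2 at x; its determinant is the minor at z.\<close>

lemma theta_2_combination:
 assumes "minor d (%u. theta d W 2 u z) p \<kappa> ~= 0"
 obtains c where "\<And>x. theta d W 2 (%i. p i + subset_shift d \<eta> i) x =
   (\<Sum>\<eta>'\<in>UNIV. c \<eta>' * (theta d W 1 (\<kappa> \<eta>') (x + z) * theta d W 1 (%i. p i - \<kappa> \<eta>' i) (x + - z)))"
proof -
 define M :: "complex^('n set)^('n set)"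
  where "M = (\<chi> \<eta> \<eta>'. theta d W 2 (%i. 2 * \<kappa> \<eta> i - p i - subset_shift d \<eta>' i) z)"
 have "det M ~= 0" using assms by (simp add: minor_def M_def)
 hence "invertible M" by (simp add: invertible_det_nz)
 then obtain N where N: "N ** M = mat 1" by (auto simp: invertible_def)
 have "theta d W 2 (%i. p i + subset_shift d \<eta> i) x =
   (\<Sum>\<eta>'\<in>UNIV. N $ \<eta> $ \<eta>' * (theta d W 1 (\<kappa> \<eta>') (x + z) * theta d W 1 (%i. p i - \<kappa> \<eta>' i) (x + - z)))" for x
 proof -
  define t :: "complex^('n set)" where "t = (\<chi> \<eta>. theta d W 2 (%i. p i + subset_shift d \<eta> i) x)"
  define v :: "complex^('n set)" where "v = (\<chi> \<eta>'. theta d W 1 (\<kappa> \<eta>') (x + z) * theta d W 1 (%i. p i - \<kappa> \<eta>' i) (x + - z))"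
  have "v = M *v t"
   by (simp only: v_def M_def t_def vec_eq_iff matrix_vector_mult_def vec_lambda_beta addition_formula) simp
  hence "N *v v = t" by (simp add: matrix_vector_mul_assoc N)
  hence "t $ \<eta> = (N *v v) $ \<eta>" by simp
  thus ?thesis by (simp add: t_def v_def matrix_vector_mult_def)
 qed
 thus ?thesis using that by blast
qed

lemma minor_nonzero_near_0:
 assumes "minor d (%u. theta d W 2 u 0) p \<kappa> ~= 0"
 obtains \<delta> where "\<delta> > 0" "\<And>z. norm z < \<delta> ==> minor d (%u. theta d W 2 u z) p \<kappa> ~= 0"
proof -
 have "continuous_on UNIV (%z. minor d (%u. theta d W 2 u z) p \<kappa>)"
  unfolding minor_def det_def
  by (intro continuous_intros) (auto simp: theta_def intro!: entire_continuous entire_fser rapid_gauss)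
 hence "open {z. minor d (%u. theta d W 2 u z) p \<kappa> ~= 0}"
  by (intro open_Collect_neq continuous_on_const)
 then obtain \<delta> where "\<delta> > 0" "ball 0 \<delta> \<subseteq> {z. minor d (%u. theta d W 2 u z) p \<kappa> ~= 0}"
  by (rule openE[where x = 0]) (use assms in auto)
 thus ?thesis using that by (auto simp: subset_iff)
qed

text \<open>For r = 1 the addition formula is inverted at z = 0. For r >= 2 the degree is split as 2
  + b. For small z the factor of degree 2 becomes a combination of products of two factors of degree
  1, one of which does not depend on z, while the other joins the factor of degree b to form an
  element of V r. Varying z and the class P then isolates every theta function of degree r + 1,
  because the coordinates of these products are independent Fourier series in z.\<close>

theorem theta_space_generated:
 assumes good: "\<And>p. \<exists>\<kappa>. minor d (%u. theta d W 2 u 0) p \<kappa> ~= 0" and r: "r >= 1" and f: "f \<in> V (Suc r)"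
 shows "f \<in> products r"
proof -
 have theta_mem_products: "theta d W (Suc r) N \<in> products r" if N: "N \<in> residues d (Suc r)" for N
 proof (cases "r = 1")
  case True
  obtain \<kappa> where "minor d (%u. theta d W 2 u 0) N \<kappa> ~= 0" using good by blast
  from theta_2_combination[OF this, of "{}"] obtain c where
   "\<And>x. theta d W 2 (%i. N i + subset_shift d {} i) x =
   (\<Sum>\<eta>'\<in>UNIV. c \<eta>' * (theta d W 1 (\<kappa> \<eta>') (x + 0) * theta d W 1 (%i. N i - \<kappa> \<eta>' i) (x + - 0)))"
   by blast
  hence "theta d W 2 N = (%x. \<Sum>\<eta>'\<in>UNIV. c \<eta>' * (theta d W 1 (\<kappa> \<eta>') x * theta d W 1 (%i. N i - \<kappa> \<eta>' i) x))"
   by (simp add: subset_shift_def fun_eq_iff)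
  also have "\<dots> \<in> products r"
   unfolding True by (intro products_sum products_scale products_mult theta_mem) auto
  finally show ?thesis by (simp add: True numeral_2_eq_2)
 next
  case False
  hence r2: "r >= 2" using r by simp
  define b where "b = r - 1"
  have b: "b > 0" "2 + b = Suc r" "Suc b = r" using r2 by (simp_all add: b_def)
  obtain \<kappa> where \<kappa>: "minor d (%u. theta d W 2 u 0) (%_. 0) \<kappa> ~= 0" using good by blast
  obtain \<delta> where \<delta>: "\<delta> > 0" "\<And>z. norm z < \<delta> ==> minor d (%u. theta d W 2 u z) (%_. 0) \<kappa> ~= 0"
   using minor_nonzero_near_0[OF \<kappa>] by blast
  define H where "H P z x = theta d W 2 (%_. 0) (x + of_nat b *s z) * theta d W b P (x + (- of_nat 2) *s z)" for P z x
  have HV: "H P z \<in> V (Suc r)" for P z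
   using shifted_product_mem[OF theta_mem[of 2 "%_. 0"] theta_mem[OF b(1), of P], of z]
   unfolding H_def b(2) by simp
  have HP: "H P z \<in> products r" if z: "norm z < \<delta> / real b" for P z
  proof -
   \<comment> \<open>Chosen to cancel the shift in the first factor of degree 1; the second factor
     then carries the shift 2 b z.\<close>
   define y where "y = (- of_nat b) *s z"
   have "norm y < \<delta>" using z b(1) by (simp add: y_def norm_vector_scalar_mult pos_less_divide_eq mult.commute)
   from theta_2_combination[OF \<delta>(2)[OF this], of "{}"] obtain c where
    c: "\<And>x. theta d W 2 (%i. 0 + subset_shift d {} i) x =
    (\<Sum>\<eta>'\<in>UNIV. c \<eta>' * (theta d W 1 (\<kappa> \<eta>') (x + y) * theta d W 1 (%i. 0 - \<kappa> \<eta>' i) (x + - y)))"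
    by blast
   have 1: "theta d W 2 (%_. 0) (x + of_nat b *s z) = (\<Sum>\<eta>'\<in>UNIV. c \<eta>' * (theta d W 1 (\<kappa> \<eta>') x *
      theta d W 1 (%i. - \<kappa> \<eta>' i) (x + of_nat b *s (2 *s z))))" for x
   proof -
    have "x + of_nat b *s z + y = x" by (simp add: y_def)
    moreover have "x + of_nat b *s z + - y = x + of_nat b *s (2 *s z)"
     by (simp add: y_def vec_eq_iff algebra_simps)
    moreover have "(%i. 0 + subset_shift d {} i) = (%_. 0)" by (simp add: subset_shift_def)
    moreover have "(%i. 0 - \<kappa> \<eta>' i) = (%i. - \<kappa> \<eta>' i)" for \<eta>' by simp
    ultimately show ?thesis using c[of "x + of_nat b *s z"] by (simp only:)
   qed
   have "H P z = (%x. \<Sum>\<eta>'\<in>UNIV. c \<eta>' * (theta d W 1 (\<kappa> \<eta>') x *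
      (theta d W 1 (%i. - \<kappa> \<eta>' i) (x + of_nat b *s (2 *s z)) * theta d W b P (x + (- of_nat 1) *s (2 *s z)))))"
    unfolding H_def 1 by (simp add: sum_distrib_right mult.assoc vec.sc_sc)
   also have "\<dots> \<in> products r"
   proof (intro products_sum products_scale products_mult)
    fix \<eta>'
    show "(%x. theta d W 1 (%i. - \<kappa> \<eta>' i) (x + of_nat b *s (2 *s z)) * theta d W b P (x + (- of_nat 1) *s (2 *s z))) \<in> V r"
     using shifted_product_mem[OF theta_mem[of 1 "%i. - \<kappa> \<eta>' i"] theta_mem[OF b(1), of P], of "2 *s z"] b(3)
     by simp
   qed (simp add: theta_mem)
   finally show ?thesis .
  qed
  have coord: "coordinate (Suc r) (H P z) N = fser (product_coefficient 2 b (%_. 0) P N) z" for P z N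
   using coordinate_product[of 2 b "%_. 0" z P N] b(1,2) unfolding H_def by simp
  show ?thesis
  proof (rule independent_coefficients_span[where J = "residues d (Suc r)" and \<theta> = "theta d W (Suc r)" and j = N
     and Y = "UNIV \<times> ball 0 (\<delta> / real b)" and D = "%N (P, z). fser (product_coefficient 2 b (%_. 0) P N) z"])
   fix l P
   assume l: "\<And>y. y \<in> UNIV \<times> ball 0 (\<delta> / real b) ==>
     (\<Sum>N\<in>residues d (Suc r). l N * (case y of (P, z) => fser (product_coefficient 2 b (%_. 0) P N) z)) = 0"
    and P: "P \<in> residues d (Suc r)"
   define G where "G w = (\<Sum>N\<in>residues d (Suc r). l N * product_coefficient 2 b (%_. 0) P N w)" for w
   have pc: "rapid (product_coefficient 2 b (%_. 0) P N)" for N by (rule rapid_product_coefficient) (use b in auto)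
   have G: "rapid G" unfolding G_def by (intro rapid_sum pc)
   have "fser G z = (\<Sum>N\<in>residues d (Suc r). l N * fser (product_coefficient 2 b (%_. 0) P N) z)" for z
    unfolding G_def by (intro fser_sum pc) simp
   hence "fser G z = 0" if "norm z < \<delta> / real b" for z
    using l[of "(P, z)"] that by simp
   hence "fser G = (%_. 0)"
    using entire_zero_on_ball[OF entire_fser[OF G], of "\<delta> / real b"] \<delta>(1) b(1) by auto
   hence G0: "G w = 0" for w
    using fcoef_fser[OF G, of w] fcoef_const[of 0 w] by simp
   \<comment> \<open>The mode - 2 P occurs only for N = P, through u = 0: since u is divisible by 2
     D, any other solution would give N congruent to P modulo (r + 1) D. Its coefficient therefore
     isolates l P.\<close>
   define w where "w = (%i. - 2 * P i)"
   have "product_coefficient 2 b (%_. 0) P N w = (if N = P then expi (qf W w / (2 * of_nat (2 * b * (2 + b)))) else 0)"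
    if N: "N \<in> residues d (Suc r)" for N
   proof (cases "N = P")
    case True
    have "\<exists>u. w = (%i. int (2 + b) * u i - int 2 * N i) \<and> dcong d 2 u (%_. 0) \<and> dcong d b (%i. N i - u i) P"
     by (rule exI[of _ "%_. 0"]) (simp add: w_def True)
    thus ?thesis using True by (simp add: product_coefficient_def)
   next
    case False
    have "\<not> (w = (%i. int (2 + b) * u i - int 2 * N i) \<and> dcong d 2 u (%_. 0))" for u
    proof
     assume u: "w = (%i. int (2 + b) * u i - int 2 * N i) \<and> dcong d 2 u (%_. 0)"
     have "int (Suc r * d i) dvd N i - P i" for i
     proof -
      have "2 * int (d i) dvd u i" using u by (simp add: dcong_def)
      then obtain s where s: "u i = 2 * int (d i) * s" unfolding dvd_def by blast
      have "w i = int (2 + b) * u i - int 2 * N i" using u by metis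
      hence "2 * (N i - P i) = 2 * (int (Suc r * d i) * s)"
       by (simp add: w_def s b(2)[symmetric] algebra_simps)
      hence "N i - P i = int (Suc r * d i) * s" by simp
      thus ?thesis by (metis dvd_triv_left)
     qed
     hence "dcong d (Suc r) N P" by (simp add: dcong_def)
     thus False using residues_unique[OF N P] False by simp
    qed
    thus ?thesis using False by (auto simp: product_coefficient_def)
   qed
   hence "G w = (\<Sum>N\<in>residues d (Suc r). if N = P then l P * expi (qf W w / (2 * of_nat (2 * b * (2 + b)))) else 0)"
    unfolding G_def by (intro sum.cong) auto
   thus "l P = 0" using G0[of w] P by simp
  next
   fix y :: "('n => int) \<times> (complex^'n)" assume y: "y \<in> UNIV \<times> ball 0 (\<delta> / real b)"
   obtain P z where Pz: "y = (P, z)" by force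
   have "H P z = (%x. \<Sum>N\<in>residues d (Suc r). coordinate (Suc r) (H P z) N * theta d W (Suc r) N x)"
    using theta_expansion[OF _ HV] by blast
   thus "(%x. \<Sum>N\<in>residues d (Suc r). (case y of (P, z) => fser (product_coefficient 2 b (%_. 0) P N) z) * theta d W (Suc r) N x) \<in> products r"
    using HP[of z P] y by (simp add: Pz coord)
  qed (auto intro: products_add products_scale N)
 qed
 have "f = (%x. \<Sum>N\<in>residues d (Suc r). coordinate (Suc r) f N * theta d W (Suc r) N x)"
  using theta_expansion[OF _ f] by blast
 also have "\<dots> \<in> products r"
  by (intro products_sum products_scale theta_mem_products)
 finally show ?thesis .
qed

end

section \<open>Projective normality from theta functions\<close>

lemma multiply_in_H0:
 assumes "set_mset M \<subseteq> H0 \<Lambda> e"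
 shows "(%v. \<Prod>\<sigma>\<in>#M. \<sigma> v) \<in> H0 \<Lambda> (tensor_power e (size M))"
 using assms
proof (induction M)
 case empty
 thus ?case by (simp add: H0_def tensor_power_def entire_iff_slicewise)
next
 case (add \<sigma> M)
 hence "\<sigma> \<in> H0 \<Lambda> e" "(%v. \<Prod>\<sigma>\<in>#M. \<sigma> v) \<in> H0 \<Lambda> (tensor_power e (size M))" by auto
 thus ?case
  unfolding H0_def tensor_power_def entire_iff_slicewise
  by (auto intro!: vec.slicewise_mult)
qed

lemma H0_combination:
 assumes "\<And>i. i \<in> I ==> f i \<in> H0 \<Lambda> e"
 shows "(%v. \<Sum>i\<in>I. c i * f i v) \<in> H0 \<Lambda> e"
 using assms unfolding H0_def entire_iff_slicewise
 by (auto intro!: vec.slicewise_sum vec.slicewise_mult simp: sum_distrib_left algebra_simps)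

lemma multiply_sym_free_subset: "multiply ` sym_free r (H0 \<Lambda> e) \<subseteq> H0 \<Lambda> (tensor_power e r)"
proof
 fix f assume "f \<in> multiply ` sym_free r (H0 \<Lambda> e)"
 then obtain x where x: "x \<in> sym_free r (H0 \<Lambda> e)" "f = multiply x" by blast
 have "(%v. \<Sum>M\<in>Poly_Mapping.keys x. Poly_Mapping.lookup x M * (\<Prod>\<sigma>\<in>#M. \<sigma> v)) \<in> H0 \<Lambda> (tensor_power e r)"
 proof (rule H0_combination)
  fix M assume "M \<in> Poly_Mapping.keys x"
  hence "size M = r" "set_mset M \<subseteq> H0 \<Lambda> e" using x(1) by (auto simp: sym_free_def)
  thus "(%v. \<Prod>\<sigma>\<in>#M. \<sigma> v) \<in> H0 \<Lambda> (tensor_power e r)" using multiply_in_H0[of M \<Lambda> e] by simp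
 qed
 thus "f \<in> H0 \<Lambda> (tensor_power e r)" by (simp add: x multiply_def[abs_def])
qed

lemma sym_free_add: "x \<in> sym_free r S ==> y \<in> sym_free r S ==> x + y \<in> sym_free r S"
 using Poly_Mapping.keys_add[of x y] by (auto simp: sym_free_def)

lemma sym_free_zero: "0 \<in> sym_free r S"
 by (simp add: sym_free_def)

lemma sym_free_sum: "(\<And>i. i \<in> I ==> f i \<in> sym_free r S) ==> (\<Sum>i\<in>I. f i) \<in> sym_free r S"
 by (induction I rule: infinite_finite_induct) (auto intro: sym_free_add sym_free_zero)

lemma multiply_zero: "multiply 0 v = 0"
 by (simp add: multiply_def)

lemma multiply_sum: "multiply (\<Sum>i\<in>I. f i) v = (\<Sum>i\<in>I. multiply (f i) v)"
 by (induction I rule: infinite_finite_induct) (auto simp: multiply_add multiply_zero)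

lemma multiply_section:
 assumes x: "x \<in> sym_free r S" and \<sigma>: "\<sigma> \<in> S"
 obtains y where "y \<in> sym_free (Suc r) S" "\<And>v. multiply y v = \<sigma> v * multiply x v"
proof -
 define y where "y = (\<Sum>M\<in>Poly_Mapping.keys x. Poly_Mapping.single (add_mset \<sigma> M) (Poly_Mapping.lookup x M))"
 have "y \<in> sym_free (Suc r) S"
  unfolding y_def
 proof (rule sym_free_sum)
  fix M assume "M \<in> Poly_Mapping.keys x"
  thus "Poly_Mapping.single (add_mset \<sigma> M) (Poly_Mapping.lookup x M) \<in> sym_free (Suc r) S"
   using x \<sigma> by (auto simp: sym_free_def)
 qed
 moreover have "multiply y v = \<sigma> v * multiply x v" for v
  by (simp add: y_def multiply_sum multiply_single multiply_def[of x] sum_distrib_left mult_ac)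
 ultimately show ?thesis using that by blast
qed

text \<open>The normal form uses E and A independently of r, so the factorisation of theta functions
  of degree r + 1 into degrees 1 and r carries over to sections, and induction on r applies.\<close>

theorem projectively_normal_if_minors_nonzero:
 fixes a b :: "'n::finite => complex^'n"
 assumes full: "full_rank_lattice \<Lambda>" and F: "factor_of_automorphy \<Lambda> e"
  and sb: "symplectic_basis d \<Lambda> e a b" and Z: "Z \<in> siegel" and d: "\<And>i. 0 < d i"
  and aZ: "\<And>i. a i = (\<Sum>j\<in>UNIV. (Z $ j $ i / of_nat (d j)) *s b j)"
  and good: "\<And>p. \<exists>\<kappa>. minor d (%u. theta d (scaled d Z) 2 u 0) p \<kappa> ~= 0"
 shows "projectively_normal \<Lambda> e"
proof -
 interpret siegel_point d Z by unfold_locales (use d Z in auto)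
 obtain E A where EA: "\<And>v. E v ~= 0"
  "\<And>r. H0 \<Lambda> (tensor_power e r) = (%f v. E v ^ r * f (A v)) ` V r"
  using sections_normal_form[where d = d, OF full F sb Z _ aZ] d by blast
 have H1: "H0 \<Lambda> (tensor_power e 1) = H0 \<Lambda> e" by (simp add: tensor_power_def)
 have sup: "(%v. E v ^ r * f (A v)) \<in> multiply ` sym_free r (H0 \<Lambda> e)" if "r >= 1" "f \<in> V r" for r f
  using that
 proof (induction r arbitrary: f rule: dec_induct)
  case base
  define \<sigma> where "\<sigma> = (%v. E v ^ 1 * f (A v))"
  have "\<sigma> \<in> H0 \<Lambda> e" using base EA(2)[of 1] unfolding H1 by (auto simp: \<sigma>_def)
  hence "Poly_Mapping.single {#\<sigma>#} 1 \<in> sym_free 1 (H0 \<Lambda> e)" by (simp add: sym_free_def)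
  moreover have "\<sigma> = multiply (Poly_Mapping.single {#\<sigma>#} 1)" by (rule ext) (simp add: multiply_single)
  ultimately show ?case unfolding \<sigma>_def by blast
 next
  case (step r)
  have "f \<in> products r" by (rule theta_space_generated[OF good]) (use step in auto)
  then obtain K :: "nat set" and g h where f: "f = (%x. \<Sum>k\<in>K. g k x * h k x)" "finite K"
   and gh: "\<And>k. k \<in> K ==> g k \<in> V 1" "\<And>k. k \<in> K ==> h k \<in> V r"
   unfolding products_def by blast
  have "\<exists>y. y \<in> sym_free (Suc r) (H0 \<Lambda> e) \<and> (\<forall>v. multiply y v = (E v * g k (A v)) * (E v ^ r * h k (A v)))" if k: "k \<in> K" for k
  proof -
   obtain x where x: "x \<in> sym_free r (H0 \<Lambda> e)" "(%v. E v ^ r * h k (A v)) = multiply x"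
    using step.IH[OF gh(2)[OF k]] by blast
   have "(%v. E v * g k (A v)) \<in> H0 \<Lambda> e"
    using gh(1)[OF k] EA(2)[of 1] unfolding H1 by auto
   from multiply_section[OF x(1) this] obtain y where "y \<in> sym_free (Suc r) (H0 \<Lambda> e)"
    "\<And>v. multiply y v = (E v * g k (A v)) * multiply x v" by blast
   thus ?thesis unfolding x(2)[symmetric] by blast
  qed
  then obtain y where y: "\<And>k. k \<in> K ==> y k \<in> sym_free (Suc r) (H0 \<Lambda> e)"
   "\<And>k v. k \<in> K ==> multiply (y k) v = (E v * g k (A v)) * (E v ^ r * h k (A v))" by metis
  have "(%v. E v ^ Suc r * f (A v)) = multiply (\<Sum>k\<in>K. y k)"
   by (rule ext) (simp add: multiply_sum f(1) y(2) sum_distrib_left mult_ac)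
  moreover have "(\<Sum>k\<in>K. y k) \<in> sym_free (Suc r) (H0 \<Lambda> e)" by (rule sym_free_sum) (rule y(1))
  ultimately show ?case by blast
 qed
 show ?thesis
  unfolding projectively_normal_def range_multiplication_map
 proof (intro allI impI equalityI multiply_sym_free_subset)
  fix r :: nat assume "r >= 1"
  thus "H0 \<Lambda> (tensor_power e r) \<subseteq> multiply ` sym_free r (H0 \<Lambda> e)"
   unfolding EA(2) by (intro image_subsetI sup)
 qed
qed

section \<open>The theta function of one variable\<close>

text \<open>Jacobi's theta function. An inversion generator acts on one coordinate at a time, so the
  transformation law is needed in one variable only; this function is the case n = 1, d = 1 of
  \<open>theta\<close>.\<close>

definition jtheta :: "complex => complex => complex" where
 "jtheta \<tau> x = (\<Sum>\<^sub>\<infinity>k::int. expi ((of_int k)\<^sup>2 * \<tau> / 2 + of_int k * x))"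

interpretation cplx: complex_scaling "(*) :: complex => complex => complex"
 by unfold_locales (simp_all add: algebra_simps norm_mult scaleR_conv_of_real)

lemma slicewise_iff_holomorphic_on:
 assumes "open S"
 shows "slicewise_holomorphic (*) S f \<longleftrightarrow> f holomorphic_on S"
proof
 assume "slicewise_holomorphic (*) S f"
 hence "(%t. f (0 + t * 1)) holomorphic_on S"
  by (rule cplx.slice_holomorphic_on[OF assms]) auto
 thus "f holomorphic_on S" by simp
next
 assume f: "f holomorphic_on S"
 have "(%t. f (x + t * u)) field_differentiable at 0" if "x \<in> S" for x u
 proof -
  have "(f \<circ> (%t. x + t * u)) field_differentiable at 0"
   using f that assms by (intro field_differentiable_compose derivative_intros) (auto simp: holomorphic_on_open field_differentiable_def)
  thus ?thesis by (simp add: o_def)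
 qed
 thus "slicewise_holomorphic (*) S f"
  using f by (simp add: slicewise_holomorphic_def holomorphic_on_imp_continuous_on)
qed

lemma norm_jtheta_term_le:
 assumes b: "0 < b" "b <= Im \<tau>" and X: "cmod x <= X"
 shows "cmod (expi ((of_int k)\<^sup>2 * \<tau> / 2 + of_int k * x))
   <= exp ((2 * pi * X + 1)\<^sup>2 / (4 * pi * b)) * exp (- \<bar>real_of_int k\<bar>)"
proof -
 define t where "t = \<bar>real_of_int k\<bar>"
 have 1: "- (real_of_int k * Im x) <= t * X"
 proof -
  have "\<bar>real_of_int k * Im x\<bar> <= t * X"
   unfolding t_def abs_mult using abs_Im_le_cmod[of x] X by (intro mult_left_mono) auto
  thus ?thesis by linarith
 qed
 have 2: "t\<^sup>2 * b <= (real_of_int k)\<^sup>2 * Im \<tau>"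
  unfolding t_def power2_abs using b by (intro mult_left_mono) auto
 have "0 <= (2 * pi * b * t - (2 * pi * X + 1))\<^sup>2 / (4 * pi * b)"
  using b by (intro divide_nonneg_nonneg) auto
 also have "\<dots> = pi * b * t\<^sup>2 - (2 * pi * X + 1) * t + (2 * pi * X + 1)\<^sup>2 / (4 * pi * b)"
  using b by (simp add: field_simps power2_eq_square)
 finally have 3: "0 <= pi * b * t\<^sup>2 - (2 * pi * X + 1) * t + (2 * pi * X + 1)\<^sup>2 / (4 * pi * b)" .
 have "Im ((of_int k)\<^sup>2 * \<tau> / 2 + of_int k * x) = (real_of_int k)\<^sup>2 * Im \<tau> / 2 + real_of_int k * Im x"
  by (simp flip: of_int_power)
 hence "- (2 * pi * Im ((of_int k)\<^sup>2 * \<tau> / 2 + of_int k * x)) =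
   pi * (2 * (- (real_of_int k * Im x)) - (real_of_int k)\<^sup>2 * Im \<tau>)"
  by (simp add: algebra_simps)
 also have "\<dots> <= pi * (2 * (t * X) - t\<^sup>2 * b)"
  using 1 2 by (intro mult_left_mono) auto
 also have "\<dots> <= (2 * pi * X + 1)\<^sup>2 / (4 * pi * b) - t"
  using 3 by (simp add: algebra_simps)
 finally show ?thesis
  by (simp add: norm_expi t_def flip: exp_add)
qed

lemma jtheta_summable:
 assumes "Im \<tau> > 0"
 shows "(%k::int. norm (expi ((of_int k)\<^sup>2 * \<tau> / 2 + of_int k * x))) summable_on UNIV"
 by (rule summable_on_comparison_test[OF summable_on_cmult_right[OF summable_exp_abs]])
   (use norm_jtheta_term_le[OF assms order.refl order.refl] in auto)

lemma jtheta_holomorphic: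
 assumes A: "open A" and a: "a holomorphic_on A" and x: "x holomorphic_on A"
  and pos: "\<And>t. t \<in> A ==> 0 < Im (a t)"
 shows "(%t. jtheta (a t) (x t)) holomorphic_on A"
 unfolding jtheta_def slicewise_iff_holomorphic_on[OF A, symmetric]
proof (rule cplx.slicewise_infsum[OF A])
 show "slicewise_holomorphic (*) A (%t. expi ((of_int k)\<^sup>2 * a t / 2 + of_int k * x t))" for k :: int
  unfolding slicewise_iff_holomorphic_on[OF A] by (intro holomorphic_intros a x) auto
 fix t assume t: "t \<in> A"
 define b where "b = Im (a t) / 2"
 have b: "b > 0" using pos[OF t] by (simp add: b_def)
 define U where "U = {s \<in> A. b < Im (a s) \<and> cmod (x s) < cmod (x t) + 1}"
 have "open (A \<inter> (%s. (Im (a s), cmod (x s))) -` ({b<..} \<times> {..<cmod (x t) + 1}))"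
  using a x A by (intro continuous_open_preimage continuous_intros holomorphic_on_imp_continuous_on) (auto intro: open_Times)
 moreover have "A \<inter> (%s. (Im (a s), cmod (x s))) -` ({b<..} \<times> {..<cmod (x t) + 1}) = U"
  by (auto simp: U_def)
 ultimately have "open U" by simp
 moreover have "t \<in> U" using t b by (simp add: U_def b_def)
 moreover have "(%k::int. exp ((2 * pi * (cmod (x t) + 1) + 1)\<^sup>2 / (4 * pi * b)) * exp (- \<bar>real_of_int k\<bar>)) summable_on UNIV"
  by (rule summable_on_cmult_right[OF summable_exp_abs])
 moreover have "\<forall>s\<in>U \<inter> A. \<forall>k\<in>UNIV. cmod (expi ((of_int k)\<^sup>2 * a s / 2 + of_int k * x s))
   <= exp ((2 * pi * (cmod (x t) + 1) + 1)\<^sup>2 / (4 * pi * b)) * exp (- \<bar>real_of_int k\<bar>)"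
  using b by (intro ballI norm_jtheta_term_le) (auto simp: U_def)
 ultimately show "\<exists>U M. open U \<and> t \<in> U \<and> M summable_on (UNIV :: int set) \<and>
   (\<forall>s\<in>U \<inter> A. \<forall>k\<in>UNIV. cmod (expi ((of_int k)\<^sup>2 * a s / 2 + of_int k * x s)) <= M k)"
  by blast
qed

lemma infsum_int_residues:
 fixes h :: "int => complex"
 assumes N: "N > 0" and h: "(%k. norm (h k)) summable_on UNIV"
 shows "(\<Sum>\<^sub>\<infinity>k. h k) = (\<Sum>r\<in>{0..<N}. \<Sum>\<^sub>\<infinity>s. h (N * s + r))"
  and "(%s. norm (h (N * s + r))) summable_on UNIV"
proof -
 have bij: "bij_betw (%(r, s). N * s + r) ({0..<N} \<times> UNIV) UNIV"
  using N by (intro bij_betwI[where g = "%k. (k mod N, k div N)"]) auto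
 have "(%k. norm (h k)) summable_on ((%s. N * s + r) ` UNIV)"
  using summable_on_subset_banach[OF h] by blast
 moreover have "inj (%s. N * s + r)" using N by (simp add: inj_on_def)
 ultimately show "(%s. norm (h (N * s + r))) summable_on UNIV"
  by (simp add: summable_on_reindex o_def)
 have "h summable_on UNIV" using h by (rule abs_summable_summable)
 hence hs: "(%(r, s). h (N * s + r)) summable_on {0..<N} \<times> UNIV"
  using summable_on_reindex_bij_betw[OF bij, of h] by (simp add: case_prod_unfold)
 have "(\<Sum>\<^sub>\<infinity>k. h k) = (\<Sum>\<^sub>\<infinity>(r, s)\<in>{0..<N} \<times> UNIV. h (N * s + r))"
  using infsum_reindex_bij_betw[OF bij, of h] by (simp add: case_prod_unfold)
 also have "\<dots> = (\<Sum>\<^sub>\<infinity>r\<in>{0..<N}. \<Sum>\<^sub>\<infinity>s. h (N * s + r))"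
  using infsum_Sigma'_banach[of "%r s. h (N * s + r)" "{0..<N}" "%_. UNIV"] hs by simp
 finally show "(\<Sum>\<^sub>\<infinity>k. h k) = (\<Sum>r\<in>{0..<N}. \<Sum>\<^sub>\<infinity>s. h (N * s + r))" by simp
qed

lemma scalar_matrix_siegel: "Im \<tau> > 0 ==> (\<chi> i j. \<tau> :: complex^1^1) \<in> siegel"
 by (simp add: siegel_def transpose_def vec_eq_iff inner_vec_def matrix_vector_mult_def sum_1 forall_1 power2_eq_square)
   (metis mult.assoc mult.commute mult_pos_pos not_real_square_gt_zero)

lemma theta_1_eq_jtheta:
 "theta (%_. 1) (scaled (%_. 1) (\<chi> i j. \<tau> :: complex^1^1)) 1 (%_. 0) x = jtheta \<tau> (x $ 1)"
proof -
 have bij: "bij_betw (%u :: 1 => int. u 1) UNIV UNIV"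
  by (rule bij_betwI[where g = "%k _. k"]) (auto simp: fun_eq_iff forall_1)
 have "gauss (%_. 1) (scaled (%_. 1) (\<chi> i j. \<tau> :: complex^1^1)) 1 (%_. 0) u * mode u x =
   expi ((of_int (u 1))\<^sup>2 * \<tau> / 2 + of_int (u 1) * x $ 1)" for u
  by (simp add: gauss_def dcong_def qf_def scaled_def mode_def sum_1 expi_add power2_eq_square mult_ac)
 thus ?thesis
  using infsum_reindex_bij_betw[OF bij, of "%k. expi ((of_int k)\<^sup>2 * \<tau> / 2 + of_int k * x $ 1)"]
  by (simp add: theta_def fser_def jtheta_def)
qed

lemma jtheta_shift_1: "jtheta \<tau> (x + 1) = jtheta \<tau> x"
 by (simp add: jtheta_def distrib_left expi_add)

lemma jtheta_shift_tau: "expi (x + \<tau> / 2) * jtheta \<tau> (x + \<tau>) = jtheta \<tau> x"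
proof -
 have bij: "bij_betw (%k::int. k + 1) UNIV UNIV"
  by (rule bij_betwI[where g = "%k. k - 1"]) auto
 have "expi (x + \<tau> / 2) * jtheta \<tau> (x + \<tau>)
   = (\<Sum>\<^sub>\<infinity>k::int. expi ((of_int (k + 1))\<^sup>2 * \<tau> / 2 + of_int (k + 1) * x))"
  unfolding jtheta_def infsum_cmult_right'[symmetric]
  by (rule infsum_cong) (simp add: power2_eq_square algebra_simps add_divide_distrib flip: expi_add)
 also have "\<dots> = jtheta \<tau> x"
  unfolding jtheta_def by (rule infsum_reindex_bij_betw[OF bij])
 finally show ?thesis .
qed

lemma jtheta_neg: "jtheta \<tau> (- x) = jtheta \<tau> x"
proof -
 have bij: "bij_betw (%k::int. - k) UNIV UNIV"
  by (rule bij_betwI[where g = "%k. - k"]) auto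
 show ?thesis
  using infsum_reindex_bij_betw[OF bij, of "%k. expi ((of_int k)\<^sup>2 * \<tau> / 2 + of_int k * x)"]
  by (simp add: jtheta_def)
qed

lemma jtheta_nonzero:
 assumes "Im \<tau> > 0"
 obtains x where "jtheta \<tau> x ~= 0"
proof -
 interpret siegel_point "%_. 1" "\<chi> i j. \<tau> :: complex^1^1"
  by unfold_locales (use scalar_matrix_siegel[OF assms] in auto)
 have "fcoef (theta (%_. 1) W 1 (%_. 0)) (%_. 0) = gauss (%_. 1) W 1 (%_. 0) (%_. 0)"
  unfolding theta_def by (rule fcoef_fser[OF rapid_gauss]) simp
 also have "\<dots> = 1" by (simp add: gauss_def qf_def)
 finally have "theta (%_. 1) W 1 (%_. 0) ~= (%_. 0)"
  using fcoef_cmult[of 0 "%_ :: complex^1. 0" "%_. 0"] by (metis mult_zero_left zero_neq_one)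
 thus ?thesis using that by (metis theta_1_eq_jtheta)
qed

text \<open>Both sides of the inversion formula span the one-dimensional space \<^term>\<open>theta_space (%_. 1) Z 1\<close> for \<open>Z = -1/\<tau>\<close>.\<close>

lemma jtheta_inversion_proportional:
 assumes \<tau>: "Im \<tau> > 0"
 shows "\<exists>s. \<forall>x. expi (\<tau> * x\<^sup>2 / 2) * jtheta \<tau> (\<tau> * x) = s * jtheta (- 1 / \<tau>) x"
proof -
 define Z :: "complex^1^1" where "Z = (\<chi> i j. - 1 / \<tau>)"
 have t0: "\<tau> ~= 0" using \<tau> by auto
 have "Im (- 1 / \<tau>) > 0" using \<tau> by (simp add: Im_divide sum_power2_gt_zero_iff zero_less_divide_iff t0)
 then interpret siegel_point "%_. 1" Z
  by unfold_locales (use scalar_matrix_siegel in \<open>auto simp: Z_def\<close>)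
 interpret T: siegel_point "%_. 1" "\<chi> i j. \<tau> :: complex^1^1"
  by unfold_locales (use scalar_matrix_siegel[OF \<tau>] in auto)
 define f :: "complex^1 => complex" where "f x = expi (\<tau> * (x $ 1)\<^sup>2 / 2) * jtheta \<tau> (\<tau> * x $ 1)" for x
 have "f \<in> V 1"
  unfolding theta_space_def mem_Collect_eq
 proof (intro conjI allI)
  have "entire (theta (%_. 1) T.W 1 (%_. 0))" using T.theta_mem[of 1 "%_. 0"] by (simp add: theta_space_def)
  hence "slicewise_holomorphic (*s) UNIV (%x. theta (%_. 1) T.W 1 (%_. 0) (\<tau> *s x))"
   unfolding entire_iff_slicewise
   by (rule slicewise_affine_compose[where \<psi> = "%u. \<tau> *s u"])
     (auto simp: vec_eq_iff algebra_simps vector_scalar_mult_def intro!: continuous_intros)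
  hence "entire (%x :: complex^1. jtheta \<tau> ((\<tau> *s x) $ 1))"
   unfolding entire_iff_slicewise theta_1_eq_jtheta .
  thus "entire f"
   unfolding f_def[abs_def] divide_inverse power2_eq_square entire_iff_slicewise expi_def
   by (intro vec.slicewise_intros slicewise_nth) auto
  have "f (x + axis 1 1) = f x" for x
  proof -
   have e: "expi (\<tau> * (x $ 1 + 1)\<^sup>2 / 2) = expi (\<tau> * (x $ 1)\<^sup>2 / 2) * expi (\<tau> * x $ 1 + \<tau> / 2)"
    by (simp flip: expi_add add: power2_eq_square algebra_simps add_divide_distrib)
   show ?thesis
    using jtheta_shift_tau[of "\<tau> * x $ 1" \<tau>] by (simp add: f_def axis_def e distrib_left)
  qed
  thus "periodic f" by (simp add: periodic_def forall_1)
  fix j :: 1 and x :: "complex^1"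
  have j: "j = 1" by (rule num1_eq1)
  have "\<tau> * (x $ 1 - 1 / \<tau>)\<^sup>2 / 2 = - (x $ 1 + (- 1 / \<tau>) / 2) + \<tau> * (x $ 1)\<^sup>2 / 2"
   using t0 by (simp add: power2_eq_square field_simps)
  hence e: "expi (\<tau> * (x $ 1 - 1 / \<tau>)\<^sup>2 / 2) = expi (- (x $ 1 + (- 1 / \<tau>) / 2)) * expi (\<tau> * (x $ 1)\<^sup>2 / 2)"
   by (simp only: expi_add)
  have m: "\<tau> * (x $ 1 - 1 / \<tau>) = \<tau> * x $ 1 - 1" using t0 by (simp add: field_simps)
  have "jtheta \<tau> (\<tau> * x $ 1 - 1) = jtheta \<tau> (\<tau> * x $ 1)" using jtheta_shift_1[of \<tau> "\<tau> * x $ 1 - 1"] by simp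
  moreover have "(x + tau (%_. 1) Z j) $ 1 = x $ 1 - 1 / \<tau>" by (simp add: tau_def Z_def)
  moreover have "of_nat 1 * (of_nat 1 * x $ j + Z $ j $ j / 2) = x $ 1 + (- 1 / \<tau>) / 2" by (simp add: Z_def j)
  ultimately show "f (x + tau (%_. 1) Z j) = expi (- (of_nat 1 * (of_nat 1 * x $ j + Z $ j $ j / 2))) * f x"
   by (simp only: f_def e m mult.assoc)
 qed
 moreover have "residues (%_::1. 1) 1 = {%_. 0}"
  by (auto simp: residues_def PiE_iff fun_eq_iff forall_1 extensional_def)
 ultimately have "f x = coordinate 1 f (%_. 0) * theta (%_. 1) W 1 (%_. 0) x" for x
  using theta_expansion[of 1 f x] by simp
 hence "f x = coordinate 1 f (%_. 0) * jtheta (- 1 / \<tau>) (x $ 1)" for x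
  unfolding Z_def theta_1_eq_jtheta .
 from this[of "\<chi> i. y" for y] show ?thesis by (auto simp: f_def)
qed

section \<open>The inversion factor of Jacobi's theta function\<close>

lemma jtheta_complete_square:
 "expi (\<tau> * x\<^sup>2 / 2) * jtheta \<tau> (\<tau> * x) = (\<Sum>\<^sub>\<infinity>t::int. expi (\<tau> * (x + of_int t)\<^sup>2 / 2))"
 unfolding jtheta_def infsum_cmult_right'[symmetric]
 by (rule infsum_cong) (simp add: power2_eq_square algebra_simps add_divide_distrib flip: expi_add)

text \<open>Up to sign the square root of \<i> / \<tau>; no branch is fixed, and only its square is
  computed.\<close>

definition jfactor :: "complex => complex" where
 "jfactor \<tau> = (SOME s. \<forall>x. expi (\<tau> * x\<^sup>2 / 2) * jtheta \<tau> (\<tau> * x) = s * jtheta (- 1 / \<tau>) x)"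

lemma jtheta_inversion:
 assumes "Im \<tau> > 0"
 shows "expi (\<tau> * x\<^sup>2 / 2) * jtheta \<tau> (\<tau> * x) = jfactor \<tau> * jtheta (- 1 / \<tau>) x"
 using someI_ex[OF jtheta_inversion_proportional[OF assms]] unfolding jfactor_def by blast

lemma Im_minus_inverse:
 assumes "Im \<tau> > 0"
 shows "Im (- 1 / \<tau>) > 0" "\<tau> ~= 0"
proof -
 show t0: "\<tau> ~= 0" using assms by auto
 show "Im (- 1 / \<tau>) > 0" using assms by (simp add: Im_divide sum_power2_gt_zero_iff zero_less_divide_iff t0)
qed

lemma jfactor_unique:
 assumes "Im \<tau> > 0" and s: "\<And>x. expi (\<tau> * x\<^sup>2 / 2) * jtheta \<tau> (\<tau> * x) = s * jtheta (- 1 / \<tau>) x"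
 shows "jfactor \<tau> = s"
proof -
 obtain x where "jtheta (- 1 / \<tau>) x ~= 0" using jtheta_nonzero[OF Im_minus_inverse(1)[OF assms(1)]] by blast
 thus ?thesis using s[of x] jtheta_inversion[OF assms(1), of x] by simp
qed

text \<open>Near any point it is a quotient of theta functions, for an x at which the denominator
  does not vanish.\<close>

lemma jfactor_holomorphic: "jfactor holomorphic_on {\<tau>. Im \<tau> > 0}"
 unfolding holomorphic_on_def
proof (rule ballI, rule field_differentiable_at_within)
 fix \<tau>0 assume t: "\<tau>0 \<in> {\<tau>. Im \<tau> > 0}"
 have "Im (- 1 / \<tau>0) > 0" by (rule Im_minus_inverse) (use t in simp)
 then obtain x where x: "jtheta (- 1 / \<tau>0) x ~= 0" using jtheta_nonzero by blast
 define H where "H = {\<tau>. Im \<tau> > 0}"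
 have H: "open H" by (simp add: H_def open_halfspace_Im_gt)
 have n: "(%\<tau>. expi (\<tau> * x\<^sup>2 / 2) * jtheta \<tau> (\<tau> * x)) holomorphic_on H"
  by (intro holomorphic_intros jtheta_holomorphic H) (auto simp: H_def)
 have dn: "(%\<tau>. jtheta (- 1 / \<tau>) x) holomorphic_on H"
  by (intro jtheta_holomorphic holomorphic_intros H) (use Im_minus_inverse in \<open>auto simp: H_def\<close>)
 define U where "U = H \<inter> (%\<tau>. jtheta (- 1 / \<tau>) x) -` (- {0})"
 have U: "open U" unfolding U_def
  by (intro continuous_open_preimage holomorphic_on_imp_continuous_on dn H) auto
 have "(%\<tau>. expi (\<tau> * x\<^sup>2 / 2) * jtheta \<tau> (\<tau> * x) / jtheta (- 1 / \<tau>) x) holomorphic_on U"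
  by (intro holomorphic_on_divide holomorphic_on_subset[OF n] holomorphic_on_subset[OF dn]) (auto simp: U_def)
 hence "jfactor holomorphic_on U"
  by (rule holomorphic_transform) (use jtheta_inversion in \<open>auto simp: U_def H_def field_simps\<close>)
 thus "jfactor field_differentiable at \<tau>0"
  using U t x by (auto simp: U_def H_def elim: holomorphic_on_imp_differentiable_at)
qed

text \<open>Inverting twice returns to \<tau> with - x in place of x, and \<open>jtheta\<close> is
  even.\<close>

lemma jfactor_inverse:
 assumes "Im \<tau> > 0"
 shows "jfactor \<tau> * jfactor (- 1 / \<tau>) = 1"
proof -
 note t0 = Im_minus_inverse[OF assms]
 obtain x where x: "jtheta \<tau> x ~= 0" using jtheta_nonzero[OF assms] by blast
 define y where "y = x / \<tau>"
 have 1: "expi (\<tau> * y\<^sup>2 / 2) * jtheta \<tau> x = jfactor \<tau> * jtheta (- 1 / \<tau>) y"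
  using jtheta_inversion[OF assms, of y] t0 by (simp add: y_def)
 have "expi (- 1 / \<tau> * x\<^sup>2 / 2) * jtheta (- 1 / \<tau>) (- y) = jfactor (- 1 / \<tau>) * jtheta \<tau> x"
  using jtheta_inversion[OF t0(1), of x] t0 by (simp add: y_def)
 hence 2: "jtheta (- 1 / \<tau>) y = expi (1 / \<tau> * x\<^sup>2 / 2) * (jfactor (- 1 / \<tau>) * jtheta \<tau> x)"
  by (simp add: jtheta_neg expi_minus field_simps)
 have 3: "\<tau> * y\<^sup>2 / 2 = 1 / \<tau> * x\<^sup>2 / 2" using t0 by (simp add: y_def power2_eq_square)
 show ?thesis using 1 x unfolding 2 3 by simp
qed

lemma sum_expi_div:
 assumes N: "N > 0"
 shows "(\<Sum>r\<in>{0..<N}. expi (of_int k * of_int r / of_int N)) = (if N dvd k then of_int N else 0)"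
proof (cases "N dvd k")
 case True
 hence "of_int k * of_int r / of_int N = (of_int (k div N * r) :: complex)" for r
  using N by (auto elim!: dvdE)
 thus ?thesis using True N by (simp del: of_int_mult)
next
 case False
 define z where "z = expi (of_int k / of_int N)"
 have "z ~= 1"
 proof
  assume "z = 1"
  then obtain m where "of_int k / of_int N = (of_int m :: complex)" by (auto simp: z_def expi_eq_1_iff elim: Ints_cases)
  hence "(of_int k :: complex) = of_int (m * N)" using N by (simp add: field_simps)
  hence "k = m * N" unfolding of_int_eq_iff .
  thus False using False by simp
 qed
 have "(\<Sum>r\<in>{0..<N}. expi (of_int k * of_int r / of_int N)) = (\<Sum>r<nat N. z ^ r)"
  by (rule sum.reindex_bij_witness[where i = int and j = nat]) (auto simp: z_def expi_power mult_ac)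
 also have "z ^ nat N = 1" using N by (simp add: z_def expi_power)
 hence "(\<Sum>r<nat N. z ^ r) = 0" using \<open>z ~= 1\<close> by (simp add: geometric_sum)
 finally show ?thesis using False by simp
qed

text \<open>Summing over r modulo N retains only the terms with k divisible by N.\<close>

lemma jtheta_distribution:
 assumes \<tau>: "Im \<tau> > 0" and N: "N > 0"
 shows "(\<Sum>r\<in>{0..<N}. jtheta \<tau> ((of_int r + x) / of_int N)) = of_int N * jtheta (of_int N ^ 2 * \<tau>) x"
proof -
 define h where "h y k = expi ((of_int k)\<^sup>2 * \<tau> / 2 + of_int k * y)" for y and k :: int
 have s: "(%k. norm (h y k)) summable_on UNIV" for y
  using jtheta_summable[OF \<tau>, of y] by (simp add: h_def)
 have inner: "(\<Sum>r\<in>{0..<N}. h ((of_int r + x) / of_int N) k) = (if N dvd k then of_int N * h (x / of_int N) k else 0)" for k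
 proof -
  have "h ((of_int r + x) / of_int N) k = h (x / of_int N) k * expi (of_int k * of_int r / of_int N)" for r
   by (simp add: h_def add_divide_distrib distrib_left expi_add)
  hence "(\<Sum>r\<in>{0..<N}. h ((of_int r + x) / of_int N) k) = h (x / of_int N) k * (\<Sum>r\<in>{0..<N}. expi (of_int k * of_int r / of_int N))"
   by (simp add: sum_distrib_left)
  also have "(\<Sum>r\<in>{0..<N}. expi (of_int k * of_int r / of_int N)) = (if N dvd k then of_int N else 0)"
   by (rule sum_expi_div[OF N])
  finally show ?thesis by simp
 qed
 have "(\<Sum>r\<in>{0..<N}. jtheta \<tau> ((of_int r + x) / of_int N)) = (\<Sum>\<^sub>\<infinity>k. \<Sum>r\<in>{0..<N}. h ((of_int r + x) / of_int N) k)"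
  unfolding jtheta_def h_def[symmetric]
  by (rule infsumI[symmetric], rule has_sum_finite_sum) (use s in \<open>auto intro: abs_summable_summable has_sum_infsum\<close>)
 also have "\<dots> = (\<Sum>\<^sub>\<infinity>k. if N dvd k then of_int N * h (x / of_int N) k else 0)"
  unfolding inner ..
 also have "\<dots> = (\<Sum>\<^sub>\<infinity>k\<in>range (%s. N * s). of_int N * h (x / of_int N) k)"
  by (rule infsum_cong_neutral) (auto elim: dvdE)
 also have "\<dots> = (\<Sum>\<^sub>\<infinity>s. of_int N * h (x / of_int N) (N * s))"
  using N by (subst infsum_reindex) (auto simp: inj_on_def o_def)
 also have "\<dots> = of_int N * jtheta (of_int N ^ 2 * \<tau>) x"
  unfolding jtheta_def infsum_cmult_right'[symmetric]
  by (rule infsum_cong) (use N in \<open>simp add: h_def power_mult_distrib mult_ac\<close>)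
 finally show ?thesis .
qed

text \<open>In the completed-square form the sum over t splits into classes modulo N, and each class
  is a series for \<tau> itself. Inverting each class and recombining by the distribution relation
  gives the inverted series with the extra factor N.\<close>

lemma jfactor_scale:
 assumes \<tau>: "Im \<tau> > 0" and N: "N > 0"
 shows "jfactor (\<tau> / of_int N ^ 2) = of_int N * jfactor \<tau>"
proof (rule jfactor_unique)
 note t0 = Im_minus_inverse[OF \<tau>]
 have Ne: "Im (\<tau> / of_int N ^ 2) = Im \<tau> / (real_of_int N)\<^sup>2"
  using Im_divide_of_real[of \<tau> "(real_of_int N)\<^sup>2"] by simp
 thus *: "Im (\<tau> / of_int N ^ 2) > 0" using \<tau> N by simp
 fix x
 define h where "h t = expi (\<tau> / of_int N ^ 2 * (x + of_int t)\<^sup>2 / 2)" for t :: int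
 have "(%t. norm (expi (\<tau> / of_int N ^ 2 * x\<^sup>2 / 2) * expi ((of_int t)\<^sup>2 * (\<tau> / of_int N ^ 2) / 2 + of_int t * (\<tau> / of_int N ^ 2 * x)))) summable_on UNIV"
  unfolding norm_mult by (rule summable_on_cmult_right[OF jtheta_summable[OF *]])
 also have "(%t. expi (\<tau> / of_int N ^ 2 * x\<^sup>2 / 2) * expi ((of_int t)\<^sup>2 * (\<tau> / of_int N ^ 2) / 2 + of_int t * (\<tau> / of_int N ^ 2 * x))) = h"
  by (auto simp: h_def power2_eq_square algebra_simps add_divide_distrib simp flip: expi_add)
 finally have s: "(%t. norm (h t)) summable_on UNIV" .
 have "expi (\<tau> / of_int N ^ 2 * x\<^sup>2 / 2) * jtheta (\<tau> / of_int N ^ 2) (\<tau> / of_int N ^ 2 * x) = (\<Sum>\<^sub>\<infinity>t. h t)"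
  unfolding jtheta_complete_square h_def ..
 also have "\<dots> = (\<Sum>r\<in>{0..<N}. \<Sum>\<^sub>\<infinity>s. h (N * s + r))"
  by (rule infsum_int_residues(1)[OF N s])
 also have "\<dots> = (\<Sum>r\<in>{0..<N}. jfactor \<tau> * jtheta (- 1 / \<tau>) ((of_int r + x) / of_int N))"
  unfolding jtheta_inversion[OF \<tau>, symmetric] jtheta_complete_square h_def
  by (intro sum.cong refl infsum_cong arg_cong[where f = expi]) (use N in \<open>simp add: field_simps power2_eq_square\<close>)
 also have "\<dots> = jfactor \<tau> * (of_int N * jtheta (of_int N ^ 2 * (- 1 / \<tau>)) x)"
  unfolding jtheta_distribution[OF t0(1) N, symmetric] by (simp add: sum_distrib_left)
 finally show "expi (\<tau> / of_int N ^ 2 * x\<^sup>2 / 2) * jtheta (\<tau> / of_int N ^ 2) (\<tau> / of_int N ^ 2 * x) =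
   of_int N * jfactor \<tau> * jtheta (- 1 / (\<tau> / of_int N ^ 2)) x"
  by (simp add: mult_ac)
qed

text \<open>The function \<open>\<tau> \<mapsto> (jfactor \<tau>)\<^sup>2 \<tau>\<close> is invariant under \<open>\<tau> \<mapsto> (m / n)\<^sup>2 \<tau>\<close>, hence constant.\<close>

lemma jfactor_square:
 assumes "Im \<tau> > 0"
 shows "(jfactor \<tau>)\<^sup>2 * \<tau> = \<i>"
proof -
 define H where "H = {\<tau>. Im \<tau> > 0}"
 define q where "q \<tau> = (jfactor \<tau>)\<^sup>2 * \<tau>" for \<tau>
 have q_inv: "q (\<tau> / of_int N ^ 2) = q \<tau>" if "Im \<tau> > 0" "N > 0" for \<tau> and N :: int
  using that jfactor_scale[OF that] by (simp add: q_def power_mult_distrib)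
 \<comment> \<open>\<open>x n / (n + 2)^2 = \<i> / (n + 1)^2\<close>, so q takes the value q \<i> at
   all x n, and these points accumulate at \<i> without meeting it.\<close>
 define x where "x n = \<i> * ((of_nat n + 2) / (of_nat n + 1))\<^sup>2" for n :: nat
 have xr: "x n = \<i> * of_real (((real n + 2) / (real n + 1))\<^sup>2)" for n by (simp add: x_def)
 have gt: "(real n + 2) / (real n + 1) > 1" for n by simp
 have xH: "x n \<in> H" for n
  unfolding H_def xr using gt[of n] by (simp add: less_trans[OF zero_less_one])
 have xi: "x n ~= \<i>" for n
 proof
  assume "x n = \<i>"
  hence "((real n + 2) / (real n + 1))\<^sup>2 = 1" unfolding xr by (simp add: complex_eq_iff)
  thus False using gt[of n] by (simp add: power2_eq_1_iff)
 qed
 have "(%n. ((real n + 2) / (real n + 1))\<^sup>2) \<longlonglongrightarrow> 1" by real_asymp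
 hence "(%n. \<i> * of_real (((real n + 2) / (real n + 1))\<^sup>2)) \<longlonglongrightarrow> \<i> * of_real 1"
  by (intro tendsto_intros)
 hence lim: "x \<longlonglongrightarrow> \<i>" unfolding xr[abs_def] by simp
 have qx: "q (x n) = q \<i>" for n
 proof -
  have "q (x n / of_int (int n + 2) ^ 2) = q (x n)"
   using xH[of n] by (intro q_inv) (auto simp: H_def)
  moreover have "q (\<i> / of_int (int n + 1) ^ 2) = q \<i>" by (rule q_inv) auto
  moreover have "x n / of_int (int n + 2) ^ 2 = \<i> / of_int (int n + 1) ^ 2"
  proof -
   have "(of_nat n + 2 :: complex) ~= 0" by (metis of_nat_Suc of_nat_neq_0 add_Suc_right add_2_eq_Suc' of_nat_add of_nat_numeral)
   thus ?thesis by (simp add: x_def power_divide)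
  qed
  ultimately show ?thesis by simp
 qed
 have "q \<tau> - q \<i> = 0"
 proof (rule analytic_continuation[where f = "%\<tau>. q \<tau> - q \<i>" and S = H and U = "range x" and \<xi> = \<i>])
  show "(%\<tau>. q \<tau> - q \<i>) holomorphic_on H"
   unfolding q_def using jfactor_holomorphic by (intro holomorphic_intros) (auto simp: H_def)
  show "\<i> islimpt range x"
   unfolding islimpt_sequential using xi lim by blast
  show "connected H" unfolding H_def by (intro convex_connected convex_halfspace_Im_gt)
 qed (use xH qx assms in \<open>auto simp: H_def open_halfspace_Im_gt\<close>)
 \<comment> \<open>\<i> is the fixed point of the inversion, where \<open>jfactor_inverse\<close>
   evaluates the square.\<close>
 moreover have "q \<i> = \<i>" using jfactor_inverse[of \<i>] by (simp add: q_def power2_eq_square)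
 ultimately show ?thesis by (simp add: q_def)
qed

section \<open>Theta constants and the generators of the paramodular group\<close>

definition cform :: "complex^'n^'n => ('n::finite => complex) => ('n => complex) => complex" where
 "cform Z v w = (\<Sum>i\<in>UNIV. \<Sum>j\<in>UNIV. Z $ i $ j * v i * w j)"

lemma qf_eq_cform: "qf W u = cform W (%i. of_int (u i)) (%i. of_int (u i))"
 by (simp add: qf_def cform_def)

lemma cform_left: "cform Z (%k. a k + c * b k) w = cform Z a w + c * cform Z b w"
 and cform_right: "cform Z w (%k. a k + c * b k) = cform Z w a + c * cform Z w b"
 by (simp_all add: cform_def algebra_simps sum.distrib sum_distrib_left)

lemma cform_commute: "transpose Z = Z ==> cform Z v w = cform Z w v"
 unfolding cform_def by (subst sum.swap) (auto simp: transpose_def vec_eq_iff mult_ac intro!: sum.cong)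

lemma siegel_iff:
 "Z \<in> siegel \<longleftrightarrow> transpose Z = Z \<and>
   (\<forall>x :: 'n::finite => real. (\<exists>i. x i ~= 0) --> 0 < Im (cform Z (%i. of_real (x i)) (%i. of_real (x i))))"
 for Z :: "complex^'n^'n"
proof -
 have e: "Im (cform Z (%i. of_real (x $ i)) (%i. of_real (x $ i))) = x \<bullet> ((\<chi> i j. Im (Z $ i $ j)) *v x)" for x :: "real^'n"
  by (simp add: cform_def inner_vec_def matrix_vector_mult_def sum_distrib_left mult_ac)
 have "(\<forall>x::real^'n. x ~= 0 --> 0 < x \<bullet> ((\<chi> i j. Im (Z $ i $ j)) *v x)) \<longleftrightarrow>
   (\<forall>x :: 'n => real. (\<exists>i. x i ~= 0) --> 0 < Im (cform Z (%i. of_real (x i)) (%i. of_real (x i))))"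
  (is "?L \<longleftrightarrow> ?R")
 proof
  assume L: ?L
  show ?R
  proof (intro allI impI)
   fix x :: "'n => real" assume "\<exists>i. x i ~= 0"
   hence "(\<chi> i. x i) ~= 0" by (auto simp: vec_eq_iff)
   with L have "0 < (\<chi> i. x i) \<bullet> ((\<chi> i j. Im (Z $ i $ j)) *v (\<chi> i. x i))" by blast
   thus "0 < Im (cform Z (%i. of_real (x i)) (%i. of_real (x i)))"
    using e[of "\<chi> i. x i"] by simp
  qed
 next
  assume R: ?R
  show ?L
   unfolding e[symmetric]
  proof (intro allI impI)
   fix x :: "real^'n" assume "x ~= 0"
   hence "\<exists>i. x $ i ~= 0" by (auto simp: vec_eq_iff)
   thus "0 < Im (cform Z (%i. of_real (x $ i)) (%i. of_real (x $ i)))" using R by blast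
  qed
 qed
 thus ?thesis by (simp add: siegel_def)
qed

lemma siegel_Im_pos:
 assumes "Z \<in> siegel" "x i ~= 0"
 shows "0 < Im (cform Z (%i. of_real (x i)) (%i. of_real (x i)))"
proof -
 have "\<exists>i. x i ~= 0" using assms(2) by blast
 thus ?thesis using assms(1) unfolding siegel_iff by blast
qed

lemma siegel_Im_hermitian_pos:
 assumes Z: "Z \<in> siegel" and v: "v i ~= 0"
 shows "0 < Im (cform Z (%k. cnj (v k)) v)"
proof -
 define a b where "a k = (of_real (Re (v k)) :: complex)" and "b k = (of_real (Im (v k)) :: complex)" for k
 have v': "(%k. cnj (v k)) = (%k. a k + (- \<i>) * b k)" "v = (%k. a k + \<i> * b k)"
  by (auto simp: a_def b_def complex_eq_iff)
 have "cform Z (%k. cnj (v k)) v = cform Z a a + cform Z b b + \<i> * (cform Z a b - cform Z b a)"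
 proof -
  have "cform Z (%k. a k + (- \<i>) * b k) (%k. a k + \<i> * b k) = cform Z a a + cform Z b b + \<i> * (cform Z a b - cform Z b a)"
   unfolding cform_left cform_right by (simp add: algebra_simps)
  thus ?thesis using v' by simp
 qed
 also have "cform Z a b = cform Z b a" using Z by (intro cform_commute) (simp add: siegel_def)
 finally have e: "Im (cform Z (%k. cnj (v k)) v) = Im (cform Z a a) + Im (cform Z b b)" by simp
 have nn: "0 <= Im (cform Z (%k. of_real (x k)) (%k. of_real (x k)))" for x
 proof (cases "\<exists>i. x i ~= 0")
  case True
  thus ?thesis using siegel_Im_pos[OF Z] less_imp_le by blast
 qed (simp add: cform_def)
 have "Re (v i) ~= 0 \<or> Im (v i) ~= 0" using v by (simp add: complex_eq_iff)
 hence "0 < Im (cform Z a a) \<or> 0 < Im (cform Z b b)"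
  unfolding a_def[abs_def] b_def[abs_def]
  using siegel_Im_pos[OF Z, of "%k. Re (v k)" i] siegel_Im_pos[OF Z, of "%k. Im (v k)" i] by blast
 thus ?thesis using nn[of "%k. Re (v k)"] nn[of "%k. Im (v k)"] unfolding e a_def[abs_def, symmetric] b_def[abs_def, symmetric] by linarith
qed

definition unit :: "'n => 'n => complex" where
 "unit i k = (if k = i then 1 else 0)"

lemma cform_unit: "cform Z (unit i) v = (\<Sum>k\<in>UNIV. Z $ i $ k * v k)"
 unfolding cform_def
proof -
 have "(\<Sum>a\<in>UNIV. \<Sum>j\<in>UNIV. Z $ a $ j * unit i a * v j) = (\<Sum>a\<in>UNIV. if a = i then (\<Sum>j\<in>UNIV. Z $ i $ j * v j) else 0)"
  by (intro sum.cong refl) (simp add: unit_def)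
 thus "(\<Sum>a\<in>UNIV. \<Sum>j\<in>UNIV. Z $ a $ j * unit i a * v j) = (\<Sum>k\<in>UNIV. Z $ i $ k * v k)" by simp
qed

lemma cform_unit_unit: "cform Z (unit i) (unit j) = Z $ i $ j"
 by (simp add: cform_unit unit_def if_distrib cong: if_cong)

lemma siegel_diagonal_pos:
 assumes "Z \<in> siegel"
 shows "0 < Im (Z $ i $ i)"
 using siegel_Im_hermitian_pos[OF assms, of "unit i" i] cform_unit_unit[of Z i i]
 by (simp add: unit_def[abs_def] if_distrib cong: if_cong)

section \<open>Partial inversion on the Siegel space\<close>

definition inversion_row :: "('n => nat) => 'n => complex^'n^'n => 'n::finite => complex" where
 "inversion_row d i Z k = (if k = i then of_nat (d i) else Z $ i $ k)"

text \<open>Exchanging a i and b i in a symplectic basis, up to sign: a Schur complement away from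
  the index i and - (d i)^2 / Z i i at it.\<close>

definition inversion :: "('n::finite => nat) => 'n => complex^'n^'n => complex^'n^'n" where
 "inversion d i Z = (\<chi> j k. (if j = i \<or> k = i then 0 else Z $ j $ k) -
   inversion_row d i Z j * inversion_row d i Z k / Z $ i $ i)"

lemma cform_rank_one: "(\<Sum>j\<in>UNIV. \<Sum>k\<in>UNIV. a j * a k / z * v j * v k) = (\<Sum>k\<in>UNIV. a k * v k)\<^sup>2 / (z :: complex)"
 by (simp add: power2_eq_square sum_product sum_divide_distrib mult_ac)

lemma cform_inversion:
 "cform (inversion d i Z) v v = cform Z (v(i := 0)) (v(i := 0)) - (\<Sum>k\<in>UNIV. inversion_row d i Z k * v k)\<^sup>2 / Z $ i $ i"
proof -
 have "cform (inversion d i Z) v v =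
   (\<Sum>j\<in>UNIV. \<Sum>k\<in>UNIV. (if j = i \<or> k = i then 0 else Z $ j $ k) * v j * v k) -
   (\<Sum>j\<in>UNIV. \<Sum>k\<in>UNIV. inversion_row d i Z j * inversion_row d i Z k / Z $ i $ i * v j * v k)"
  by (simp add: cform_def inversion_def left_diff_distrib sum_subtractf)
 also have "(\<Sum>j\<in>UNIV. \<Sum>k\<in>UNIV. (if j = i \<or> k = i then 0 else Z $ j $ k) * v j * v k) = cform Z (v(i := 0)) (v(i := 0))"
  unfolding cform_def by (intro sum.cong refl) auto
 finally show ?thesis unfolding cform_rank_one .
qed

lemma inversion_row_sum:
 "(\<Sum>k\<in>UNIV. inversion_row d i Z k * v k) = of_nat (d i) * v i + cform Z (unit i) (v(i := 0))"
proof -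
 have "(\<Sum>k\<in>UNIV. inversion_row d i Z k * v k) = (\<Sum>k\<in>UNIV. (if k = i then of_nat (d i) * v i else 0) + Z $ i $ k * (v(i := 0)) k)"
  by (intro sum.cong refl) (simp add: inversion_row_def)
 thus ?thesis by (simp add: sum.distrib cform_unit)
qed

lemma inversion_siegel:
 fixes d :: "'n::finite => nat"
 assumes Z: "Z \<in> siegel" and d: "0 < d i"
 shows "inversion d i Z \<in> siegel"
 unfolding siegel_iff
proof (intro conjI allI impI)
 have sym: "transpose Z = Z" using Z by (simp add: siegel_def)
 hence "Z $ j $ k = Z $ k $ j" for j k by (simp add: transpose_def vec_eq_iff)
 thus "transpose (inversion d i Z) = inversion d i Z"
  by (auto simp: transpose_def inversion_def vec_eq_iff)
 fix x :: "'n => real" assume x: "\<exists>k. x k ~= 0"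
 define q where "q k = (of_real (x k) :: complex)" for k
 define r where "r = q(i := 0)"
 define s where "s = cform Z (unit i) r"
 define z where "z = Z $ i $ i"
 have z0: "z ~= 0" using siegel_diagonal_pos[OF Z, of i] by (auto simp: z_def)
 define a where "a = of_nat (d i) * q i"
 \<comment> \<open>Chosen to complete the square: with - w as i-th coordinate, the Hermitian form of
   Z at v has the same imaginary part as the inverted matrix at the real vector q.\<close>
 define w where "w = (a + s) / z"
 define v where "v k = r k + (- w) * unit i k" for k
 have cn: "cnj (v k) = r k + (- cnj w) * unit i k" for k
  by (simp add: v_def r_def q_def unit_def)
 have "cform Z (%k. cnj (v k)) v = cform Z r r - w * s - cnj w * s + cnj w * w * z"
  unfolding cn unfolding v_def[abs_def] cform_left cform_right cform_unit_unit
  by (simp add: s_def[symmetric] z_def[symmetric] cform_commute[OF sym, of r "unit i"] algebra_simps)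
 also have "\<dots> = (cform Z r r - (a + s)\<^sup>2 / z) + (w + cnj w) * a"
  using z0 by (simp add: w_def power2_eq_square field_simps)
 finally have "Im (cform Z (%k. cnj (v k)) v) = Im (cform Z r r - (a + s)\<^sup>2 / z) + Im ((w + cnj w) * a)"
  by simp
 also have "Im ((w + cnj w) * a) = 0" by (simp add: a_def q_def complex_add_cnj)
 also have "cform Z r r - (a + s)\<^sup>2 / z = cform (inversion d i Z) q q"
  unfolding cform_inversion inversion_row_sum by (simp add: r_def s_def a_def z_def)
 finally have e: "Im (cform (inversion d i Z) q q) = Im (cform Z (%k. cnj (v k)) v)" by simp
 have "\<exists>k. v k ~= 0"
 proof (rule ccontr)
  assume "\<not> (\<exists>k. v k ~= 0)"
  hence v0: "v k = 0" for k by blast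
  have r0: "r k = 0" for k
   using v0[of k] by (auto simp: v_def r_def unit_def split: if_splits)
  have "w = 0" using v0[of i] by (simp add: v_def r_def unit_def)
  moreover have "s = 0" using r0 by (simp add: s_def cform_def)
  ultimately have "a = 0" using z0 by (simp add: w_def)
  hence "x i = 0" using d by (simp add: a_def q_def)
  moreover have "x k = 0" if "k ~= i" for k using r0[of k] that by (simp add: r_def q_def)
  ultimately show False using x by metis
 qed
 thus "0 < Im (cform (inversion d i Z) (%i. of_real (x i)) (%i. of_real (x i)))"
  using siegel_Im_hermitian_pos[OF Z, of v] unfolding e[symmetric] q_def[abs_def] by blast
qed

section \<open>Generators and their action on theta constants\<close>

text \<open>Symmetric translations and partial inversions; \<open>reduce_to_identity\<close> shows
  that they generate the paramodular group.\<close>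

datatype 'n generator = Shift 'n 'n int | Inversion 'n

text \<open>A shift adds \<open>k * d j\<close> at two symmetric places. Written as \<beta> D, the
  matrix \<beta> has entries k and \<open>k * d j / d i\<close> there, so the divisibility keeps it
  integral.\<close>

fun admissible :: "('n => nat) => 'n generator => bool" where
 "admissible d (Shift i j k) \<longleftrightarrow> d i dvd d j"
| "admissible d (Inversion i) \<longleftrightarrow> True"

fun gact :: "('n::finite => nat) => 'n generator => complex^'n^'n => complex^'n^'n" where
 "gact d (Shift i j k) Z =
   (\<chi> a b. Z $ a $ b + (if (a = i \<and> b = j) \<or> (a = j \<and> b = i) then of_int k * of_nat (d j) else 0))"
| "gact d (Inversion i) Z = inversion d i Z"

text \<open>The determinant of the automorphy factor of the generator, see
  \<open>row_value_generator\<close>.\<close>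

fun gden :: "('n::finite => nat) => 'n generator => complex^'n^'n => complex" where
 "gden d (Shift i j k) Z = 1"
| "gden d (Inversion i) Z = - Z $ i $ i / of_nat (d i)"

text \<open>The operators of the Weil representation on functions of classes modulo 2 D: a quadratic
  phase, or a Fourier transform in one coordinate. The square root normalises the transform so that
  its fourth power is the identity.\<close>

fun gop :: "('n => nat) => 'n generator => (('n => int) => complex) => ('n => int) => complex" where
 "gop d (Shift i j k) c u =
   expi (of_int (k * (if i = j then 1 else 2) * u i * u j) / of_nat (4 * d i)) * c u"
| "gop d (Inversion i) c u =
   (\<Sum>l\<in>{0..<2 * int (d i)}. expi (of_int (l * u i) / of_nat (2 * d i)) * c (u(i := l))) / of_real (sqrt (2 * real (d i)))"

definition theta_null :: "('n::finite => nat) => complex^'n^'n => ('n => int) => complex" where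
 "theta_null d Z u = theta d (scaled d Z) 2 u 0"

lemma theta_null_eq: "theta_null d Z u = (\<Sum>\<^sub>\<infinity>m. if dcong d 2 m u then expi (qf (scaled d Z) m / 4) else 0)"
 unfolding theta_null_def theta_def fser_def by (rule infsum_cong) (simp add: gauss_def)

lemma gact_siegel:
 assumes Z: "Z \<in> siegel" and d: "\<And>i. 0 < d i"
 shows "gact d g Z \<in> siegel"
proof (cases g)
 case (Shift i j k)
 have "Im (gact d g Z $ a $ b) = Im (Z $ a $ b)" for a b by (simp add: Shift)
 moreover have "transpose (gact d g Z) = gact d g Z"
  using Z by (auto simp: Shift siegel_def transpose_def vec_eq_iff)
 ultimately show ?thesis using Z by (simp add: siegel_def)
qed (use inversion_siegel[OF Z d] in simp)

lemma gden_nonzero: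
 assumes Z: "Z \<in> siegel" and d: "\<And>i. 0 < d i"
 shows "gden d g Z ~= 0"
proof (cases g)
 case (Inversion i)
 have "Z $ i $ i ~= 0" using siegel_diagonal_pos[OF Z, of i] by auto
 thus ?thesis using d[of i] by (simp add: Inversion)
qed simp

text \<open>R runs over the possible other coordinates, the i-th being set to 0; absolute
  convergence allows summing the i-th coordinate first.\<close>

lemma theta_null_split:
 fixes u :: "'n::finite => int" and i :: 'n
 assumes Z: "Z \<in> siegel" and d: "\<And>i. 0 < d i"
 defines "R \<equiv> {r :: 'n => int. r i = 0 \<and> (\<forall>k. k ~= i --> int (2 * d k) dvd r k - u k)}"
 shows "theta_null d Z u = (\<Sum>\<^sub>\<infinity>r\<in>R. \<Sum>\<^sub>\<infinity>t::int. expi (qf (scaled d Z) (r(i := 2 * int (d i) * t + u i)) / 4))"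
  and "(%r. \<Sum>\<^sub>\<infinity>t::int. expi (qf (scaled d Z) (r(i := 2 * int (d i) * t + u i)) / 4)) summable_on R"
  and "(%k::int. norm (expi (qf (scaled d Z) (r(i := k)) / 4))) summable_on UNIV"
proof -
 interpret siegel_point d Z by unfold_locales (use Z d in auto)
 define h where "h m = expi (qf W m / 4)" for m
 have "rapid h" using rapid_gaussian[of "1 / 4" "%_. 1" 1] by (simp add: h_def[abs_def])
 from fser_has_sum(2)[OF this, of 0] have h: "(%m. norm (h m)) summable_on UNIV" by simp
 have inj: "inj (%k. r(i := k))" by (auto simp: inj_on_def fun_eq_iff)
 have "(%m. norm (h m)) summable_on (range (%k. r(i := k)))"
  using summable_on_subset_banach[OF h] by blast
 thus "(%k::int. norm (expi (qf (scaled d Z) (r(i := k)) / 4))) summable_on UNIV"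
  by (simp add: summable_on_reindex[OF inj] o_def h_def)
 have bij: "bij_betw (%(r, t). r(i := 2 * int (d i) * t + u i)) (R \<times> UNIV) {m. dcong d 2 m u}"
 proof (rule bij_betwI[where g = "%m. (m(i := 0), (m i - u i) div (2 * int (d i)))"])
  show "(%(r, t). r(i := 2 * int (d i) * t + u i)) \<in> R \<times> UNIV \<rightarrow> {m. dcong d 2 m u}"
   by (auto simp: R_def dcong_def)
  show "(%m. (m(i := 0), (m i - u i) div (2 * int (d i)))) \<in> {m. dcong d 2 m u} \<rightarrow> R \<times> UNIV"
   by (auto simp: R_def dcong_def)
  show "(%m. (m(i := 0), (m i - u i) div (2 * int (d i)))) ((%(r, t). r(i := 2 * int (d i) * t + u i)) x) = x" if "x \<in> R \<times> UNIV" for x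
   using that d[of i] by (auto simp: R_def fun_eq_iff)
  fix m assume "m \<in> {m. dcong d 2 m u}"
  hence "2 * int (d i) dvd m i - u i" by (auto simp: dcong_def)
  thus "(%(r, t). r(i := 2 * int (d i) * t + u i)) (m(i := 0), (m i - u i) div (2 * int (d i))) = m"
   by (auto simp: fun_eq_iff)
 qed
 have "theta_null d Z u = (\<Sum>\<^sub>\<infinity>m\<in>{m. dcong d 2 m u}. h m)"
  unfolding theta_null_eq h_def by (rule infsum_cong_neutral) auto
 also have "\<dots> = (\<Sum>\<^sub>\<infinity>(r, t)\<in>R \<times> UNIV. h (r(i := 2 * int (d i) * t + u i)))"
  using infsum_reindex_bij_betw[OF bij, of h] by (simp add: case_prod_unfold)
 finally have 1: "theta_null d Z u = (\<Sum>\<^sub>\<infinity>(r, t)\<in>R \<times> UNIV. h (r(i := 2 * int (d i) * t + u i)))" .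
 have "h summable_on {m. dcong d 2 m u}"
  using abs_summable_summable[OF h] summable_on_subset_banach by blast
 hence s: "(%(r, t). h (r(i := 2 * int (d i) * t + u i))) summable_on R \<times> UNIV"
  using summable_on_reindex_bij_betw[OF bij, of h] by (simp add: case_prod_unfold)
 show "theta_null d Z u = (\<Sum>\<^sub>\<infinity>r\<in>R. \<Sum>\<^sub>\<infinity>t::int. expi (qf (scaled d Z) (r(i := 2 * int (d i) * t + u i)) / 4))"
  using infsum_Sigma'_banach[of "%r t. h (r(i := 2 * int (d i) * t + u i))" R "%_. UNIV"] s 1 by (simp add: h_def)
 show "(%r. \<Sum>\<^sub>\<infinity>t::int. expi (qf (scaled d Z) (r(i := 2 * int (d i) * t + u i)) / 4)) summable_on R"
  using summable_on_Sigma_banach[of "%r t. h (r(i := 2 * int (d i) * t + u i))" R "%_. UNIV"] s by (simp add: h_def)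
qed

lemma qf_update:
 assumes Z: "transpose Z = Z" and r: "r i = 0"
 shows "qf Z (r(i := k)) = qf Z r + 2 * of_int k * cform Z (unit i) (%j. of_int (r j)) + (of_int k)\<^sup>2 * Z $ i $ i"
proof -
 have "(%j. of_int ((r(i := k)) j)) = (%j. of_int (r j) + of_int k * unit i j)"
  using r by (auto simp: unit_def)
 thus ?thesis
  unfolding qf_eq_cform
  by (simp add: cform_left cform_right cform_unit_unit cform_commute[OF Z, of "%j. of_int (r j)" "unit i"]
    power2_eq_square algebra_simps)
qed

lemma scaled_scale: "cform (scaled d Z) v w = cform Z (%i. v i / of_nat (d i)) (%i. w i / of_nat (d i))"
 unfolding cform_def scaled_def by (intro sum.cong refl) simp

text \<open>With the other coordinates fixed, the sum over the i-th one is a series of shifted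
  Gaussians, to which Jacobi's inversion applies. The dual series runs over all integers k, and
  grouping k modulo 2 d i yields the Fourier transform of the theta constants.\<close>

lemma theta_null_inversion:
 fixes d :: "'n::finite => nat"
 assumes Z: "Z \<in> siegel" and d: "\<And>i. 0 < d i"
 shows "theta_null d (inversion d i Z) u = jfactor (- 2 / scaled d Z $ i $ i) *
   (\<Sum>l\<in>{0..<2 * int (d i)}. expi (of_int (l * u i) / of_nat (2 * d i)) * theta_null d Z (u(i := l)))"
proof -
 define W where "W = scaled d Z"
 define w where "w = W $ i $ i"
 define R where "R = {r :: 'n => int. r i = 0 \<and> (\<forall>k. k ~= i --> int (2 * d k) dvd r k - u k)}"
 have w: "0 < Im w" and di: "of_nat (d i) ~= (0::complex)"
  using siegel_diagonal_pos[OF Z, of i] d[of i]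
  by (auto simp: w_def W_def scaled_def simp flip: of_nat_mult power2_eq_square)
 have w0: "w ~= 0" using w by auto
 have tau: "0 < Im (- 2 / w)" using Im_minus_inverse(1)[of "w / 2"] w by simp
 have inverse_tau: "- 1 / (- 2 / w) = w / 2" by simp
 have sym: "transpose W = W" using Z by (auto simp: W_def scaled_def siegel_def transpose_def vec_eq_iff mult_ac)
 have inner: "(\<Sum>\<^sub>\<infinity>t::int. expi (qf (scaled d (inversion d i Z)) (r(i := 2 * int (d i) * t + u i)) / 4)) =
   (\<Sum>l\<in>{0..<2 * int (d i)}. jfactor (- 2 / w) * expi (of_int (l * u i) / of_nat (2 * d i)) *
     (\<Sum>\<^sub>\<infinity>t::int. expi (qf W (r(i := 2 * int (d i) * t + l)) / 4)))" if "r \<in> R" for r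
 proof -
  have r: "r i = 0" using that by (simp add: R_def)
  have period: "expi (of_int ((2 * int (d i) * t + l) * u i) / of_nat (2 * d i)) = expi (of_int (l * u i) / of_nat (2 * d i))" for t l
  proof -
   have "of_int ((2 * int (d i) * t + l) * u i) / of_nat (2 * d i) = of_int (l * u i) / of_nat (2 * d i) + (of_int (t * u i) :: complex)"
    using di by (simp add: field_simps)
   thus ?thesis by (simp only: expi_add) simp
  qed
  define s where "s = cform W (unit i) (%j. of_int (r j))"
  define \<xi> where "\<xi> = (of_int (u i) / of_nat (d i) + s) / 2"
  have "qf (scaled d (inversion d i Z)) (r(i := m)) = qf W r - (of_int m / of_nat (d i) + s)\<^sup>2 / w" for m
  proof -
   define v where "v k = of_int ((r(i := m)) k) / (of_nat (d k) :: complex)" for k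
   have v0: "v(i := 0) = (%k. of_int (r k) / of_nat (d k))" by (auto simp: v_def r)
   have "qf (scaled d (inversion d i Z)) (r(i := m)) = cform (inversion d i Z) v v"
    by (simp add: qf_eq_cform scaled_scale v_def[abs_def])
   also have "\<dots> = qf W r - (of_nat (d i) * v i + cform Z (unit i) (v(i := 0)))\<^sup>2 / Z $ i $ i"
    unfolding cform_inversion inversion_row_sum v0 by (simp add: W_def qf_eq_cform scaled_scale)
   also have "cform Z (unit i) (v(i := 0)) = of_nat (d i) * s"
    unfolding s_def cform_unit v0 W_def scaled_def using di by (simp add: sum_distrib_left)
   also have "v i = of_int m / of_nat (d i)" by (simp add: v_def)
   also have "Z $ i $ i = of_nat (d i) * of_nat (d i) * w" using di by (simp add: w_def W_def scaled_def)
   finally have "qf (scaled d (inversion d i Z)) (r(i := m)) = qf W r -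
     (of_nat (d i) * (of_int m / of_nat (d i) + s))\<^sup>2 / (of_nat (d i) * of_nat (d i) * w)"
    by (simp only: distrib_left)
   thus ?thesis using di by (simp add: power_mult_distrib power2_eq_square)
  qed
  hence "expi (qf (scaled d (inversion d i Z)) (r(i := 2 * int (d i) * t + u i)) / 4) =
    expi (qf W r / 4) * expi (- 2 / w * (\<xi> + of_int t)\<^sup>2 / 2)" for t
  proof -
   have "of_int (2 * int (d i) * t + u i) / of_nat (d i) + s = 2 * (\<xi> + of_int t)"
    using di by (simp add: \<xi>_def field_simps)
   moreover have "(qf W r - (2 * y)\<^sup>2 / w) / 4 = qf W r / 4 + - 2 / w * y\<^sup>2 / 2" for y
    by (simp add: power_mult_distrib diff_divide_distrib)
   ultimately show ?thesis
    unfolding \<open>\<And>m. qf (scaled d (inversion d i Z)) (r(i := m)) = _\<close> by (simp only: expi_add)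
  qed
  hence "(\<Sum>\<^sub>\<infinity>t::int. expi (qf (scaled d (inversion d i Z)) (r(i := 2 * int (d i) * t + u i)) / 4)) =
    expi (qf W r / 4) * (\<Sum>\<^sub>\<infinity>t::int. expi (- 2 / w * (\<xi> + of_int t)\<^sup>2 / 2))"
   by (simp only: infsum_cmult_right')
  also have "(\<Sum>\<^sub>\<infinity>t::int. expi (- 2 / w * (\<xi> + of_int t)\<^sup>2 / 2)) = jfactor (- 2 / w) * jtheta (w / 2) \<xi>"
   using jtheta_inversion[OF tau, of \<xi>] unfolding jtheta_complete_square inverse_tau .
  also have "expi (qf W r / 4) * (jfactor (- 2 / w) * jtheta (w / 2) \<xi>) = jfactor (- 2 / w) * (\<Sum>\<^sub>\<infinity>k::int. expi (of_int (k * u i) / of_nat (2 * d i)) * expi (qf W (r(i := k)) / 4))"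
  proof -
   have "expi (qf W r / 4) * expi ((of_int k)\<^sup>2 * (w / 2) / 2 + of_int k * \<xi>) =
     expi (of_int (k * u i) / of_nat (2 * d i)) * expi (qf W (r(i := k)) / 4)" for k
    unfolding qf_update[where r = r and i = i, OF sym r] s_def[symmetric] w_def[symmetric] expi_add[symmetric]
    by (rule arg_cong[where f = expi]) (simp add: \<xi>_def field_simps)
   thus ?thesis by (simp add: jtheta_def mult_ac flip: infsum_cmult_right')
  qed
  also have "(\<Sum>\<^sub>\<infinity>k::int. expi (of_int (k * u i) / of_nat (2 * d i)) * expi (qf W (r(i := k)) / 4)) =
    (\<Sum>l\<in>{0..<2 * int (d i)}. \<Sum>\<^sub>\<infinity>t. expi (of_int ((2 * int (d i) * t + l) * u i) / of_nat (2 * d i)) *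
      expi (qf W (r(i := 2 * int (d i) * t + l)) / 4))"
  proof (rule infsum_int_residues(1))
   have "cmod (expi (of_int (k * u i) / of_nat (2 * d i))) = 1" for k by (simp add: norm_expi Im_divide_of_nat)
   thus "(%k. norm (expi (of_int (k * u i) / of_nat (2 * d i)) * expi (qf W (r(i := k)) / 4))) summable_on UNIV"
    using theta_null_split(3)[where d = d and r = r and i = i, OF Z d] by (simp add: norm_mult W_def)
  qed (use d in simp)
  finally show ?thesis unfolding period by (simp only: infsum_cmult_right' sum_distrib_left mult.assoc)
 qed
 have R_l: "R = {r. r i = 0 \<and> (\<forall>k. k ~= i --> int (2 * d k) dvd r k - (u(i := l)) k)}" for l
  by (auto simp: R_def)
 have "theta_null d (inversion d i Z) u = (\<Sum>\<^sub>\<infinity>r\<in>R. \<Sum>l\<in>{0..<2 * int (d i)}. jfactor (- 2 / w) * expi (of_int (l * u i) / of_nat (2 * d i)) *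
     (\<Sum>\<^sub>\<infinity>t::int. expi (qf W (r(i := 2 * int (d i) * t + l)) / 4)))"
  unfolding theta_null_split(1)[where d = d and u = u and i = i, OF inversion_siegel[where d = d and i = i, OF Z d] d] R_def[symmetric]
  by (rule infsum_cong) (rule inner)
 also have "\<dots> = (\<Sum>l\<in>{0..<2 * int (d i)}. jfactor (- 2 / w) * expi (of_int (l * u i) / of_nat (2 * d i)) * theta_null d Z (u(i := l)))"
 proof (rule infsumI, rule has_sum_finite_sum)
  fix l
  have "((%r. \<Sum>\<^sub>\<infinity>t::int. expi (qf W (r(i := 2 * int (d i) * t + l)) / 4)) has_sum theta_null d Z (u(i := l))) R"
   using theta_null_split(1,2)[where d = d and u = "u(i := l)" and i = i, OF Z d]
   unfolding R_l[of l, symmetric] by (simp add: W_def)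
  thus "((%r. jfactor (- 2 / w) * expi (of_int (l * u i) / of_nat (2 * d i)) *
     (\<Sum>\<^sub>\<infinity>t::int. expi (qf W (r(i := 2 * int (d i) * t + l)) / 4))) has_sum
    jfactor (- 2 / w) * expi (of_int (l * u i) / of_nat (2 * d i)) * theta_null d Z (u(i := l))) R"
   by (rule has_sum_cmult_right)
 qed simp
 finally show ?thesis by (simp add: sum_distrib_left w_def W_def mult_ac)
qed

text \<open>The quadratic phase lives on classes modulo 2 D. For the mixed term
  \<open>d i dvd d j\<close> is used: it makes the j-th entries congruent modulo 2 d i as
  well.\<close>

lemma shift_phase_cong:
 fixes d :: "'n => nat"
 assumes d: "\<And>i. 0 < d i" and ij: "d i dvd d j" and mu: "dcong d 2 m u"
 shows "expi (of_int (k * (if i = j then 1 else 2) * m i * m j) / of_nat (4 * d i)) =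
     expi (of_int (k * (if i = j then 1 else 2) * u i * u j) / of_nat (4 * d i))"
proof -
 have d0: "of_nat (d i) ~= (0::complex)" using d[of i] by auto
 have dv: "2 * int (d i) dvd m i - u i" "2 * int (d j) dvd m j - u j" using mu by (auto simp: dcong_def)
 hence dj: "2 * int (d i) dvd m j - u j" using ij by (meson dvd_trans mult_dvd_mono dvd_refl int_dvd_int_iff)
 from dv obtain s where s: "m i = u i + 2 * int (d i) * s" by (metis dvdE add_diff_cancel_left' diff_add_cancel add.commute)
 from dj obtain t where t: "m j = u j + 2 * int (d i) * t" by (metis dvdE add.commute diff_add_cancel)
 have "\<exists>n. k * (if i = j then 1 else 2) * m i * m j = k * (if i = j then 1 else 2) * u i * u j + 4 * int (d i) * n"
 proof (cases "i = j")
  case True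
  hence "k * m i * m j = k * u i * u j + 4 * int (d i) * (k * (u i * s + int (d i) * s\<^sup>2))"
   using s by (simp add: power2_eq_square algebra_simps)
  thus ?thesis using True by auto
 next
  case False
  hence "k * 2 * m i * m j = k * 2 * u i * u j + 4 * int (d i) * (k * (u i * t + u j * s + 2 * int (d i) * s * t))"
   using s t by (simp add: algebra_simps)
  thus ?thesis using False by auto
 qed
 then obtain n where n: "k * (if i = j then 1 else 2) * m i * m j = k * (if i = j then 1 else 2) * u i * u j + 4 * int (d i) * n" by blast
 have "of_int (k * (if i = j then 1 else 2) * m i * m j) / of_nat (4 * d i) =
   of_int (k * (if i = j then 1 else 2) * u i * u j) / of_nat (4 * d i) + (of_int n :: complex)"
  unfolding n using d0 by (simp add: field_simps)
 thus ?thesis by (simp only: expi_add) simp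
qed

lemma sum_sum_delta: "(\<Sum>a\<in>UNIV. \<Sum>b\<in>UNIV. if a = i \<and> b = j then f a b else 0) = (f i j :: 'c::comm_monoid_add)"
 for i :: "'a::finite" and j :: "'b::finite"
proof -
 have "(\<Sum>b\<in>UNIV. if a = i \<and> b = j then f a b else 0) = (if a = i then f a j else 0)" for a by simp
 thus ?thesis by simp
qed

lemma theta_null_shift:
 fixes d :: "'n::finite => nat"
 assumes Z: "Z \<in> siegel" and d: "\<And>i. 0 < d i" and ij: "d i dvd d j"
 shows "theta_null d (gact d (Shift i j k) Z) u = gop d (Shift i j k) (theta_null d Z) u"
proof -
 define \<epsilon> where "\<epsilon> = (if i = j then 1 else 2 :: int)"
 have d0: "of_nat (d i) ~= (0::complex)" "of_nat (d j) ~= (0::complex)" using d[of i] d[of j] by auto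
 have q: "qf (scaled d (gact d (Shift i j k) Z)) m = qf (scaled d Z) m + of_int (k * \<epsilon> * m i * m j) / of_nat (d i)" for m
 proof -
  have "qf (scaled d (gact d (Shift i j k) Z)) m = qf (scaled d Z) m +
    (\<Sum>a\<in>UNIV. \<Sum>b\<in>UNIV. (if (a = i \<and> b = j) \<or> (a = j \<and> b = i) then of_int k * of_nat (d j) else 0) /
      (of_nat (d a) * of_nat (d b)) * of_int (m a) * of_int (m b))"
   by (simp add: qf_def scaled_def add_divide_distrib distrib_right sum.distrib)
  also have "(%a b. (if (a = i \<and> b = j) \<or> (a = j \<and> b = i) then of_int k * of_nat (d j) else 0) /
      (of_nat (d a) * of_nat (d b)) * of_int (m a) * of_int (m b)) =
    (%a b. (if a = i \<and> b = j then of_int (k * m i * m j) / of_nat (d i) else (0 :: complex)) +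
      (if a = j \<and> b = i then (if i = j then 0 else of_int (k * m i * m j) / of_nat (d i)) else 0))"
   using d0 by (auto simp: fun_eq_iff)
  also have "(\<Sum>a\<in>UNIV. \<Sum>b\<in>UNIV. (if a = i \<and> b = j then of_int (k * m i * m j) / of_nat (d i) else (0 :: complex)) +
      (if a = j \<and> b = i then (if i = j then 0 else of_int (k * m i * m j) / of_nat (d i)) else 0)) =
    of_int (k * \<epsilon> * m i * m j) / of_nat (d i)"
   unfolding sum.distrib sum_sum_delta by (simp add: \<epsilon>_def)
  finally show ?thesis .
 qed
 have "(if dcong d 2 m u then expi (qf (scaled d (gact d (Shift i j k) Z)) m / 4) else 0) =
   expi (of_int (k * \<epsilon> * u i * u j) / of_nat (4 * d i)) * (if dcong d 2 m u then expi (qf (scaled d Z) m / 4) else 0)" for m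
 proof (cases "dcong d 2 m u")
  case True
  have "expi (of_int (k * \<epsilon> * m i * m j) / of_nat (4 * d i)) = expi (of_int (k * \<epsilon> * u i * u j) / of_nat (4 * d i))"
   unfolding \<epsilon>_def by (rule shift_phase_cong[OF d ij True])
  moreover have "qf (scaled d (gact d (Shift i j k) Z)) m / 4 = of_int (k * \<epsilon> * m i * m j) / of_nat (4 * d i) + qf (scaled d Z) m / 4"
   unfolding q using d0 by (simp add: field_simps)
  ultimately show ?thesis using True by (simp only: expi_add) simp
 qed simp
 thus ?thesis
  by (simp add: theta_null_eq \<epsilon>_def infsum_cmult_right' del: gact.simps)
qed

text \<open>The multiplier j contains \<open>jfactor\<close>, of which only the square is known: j^2
  is \<i> times the automorphy factor for an inversion. The eighth power removes the root of
  unity.\<close>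

theorem theta_null_generator:
 fixes d :: "'n::finite => nat"
 assumes Z: "Z \<in> siegel" and d: "\<And>i. 0 < d i" and g: "admissible d g"
 obtains j where "j ^ 8 = gden d g Z ^ 4" "\<And>u. theta_null d (gact d g Z) u = j * gop d g (theta_null d Z) u"
proof (cases g)
 case (Shift i j k)
 thus ?thesis using theta_null_shift[where d = d, OF Z d] g that[of 1] by auto
next
 case (Inversion i)
 define w where "w = scaled d Z $ i $ i"
 define j where "j = jfactor (- 2 / w) * of_real (sqrt (2 * real (d i)))"
 have di: "of_nat (d i) ~= (0::complex)" using d[of i] by auto
 have w: "0 < Im w"
  using siegel_diagonal_pos[OF Z, of i] d[of i]
  by (auto simp: w_def scaled_def simp flip: of_nat_mult power2_eq_square)
 hence w0: "w ~= 0" by auto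
 have tau: "0 < Im (- 2 / w)" using Im_minus_inverse(1)[of "w / 2"] w by simp
 have "(jfactor (- 2 / w))\<^sup>2 = (jfactor (- 2 / w))\<^sup>2 * (- 2 / w) * (- w / 2)" using w0 by simp
 hence "(jfactor (- 2 / w))\<^sup>2 = - \<i> * w / 2"
  unfolding jfactor_square[OF tau] by simp
 moreover have "(of_real (sqrt (2 * real (d i))) :: complex)\<^sup>2 = 2 * of_nat (d i)"
  by (simp flip: of_real_power)
 ultimately have "j\<^sup>2 = - \<i> * (w * of_nat (d i))" by (simp add: j_def power_mult_distrib)
 also have "w * of_nat (d i) = Z $ i $ i / of_nat (d i)" using di by (simp add: w_def scaled_def)
 finally have "(j\<^sup>2) ^ 4 = (- \<i> * (Z $ i $ i / of_nat (d i))) ^ 4" by simp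
 hence "j ^ 8 = gden d g Z ^ 4"
  by (simp add: Inversion power_mult_distrib power_divide flip: power_mult)
 moreover have "theta_null d (gact d g Z) u = j * gop d g (theta_null d Z) u" for u
  using theta_null_inversion[where d = d, OF Z d, of i u] d[of i] by (simp add: Inversion j_def w_def)
 ultimately show ?thesis by (rule that)
qed

section \<open>Generation of the paramodular group\<close>

type_synonym 'n row = "('n => int) \<times> ('n => int)"

text \<open>The alternating form with matrix (0, D; -D, 0), which paramodular matrices preserve on
  their rows.\<close>

definition pairing :: "('n::finite => nat) => 'n row => 'n row => int" where
 "pairing d v w = (\<Sum>k\<in>UNIV. int (d k) * (fst v k * snd w k - snd v k * fst w k))"

text \<open>Right multiplication of a row by the block matrix of the generator. Generation of the
  group thus becomes row reduction over the integers.\<close>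

fun grow :: "('n => nat) => 'n generator => 'n row => 'n row" where
 "grow d (Shift i j k) v =
   (fst v, %m. snd v m + (if m = j then k * fst v i else 0) +
    (if m = i \<and> i ~= j then k * int (d j div d i) * fst v j else 0))"
| "grow d (Inversion i) v = ((fst v)(i := - snd v i), (snd v)(i := fst v i))"

fun indices :: "'n generator => 'n set" where
 "indices (Shift i j k) = {i, j}"
| "indices (Inversion i) = {i}"

definition word :: "('n => nat) => 'n set => 'n generator list => bool" where
 "word d U ws \<longleftrightarrow> (\<forall>g\<in>set ws. admissible d g \<and> indices g \<subseteq> U)"

definition run :: "('n => nat) => 'n generator list => 'n row => 'n row" where
 "run d ws = fold (grow d) ws"

lemma word_simps [simp]:
 "word d U []"
 "word d U (g # ws) \<longleftrightarrow> admissible d g \<and> indices g \<subseteq> U \<and> word d U ws"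
 "word d U (ws @ vs) \<longleftrightarrow> word d U ws \<and> word d U vs"
 by (auto simp: word_def)

lemma word_mono: "word d U ws ==> U \<subseteq> U' ==> word d U' ws"
 by (auto simp: word_def)

lemma run_simps [simp]:
 "run d [] v = v"
 "run d (g # ws) v = run d ws (grow d g v)"
 "run d (ws @ vs) v = run d vs (run d ws v)"
 by (simp_all add: run_def)

definition supported :: "'n set => 'n row => bool" where
 "supported U v \<longleftrightarrow> (\<forall>k. k \<notin> U --> fst v k = 0 \<and> snd v k = 0)"

lemma supported_grow:
 assumes "indices g \<subseteq> U" "supported U v"
 shows "supported U (grow d g v)"
 using assms by (cases g) (auto simp: supported_def)

lemma supported_run: "word d U ws ==> supported U v ==> supported U (run d ws v)"
 by (induction ws arbitrary: v) (auto simp: supported_grow)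

lemma run_fixes: "word d U ws ==> supported (- U) v ==> run d ws v = v"
proof (induction ws)
 case (Cons g ws)
 have "grow d g v = v"
  using Cons.prems by (cases g) (auto simp: supported_def prod_eq_iff fun_eq_iff)
 thus ?case using Cons by simp
qed simp

lemma pairing_grow:
 assumes "admissible d g" "\<And>i. 0 < d i"
 shows "pairing d (grow d g v) (grow d g w) = pairing d v w"
proof (cases g)
 case (Shift i j k)
 hence dv: "d i dvd d j" using assms by simp
 show ?thesis
 proof (cases "i = j")
  case False
  have q: "int (d i) * int (d j div d i) = int (d j)" using dv by (simp flip: of_nat_mult)
  have "pairing d (grow d g v) (grow d g w) = (\<Sum>m\<in>UNIV. int (d m) * (fst v m * snd w m - snd v m * fst w m) +
    (if m = j then int (d j) * k * (fst v j * fst w i - fst v i * fst w j) else 0) +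
    (if m = i then int (d i) * int (d j div d i) * k * (fst v i * fst w j - fst v j * fst w i) else 0))"
   unfolding pairing_def Shift using False by (intro sum.cong refl) (auto simp: algebra_simps)
  also have "\<dots> = pairing d v w"
   unfolding q sum.distrib by (simp add: pairing_def) (simp add: algebra_simps)
  finally show ?thesis .
 qed (simp add: Shift pairing_def algebra_simps, intro sum.cong, auto)
next
 case (Inversion i)
 thus ?thesis unfolding pairing_def by (intro sum.cong refl) (auto simp: algebra_simps)
qed

lemma pairing_run:
 assumes d: "\<And>i. 0 < d i" and "word d U ws"
 shows "pairing d (run d ws v) (run d ws w) = pairing d v w"
 using assms(2) by (induction ws arbitrary: v w) (auto simp: pairing_grow d)

definition indicator_row :: "'n => 'n => int" where
 "indicator_row i k = (if k = i then 1 else 0)"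

definition row_a :: "'n => 'n row" where "row_a i = (indicator_row i, %_. 0)"
definition row_b :: "'n => 'n row" where "row_b i = (%_. 0, indicator_row i)"

lemma pairing_row: "pairing d (row_a i) v = int (d i) * snd v i" "pairing d (row_b i) v = - int (d i) * fst v i"
proof -
 have "pairing d (row_a i) v = (\<Sum>k\<in>UNIV. if k = i then int (d i) * snd v i else 0)"
  "pairing d (row_b i) v = (\<Sum>k\<in>UNIV. if k = i then - int (d i) * fst v i else 0)"
  unfolding pairing_def by (intro sum.cong refl; simp add: row_a_def row_b_def indicator_row_def)+
 thus "pairing d (row_a i) v = int (d i) * snd v i" "pairing d (row_b i) v = - int (d i) * fst v i" by simp_all
qed

text \<open>The Euclidean algorithm on the two entries at i: inversion swaps them up to sign, a
  diagonal shift reduces one modulo the other.\<close>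

lemma euclid_plane:
 "\<exists>ws. word d {i} ws \<and> snd (run d ws v) i = 0 \<and>
   (\<forall>m. m ~= i --> fst (run d ws v) m = fst v m \<and> snd (run d ws v) m = snd v m)"
proof (induction "nat \<bar>snd v i\<bar>" arbitrary: v rule: less_induct)
 case less
 show ?case
 proof (cases "snd v i = 0")
  case True
  thus ?thesis by (intro exI[of _ "[]"]) simp
 next
  case False
  define k where "k = fst v i div snd v i"
  define w where "w = run d [Inversion i, Shift i i k] v"
  have wi: "snd w i = fst v i mod snd v i"
   by (simp add: w_def k_def minus_div_mult_eq_mod algebra_simps)
  have "nat \<bar>snd w i\<bar> < nat \<bar>snd v i\<bar>"
   unfolding wi using False by (simp add: abs_mod_less)
  from less[OF this] obtain ws where ws: "word d {i} ws" "snd (run d ws w) i = 0"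
   "\<And>m. m ~= i ==> fst (run d ws w) m = fst w m \<and> snd (run d ws w) m = snd w m" by blast
  show ?thesis
   by (rule exI[of _ "[Inversion i, Shift i i k] @ ws"]) (use ws in \<open>auto simp: w_def\<close>)
 qed
qed

lemma euclid_planes:
 "finite T ==> \<exists>ws. word d T ws \<and> (\<forall>i\<in>T. snd (run d ws v) i = 0)"
proof (induction T arbitrary: v rule: finite_induct)
 case (insert i T)
 obtain ws where ws: "word d T ws" "\<forall>j\<in>T. snd (run d ws v) j = 0" using insert.IH by blast
 obtain vs where vs: "word d {i} vs" "snd (run d vs (run d ws v)) i = 0"
  "\<And>m. m ~= i ==> snd (run d vs (run d ws v)) m = snd (run d ws v) m" using euclid_plane[of d i "run d ws v"] by blast
 have "word d (insert i T) (ws @ vs)" using ws(1) vs(1) by (auto elim: word_mono)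
 moreover have "\<forall>j\<in>insert i T. snd (run d (ws @ vs) v) j = 0" using ws vs by (metis insertE run_simps(3))
 ultimately show ?case by blast
qed (auto intro: exI[of _ "[]"])

text \<open>Shifts leave all first entries alone, so their effects on the second entry at i simply
  add up. In \<open>reduce_pair\<close> the total is made 1.\<close>

lemma shift_combination:
 assumes "finite T" "T \<subseteq> U" "i \<in> U" and dv: "\<And>k. k \<in> U ==> d i dvd d k" and d: "\<And>i. 0 < d i"
 shows "\<exists>ws. word d U ws \<and> fst (run d ws v) = fst v \<and>
   snd (run d ws v) i = snd v i + (\<Sum>k\<in>T. int (d k div d i) * fst v k * t k)"
 using assms(1,2)
proof (induction T rule: finite_induct)
 case (insert k T)
 then obtain ws where ws: "word d U ws" "fst (run d ws v) = fst v"
  "snd (run d ws v) i = snd v i + (\<Sum>k\<in>T. int (d k div d i) * fst v k * t k)" by auto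
 have "d i div d i = 1" using d[of i] by simp
 thus ?case
  by (intro exI[of _ "ws @ [Shift i k (t k)]"]) (use ws insert assms(3) dv in \<open>auto simp: algebra_simps\<close>)
qed (auto intro: exI[of _ "[]"])

text \<open>A first entry 1 at i clears all other entries by shifts. The last clause keeps intact
  the already reduced partner row, which after an inversion has only a second entry at i.\<close>

lemma clear_row:
 assumes U: "finite U" and i: "i \<in> U" and dv: "\<And>k. k \<in> U ==> d i dvd d k"
  and v: "supported U v" "fst v i = 1"
 shows "\<exists>ws. word d U ws \<and> run d ws v = row_a i \<and>
   (\<forall>r. (\<forall>k\<in>U. fst r k = 0 \<and> (k ~= i --> snd r k = 0)) --> run d ws r = r)"
proof -
 have clear: "\<exists>ws. word d U ws \<and> fst (run d ws v) i = 1 \<and> (\<forall>k\<in>T. fst (run d ws v) k = 0 \<and> snd (run d ws v) k = 0) \<and>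
   (\<forall>r. (\<forall>k\<in>U. fst r k = 0 \<and> (k ~= i --> snd r k = 0)) --> run d ws r = r)" if "finite T" "T \<subseteq> U - {i}" for T
  using that
 proof (induction T rule: finite_induct)
  case empty
  show ?case by (rule exI[of _ "[]"]) (use v in simp)
 next
  case (insert k T)
  then obtain ws where ws: "word d U ws" "fst (run d ws v) i = 1" "\<forall>k\<in>T. fst (run d ws v) k = 0 \<and> snd (run d ws v) k = 0"
   "\<And>r. (\<forall>k\<in>U. fst r k = 0 \<and> (k ~= i --> snd r k = 0)) ==> run d ws r = r" by auto
  define w where "w = run d ws v"
  \<comment> \<open>The first shift clears the second entry at k, the inversion moves the first
    entry into the vacated place, and the last shift clears it there.\<close>
  define vs where "vs = [Shift i k (- snd w k), Inversion k, Shift i k (- fst w k)]"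
  have k: "k \<in> U" "k ~= i" using insert.prems by auto
  have "run d vs r = r" if "\<forall>k\<in>U. fst r k = 0 \<and> (k ~= i --> snd r k = 0)" for r
   using that i k by (auto simp: vs_def prod_eq_iff fun_eq_iff)
  moreover have "word d U vs" using i k dv by (simp add: vs_def)
  moreover have "fst (run d vs w) i = 1 \<and> (\<forall>m\<in>insert k T. fst (run d vs w) m = 0 \<and> snd (run d vs w) m = 0)"
   using ws(2,3) k insert.prems insert.hyps by (auto simp: vs_def w_def[symmetric])
  ultimately show ?case
   by (intro exI[of _ "ws @ vs"]) (use ws in \<open>auto simp: w_def\<close>)
 qed
 from clear[of "U - {i}"] U obtain ws where ws: "word d U ws" "fst (run d ws v) i = 1"
  "\<forall>k\<in>U - {i}. fst (run d ws v) k = 0 \<and> snd (run d ws v) k = 0"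
  "\<And>r. (\<forall>k\<in>U. fst r k = 0 \<and> (k ~= i --> snd r k = 0)) ==> run d ws r = r" by auto
 define w where "w = run d ws v"
 have sw: "supported U w" unfolding w_def by (rule supported_run[OF ws(1) v(1)])
 have "run d [Shift i i (- snd w i)] w = row_a i"
  using sw ws(2,3) unfolding w_def[symmetric]
  by (auto simp: row_a_def indicator_row_def prod_eq_iff fun_eq_iff supported_def)
 thus ?thesis
  by (intro exI[of _ "ws @ [Shift i i (- snd w i)]"])
    (use ws i in \<open>auto simp: w_def prod_eq_iff fun_eq_iff\<close>)
qed

text \<open>Euclid's algorithm makes all second entries of v zero. The pairing with v' then exhibits
  1 as a combination of the numbers \<open>(d k / d i) * fst v k\<close>, which is where
  divisibility by d i enters; shifts install this 1 and \<open>clear_row\<close> finishes v.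
  Preservation of the pairing then forces the second entry of v' at i to be 1, and the same method
  reduces v' without disturbing v.\<close>

lemma reduce_pair:
 assumes d: "\<And>i. 0 < d i" and i: "i \<in> U" and dv: "\<And>k. k \<in> U ==> d i dvd d k"
  and v: "supported U v" and v': "supported U v'" and p: "pairing d v v' = int (d i)"
 shows "\<exists>ws. word d (U :: 'n::finite set) ws \<and> run d ws v = row_a i \<and> run d ws v' = row_b i"
proof -
 \<comment> \<open>The inverse of an inversion, moving the second entry at i to the first place with
   its sign.\<close>
 define J where "J = [Inversion i, Inversion i, Inversion i]"
 have J: "word d U J" "fst (run d J r) i = snd r i" for r using i by (simp_all add: J_def)
 obtain w1 where w1: "word d U w1" "\<And>k. k \<in> U ==> snd (run d w1 v) k = 0"
  using euclid_planes[of U d v] by auto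
 define v1 v1' where "v1 = run d w1 v" and "v1' = run d w1 v'"
 have s1: "supported U v1" unfolding v1_def by (rule supported_run[OF w1(1) v])
 have y0: "snd v1 k = 0" for k using s1 w1(2)[of k] by (cases "k \<in> U") (auto simp: supported_def v1_def)
 have x0: "fst v1 k = 0" if "k \<notin> U" for k using s1 that by (simp add: supported_def)
 have "int (d i) = pairing d v1 v1'" using p pairing_run[OF d w1(1), of v v'] by (simp add: v1_def v1'_def)
 also have "\<dots> = (\<Sum>k\<in>U. int (d k) * (fst v1 k * snd v1' k))"
  unfolding pairing_def by (rule sum.mono_neutral_cong_right) (use y0 x0 in auto)
 also have "\<dots> = int (d i) * (\<Sum>k\<in>U. int (d k div d i) * fst v1 k * snd v1' k)"
  unfolding sum_distrib_left
 proof (rule sum.cong[OF refl])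
  fix k assume "k \<in> U"
  hence "int (d k) = int (d i) * int (d k div d i)" using dv by (simp flip: of_nat_mult)
  thus "int (d k) * (fst v1 k * snd v1' k) = int (d i) * (int (d k div d i) * fst v1 k * snd v1' k)" by simp
 qed
 finally have sum1: "(\<Sum>k\<in>U. int (d k div d i) * fst v1 k * snd v1' k) = 1" using d[of i] by simp
 obtain w2 where w2: "word d U w2" "snd (run d w2 v1) i = 1"
  using shift_combination[of U U i d v1 "snd v1'"] i dv d sum1 y0 by auto
 define v3 where "v3 = run d J (run d w2 v1)"
 have "supported U v3" unfolding v3_def by (intro supported_run J w2(1) s1)
 moreover have "fst v3 i = 1" using w2 by (simp add: v3_def J)
 ultimately obtain w4 where w4: "word d U w4" "run d w4 v3 = row_a i"
  using clear_row[of U i d v3] i dv by auto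
 define ws where "ws = w1 @ w2 @ J @ w4"
 have ws: "word d U ws" "run d ws v = row_a i" using w1 w2 w4 J by (auto simp: ws_def v3_def v1_def)
 define v5 where "v5 = run d ws v'"
 have "int (d i) = int (d i) * snd v5 i"
  using p pairing_run[OF d ws(1), of v v'] ws(2) by (simp add: v5_def pairing_row)
 hence y5: "snd v5 i = 1" using d[of i] by simp
 have "supported U (run d J v5)" unfolding v5_def by (intro supported_run J ws(1) v')
 moreover have "fst (run d J v5) i = 1" using y5 by (simp add: J)
 ultimately obtain w6 where w6: "word d U w6" "run d w6 (run d J v5) = row_a i"
  "\<And>r. (\<forall>k\<in>U. fst r k = 0 \<and> (k ~= i --> snd r k = 0)) ==> run d w6 r = r"
  using clear_row[of U i d "run d J v5"] i dv by auto
 have Ja: "run d J (row_a i) = (%_. 0, %k. - indicator_row i k)"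
  by (auto simp: J_def row_a_def indicator_row_def fun_eq_iff)
 have "run d w6 (run d J (row_a i)) = run d J (row_a i)"
  unfolding Ja by (rule w6(3)) (simp add: indicator_row_def)
 hence "run d (ws @ J @ w6 @ [Inversion i]) v = row_a i"
  using ws(2) by (simp add: Ja) (auto simp: row_a_def indicator_row_def fun_eq_iff)
 moreover have "run d (ws @ J @ w6 @ [Inversion i]) v' = row_b i"
  using w6(2) by (simp add: v5_def) (auto simp: row_a_def row_b_def indicator_row_def fun_eq_iff)
 moreover have "word d U (ws @ J @ w6 @ [Inversion i])" using ws w6 J i by simp
 ultimately show ?thesis by blast
qed

text \<open>Indices are treated in increasing order, so that d i divides all d k still to come. The
  remaining rows are orthogonal to the finished pairs and hence supported on the remaining indices,
  where words do not disturb what has been achieved.\<close>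

theorem reduce_to_identity:
 fixes d :: "'n::{finite,linorder} => nat" and A B :: "'n => 'n row"
 assumes d: "\<And>i. 0 < d i" and dv: "\<And>i j. i <= j ==> d i dvd d j"
  and AA: "\<And>i j. pairing d (A i) (A j) = 0" and BB: "\<And>i j. pairing d (B i) (B j) = 0"
  and AB: "\<And>i j. pairing d (A i) (B j) = (if i = j then int (d i) else 0)"
 obtains ws where "word d UNIV ws" "\<And>i. run d ws (A i) = row_a i" "\<And>i. run d ws (B i) = row_b i"
proof -
 have anti: "pairing d v w = - pairing d w v" for v w
  unfolding pairing_def sum_negf[symmetric] by (intro sum.cong refl) (simp add: algebra_simps)
 have "\<exists>S ws. card S = n \<and> (\<forall>i\<in>S. \<forall>j\<le>i. j \<in> S) \<and> word d UNIV ws \<and>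
   (\<forall>i\<in>S. run d ws (A i) = row_a i \<and> run d ws (B i) = row_b i)" if "n <= CARD('n)" for n
  using that
 proof (induction n)
  case 0
  show ?case by (intro exI[of _ "{}"] exI[of _ "[]"]) simp
 next
  case (Suc n)
  then obtain S ws where S: "card S = n" "\<forall>i\<in>S. \<forall>j\<le>i. j \<in> S" and ws: "word d UNIV ws"
   "\<And>i. i \<in> S ==> run d ws (A i) = row_a i" "\<And>i. i \<in> S ==> run d ws (B i) = row_b i" by auto
  have "- S ~= {}"
  proof
   assume "- S = {}"
   hence "S = UNIV" by auto
   thus False using S(1) Suc.prems by simp
  qed
  define i where "i = Min (- S)"
  have i: "i \<in> - S" unfolding i_def using \<open>- S ~= {}\<close> by (intro Min_in) auto
  have le: "i <= k" if "k \<in> - S" for k unfolding i_def using that by (intro Min_le) auto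
  have sup: "supported (- S) (run d ws r)" if "\<And>j. j \<in> S ==> pairing d (A j) r = 0" "\<And>j. j \<in> S ==> pairing d (B j) r = 0" for r
   unfolding supported_def
  proof (intro allI impI conjI)
   fix k assume "k \<notin> - S"
   hence k: "k \<in> S" by simp
   show "snd (run d ws r) k = 0"
    using pairing_run[OF d ws(1), of "A k" r] that(1)[OF k] ws(2)[OF k] d[of k] by (simp add: pairing_row)
   show "fst (run d ws r) k = 0"
    using pairing_run[OF d ws(1), of "B k" r] that(2)[OF k] ws(3)[OF k] d[of k] by (simp add: pairing_row)
  qed
  have "supported (- S) (run d ws (A i))"
   by (rule sup) (use i AA AB anti[of "B j" "A i" for j] in auto)
  moreover have "supported (- S) (run d ws (B i))"
   by (rule sup) (use i BB AB in auto)
  moreover have "pairing d (run d ws (A i)) (run d ws (B i)) = int (d i)"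
   using pairing_run[OF d ws(1)] AB by simp
  ultimately have "\<exists>vs. word d (- S) vs \<and> run d vs (run d ws (A i)) = row_a i \<and> run d vs (run d ws (B i)) = row_b i"
   by (intro reduce_pair[where d = d, OF d i]) (use dv le in auto)
  then obtain vs where vs: "word d (- S) vs" "run d vs (run d ws (A i)) = row_a i" "run d vs (run d ws (B i)) = row_b i"
   by blast
  have fixed: "run d vs (row_a j) = row_a j" "run d vs (row_b j) = row_b j" if "j \<in> S" for j
   using that by (auto intro!: run_fixes[OF vs(1)] simp: supported_def row_a_def row_b_def indicator_row_def)
  have "card (insert i S) = Suc n" using S(1) i by simp
  moreover have "\<forall>k\<in>insert i S. \<forall>j\<le>k. j \<in> insert i S"
   using S(2) le by (metis ComplI insert_iff order.antisym order.trans)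
  moreover have "word d UNIV (ws @ vs)" using ws(1) vs(1) word_mono[OF vs(1)] by simp
  ultimately show ?case
   by (intro exI[of _ "insert i S"] exI[of _ "ws @ vs"]) (use ws vs fixed in auto)
 qed
 from this[of "CARD('n)"] obtain S :: "'n set" and ws where "card S = CARD('n)" "word d UNIV ws"
  "\<forall>i\<in>S. run d ws (A i) = row_a i \<and> run d ws (B i) = row_b i" by auto
 moreover hence "S = UNIV" by (simp add: card_eq_UNIV_imp_eq_UNIV)
 ultimately show ?thesis using that by auto
qed

lemma grow_inverse:
 assumes "admissible d g"
 obtains ws where "word d UNIV ws" "\<And>v. run d ws (grow d g v) = v"
proof (cases g)
 case (Shift i j k)
 have "run d [Shift i j (- k)] (grow d g v) = v" for v
  by (auto simp: Shift prod_eq_iff fun_eq_iff)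
 thus ?thesis using that[of "[Shift i j (- k)]"] assms Shift by simp
next
 case (Inversion i)
 have "run d [Inversion i, Inversion i, Inversion i] (grow d g v) = v" for v
  by (auto simp: Inversion prod_eq_iff fun_eq_iff)
 thus ?thesis using that[of "[Inversion i, Inversion i, Inversion i]"] by simp
qed

section \<open>From rows to the automorphy of functions\<close>

definition blocks :: "('n => 'n row) => ('n => 'n row) => 'n::finite block_matrix" where
 "blocks A B = (\<chi> i j. of_int (fst (A i) j), \<chi> i j. of_int (snd (A i) j),
         \<chi> i j. of_int (fst (B i) j), \<chi> i j. of_int (snd (B i) j))"

definition row_value :: "('n => nat) => 'n::finite row => complex^'n^'n => complex^'n" where
 "row_value d v Z = (\<chi> b. (\<Sum>a\<in>UNIV. of_int (fst v a) * Z $ a $ b) + of_int (snd v b) * of_nat (d b))"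

lemma diag_matrix_mult: "(M ** diag_matrix d) $ i $ j = M $ i $ j * of_nat (d j)"
 by (simp add: matrix_matrix_mult_def diag_matrix_def if_distrib cong: if_cong)

lemma numerator_blocks:
 "(\<chi> i j. of_int (fst (A i) j)) ** Z + (\<chi> i j. of_int (snd (A i) j)) ** diag_matrix d = (\<chi> i. row_value d (A i) Z)"
 by (simp add: vec_eq_iff diag_matrix_mult row_value_def) (simp add: matrix_matrix_mult_def)

lemma denominator_blocks: "denominator d (blocks A B) Z = matrix_inv (diag_matrix d) ** (\<chi> i. row_value d (B i) Z)"
 by (simp add: denominator_def blocks_def numerator_blocks)

lemma siegel_action_blocks:
 "siegel_action d (blocks A B) Z = (\<chi> i. row_value d (A i) Z) ** matrix_inv (denominator d (blocks A B) Z)"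
 by (simp add: siegel_action_def blocks_def numerator_blocks)

lemma
 fixes A :: "'a::field^'n^'n"
 assumes "invertible A"
 shows matrix_inv_right: "A ** matrix_inv A = mat 1" and matrix_inv_left: "matrix_inv A ** A = mat 1"
 using someI_ex[OF assms[unfolded invertible_def]] by (simp_all add: matrix_inv_def)

lemma matrix_inv_mult:
 fixes A B :: "'a::field^'n^'n"
 assumes A: "invertible A" and B: "invertible B"
 shows "matrix_inv (A ** B) = matrix_inv B ** matrix_inv A"
proof -
 have "(matrix_inv B ** matrix_inv A) ** (A ** B) = matrix_inv B ** (matrix_inv A ** A) ** B" by (simp only: matrix_mul_assoc)
 hence l: "(matrix_inv B ** matrix_inv A) ** (A ** B) = mat 1" by (simp add: matrix_inv_left A B)
 have "matrix_inv B ** matrix_inv A = (matrix_inv B ** matrix_inv A) ** ((A ** B) ** matrix_inv (A ** B))"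
  by (simp add: matrix_inv_right invertible_mult A B)
 also have "\<dots> = matrix_inv (A ** B)" unfolding matrix_mul_assoc using l by (simp add: matrix_mul_assoc)
 finally show ?thesis ..
qed

lemma invertible_mat_one: "invertible (mat 1 :: 'a::field^'n^'n)"
 unfolding invertible_def by (metis matrix_mul_lid)

lemma matrix_inv_one: "matrix_inv (mat 1 :: 'a::field^'n^'n) = mat 1"
 using matrix_inv_left[OF invertible_mat_one] by simp

lemma diag_matrix_inv:
 fixes d :: "'n::finite => nat"
 assumes d: "\<And>i. 0 < d i"
 shows "matrix_inv (diag_matrix d) ** diag_matrix d = mat 1"
proof -
 have "diag_matrix d ** (\<chi> i j. if i = j then 1 / of_nat (d i) else 0) = mat 1"
  (is "_ ** ?E = _")
 proof -
  have "(diag_matrix d ** ?E) $ i $ j = (\<Sum>k\<in>UNIV. if k = i then mat 1 $ i $ j else 0)" for i j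
   unfolding matrix_matrix_mult_def vec_lambda_beta using d[of i]
   by (intro sum.cong refl) (auto simp: diag_matrix_def mat_def)
  thus ?thesis by (simp add: vec_eq_iff)
 qed
 hence "invertible (diag_matrix d)" using invertible_right_inverse by blast
 thus ?thesis by (rule matrix_inv_left)
qed

text \<open>The cocycle relation for a generator. One matrix G serves all rows: it cancels in the
  action and contributes its determinant to the automorphy factor.\<close>

lemma row_value_generator:
 fixes d :: "'n::finite => nat"
 assumes Z: "Z \<in> siegel" and d: "\<And>i. 0 < d i" and g: "admissible d g"
 obtains G :: "complex^'n^'n" where "invertible G" "det G = gden d g Z"
  "\<And>v. row_value d (grow d g v) Z = row_value d v (gact d g Z) v* G"
proof (cases g)
 case (Shift i j k)
 have q: "of_nat (d j div d i) * of_nat (d i) = (of_nat (d j) :: complex)"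
  using g Shift by (simp flip: of_nat_mult)
 have "row_value d (grow d g v) Z = row_value d v (gact d g Z)" for v
 proof -
  have "(\<Sum>a\<in>UNIV. of_int (fst v a) * (if (a = i \<and> b = j) \<or> (a = j \<and> b = i) then of_int k * of_nat (d j) else 0)) =
    (if b = j then of_int (k * fst v i) * of_nat (d j) else 0) +
    (if b = i \<and> i ~= j then of_int k * of_nat (d j) * of_int (fst v j) else (0 :: complex))" for b
  proof -
   have "(\<Sum>a\<in>UNIV. of_int (fst v a) * (if (a = i \<and> b = j) \<or> (a = j \<and> b = i) then of_int k * of_nat (d j) else 0)) =
    (\<Sum>a\<in>UNIV. (if a = i then (if b = j then of_int (k * fst v i) * of_nat (d j) else 0) else 0) +
     (if a = j then (if b = i \<and> i ~= j then of_int k * of_nat (d j) * of_int (fst v j) else 0) else (0 :: complex)))"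
    by (intro sum.cong refl) auto
   thus ?thesis by (simp add: sum.distrib)
  qed
  thus ?thesis
   using q by (simp add: vec_eq_iff row_value_def Shift distrib_left sum.distrib) (auto simp: algebra_simps)
 qed
 thus ?thesis using that[of "mat 1"] by (simp add: Shift invertible_mat_one vector_matrix_mul_rid)
next
 case (Inversion i)
 define x :: "complex^'n" where "x = (\<chi> b. - Z $ i $ b / of_nat (d i))"
 \<comment> \<open>The identity with row i replaced by x, so Cramer's rule for the transpose gives
   the determinant \<open>x $ i\<close>.\<close>
 define G :: "complex^'n^'n" where "G = (\<chi> a b. if a = i then x $ b else mat 1 $ a $ b)"
 have z0: "Z $ i $ i ~= 0" using siegel_diagonal_pos[OF Z, of i] by auto
 have di: "of_nat (d i) ~= (0::complex)" using d[of i] by simp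
 have "transpose G = (\<chi> a b. if b = i then (mat 1 *v x) $ a else mat 1 $ a $ b)"
  by (simp add: vec_eq_iff transpose_def G_def) (simp add: mat_def)
 hence "det (transpose G) = x $ i * det (mat 1 :: complex^'n^'n)" by (simp only: cramer_lemma)
 hence detG: "det G = gden d g Z" by (simp add: Inversion x_def det_transpose)
 have inv: "invertible G" using gden_nonzero[where d = d, OF Z d, of g] detG by (simp add: invertible_det_nz)
 have sym: "Z $ a $ b = Z $ b $ a" for a b using Z by (simp add: siegel_def transpose_def vec_eq_iff)
 have vG: "(y v* G) $ b = y $ i * x $ b + (if b = i then 0 else y $ b)" for y :: "complex^'n" and b
 proof -
  have "(y v* G) $ b = (\<Sum>a\<in>UNIV. (if a = i then y $ i * x $ b else 0) + (if a = b then (if b = i then 0 else y $ b) else 0))"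
   unfolding vector_matrix_mult_def vec_lambda_beta by (intro sum.cong refl) (auto simp: G_def mat_def)
  thus ?thesis by (simp add: sum.distrib)
 qed
 have JZ: "inversion d i Z $ a $ i * x $ b + (if b = i then 0 else inversion d i Z $ a $ b) =
   (if a = i then (if b = i then of_nat (d i) else 0) else Z $ a $ b)" for a b
  using z0 di sym[of a i] by (auto simp: inversion_def inversion_row_def x_def field_simps)
 have "row_value d (grow d g v) Z = row_value d v (gact d g Z) v* G" for v
  unfolding vec_eq_iff
 proof
  fix b
  have "(row_value d v (inversion d i Z) v* G) $ b =
    (\<Sum>a\<in>UNIV. of_int (fst v a) * (inversion d i Z $ a $ i * x $ b + (if b = i then 0 else inversion d i Z $ a $ b))) +
    of_int (snd v i) * of_nat (d i) * x $ b + (if b = i then 0 else of_int (snd v b) * of_nat (d b))"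
   unfolding vG by (simp add: row_value_def algebra_simps sum.distrib sum_distrib_left)
  also have "\<dots> = (\<Sum>a\<in>UNIV. (if a = i then of_int (fst v i) * (if b = i then of_nat (d i) else 0) else of_int (fst v a) * Z $ a $ b)) -
    of_int (snd v i) * Z $ i $ b + (if b = i then 0 else of_int (snd v b) * of_nat (d b))"
  proof -
   have "of_int (snd v i) * of_nat (d i) * x $ b = - (of_int (snd v i) * Z $ i $ b)" using di by (simp add: x_def)
   moreover have "(\<Sum>a\<in>UNIV. of_int (fst v a) * (if a = i then (if b = i then of_nat (d i) else 0) else Z $ a $ b)) =
     (\<Sum>a\<in>UNIV. if a = i then of_int (fst v i) * (if b = i then of_nat (d i) else 0) else of_int (fst v a) * Z $ a $ b)"
    by (intro sum.cong refl) auto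
   ultimately show ?thesis unfolding JZ by simp
  qed
  also have "(\<Sum>a\<in>UNIV. (if a = i then of_int (fst v i) * (if b = i then of_nat (d i) else 0) else of_int (fst v a) * Z $ a $ b)) =
    of_int (fst v i) * (if b = i then of_nat (d i) else 0) + (\<Sum>a\<in>UNIV - {i}. of_int (fst v a) * Z $ a $ b)"
   by (subst sum.remove[of _ i]) auto
  also have "\<dots> - of_int (snd v i) * Z $ i $ b + (if b = i then 0 else of_int (snd v b) * of_nat (d b)) = row_value d (grow d g v) Z $ b"
   unfolding row_value_def Inversion by (subst (2) sum.remove[of _ i]) auto
  finally show "row_value d (grow d g v) Z $ b = (row_value d v (gact d g Z) v* G) $ b" by (simp add: Inversion)
 qed
 thus ?thesis using that[OF inv detG] by blast
qed

text \<open>Invertibility of the denominator and stability of the Siegel space are bundled with the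
  transformation law because an induction over words needs all three together.\<close>

definition automorphic_at :: "('n::finite => nat) => nat => (complex^'n^'n => complex) => 'n block_matrix => bool" where
 "automorphic_at d k F R \<longleftrightarrow> (\<forall>Z\<in>siegel. invertible (denominator d R Z) \<and> siegel_action d R Z \<in> siegel \<and>
   F (siegel_action d R Z) = det (denominator d R Z) ^ k * F Z)"

lemma automorphic_at_generator:
 fixes d :: "'n::finite => nat"
 assumes d: "\<And>i. 0 < d i" and g: "admissible d g"
  and F: "\<And>Z. Z \<in> siegel ==> F (gact d g Z) = gden d g Z ^ k * F Z"
  and AB: "automorphic_at d k F (blocks A B)"
 shows "automorphic_at d k F (blocks (%i. grow d g (A i)) (%i. grow d g (B i)))"
 unfolding automorphic_at_def
proof
 fix Z :: "complex^'n^'n" assume Z: "Z \<in> siegel"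
 obtain G :: "complex^'n^'n" where G: "invertible G" "det G = gden d g Z"
  "\<And>v. row_value d (grow d g v) Z = row_value d v (gact d g Z) v* G"
  using row_value_generator[where d = d, OF Z d g] by blast
 have Z': "gact d g Z \<in> siegel" by (rule gact_siegel[where d = d, OF Z d])
 define N where "N = denominator d (blocks A B) (gact d g Z)"
 have N: "invertible N" "siegel_action d (blocks A B) (gact d g Z) \<in> siegel"
  "F (siegel_action d (blocks A B) (gact d g Z)) = det N ^ k * F (gact d g Z)"
  using AB Z' by (auto simp: automorphic_at_def N_def)
 have rows: "(\<chi> i. row_value d (grow d g (C i)) Z) = (\<chi> i. row_value d (C i) (gact d g Z)) ** G" for C :: "'n => 'n row"
  by (simp add: vec_eq_iff G(3) vector_matrix_mult_def matrix_matrix_mult_def mult.commute)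
 have den: "denominator d (blocks (%i. grow d g (A i)) (%i. grow d g (B i))) Z = N ** G"
  by (simp add: denominator_blocks rows N_def matrix_mul_assoc)
 have "siegel_action d (blocks (%i. grow d g (A i)) (%i. grow d g (B i))) Z =
   (\<chi> i. row_value d (A i) (gact d g Z)) ** (G ** (matrix_inv G ** matrix_inv N))"
  unfolding siegel_action_blocks den rows matrix_inv_mult[OF N(1) G(1)] by (simp add: matrix_mul_assoc)
 also have "G ** (matrix_inv G ** matrix_inv N) = matrix_inv N"
  using G(1) by (simp add: matrix_mul_assoc matrix_inv_right)
 finally have act: "siegel_action d (blocks (%i. grow d g (A i)) (%i. grow d g (B i))) Z = siegel_action d (blocks A B) (gact d g Z)"
  by (simp add: siegel_action_blocks N_def)
 show "invertible (denominator d (blocks (%i. grow d g (A i)) (%i. grow d g (B i))) Z) \<and>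
   siegel_action d (blocks (%i. grow d g (A i)) (%i. grow d g (B i))) Z \<in> siegel \<and>
   F (siegel_action d (blocks (%i. grow d g (A i)) (%i. grow d g (B i))) Z) =
    det (denominator d (blocks (%i. grow d g (A i)) (%i. grow d g (B i))) Z) ^ k * F Z"
  unfolding act den using N G F[OF Z] by (simp add: invertible_mult det_mul power_mult_distrib)
qed

lemma automorphic_at_identity:
 fixes d :: "'n::finite => nat"
 assumes d: "\<And>i. 0 < d i"
 shows "automorphic_at d k F (blocks row_a row_b)"
proof -
 have value_a: "(\<chi> i. row_value d (row_a i) Z) = Z" for Z
  by (simp add: vec_eq_iff row_value_def row_a_def indicator_row_def if_distrib if_distribR cong: if_cong)
 have value_b: "(\<chi> i. row_value d (row_b i) Z) = diag_matrix d" for Z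
  by (auto simp: vec_eq_iff row_value_def row_b_def indicator_row_def diag_matrix_def)
 have den: "denominator d (blocks row_a row_b) Z = mat 1" for Z
  by (simp add: denominator_blocks value_b diag_matrix_inv d)
 have act: "siegel_action d (blocks row_a row_b) Z = Z" for Z
  by (simp add: siegel_action_blocks den value_a matrix_inv_one)
 show ?thesis unfolding automorphic_at_def den act by (simp add: invertible_mat_one)
qed

text \<open>An equivalence is needed: the reduction word leads from the given matrix to the
  identity, where the law is known, and the law has to be carried back by inverse words.\<close>

lemma automorphic_at_run:
 fixes d :: "'n::finite => nat"
 assumes d: "\<And>i. 0 < d i"
  and F: "\<And>g Z. admissible d g ==> Z \<in> siegel ==> F (gact d g Z) = gden d g Z ^ k * F Z"
  and "word d UNIV ws"
 shows "automorphic_at d k F (blocks (%i. run d ws (A i)) (%i. run d ws (B i))) \<longleftrightarrow> automorphic_at d k F (blocks A B)"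
proof -
 have step: "automorphic_at d k F (blocks (%i. run d vs (A i)) (%i. run d vs (B i)))"
  if "word d UNIV vs" "automorphic_at d k F (blocks A B)" for vs A B
  using that
 proof (induction vs arbitrary: A B)
  case (Cons g vs)
  have "automorphic_at d k F (blocks (%i. grow d g (A i)) (%i. grow d g (B i)))"
   by (rule automorphic_at_generator) (use Cons.prems d F in auto)
  from Cons.IH[OF _ this] show ?case using Cons.prems by simp
 qed simp
 have "automorphic_at d k F (blocks A B)"
  if "word d UNIV ws" "automorphic_at d k F (blocks (%i. run d ws (A i)) (%i. run d ws (B i)))" for A B ws
  using that
 proof (induction ws arbitrary: A B)
  case (Cons g ws)
  have "automorphic_at d k F (blocks (%i. grow d g (A i)) (%i. grow d g (B i)))"
   by (rule Cons.IH) (use Cons.prems in auto)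
  moreover obtain vs where "word d UNIV vs" "\<And>v. run d vs (grow d g v) = v"
   using grow_inverse Cons.prems by (metis word_simps(2))
  ultimately show ?case using step[of vs "%i. grow d g (A i)" "%i. grow d g (B i)"] by simp
 qed simp
 thus ?thesis using step assms(3) by blast
qed

lemma paramodular_blocks:
 fixes d :: "'n::finite => nat"
 assumes R: "R \<in> paramodular_group d"
 obtains A B where "R = blocks A B" "\<And>i j. pairing d (A i) (A j) = 0" "\<And>i j. pairing d (B i) (B j) = 0"
  "\<And>i j. pairing d (A i) (B j) = (if i = j then int (d i) else 0)"
proof -
 obtain \<alpha> \<beta> \<gamma> \<delta> where R_eq: "R = (\<alpha>, \<beta>, \<gamma>, \<delta>)" by (cases R) auto
 define A B where "A i = (%j. \<lfloor>Re (\<alpha> $ i $ j)\<rfloor>, %j. \<lfloor>Re (\<beta> $ i $ j)\<rfloor>)"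
  and "B i = (%j. \<lfloor>Re (\<gamma> $ i $ j)\<rfloor>, %j. \<lfloor>Re (\<delta> $ i $ j)\<rfloor>)" for i
 have floor: "of_int \<lfloor>Re (M $ i $ j)\<rfloor> = M $ i $ j" if "integral_matrix M" for M :: "complex^'n^'n" and i j
 proof -
  have "M $ i $ j \<in> \<int>" using that by (simp add: integral_matrix_def)
  thus ?thesis by (auto elim: Ints_cases)
 qed
 have int: "integral_matrix \<alpha>" "integral_matrix \<beta>" "integral_matrix \<gamma>" "integral_matrix \<delta>"
  using R by (auto simp: R_eq paramodular_group_def)
 have 1: "R = blocks A B" by (simp add: R_eq blocks_def A_def B_def vec_eq_iff floor int)
 have pair: "of_int (pairing d v w) =
   (\<Sum>k\<in>UNIV. of_int (fst v k) * of_nat (d k) * of_int (snd w k)) - (\<Sum>k\<in>UNIV. of_int (snd v k) * of_nat (d k) * (of_int (fst w k) :: complex))" for v w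
  by (simp add: pairing_def right_diff_distrib sum_subtractf mult_ac)
 have prod: "(M ** diag_matrix d ** transpose M') $ i $ j = (\<Sum>k\<in>UNIV. M $ i $ k * of_nat (d k) * M' $ j $ k)" for M M' :: "complex^'n^'n" and i j
  unfolding matrix_matrix_mult_def[of "M ** diag_matrix d"] by (simp add: diag_matrix_mult transpose_def)
 have "\<alpha> ** diag_matrix d ** transpose \<beta> = \<beta> ** diag_matrix d ** transpose \<alpha>"
  "\<gamma> ** diag_matrix d ** transpose \<delta> = \<delta> ** diag_matrix d ** transpose \<gamma>"
  "\<alpha> ** diag_matrix d ** transpose \<delta> - \<beta> ** diag_matrix d ** transpose \<gamma> = diag_matrix d"
  using R by (auto simp: R_eq paramodular_group_def)
 note this[unfolded vec_eq_iff vector_minus_component prod]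
 hence "(of_int (pairing d (A i) (A j)) :: complex) = of_int 0" "(of_int (pairing d (B i) (B j)) :: complex) = of_int 0"
  "(of_int (pairing d (A i) (B j)) :: complex) = of_int (if i = j then int (d i) else 0)" for i j
  unfolding pair by (simp_all add: A_def B_def floor int diag_matrix_def)
 note this[unfolded of_int_eq_iff]
 from that[OF 1 this] show ?thesis .
qed

theorem automorphic_if_generators:
 fixes d :: "'n::{finite,linorder} => nat"
 assumes d: "\<And>i. 0 < d i" and dv: "\<And>i j. i <= j ==> d i dvd d j"
  and F: "\<And>g Z. admissible d g ==> Z \<in> siegel ==> F (gact d g Z) = gden d g Z ^ k * F Z"
  and R: "R \<in> paramodular_group d"
 shows "automorphic_at d k F R"
proof -
 obtain A B where R_eq: "R = blocks A B" and AB: "\<And>i j. pairing d (A i) (A j) = 0" "\<And>i j. pairing d (B i) (B j) = 0"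
  "\<And>i j. pairing d (A i) (B j) = (if i = j then int (d i) else 0)"
  using paramodular_blocks[OF R] by metis
 obtain ws where ws: "word d UNIV ws" "\<And>i. run d ws (A i) = row_a i" "\<And>i. run d ws (B i) = row_b i"
  using reduce_to_identity[where A = A and B = B and d = d, OF d dv AB] by blast
 show ?thesis
  using automorphic_at_run[where F = F and k = k and d = d, OF d F ws(1), of A B] automorphic_at_identity[where d = d and F = F and k = k, OF d]
  unfolding ws(2,3) R_eq by simp
qed

section \<open>The action of the generators on vectors of theta constants\<close>

definition dperiodic :: "('n => nat) => (('n => int) => complex) => bool" where
 "dperiodic d c \<longleftrightarrow> (\<forall>u w. dcong d 2 u w --> c u = c w)"

lemma dperiodicD: "dperiodic d c ==> dcong d 2 u w ==> c u = c w"
 by (simp add: dperiodic_def)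

lemma dperiodic_theta_null: "dperiodic d (theta_null d Z)"
 unfolding dperiodic_def theta_null_eq
 by (intro allI impI infsum_cong if_cong refl) (meson dcong_sym dcong_trans)

text \<open>By \<open>foldr\<close> the last letter acts first, so \<open>w @ [g]\<close> applies g
  and then w.\<close>

definition grun :: "('n => nat) => 'n generator list => (('n => int) => complex) => ('n => int) => complex" where
 "grun d ws = foldr (gop d) ws"

lemma grun_simps [simp]:
 "grun d [] c = c"
 "grun d (g # ws) c = gop d g (grun d ws c)"
 "grun d (ws @ vs) c = grun d ws (grun d vs c)"
 by (simp_all add: grun_def)

lemma expi_div_cong:
 assumes "int (d i) > 0" "int (2 * d i) dvd m - n"
 shows "expi (of_int m / of_nat (2 * d i)) = expi (of_int n / of_nat (2 * d i))"
proof -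
 from assms(2) obtain s where "m = n + int (2 * d i) * s" by (metis dvdE add.commute diff_add_cancel)
 hence "of_int m / of_nat (2 * d i) = of_int n / of_nat (2 * d i) + (of_int s :: complex)"
  using assms(1) by (simp add: field_simps)
 thus ?thesis by (simp only: expi_add) simp
qed

lemma dcong_update: "dcong d k u w ==> dcong d k (u(i := l)) (w(i := l))"
 by (simp add: dcong_def)

context
 fixes d :: "'n::finite => nat"
 assumes d: "\<And>i. 0 < d i"
begin

lemma dperiodic_gop:
 assumes "admissible d g" "dperiodic d c"
 shows "dperiodic d (gop d g c)"
 unfolding dperiodic_def
proof (intro allI impI)
 fix u w assume uw: "dcong d 2 u w"
 show "gop d g c u = gop d g c w"
 proof (cases g)
  case (Shift i j k)
  show ?thesis
   using shift_phase_cong[where d = d, OF d _ uw, of i j k] assms(1) dperiodicD[OF assms(2) uw] unfolding Shift by simp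
 next
  case (Inversion i)
  have "expi (of_int (l * u i) / of_nat (2 * d i)) * c (u(i := l)) = expi (of_int (l * w i) / of_nat (2 * d i)) * c (w(i := l))" for l
  proof -
   have "int (2 * d i) dvd l * u i - l * w i"
    using uw by (simp add: dcong_def flip: right_diff_distrib)
   thus ?thesis
    using expi_div_cong[of d i "l * u i" "l * w i"] d[of i] dperiodicD[OF assms(2) dcong_update[OF uw]] by simp
  qed
  thus ?thesis unfolding Inversion gop.simps by simp
 qed
qed

lemma dperiodic_grun: "word d UNIV ws ==> dperiodic d c ==> dperiodic d (grun d ws c)"
 by (induction ws) (auto intro: dperiodic_gop)

lemma gop_sum: "gop d g (%u. \<Sum>i\<in>I. a i * f i u) = (%u. \<Sum>i\<in>I. a i * gop d g (f i) u)"
proof (cases g)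
 case (Shift i j k)
 show ?thesis unfolding Shift gop.simps sum_distrib_left by (intro ext sum.cong refl) (simp only: mult_ac)
next
 case (Inversion i)
 have "(\<Sum>l\<in>L. e l * (\<Sum>i\<in>I. a i * f i (\<phi> l))) / r = (\<Sum>i\<in>I. a i * ((\<Sum>l\<in>L. e l * f i (\<phi> l)) / r))" for L :: "int set" and e \<phi> r
  unfolding sum_distrib_left sum_divide_distrib by (subst sum.swap) (simp add: mult_ac)
 thus ?thesis by (simp add: Inversion fun_eq_iff)
qed

lemma grun_sum: "grun d ws (%u. \<Sum>i\<in>I. a i * f i u) = (%u. \<Sum>i\<in>I. a i * grun d ws (f i) u)"
 by (induction ws) (auto simp: gop_sum)

lemma grun_scale: "grun d ws (%u. a * f u) = (%u. a * grun d ws f u)"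
 using grun_sum[where I = "{0 :: nat}" and a = "%_. a" and f = "%_. f"] by simp

lemma gop_scale: "gop d g (%u. a * f u) = (%u. a * gop d g f u)"
 using grun_scale[of "[g]"] by simp

lemma inversion_twice:
 assumes "dperiodic d c"
 shows "gop d (Inversion i) (gop d (Inversion i) c) u = c (u(i := - u i))"
proof -
 define N where "N = 2 * int (d i)"
 have N: "N > 0" using d[of i] by (simp add: N_def)
 have cN: "complex_of_nat (2 * d i) = of_int N" by (simp add: N_def)
 have sq: "(of_real (sqrt (2 * real (d i))) :: complex) * of_real (sqrt (2 * real (d i))) = of_int N"
 proof -
  have "sqrt (2 * real (d i)) * sqrt (2 * real (d i)) = real_of_int N" by (simp add: N_def)
  thus ?thesis by (metis of_real_mult of_real_of_int_eq)
 qed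
 have "gop d (Inversion i) (gop d (Inversion i) c) u =
  (\<Sum>l\<in>{0..<N}. \<Sum>m\<in>{0..<N}. expi (of_int (l * u i) / of_int N) * expi (of_int (m * l) / of_int N) * c (u(i := m))) / of_int N"
  unfolding gop.simps cN N_def[symmetric] sq[symmetric]
  by (simp add: sum_distrib_left sum_divide_distrib mult_ac)
 also have "\<dots> = (\<Sum>m\<in>{0..<N}. c (u(i := m)) * (\<Sum>l\<in>{0..<N}. expi (of_int (u i + m) * of_int l / of_int N))) / of_int N"
 proof -
  have "expi (of_int (l * u i) / of_int N) * expi (of_int (m * l) / of_int N) = expi (of_int (u i + m) * of_int l / of_int N)" for l m
   unfolding expi_add[symmetric] add_divide_distrib[symmetric] by (simp add: algebra_simps)
  thus ?thesis by (simp only:) (subst sum.swap, simp add: sum_distrib_left mult.commute)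
 qed
 also have "\<dots> = (\<Sum>m\<in>{0..<N}. if m = (- u i) mod N then c (u(i := - u i)) * of_int N else 0) / of_int N"
 proof -
  have "c (u(i := m)) * (\<Sum>l\<in>{0..<N}. expi (of_int (u i + m) * of_int l / of_int N)) =
    (if m = (- u i) mod N then c (u(i := - u i)) * of_int N else 0)" if "m \<in> {0..<N}" for m
  proof -
   have "N dvd u i + m \<longleftrightarrow> m = (- u i) mod N"
   proof -
    have "N dvd u i + m \<longleftrightarrow> m mod N = (- u i) mod N"
     using mod_eq_dvd_iff[of m N "- u i"] by (simp add: add.commute)
    thus ?thesis using that by simp
   qed
   moreover have "c (u(i := m)) = c (u(i := - u i))" if "N dvd u i + m"
    by (rule dperiodicD[OF assms]) (use that in \<open>simp add: dcong_def N_def add.commute\<close>)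
   ultimately show ?thesis unfolding sum_expi_div[OF N] by auto
  qed
  thus ?thesis by simp
 qed
 also have "\<dots> = c (u(i := - u i))" using N by simp
 finally show ?thesis .
qed

lemma inversion_four_times:
 assumes c: "dperiodic d c"
 shows "gop d (Inversion i) (gop d (Inversion i) (gop d (Inversion i) (gop d (Inversion i) c))) = c"
proof
 fix u
 have "dperiodic d (gop d (Inversion i) (gop d (Inversion i) c))"
  using dperiodic_grun[of "[Inversion i, Inversion i]" c] c by simp
 from inversion_twice[OF this, of i u] inversion_twice[OF c, of i "u(i := - u i)"]
 show "gop d (Inversion i) (gop d (Inversion i) (gop d (Inversion i) (gop d (Inversion i) c))) u = c u"
  by (simp del: gop.simps)
qed

lemma gop_inverse:
 assumes "admissible d g"
 obtains vs where "word d UNIV vs" "\<And>c. dperiodic d c ==> grun d vs (gop d g c) = c"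
  "\<And>c. dperiodic d c ==> gop d g (grun d vs c) = c"
proof (cases g)
 case (Shift i j k)
 have "gop d (Shift i j (- k)) (gop d (Shift i j k) c) = c" "gop d (Shift i j k) (gop d (Shift i j (- k)) c) = c" for c
  by (simp_all add: fun_eq_iff expi_minus)
 thus ?thesis using that[of "[Shift i j (- k)]"] assms by (simp add: Shift)
next
 case (Inversion i)
 thus ?thesis using that[of "[Inversion i, Inversion i, Inversion i]"] inversion_four_times by simp
qed

lemma grun_inverse:
 assumes "word d UNIV ws"
 obtains vs where "word d UNIV vs" "\<And>c. dperiodic d c ==> grun d vs (grun d ws c) = c"
  "\<And>c. dperiodic d c ==> grun d ws (grun d vs c) = c"
 using assms
proof (induction ws arbitrary: thesis)
 case Nil
 thus ?case by (metis grun_simps(1) word_simps(1))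
next
 case (Cons g ws)
 obtain vs where vs: "word d UNIV vs" "\<And>c. dperiodic d c ==> grun d vs (grun d ws c) = c"
  "\<And>c. dperiodic d c ==> grun d ws (grun d vs c) = c" using Cons.IH Cons.prems(2) by auto
 obtain us where us: "word d UNIV us" "\<And>c. dperiodic d c ==> grun d us (gop d g c) = c"
  "\<And>c. dperiodic d c ==> gop d g (grun d us c) = c" using gop_inverse Cons.prems(2) by (metis word_simps(2))
 have w: "word d UNIV ws" using Cons.prems(2) by simp
 show ?case
 proof (rule Cons.prems(1))
  show "word d UNIV (vs @ us)" using vs us by simp
  show "grun d (vs @ us) (grun d (g # ws) c) = c" if "dperiodic d c" for c
   using that vs(2) us(2) dperiodic_grun[OF w] by simp
  show "grun d (g # ws) (grun d (vs @ us) c) = c" if "dperiodic d c" for c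
   using that vs(3) us(3) dperiodic_grun[OF us(1)] by simp
 qed
qed

section \<open>The finite Heisenberg group\<close>

text \<open>Translation by a times the character of b: the operators of the finite Heisenberg group.
  Each generator conjugates them among themselves up to roots of unity.\<close>

definition heis :: "('n => int) => ('n => int) => (('n => int) => complex) => ('n => int) => complex" where
 "heis a b c u = (\<Prod>k\<in>UNIV. expi (of_int (b k * u k) / of_nat (2 * d k))) * c (%k. u k + a k)"

lemma heis_cong:
 assumes "dperiodic d c" "dcong d 2 a a'" "dcong d 2 b b'"
 shows "heis a b c = heis a' b' c"
proof
 fix u
 have "c (%k. u k + a k) = c (%k. u k + a' k)"
  by (rule dperiodicD[OF assms(1)]) (use assms(2) in \<open>simp add: dcong_def\<close>)
 moreover have "expi (of_int (b k * u k) / of_nat (2 * d k)) = expi (of_int (b' k * u k) / of_nat (2 * d k))" for k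
  using expi_div_cong[of d k "b k * u k" "b' k * u k"] d[of k] assms(3) by (simp add: dcong_def flip: left_diff_distrib)
 ultimately show "heis a b c u = heis a' b' c u" by (simp add: heis_def)
qed

lemma dperiodic_heis:
 assumes "dperiodic d c"
 shows "dperiodic d (heis a b c)"
 unfolding dperiodic_def
proof (intro allI impI)
 fix u w assume uw: "dcong d 2 u w"
 have "c (%k. u k + a k) = c (%k. w k + a k)"
  by (rule dperiodicD[OF assms]) (use uw in \<open>simp add: dcong_def\<close>)
 moreover have "expi (of_int (b k * u k) / of_nat (2 * d k)) = expi (of_int (b k * w k) / of_nat (2 * d k))" for k
  using expi_div_cong[of d k "b k * u k" "b k * w k"] d[of k] uw by (simp add: dcong_def flip: right_diff_distrib)
 ultimately show "heis a b c u = heis a b c w" by (simp add: heis_def)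
qed

lemma prod_expi_update:
 "(\<Prod>k\<in>UNIV. expi (of_int ((b(i := s)) k * (u(i := t)) k) / of_nat (2 * d k))) =
  expi (of_int (s * t) / of_nat (2 * d i)) * (\<Prod>k\<in>UNIV - {i}. expi (of_int (b k * u k) / of_nat (2 * d k)))"
 by (subst prod.remove[of _ i]) (auto intro!: arg_cong2[where f = "(*)"] prod.cong)

text \<open>A common multiple of all 4 d i, hence an exponent that kills every phase that
  occurs.\<close>

abbreviation "phase_order \<equiv> 4 * (\<Prod>i\<in>UNIV. d i)"

lemma phase_root: "expi (of_int m / of_nat (4 * d i)) ^ phase_order = 1" "expi (of_int m / of_nat (2 * d i)) ^ phase_order = 1"
proof -
 have p: "(\<Prod>i\<in>UNIV. d i) = d i * (\<Prod>k\<in>UNIV - {i}. d k)" by (subst prod.remove[of _ i]) auto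
 have di: "of_nat (d i) ~= (0 :: complex)" using d[of i] by simp
 have "of_nat phase_order * (of_int m / of_nat (4 * d i)) = (of_int (m * int (\<Prod>k\<in>UNIV - {i}. d k)) :: complex)"
  "of_nat phase_order * (of_int m / of_nat (2 * d i)) = (of_int (2 * m * int (\<Prod>k\<in>UNIV - {i}. d k)) :: complex)"
  unfolding p using di by (simp_all add: field_simps)
 thus "expi (of_int m / of_nat (4 * d i)) ^ phase_order = 1" "expi (of_int m / of_nat (2 * d i)) ^ phase_order = 1"
  unfolding expi_power by (simp_all del: of_int_mult of_nat_mult)
qed

text \<open>In the i-th coordinate the Fourier transform exchanges translations and
  characters.\<close>

lemma heis_inversion:
 assumes c: "dperiodic d c"
 shows "gop d (Inversion i) (heis a b c) u =
  expi (of_int (- (a i * b i)) / of_nat (2 * d i)) * heis (a(i := b i)) (b(i := - a i)) (gop d (Inversion i) c) u"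
proof -
 define N where "N = 2 * int (d i)"
 have N: "N > 0" using d[of i] by (simp add: N_def)
 have cN: "complex_of_nat (2 * d i) = of_int N" by (simp add: N_def)
 define Q where "Q = (\<Prod>k\<in>UNIV - {i}. expi (of_int (b k * u k) / of_nat (2 * d k)))"
 define C where "C l = c ((%k. u k + a k)(i := l))" for l
 have C: "C l = C l'" if "N dvd l - l'" for l l'
  unfolding C_def by (rule dperiodicD[OF c]) (use that in \<open>simp add: dcong_def N_def\<close>)
 have h: "heis a b c (u(i := l)) = expi (of_int (b i * l) / of_int N) * Q * C (l + a i)" for l
 proof -
  have "(%k. (u(i := l)) k + a k) = (%k. u k + a k)(i := l + a i)" by auto
  thus ?thesis using prod_expi_update[of b i "b i" u l] by (simp add: heis_def C_def Q_def N_def)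
 qed
 \<comment> \<open>The character of b is absorbed into the Fourier kernel; since h' has period N,
   the translation by a i does not change its sum over a period.\<close>
 define h' where "h' l = expi (of_int (l * (u i + b i)) / of_int N) * C l" for l
 have h': "h' l = h' l'" if "N dvd l - l'" for l l'
 proof -
  have "N dvd l * (u i + b i) - l' * (u i + b i)" using that by (simp flip: left_diff_distrib)
  thus ?thesis using expi_div_cong[of d i "l * (u i + b i)" "l' * (u i + b i)"] C[OF that] d[of i]
   by (simp add: h'_def N_def)
 qed
 have shift: "(\<Sum>l\<in>{0..<N}. h' (l + m)) = (\<Sum>l\<in>{0..<N}. h' l)" for m
 proof -
  have "bij_betw (%l. (l + m) mod N) {0..<N} {0..<N}"
   by (rule bij_betwI[where g = "%l. (l - m) mod N"]) (use N in \<open>auto simp: mod_simps\<close>)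
  hence "(\<Sum>l\<in>{0..<N}. h' ((l + m) mod N)) = (\<Sum>l\<in>{0..<N}. h' l)" by (rule sum.reindex_bij_betw)
  moreover have "h' ((l + m) mod N) = h' (l + m)" for l by (rule h') (simp add: mod_eq_dvd_iff flip: mod_eq_dvd_iff)
  ultimately show ?thesis by simp
 qed
 have "(\<Sum>l\<in>{0..<N}. expi (of_int (l * u i) / of_int N) * heis a b c (u(i := l))) =
   Q * expi (of_int (- (a i * (u i + b i))) / of_int N) * (\<Sum>l\<in>{0..<N}. h' (l + a i))"
  unfolding sum_distrib_left
 proof (rule sum.cong[OF refl])
  fix l
  have "of_int (l * u i) / of_int N + of_int (b i * l) / of_int N =
    of_int (- (a i * (u i + b i))) / of_int N + (of_int ((l + a i) * (u i + b i)) / of_int N :: complex)"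
   by (simp add: algebra_simps add_divide_distrib[symmetric] diff_divide_distrib[symmetric])
  hence "expi (of_int (l * u i) / of_int N) * expi (of_int (b i * l) / of_int N) =
    expi (of_int (- (a i * (u i + b i))) / of_int N) * expi (of_int ((l + a i) * (u i + b i)) / of_int N)"
   by (simp only: expi_add[symmetric])
  thus "expi (of_int (l * u i) / of_int N) * heis a b c (u(i := l)) =
    Q * expi (of_int (- (a i * (u i + b i))) / of_int N) * h' (l + a i)"
   unfolding h h'_def by (simp add: mult_ac)
 qed
 also have "\<dots> = Q * expi (of_int (- (a i * (u i + b i))) / of_int N) * (\<Sum>l\<in>{0..<N}. h' l)" unfolding shift ..
 finally have L: "gop d (Inversion i) (heis a b c) u =
   Q * expi (of_int (- (a i * (u i + b i))) / of_int N) * (\<Sum>l\<in>{0..<N}. h' l) / of_real (sqrt (2 * real (d i)))"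
  unfolding gop.simps cN N_def[symmetric] by simp
 have g: "gop d (Inversion i) c (%k. u k + (a(i := b i)) k) = (\<Sum>l\<in>{0..<N}. h' l) / of_real (sqrt (2 * real (d i)))"
 proof -
  have "(%k. u k + (a(i := b i)) k)(i := l) = (%k. u k + a k)(i := l)" for l by auto
  thus ?thesis unfolding gop.simps cN N_def[symmetric] h'_def C_def by simp
 qed
 have "of_int (- (a i * (u i + b i))) / of_int N = of_int (- (a i * b i)) / of_int N + (of_int (- a i * u i) / of_int N :: complex)"
  by (simp add: algebra_simps add_divide_distrib diff_divide_distrib)
 hence e: "expi (of_int (- (a i * (u i + b i))) / of_int N) = expi (of_int (- (a i * b i)) / of_int N) * expi (of_int (- a i * u i) / of_int N)"
  by (simp only: expi_add)
 show ?thesis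
  using prod_expi_update[of b i "- a i" u "u i"] unfolding L e heis_def g Q_def[symmetric] cN
  by (simp add: mult_ac N_def)
qed

text \<open>Translating a quadratic phase changes it by a linear phase, which b' records, and by a
  constant.\<close>

lemma heis_shift:
 assumes c: "dperiodic d c" and ij: "d i dvd d j"
  and b'_def: "b' = (%m. b m + (if m = j then - k * (if i = j then a i else 0) else 0) +
   (if i ~= j \<and> m = i then - k * a j else 0) + (if i ~= j \<and> m = j then - k * a i * int (d j div d i) else 0))"
 shows "gop d (Shift i j k) (heis a b c) u =
  expi (of_int (- (k * (if i = j then 1 else 2) * a i * a j)) / of_nat (4 * d i)) * heis a b' (gop d (Shift i j k) c) u"
proof -
 define \<epsilon> where "\<epsilon> = (if i = j then 1 else 2 :: int)"
 have di: "of_nat (d i) ~= (0::complex)" "of_nat (d j) ~= (0::complex)" using d[of i] d[of j] by auto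
 have dj: "of_nat (d j div d i) * of_nat (d i) = (of_nat (d j) :: complex)" using ij by (simp flip: of_nat_mult)
 have q: "of_nat (d j div d i) / of_nat (d j) = 1 / (of_nat (d i) :: complex)" using di by (simp add: frac_eq_eq dj)
 have "(\<Prod>m\<in>UNIV. expi (of_int (b' m * u m) / of_nat (2 * d m))) =
   expi (\<Sum>m\<in>UNIV. of_int (b m * u m) / of_nat (2 * d m) +
    ((if m = j then - of_int (k * (if i = j then a i else 0) * u j) / of_nat (2 * d j) else 0) +
     (if m = i then (if i ~= j then - of_int (k * a j * u i) / of_nat (2 * d i) else 0) else 0) +
     (if m = j then (if i ~= j then - of_int (k * a i * u j) / (2 * of_nat (d i)) else 0) else 0)))"
  unfolding expi_sum[symmetric]
 proof (intro arg_cong[where f = expi] sum.cong refl)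
  fix m
  have "of_int (- k * a i * int (d j div d i) * u j) / of_nat (2 * d j) = - of_int (k * a i * u j) / (2 * of_nat (d i) :: complex)"
  proof -
   have "of_int (- k * a i * int (d j div d i) * u j) / of_nat (2 * d j) =
     - of_int (k * a i * u j) / 2 * (of_nat (d j div d i) / of_nat (d j) :: complex)" by simp
   thus ?thesis unfolding q by simp
  qed
  thus "of_int (b' m * u m) / of_nat (2 * d m) = of_int (b m * u m) / of_nat (2 * d m) +
    ((if m = j then - of_int (k * (if i = j then a i else 0) * u j) / of_nat (2 * d j) else 0) +
     (if m = i then (if i ~= j then - of_int (k * a j * u i) / of_nat (2 * d i) else 0) else 0) +
     (if m = j then (if i ~= j then - of_int (k * a i * u j) / (2 * of_nat (d i)) else 0) else (0 :: complex)))"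
   by (auto simp: b'_def distrib_right left_diff_distrib add_divide_distrib diff_divide_distrib)
 qed
 also have "\<dots> = (\<Prod>m\<in>UNIV. expi (of_int (b m * u m) / of_nat (2 * d m))) * expi (- of_int (k * \<epsilon> * (a i * u j + a j * u i)) / of_nat (4 * d i))"
 proof -
  have "(\<Sum>m\<in>UNIV. of_int (b m * u m) / of_nat (2 * d m) +
    ((if m = j then - of_int (k * (if i = j then a i else 0) * u j) / of_nat (2 * d j) else 0) +
     (if m = i then (if i ~= j then - of_int (k * a j * u i) / of_nat (2 * d i) else 0) else 0) +
     (if m = j then (if i ~= j then - of_int (k * a i * u j) / (2 * of_nat (d i)) else 0) else 0))) =
    (\<Sum>m\<in>UNIV. of_int (b m * u m) / of_nat (2 * d m)) + (- of_int (k * \<epsilon> * (a i * u j + a j * u i)) / of_nat (4 * d i) :: complex)"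
   unfolding sum.distrib using di by (cases "i = j") (simp_all add: \<epsilon>_def, simp_all add: field_simps)
  thus ?thesis by (simp only: expi_add expi_sum)
 qed
 finally have p: "(\<Prod>m\<in>UNIV. expi (of_int (b' m * u m) / of_nat (2 * d m))) =
   (\<Prod>m\<in>UNIV. expi (of_int (b m * u m) / of_nat (2 * d m))) * expi (- of_int (k * \<epsilon> * (a i * u j + a j * u i)) / of_nat (4 * d i))" .
 have "of_int (k * \<epsilon> * u i * u j) / of_nat (4 * d i) = of_int (- (k * \<epsilon> * a i * a j)) / of_nat (4 * d i) +
   (- of_int (k * \<epsilon> * (a i * u j + a j * u i)) / of_nat (4 * d i) + of_int (k * \<epsilon> * (u i + a i) * (u j + a j)) / (of_nat (4 * d i) :: complex))"
  by (simp add: algebra_simps add_divide_distrib[symmetric] diff_divide_distrib[symmetric])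
 hence e: "expi (of_int (k * \<epsilon> * u i * u j) / of_nat (4 * d i)) = expi (of_int (- (k * \<epsilon> * a i * a j)) / of_nat (4 * d i)) *
   (expi (- of_int (k * \<epsilon> * (a i * u j + a j * u i)) / of_nat (4 * d i)) * expi (of_int (k * \<epsilon> * (u i + a i) * (u j + a j)) / of_nat (4 * d i)))"
  by (simp only: expi_add)
 show ?thesis
  unfolding gop.simps heis_def p \<epsilon>_def[symmetric] e by (simp only: mult_ac)
qed

lemma gop_heis:
 assumes "admissible d g"
 obtains a' b' l where "l ^ phase_order = 1"
  "\<And>c. dperiodic d c ==> gop d g (heis a b c) = (%u. l * heis a' b' (gop d g c) u)"
proof (cases g)
 case (Shift i j k)
 hence ij: "d i dvd d j" using assms by simp
 show ?thesis by (rule that[OF phase_root(1)], rule ext, unfold Shift, rule heis_shift[OF _ ij refl])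
next
 case (Inversion i)
 show ?thesis by (rule that[OF phase_root(2)], rule ext, unfold Inversion, rule heis_inversion)
qed

lemma grun_heis:
 assumes "word d UNIV ws"
 shows "\<exists>a' b' l. l ^ phase_order = 1 \<and>
  (\<forall>c. dperiodic d c --> grun d ws (heis a b c) = (%u. l * heis a' b' (grun d ws c) u))"
 using assms
proof (induction ws arbitrary: a b)
 case Nil
 show ?case by (rule exI[of _ a], rule exI[of _ b], rule exI[of _ 1]) auto
next
 case (Cons g ws)
 obtain a1 b1 l1 where 1: "l1 ^ phase_order = 1"
  "\<And>c. dperiodic d c ==> grun d ws (heis a b c) = (%u. l1 * heis a1 b1 (grun d ws c) u)"
  using Cons.IH[of a b] Cons.prems by auto
 obtain a2 b2 l2 where 2: "l2 ^ phase_order = 1"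
  "\<And>c. dperiodic d c ==> gop d g (heis a1 b1 c) = (%u. l2 * heis a2 b2 (gop d g c) u)"
  using gop_heis Cons.prems by (metis word_simps(2))
 have "(l1 * l2) ^ phase_order = 1" unfolding power_mult_distrib using 1 2 by simp
 moreover have "grun d (g # ws) (heis a b c) = (%u. l1 * l2 * heis a2 b2 (grun d (g # ws) c) u)" if "dperiodic d c" for c
 proof -
  have "dperiodic d (grun d ws c)" using dperiodic_grun that Cons.prems by simp
  thus ?thesis using 1(2)[OF that] 2(2) by (simp add: gop_scale mult.assoc)
 qed
 ultimately show ?case by blast
qed

definition delta :: "('n => int) => complex" where
 "delta u = (if dcong d 2 u (%_. 0) then 1 else 0)"

lemma dperiodic_delta: "dperiodic d delta"
 unfolding dperiodic_def delta_def by (meson dcong_sym dcong_trans)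

lemma delta_expansion:
 assumes c: "dperiodic d c"
 shows "c = (%u. \<Sum>p\<in>residues d 2. c (%i. - p i) * heis p (%_. 0) delta u)"
proof
 fix u
 define q where "q = residue_of d 2 (%i. - u i)"
 have q: "q \<in> residues d 2" unfolding q_def by (rule residue_of_mem) (simp_all add: d)
 have uq: "dcong d 2 (%i. - u i) q" unfolding q_def by (rule dcong_residue_of)
 have neg: "dcong d 2 (%i. u i + p i) (%_. 0) \<longleftrightarrow> dcong d 2 (%i. - u i) p" for p
 proof -
  have "int (2 * d i) dvd u i + p i \<longleftrightarrow> int (2 * d i) dvd - u i - p i" for i
   using dvd_minus_iff[of "int (2 * d i)" "u i + p i"] by simp
  thus ?thesis by (simp add: dcong_def)
 qed
 have "heis p (%_. 0) delta u = (if p = q then 1 else 0)" if "p \<in> residues d 2" for p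
  using residues_unique[OF that q] uq dcong_trans[OF dcong_sym[of d 2 "%i. - u i" p] uq]
  by (auto simp: heis_def delta_def neg)
 hence "(\<Sum>p\<in>residues d 2. c (%i. - p i) * heis p (%_. 0) delta u) =
   (\<Sum>p\<in>residues d 2. if p = q then c (%i. - q i) else 0)"
  by (intro sum.cong refl) simp
 also have "\<dots> = c (%i. - q i)" using q by simp
 also have "c (%i. - q i) = c u"
 proof (rule dperiodicD[OF c])
  show "dcong d 2 (%i. - q i) u"
   using uq unfolding dcong_def by (subst minus_diff_commute)
 qed
 finally show "c u = (\<Sum>p\<in>residues d 2. c (%i. - p i) * heis p (%_. 0) delta u)" ..
qed

lemma zero_in_residues: "(%_. 0) \<in> residues d 2"
 using d by (auto simp: residues_def)

text \<open>The function \<open>delta\<close> is fixed by all characters, so its image is as well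
  and must be supported at 0. Translates of \<open>delta\<close> span all periodic functions, so the
  same scalar works everywhere.\<close>

lemma schur:
 assumes ws: "word d UNIV ws"
  and comm: "\<And>a b c. a \<in> residues d 2 ==> b \<in> residues d 2 ==> dperiodic d c ==>
   grun d ws (heis a b c) = heis a b (grun d ws c)"
 obtains \<mu> where "\<And>c. dperiodic d c ==> grun d ws c = (%u. \<mu> * c u)"
proof -
 define h where "h = grun d ws delta"
 have h: "dperiodic d h" unfolding h_def by (rule dperiodic_grun[OF ws dperiodic_delta])
 have h0: "h u = 0" if nz: "\<not> dcong d 2 u (%_. 0)" for u
 proof -
  from nz obtain k where k: "\<not> 2 * int (d k) dvd u k" by (auto simp: dcong_def)
  define b where "b i = (if i = k then 1 else 0 :: int)" for i
  have b: "b \<in> residues d 2"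
  proof -
   have "1 < 2 * int (d i)" for i using d[of i] by simp
   thus ?thesis using d by (auto simp: residues_def b_def)
  qed
  have e: "(\<Prod>i\<in>UNIV. expi (of_int (b i * u i) / of_nat (2 * d i))) = expi (of_int (u k) / of_nat (2 * d k))" for u
  proof -
   have "expi (of_int (b i * u i) / of_nat (2 * d i)) = (if i = k then expi (of_int (u k) / of_nat (2 * d k)) else 1)" for i
    by (simp add: b_def)
   thus ?thesis by simp
  qed
  have "heis (%_. 0) b delta = delta"
  proof
   fix u
   have "expi (of_int (u k) / of_nat (2 * d k)) = 1" if "dcong d 2 u (%_. 0)"
    using expi_div_cong[of d k "u k" 0] d[of k] that[unfolded dcong_def, rule_format, of k] by simp
   thus "heis (%_. 0) b delta u = delta u" unfolding heis_def e by (simp add: delta_def)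
  qed
  hence "heis (%_. 0) b h = h"
   using comm[OF zero_in_residues b dperiodic_delta] by (simp add: h_def)
  hence "expi (of_int (u k) / of_nat (2 * d k)) * h u = h u"
   by (metis (no_types, lifting) heis_def e add_0_right ext)
  moreover have "expi (of_int (u k) / of_nat (2 * d k)) ~= 1"
  proof
   assume "expi (of_int (u k) / of_nat (2 * d k)) = 1"
   then obtain m where "of_int (u k) / of_nat (2 * d k) = (of_int m :: complex)"
    by (auto simp: expi_eq_1_iff elim: Ints_cases)
   hence "(of_int (u k) :: complex) = of_int (2 * int (d k) * m)" using d[of k] by (simp add: field_simps)
   hence "u k = 2 * int (d k) * m" unfolding of_int_eq_iff .
   thus False using k by simp
  qed
  ultimately show ?thesis by simp
 qed
 define \<mu> where "\<mu> = h (%_. 0)"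
 have hd: "h u = \<mu> * delta u" for u
  using h0[of u] dperiodicD[OF h, of u "%_. 0"] by (auto simp: delta_def \<mu>_def)
 have "grun d ws c = (%u. \<mu> * c u)" if c: "dperiodic d c" for c
 proof
  fix u
  have "grun d ws c u = (\<Sum>p\<in>residues d 2. c (%i. - p i) * grun d ws (heis p (%_. 0) delta) u)"
   by (subst delta_expansion[OF c]) (simp only: grun_sum)
  also have "\<dots> = (\<Sum>p\<in>residues d 2. c (%i. - p i) * (\<mu> * heis p (%_. 0) delta u))"
  proof (rule sum.cong[OF refl])
   fix p assume p: "p \<in> residues d 2"
   show "c (%i. - p i) * grun d ws (heis p (%_. 0) delta) u = c (%i. - p i) * (\<mu> * heis p (%_. 0) delta u)"
    unfolding comm[OF p zero_in_residues dperiodic_delta] h_def[symmetric] by (simp add: heis_def hd)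
  qed
  also have "\<dots> = \<mu> * (\<Sum>p\<in>residues d 2. c (%i. - p i) * heis p (%_. 0) delta u)"
   by (simp add: sum_distrib_left mult_ac)
  also have "(\<Sum>p\<in>residues d 2. c (%i. - p i) * heis p (%_. 0) delta u) = c u"
   using fun_cong[OF delta_expansion[OF c], of u] by simp
  finally show "grun d ws c u = \<mu> * c u" .
 qed
 thus ?thesis by (rule that)
qed

section \<open>Words up to scalars\<close>

definition proportional :: "'n generator list => 'n generator list => bool" where
 "proportional ws vs \<longleftrightarrow> (\<exists>\<mu>. \<mu> ~= 0 \<and> (\<forall>c. dperiodic d c --> grun d vs c = (%u. \<mu> * grun d ws c u)))"

lemma proportional_refl: "proportional ws ws"
 unfolding proportional_def by (rule exI[of _ 1]) simp

lemma proportional_sym: "proportional ws vs ==> proportional vs ws"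
proof -
 assume "proportional ws vs"
 then obtain \<mu> where "\<mu> ~= 0" "\<And>c. dperiodic d c ==> grun d vs c = (%u. \<mu> * grun d ws c u)"
  by (auto simp: proportional_def)
 thus ?thesis unfolding proportional_def by (intro exI[of _ "inverse \<mu>"]) auto
qed

lemma proportional_trans: "proportional ws vs ==> proportional vs us ==> proportional ws us"
proof -
 assume "proportional ws vs" "proportional vs us"
 then obtain \<mu> \<nu> where "\<mu> ~= 0" "\<And>c. dperiodic d c ==> grun d vs c = (%u. \<mu> * grun d ws c u)"
  "\<nu> ~= 0" "\<And>c. dperiodic d c ==> grun d us c = (%u. \<nu> * grun d vs c u)"
  by (auto simp: proportional_def)
 thus ?thesis unfolding proportional_def by (intro exI[of _ "\<nu> * \<mu>"]) auto
qed

text \<open>A record t = (a', b', l) of how the word conjugates one Heisenberg operator, restricted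
  to residues and roots of unity so that there are finitely many possibilities.\<close>

definition intertwines :: "'n generator list => ('n => int) \<times> ('n => int) => ('n => int) \<times> ('n => int) \<times> complex => bool" where
 "intertwines ws x t \<longleftrightarrow> t \<in> residues d 2 \<times> residues d 2 \<times> {l. l ^ phase_order = 1} \<and>
   (\<forall>c. dperiodic d c --> grun d ws (heis (fst x) (snd x) c) = (%u. snd (snd t) * heis (fst t) (fst (snd t)) (grun d ws c) u))"

lemma intertwines_exists:
 assumes ws: "word d UNIV ws"
 shows "\<exists>t. intertwines ws x t"
proof -
 obtain a b l where l: "l ^ phase_order = 1"
  "\<And>c. dperiodic d c ==> grun d ws (heis (fst x) (snd x) c) = (%u. l * heis a b (grun d ws c) u)"
  using grun_heis[OF ws] by meson
 have "heis a b (grun d ws c) = heis (residue_of d 2 a) (residue_of d 2 b) (grun d ws c)" if "dperiodic d c" for c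
  by (rule heis_cong[OF dperiodic_grun[OF ws that] dcong_residue_of dcong_residue_of])
 hence "intertwines ws x (residue_of d 2 a, residue_of d 2 b, l)"
  using l by (simp add: intertwines_def residue_of_mem d)
 thus ?thesis by blast
qed

text \<open>If both words conjugate the Heisenberg operators alike, the quotient of their operators
  commutes with all of them and is a scalar by \<open>schur\<close>.\<close>

lemma proportional_if_same_data:
 assumes ws: "word d UNIV ws" and vs: "word d UNIV vs"
  and same: "\<And>x. x \<in> residues d 2 \<times> residues d 2 ==> \<exists>t. intertwines ws x t \<and> intertwines vs x t"
 shows "proportional ws vs"
proof -
 obtain iv where iv: "word d UNIV iv" "\<And>c. dperiodic d c ==> grun d iv (grun d ws c) = c"
  "\<And>c. dperiodic d c ==> grun d ws (grun d iv c) = c" using grun_inverse[OF ws] by blast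
 have w: "word d UNIV (iv @ vs)" using iv(1) vs by simp
 obtain \<mu> where \<mu>: "\<And>c. dperiodic d c ==> grun d (iv @ vs) c = (%u. \<mu> * c u)"
 proof (rule schur[OF w])
  fix a b c assume ab: "a \<in> residues d 2" "b \<in> residues d 2" and c: "dperiodic d c"
  obtain p q l where t: "intertwines ws (a, b) (p, q, l)" "intertwines vs (a, b) (p, q, l)"
   using same[of "(a, b)"] ab by auto
  define c' where "c' = grun d iv (grun d vs c)"
  have c': "dperiodic d c'" unfolding c'_def by (intro dperiodic_grun iv vs c)
  have "grun d vs (heis a b c) = (%u. l * heis p q (grun d vs c) u)"
   using t(2) c by (simp add: intertwines_def)
  also have "grun d vs c = grun d ws c'" unfolding c'_def by (rule iv(3)[symmetric]) (intro dperiodic_grun vs c)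
  also have "(%u. l * heis p q (grun d ws c') u) = grun d ws (heis a b c')"
   using t(1) c' by (simp add: intertwines_def)
  finally show "grun d (iv @ vs) (heis a b c) = heis a b (grun d (iv @ vs) c)"
   using iv(2)[OF dperiodic_heis[OF c']] by (simp add: c'_def)
 qed blast
 have e: "grun d vs c = (%u. \<mu> * grun d ws c u)" if c: "dperiodic d c" for c
 proof -
  have "grun d vs c = grun d ws (grun d iv (grun d vs c))"
   by (rule iv(3)[symmetric]) (intro dperiodic_grun vs c)
  also have "\<dots> = grun d ws (%u. \<mu> * c u)" using \<mu>[OF c] by simp
  finally show ?thesis by (simp only: grun_scale)
 qed
 have "\<mu> ~= 0"
 proof
  assume m: "\<mu> = 0"
  obtain jv where "\<And>c. dperiodic d c ==> grun d jv (grun d vs c) = c" using grun_inverse[OF vs] by metis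
  from this[OF dperiodic_delta] have "delta = (%u. \<mu> * grun d jv (grun d ws delta) u)"
   unfolding e[OF dperiodic_delta] grun_scale by (rule sym)
  hence "delta (%_. 0) = 0" unfolding m by (metis mult_zero_left)
  thus False by (simp add: delta_def)
 qed
 thus ?thesis using e by (auto simp: proportional_def)
qed

lemma finite_roots_of_unity: "n > 0 ==> finite {l :: complex. l ^ n = 1}"
 using card_roots_unity[of n] by (metis finite_roots_unity One_nat_def Suc_leI)

text \<open>By \<open>proportional_if_same_data\<close> a class is determined by its conjugation
  data, a function between finite sets. The representatives \<open>rp\<close> are constant on
  classes, hence finite in number.\<close>

lemma finite_word_classes:
 "\<exists>Ws. finite Ws \<and> (\<forall>w\<in>Ws. word d UNIV w) \<and> (\<forall>w. word d UNIV w --> (\<exists>!v. v \<in> Ws \<and> proportional v w))"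
proof -
 define S where "S = {w. word d UNIV w}"
 define X where "X = residues d 2 \<times> residues d 2"
 define dat where "dat w = (\<lambda>x\<in>X. SOME t. intertwines w x t)" for w
 define rp where "rp w = (SOME v. word d UNIV v \<and> proportional v w)" for w
 have dat: "intertwines w x (dat w x)" if "w \<in> S" "x \<in> X" for w x
  using someI_ex[OF intertwines_exists[of w x]] that by (simp add: dat_def S_def)
 have "dat ` S \<subseteq> (\<Pi>\<^sub>E x\<in>X. residues d 2 \<times> residues d 2 \<times> {l. l ^ phase_order = 1})"
 proof
  fix y assume "y \<in> dat ` S"
  then obtain w where w: "w \<in> S" "y = dat w" by blast
  have "y x \<in> residues d 2 \<times> residues d 2 \<times> {l. l ^ phase_order = 1}" if "x \<in> X" for x
   using dat[OF w(1) that] unfolding intertwines_def w(2) by blast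
  moreover have "y x = undefined" if "x \<notin> X" for x using that by (simp add: w(2) dat_def)
  ultimately show "y \<in> (\<Pi>\<^sub>E x\<in>X. residues d 2 \<times> residues d 2 \<times> {l. l ^ phase_order = 1})"
   by (rule PiE_I)
 qed
 moreover have "phase_order > 0" using d by (simp add: prod_pos)
 hence "finite (\<Pi>\<^sub>E x\<in>X. residues d 2 \<times> residues d 2 \<times> {l :: complex. l ^ phase_order = 1})"
  by (intro finite_PiE finite_cartesian_product finite_roots_of_unity) (simp_all add: X_def)
 ultimately have fin: "finite (dat ` S)" by (rule finite_subset)
 have rp: "word d UNIV (rp w)" "proportional (rp w) w" if "w \<in> S" for w
  using someI[of "%v. word d UNIV v \<and> proportional v w" w] that proportional_refl by (simp_all add: rp_def S_def)
 have rp_eq: "rp w = rp v" if "proportional w v" for w v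
 proof -
  have "(%u. word d UNIV u \<and> proportional u w) = (%u. word d UNIV u \<and> proportional u v)"
   using that proportional_trans proportional_sym by blast
  thus ?thesis by (simp add: rp_def)
 qed
 have same: "rp w = rp v" if wv: "w \<in> S" "v \<in> S" and e: "dat w = dat v" for w v
 proof (rule rp_eq, rule proportional_if_same_data)
  fix x assume "x \<in> residues d 2 \<times> residues d 2"
  hence "x \<in> X" by (simp only: X_def)
  from dat[OF wv(1) this] dat[OF wv(2) this]
  show "\<exists>t. intertwines w x t \<and> intertwines v x t" unfolding e by blast
 qed (use wv in \<open>auto simp: S_def\<close>)
 have "rp ` S \<subseteq> (%y. rp (inv_into S dat y)) ` (dat ` S)"
 proof
  fix v assume "v \<in> rp ` S"
  then obtain w where w: "w \<in> S" "v = rp w" by blast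
  hence "v = rp (inv_into S dat (dat w))"
   using same[of w "inv_into S dat (dat w)"] by (simp add: inv_into_into f_inv_into_f)
  thus "v \<in> (%y. rp (inv_into S dat y)) ` (dat ` S)" using w by blast
 qed
 hence "finite (rp ` S)" using fin finite_subset by blast
 moreover have "word d UNIV v" if "v \<in> rp ` S" for v using that rp by auto
 moreover have "\<exists>!v. v \<in> rp ` S \<and> proportional v w" if "word d UNIV w" for w
 proof
  show "rp w \<in> rp ` S \<and> proportional (rp w) w" using that rp(2)[of w] by (simp add: S_def)
  fix v assume v: "v \<in> rp ` S \<and> proportional v w"
  then obtain w' where w': "w' \<in> S" "v = rp w'" by blast
  have "proportional w' w"
   by (rule proportional_trans[OF proportional_sym[OF rp(2)[OF w'(1)]]]) (use v w' in simp)
  thus "v = rp w" using rp_eq w' by blast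
 qed
 ultimately show ?thesis by (intro exI[of _ "rp ` S"]) simp
qed

end

section \<open>Modular forms from minors of theta constants\<close>

definition positive_bound :: "real => complex^'n^'n => bool" where
 "positive_bound c Z \<longleftrightarrow> (\<forall>q::real^'n. c * (norm q)\<^sup>2 <= q \<bullet> ((\<chi> i j. Im (Z $ i $ j)) *v q))"

text \<open>Siegel space is not open among all matrices. This set is open and convex, contains it,
  and drops the symmetry; the theta constants extend to it by the same series.\<close>

definition positive_cone :: "(complex^'n^'n) set" where
 "positive_cone = {Z. \<exists>c>0. positive_bound c Z}"

lemma siegel_subset_positive_cone: "siegel \<subseteq> (positive_cone :: (complex^'n^'n) set)"
proof
 fix Z :: "complex^'n^'n" assume "Z \<in> siegel"
 from siegel_Im_lower_bound[OF this] obtain c where "c > 0" "positive_bound c Z"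
  unfolding positive_bound_def by blast
 thus "Z \<in> positive_cone" by (auto simp: positive_cone_def)
qed

lemma mem_siegel_if_positive_cone: "Z \<in> positive_cone ==> transpose Z = Z ==> Z \<in> siegel" for Z :: "complex^'n^'n"
proof -
 assume Z: "Z \<in> positive_cone" "transpose Z = Z"
 then obtain c where c: "c > 0" "\<And>q::real^'n. c * (norm q)\<^sup>2 <= q \<bullet> ((\<chi> i j. Im (Z $ i $ j)) *v q)"
  by (auto simp: positive_cone_def positive_bound_def)
 have "0 < q \<bullet> ((\<chi> i j. Im (Z $ i $ j)) *v q)" if "q ~= 0" for q :: "real^'n"
  using c(2)[of q] c(1) that by (smt (verit) mult_pos_pos zero_less_norm_iff zero_less_power)
 thus "Z \<in> siegel" using Z by (simp add: siegel_def)
qed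

lemma abs_quadratic_form_le:
 fixes A :: "real^'n^'n" and q :: "real^'n"
 assumes "\<And>i j. \<bar>A $ i $ j\<bar> <= e"
 shows "\<bar>q \<bullet> (A *v q)\<bar> <= e * (real CARD('n))\<^sup>2 * (norm q)\<^sup>2"
proof -
 have e: "\<bar>q $ i * (A $ i $ j * q $ j)\<bar> <= e * (norm q)\<^sup>2" for i j
 proof -
  have "\<bar>q $ i\<bar> * (\<bar>A $ i $ j\<bar> * \<bar>q $ j\<bar>) <= norm q * (e * norm q)"
   by (intro mult_mono assms component_le_norm_cart mult_nonneg_nonneg) (use assms[of i j] in auto)
  thus ?thesis by (simp add: abs_mult power2_eq_square mult_ac)
 qed
 have "\<bar>q \<bullet> (A *v q)\<bar> <= (\<Sum>i\<in>UNIV. \<Sum>j\<in>UNIV. \<bar>q $ i * (A $ i $ j * q $ j)\<bar>)"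
  unfolding inner_vec_def matrix_vector_mult_def
  by (simp add: sum_distrib_left) (rule order.trans[OF sum_abs], rule sum_mono, rule sum_abs)
 also have "\<dots> <= (\<Sum>i\<in>(UNIV :: 'n set). \<Sum>j\<in>(UNIV :: 'n set). e * (norm q)\<^sup>2)"
  by (intro sum_mono e)
 finally show ?thesis by (simp add: power2_eq_square mult_ac)
qed

lemma positive_bound_nbhd:
 fixes Z :: "complex^'n^'n"
 assumes Z: "positive_bound c Z" and M: "norm (M - Z) <= c / (2 * (real CARD('n))\<^sup>2)"
 shows "positive_bound (c / 2) M"
 unfolding positive_bound_def
proof
 fix q :: "real^'n"
 define A :: "real^'n^'n" where "A = (\<chi> i j. Im ((M - Z) $ i $ j))"
 have "\<bar>A $ i $ j\<bar> <= c / (2 * (real CARD('n))\<^sup>2)" for i j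
 proof -
  have "\<bar>A $ i $ j\<bar> <= cmod ((M - Z) $ i $ j)" unfolding A_def vec_lambda_beta by (rule abs_Im_le_cmod)
  also have "\<dots> <= norm ((M - Z) $ i)" by (rule Finite_Cartesian_Product.norm_nth_le)
  also have "\<dots> <= norm (M - Z)" by (rule Finite_Cartesian_Product.norm_nth_le)
  finally show ?thesis using M by simp
 qed
 from abs_quadratic_form_le[OF this, of q] have "\<bar>q \<bullet> (A *v q)\<bar> <= c / 2 * (norm q)\<^sup>2" by simp
 moreover have "c * (norm q)\<^sup>2 <= q \<bullet> ((\<chi> i j. Im (Z $ i $ j)) *v q)" using Z by (simp add: positive_bound_def)
 moreover have "(\<chi> i j. Im (M $ i $ j)) = (\<chi> i j. Im (Z $ i $ j)) + A" by (simp add: A_def vec_eq_iff)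
 hence "q \<bullet> ((\<chi> i j. Im (M $ i $ j)) *v q) = q \<bullet> ((\<chi> i j. Im (Z $ i $ j)) *v q) + q \<bullet> (A *v q)"
  by (simp add: matrix_vector_mult_add_rdistrib inner_add_right)
 ultimately show "c / 2 * (norm q)\<^sup>2 <= q \<bullet> ((\<chi> i j. Im (M $ i $ j)) *v q)" by simp
qed

lemma open_positive_cone: "open (positive_cone :: (complex^'n^'n) set)"
 unfolding open_contains_ball
proof
 fix Z :: "complex^'n^'n" assume "Z \<in> positive_cone"
 then obtain c where c: "c > 0" "positive_bound c Z" by (auto simp: positive_cone_def)
 have "ball Z (c / (2 * (real CARD('n))\<^sup>2)) \<subseteq> positive_cone"
  unfolding positive_cone_def
  using positive_bound_nbhd[OF c(2)] c(1) by (auto simp: dist_norm norm_minus_commute intro!: exI[of _ "c / 2"])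
 thus "\<exists>e>0. ball Z e \<subseteq> positive_cone"
  using c(1) by (intro exI[of _ "c / (2 * (real CARD('n))\<^sup>2)"]) auto
qed

lemma convex_positive_cone: "convex (positive_cone :: (complex^'n^'n) set)"
proof (rule convexI)
 fix Z W :: "complex^'n^'n" and s t :: real
 assume "Z \<in> positive_cone" "W \<in> positive_cone" and st: "0 <= s" "0 <= t" "s + t = 1"
 then obtain b c where b: "b > 0" "positive_bound b Z" and c: "c > 0" "positive_bound c W" by (auto simp: positive_cone_def)
 have "positive_bound (s * b + t * c) (s *\<^sub>R Z + t *\<^sub>R W)"
  unfolding positive_bound_def
 proof
  fix q :: "real^'n"
  have "(\<chi> i j. Im ((s *\<^sub>R Z + t *\<^sub>R W) $ i $ j)) = s *\<^sub>R (\<chi> i j. Im (Z $ i $ j)) + t *\<^sub>R (\<chi> i j. Im (W $ i $ j))"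
   by (simp add: vec_eq_iff)
  hence "q \<bullet> ((\<chi> i j. Im ((s *\<^sub>R Z + t *\<^sub>R W) $ i $ j)) *v q) =
    s * (q \<bullet> ((\<chi> i j. Im (Z $ i $ j)) *v q)) + t * (q \<bullet> ((\<chi> i j. Im (W $ i $ j)) *v q))"
   by (simp add: matrix_vector_mult_add_rdistrib inner_add_right scaleR_matrix_vector_assoc[symmetric])
  moreover have "s * (b * (norm q)\<^sup>2) <= s * (q \<bullet> ((\<chi> i j. Im (Z $ i $ j)) *v q))"
   "t * (c * (norm q)\<^sup>2) <= t * (q \<bullet> ((\<chi> i j. Im (W $ i $ j)) *v q))"
   using b c st by (auto simp: positive_bound_def intro!: mult_left_mono)
  ultimately show "(s * b + t * c) * (norm q)\<^sup>2 <= q \<bullet> ((\<chi> i j. Im ((s *\<^sub>R Z + t *\<^sub>R W) $ i $ j)) *v q)"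
   by (simp add: algebra_simps)
 qed
 moreover have "0 < s * b + t * c"
  using st b(1) c(1) by (smt (verit) mult_nonneg_nonneg mult_pos_pos)
 ultimately show "s *\<^sub>R Z + t *\<^sub>R W \<in> positive_cone" by (auto simp: positive_cone_def)
qed

lemma norm_theta_null_term_le:
 fixes d :: "'n::finite => nat"
 assumes d: "\<And>i. 0 < d i" and c: "c > 0"
 obtains C where "\<And>Z m. positive_bound c Z ==>
  cmod (if dcong d 2 m u then expi (qf (scaled d Z) m / 4) else 0) <= C * exp (- l1 m)"
proof -
 define \<gamma> where "\<gamma> = pi / 2 * (c / (Max (range (%i. real (d i))))\<^sup>2)"
 have \<gamma>: "\<gamma> > 0" using c Max_degree_pos[of d] d by (simp add: \<gamma>_def)
 define C where "C = exp (\<Sum>i\<in>(UNIV::'n set). 1\<^sup>2 / (4 * \<gamma>))"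
 have "cmod (if dcong d 2 m u then expi (qf (scaled d Z) m / 4) else 0) <= C * exp (- l1 m)" if "positive_bound c Z" for Z m
 proof -
  have "cmod (expi (qf (scaled d Z) m / 4)) = exp (- (pi / 2 * Im (qf (scaled d Z) m)))"
   by (simp add: norm_expi)
  also have "\<dots> <= exp (- (\<gamma> * (\<Sum>i\<in>UNIV. (real_of_int (m i))\<^sup>2)))"
  proof -
   have "c / (Max (range (%i. real (d i))))\<^sup>2 * (\<Sum>i\<in>UNIV. (real_of_int (m i))\<^sup>2) <= Im (qf (scaled d Z) m)"
    using that unfolding positive_bound_def by (intro Im_qf_scaled_lower_bound d c) auto
   from mult_left_mono[OF this, of "pi / 2"] show ?thesis by (simp add: \<gamma>_def mult.assoc)
  qed
  also have "\<dots> <= C * exp (- l1 m)" using exp_neg_squares_le[OF \<gamma>, of m 1] by (simp add: C_def)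
  finally have "cmod (expi (qf (scaled d Z) m / 4)) <= C * exp (- l1 m)" .
  thus ?thesis by (auto simp: C_def)
 qed
 thus ?thesis by (rule that)
qed

lemma slicewise_theta_null:
 fixes d :: "'n::finite => nat"
 assumes d: "\<And>i. 0 < d i"
 shows "slicewise_holomorphic matrix_scale positive_cone (%Z. theta_null d Z u)"
 unfolding theta_null_eq
proof (rule mat.slicewise_infsum[OF open_positive_cone])
 have "slicewise_holomorphic matrix_scale S (%Z. expi (qf (scaled d Z) m / 4))" for m and S :: "(complex^'n^'n) set"
  unfolding expi_def qf_def scaled_def vec_lambda_beta divide_inverse
  by (intro mat.slicewise_intros slicewise_entry)
 thus "slicewise_holomorphic matrix_scale positive_cone (%Z. if dcong d 2 m u then expi (qf (scaled d Z) m / 4) else 0)" for m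
  by (cases "dcong d 2 m u") simp_all
 fix Z :: "complex^'n^'n" assume "Z \<in> positive_cone"
 then obtain c where c: "c > 0" "positive_bound c Z" by (auto simp: positive_cone_def)
 obtain C where C: "\<And>Z m. positive_bound (c / 2) Z ==>
  cmod (if dcong d 2 m u then expi (qf (scaled d Z) m / 4) else 0) <= C * exp (- l1 m)"
  using norm_theta_null_term_le[where d = d and c = "c / 2" and u = u, OF d] c(1) by auto
 define U where "U = ball Z (c / (2 * (real CARD('n))\<^sup>2))"
 have "open U" "Z \<in> U" using c(1) by (auto simp: U_def)
 moreover have "(%m::'n => int. C * exp (- l1 m)) summable_on UNIV"
  by (rule summable_on_cmult_right[OF summable_exp_l1])
 moreover have "\<forall>M\<in>U \<inter> positive_cone. \<forall>m\<in>UNIV. cmod (if dcong d 2 m u then expi (qf (scaled d M) m / 4) else 0) <= C * exp (- l1 m)"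
  using C positive_bound_nbhd[OF c(2)] by (auto simp: U_def dist_norm norm_minus_commute simp del: cmod_def)
 ultimately show "\<exists>U M. open U \<and> Z \<in> U \<and> M summable_on (UNIV :: ('n => int) set) \<and>
   (\<forall>y\<in>U \<inter> positive_cone. \<forall>m\<in>UNIV. cmod (if dcong d 2 m u then expi (qf (scaled d y) m / 4) else 0) <= M m)" by blast
qed

lemma theta_null_bounded:
 fixes d :: "'n::finite => nat"
 assumes d: "\<And>i. 0 < d i" and c: "c > 0"
 obtains B where "\<And>Z. positive_bound c Z ==> cmod (theta_null d Z u) <= B"
proof -
 obtain C where C: "\<And>Z m. positive_bound c Z ==>
  cmod (if dcong d 2 m u then expi (qf (scaled d Z) m / 4) else 0) <= C * exp (- l1 m)"
  using norm_theta_null_term_le[where d = d and u = u, OF d c] by auto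
 have s: "(%m::'n => int. C * exp (- l1 m)) summable_on UNIV"
  by (rule summable_on_cmult_right[OF summable_exp_l1])
 have "cmod (theta_null d Z u) <= (\<Sum>\<^sub>\<infinity>m::'n => int. C * exp (- l1 m))" if "positive_bound c Z" for Z
 proof -
  have n: "(%m. norm (if dcong d 2 m u then expi (qf (scaled d Z) m / 4) else 0)) summable_on UNIV"
   by (rule Infinite_Sum.abs_summable_on_comparison_test'[OF s C[OF that]])
  have "(\<Sum>\<^sub>\<infinity>m. norm (if dcong d 2 m u then expi (qf (scaled d Z) m / 4) else 0)) <= (\<Sum>\<^sub>\<infinity>m::'n => int. C * exp (- l1 m))"
   by (rule infsum_mono[OF n s]) (rule C[OF that])
  thus ?thesis unfolding theta_null_eq using norm_infsum_bound[OF n] by linarith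
 qed
 thus ?thesis by (rule that)
qed

section \<open>The norm of the minors over the classes of words\<close>

text \<open>An indirect way of using that the norm form is a polynomial in the theta constants:
  applied to holomorphic functions it gives holomorphy, applied to bounded functions it gives
  boundedness at the cusp.\<close>

definition function_algebra :: "('x => complex) set => bool" where
 "function_algebra \<A> \<longleftrightarrow> (\<forall>a. (%x. a) \<in> \<A>) \<and>
   (\<forall>f\<in>\<A>. \<forall>g\<in>\<A>. (%x. f x + g x) \<in> \<A> \<and> (%x. f x * g x) \<in> \<A>)"

lemma function_algebra_sum:
 "function_algebra \<A> ==> (\<And>i. i \<in> I ==> f i \<in> \<A>) ==> (%x. \<Sum>i\<in>I. f i x) \<in> \<A>"
 by (induction I rule: infinite_finite_induct) (auto simp: function_algebra_def)

lemma function_algebra_prod: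
 "function_algebra \<A> ==> (\<And>i. i \<in> I ==> f i \<in> \<A>) ==> (%x. \<Prod>i\<in>I. f i x) \<in> \<A>"
 by (induction I rule: infinite_finite_induct) (auto simp: function_algebra_def)

lemma function_algebra_scale:
 assumes A: "function_algebra \<A>" and f: "f \<in> \<A>"
 shows "(%x. a * f x) \<in> \<A>"
proof -
 have "(%x. a) \<in> \<A>" using A unfolding function_algebra_def by blast
 moreover have "(%x. g x * h x) \<in> \<A>" if "g \<in> \<A>" "h \<in> \<A>" for g h using A that by (auto simp: function_algebra_def)
 ultimately show ?thesis using f by simp
qed

lemma function_algebra_slicewise:
 "function_algebra {g. slicewise_holomorphic matrix_scale (S :: (complex^'n^'m) set) g}"
 by (auto simp: function_algebra_def intro: mat.slicewise_intros)

lemma function_algebra_grun: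
 assumes A: "function_algebra \<A>" and c: "\<And>u. (%x. c x u) \<in> \<A>"
 shows "(%x. grun d ws (c x) u) \<in> \<A>"
proof (induction ws arbitrary: u)
 case (Cons g ws)
 show ?case
 proof (cases g)
  case (Shift i j k)
  thus ?thesis using function_algebra_scale[OF A Cons] by simp
 next
  case (Inversion i)
  have "(%x. (1 / of_real (sqrt (2 * real (d i)))) * (\<Sum>l\<in>{0..<2 * int (d i)}. expi (of_int (l * u i) / of_nat (2 * d i)) * grun d ws (c x) (u(i := l)))) \<in> \<A>"
   by (intro function_algebra_scale function_algebra_sum A Cons)
  thus ?thesis by (simp add: Inversion)
 qed
qed (simp add: c)

lemma function_algebra_minor:
 assumes A: "function_algebra \<A>" and c: "\<And>u. (%x. c x u) \<in> \<A>"
 shows "(%x. minor d (c x) p \<kappa>) \<in> \<A>"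
 unfolding minor_def det_def vec_lambda_beta
 by (intro function_algebra_sum function_algebra_scale function_algebra_prod A c)

lemma minor_scale: "minor d (%u. l * c u) p \<kappa> = l ^ CARD('n set) * minor d c p \<kappa>"
 for d :: "'n::finite => nat"
proof -
 define A :: "complex^('n set)^('n set)" where "A = (\<chi> \<eta> \<eta>'. c (%i. 2 * \<kappa> \<eta> i - p i - subset_shift d \<eta>' i))"
 have "(\<chi> \<eta> \<eta>'. l * c (%i. 2 * \<kappa> \<eta> i - p i - subset_shift d \<eta>' i)) = (\<chi> \<eta>. l *s A $ \<eta>)"
  by (simp add: A_def vec_eq_iff)
 thus ?thesis unfolding minor_def A_def[symmetric] by (simp add: det_rows_mul)
qed

lemma minor_dcong:
 fixes d :: "'n::finite => nat"
 assumes c: "dperiodic d c" and "dcong d 2 p q"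
 shows "minor d c p \<kappa> = minor d c q \<kappa>"
proof -
 have "c (%i. 2 * \<kappa> \<eta> i - p i - subset_shift d \<eta>' i) = c (%i. 2 * \<kappa> \<eta> i - q i - subset_shift d \<eta>' i)" for \<eta> \<eta>'
  by (rule dperiodicD[OF c]) (use dcong_sym[OF assms(2)] in \<open>simp add: dcong_def\<close>)
 thus ?thesis by (simp add: minor_def)
qed

definition minors :: "('n::finite => nat) => (('n => int) => 'n set => 'n => int) => (('n => int) => complex) => complex" where
 "minors d \<kappa> c = (\<Prod>p\<in>residues d 2. minor d c p (\<kappa> p))"

definition minors_degree :: "('n::finite => nat) => nat" where
 "minors_degree d = CARD('n set) * card (residues d 2)"

lemma minors_scale: "minors d \<kappa> (%u. l * c u) = l ^ minors_degree d * minors d \<kappa> c"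
 by (simp add: minors_def minors_degree_def minor_scale prod.distrib flip: power_mult)

lemma inversion_twice_matrix:
 assumes "transpose Z = Z" "Z $ i $ i ~= 0" "0 < d i"
 shows "inversion d i (inversion d i Z) = (\<chi> j k. if (j = i) = (k = i) then Z $ j $ k else - Z $ j $ k)"
proof -
 have sym: "Z $ i $ j = Z $ j $ i" for j using assms(1) by (simp add: transpose_def vec_eq_iff)
 define D where "D = (of_nat (d i) :: complex)"
 define z where "z = Z $ i $ i"
 have D0: "D ~= 0" and z0: "z ~= 0" using assms by (simp_all add: D_def z_def)
 define Y where "Y = inversion d i Z"
 have Y: "Y $ i $ i = - (D * D / z)" "k ~= i ==> Y $ i $ k = - (D * Z $ i $ k / z)"
  "j ~= i ==> k ~= i ==> Y $ j $ k = Z $ j $ k - Z $ i $ j * Z $ i $ k / z" for j k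
  by (simp_all add: Y_def inversion_def inversion_row_def D_def z_def)
 define A where "A = inversion_row d i Y"
 have A: "A i = D" "k ~= i ==> A k = - (D * Z $ i $ k / z)" for k
  by (simp_all add: A_def inversion_row_def Y D_def)
 have I: "inversion d i Y $ j $ k = (if j = i \<or> k = i then 0 else Y $ j $ k) + A j * A k * z / (D * D)" for j k
  by (simp add: inversion_def A_def Y)
 have "inversion d i Y $ j $ k = (if (j = i) = (k = i) then Z $ j $ k else - Z $ j $ k)" for j k
 proof -
  consider "j = i" "k = i" | "j = i" "k ~= i" | "j ~= i" "k = i" | "j ~= i" "k ~= i" by blast
  thus ?thesis
  proof cases
   case 1 thus ?thesis unfolding I using D0 by (simp add: A z_def)
  next
   case 2 thus ?thesis unfolding I using D0 z0 by (simp add: A)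
  next
   case 3 thus ?thesis unfolding I using D0 z0 sym[of j] by (simp add: A)
  next
   case 4 thus ?thesis unfolding I using D0 z0 by (simp add: A Y)
  qed
 qed
 thus ?thesis by (simp add: vec_eq_iff Y_def)
qed

text \<open>An inversion applied twice only changes signs, so applied four times it is the
  identity.\<close>

lemma gact_surjective:
 fixes d :: "'n::finite => nat"
 assumes Z: "Z \<in> siegel" and d: "\<And>i. 0 < d i"
 obtains Y where "Y \<in> siegel" "gact d g Y = Z"
proof (cases g)
 case (Shift i j k)
 have "gact d g (gact d (Shift i j (- k)) Z) = Z" by (simp add: Shift vec_eq_iff)
 thus ?thesis using that gact_siegel[where d = d, OF Z d] by blast
next
 case (Inversion i)
 define J where "J = inversion d i"
 have J: "J Y \<in> siegel" if "Y \<in> siegel" for Y unfolding J_def by (rule inversion_siegel[where d = d, OF that d])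
 have two: "J (J Y) = (\<chi> j k. if (j = i) = (k = i) then Y $ j $ k else - Y $ j $ k)" if "Y \<in> siegel" for Y
 proof -
  have "Y $ i $ i ~= 0" using siegel_diagonal_pos[OF that, of i] by auto
  thus ?thesis using that inversion_twice_matrix[of Y i d] d by (simp add: J_def siegel_def)
 qed
 have "J (J (J (J Z))) = Z"
  unfolding two[OF J[OF J[OF Z]]] unfolding two[OF Z] by (simp add: vec_eq_iff)
 thus ?thesis using that[of "J (J (J Z))"] J Z by (simp add: Inversion J_def)
qed

text \<open>Up to scalars every word carries the theta constants of some Y to those of Z. Hence no
  factor of the norm form vanishes identically once the minors are nonzero at one point.\<close>

lemma theta_null_reach:
 fixes d :: "'n::finite => nat"
 assumes d: "\<And>i. 0 < d i" and "word d UNIV ws" "Z \<in> siegel"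
 shows "\<exists>Y\<in>siegel. \<exists>l. l ~= 0 \<and> grun d ws (theta_null d Y) = (%u. l * theta_null d Z u)"
 using assms(2,3)
proof (induction ws arbitrary: Z)
 case Nil
 thus ?case by (intro bexI[of _ Z] exI[of _ 1]) auto
next
 case (Cons g ws)
 obtain Z1 where Z1: "Z1 \<in> siegel" "gact d g Z1 = Z" using gact_surjective[where d = d, OF Cons.prems(2) d] by blast
 obtain Y l where Y: "Y \<in> siegel" "l ~= 0" "grun d ws (theta_null d Y) = (%u. l * theta_null d Z1 u)"
  using Cons.IH[OF _ Z1(1)] Cons.prems by auto
 obtain j where j: "j ^ 8 = gden d g Z1 ^ 4" "\<And>u. theta_null d (gact d g Z1) u = j * gop d g (theta_null d Z1) u"
  using theta_null_generator[where d = d, OF Z1(1) d] Cons.prems(1) by (metis word_simps(2))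
 have j0: "j ~= 0" using j(1) gden_nonzero[where d = d, OF Z1(1) d, of g] by auto
 have "grun d (g # ws) (theta_null d Y) = (%u. l / j * theta_null d Z u)"
  using j(2) j0 Z1(2) gop_scale[where d = d, OF d] by (simp add: Y(3) fun_eq_iff)
 thus ?case using Y j0 by (intro bexI[of _ Y] exI[of _ "l / j"]) auto
qed

text \<open>Identity theorem on the complex line through two points of Siegel space, restricted to
  the parameters whose image lies in the cone: this set is open, convex and contains 0 and
  1.\<close>

lemma siegel_common_nonzero:
 fixes f :: "'i => complex^'n^'n => complex"
 assumes "finite I" "I ~= {}" and f: "\<And>i. i \<in> I ==> slicewise_holomorphic matrix_scale positive_cone (f i)"
  and nz: "\<And>i. i \<in> I ==> \<exists>Z\<in>siegel. f i Z ~= 0"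
 shows "\<exists>Z\<in>siegel. (\<Prod>i\<in>I. f i Z) ~= 0"
 using assms
proof (induction I rule: finite_ne_induct)
 case (insert i I)
 then obtain Z W where Z: "Z \<in> siegel" "(\<Prod>i\<in>I. f i Z) ~= 0" and W: "W \<in> siegel" "f i W ~= 0" by (meson insertCI)
 define L where "L t = Z + matrix_scale t (W - Z)" for t
 define T where "T = {t. L t \<in> positive_cone}"
 have cont: "continuous_on UNIV L"
  unfolding L_def matrix_scale_def by (intro continuous_intros)
 have T: "open T" using continuous_open_preimage[OF cont open_UNIV open_positive_cone] by (simp add: T_def vimage_def)
 have "convex T"
 proof (rule convexI)
  fix x y and s t :: real assume xy: "x \<in> T" "y \<in> T" "0 <= s" "0 <= t" "s + t = 1"
  have st: "of_real s = (1 - of_real t :: complex)" using xy(5) by (metis add_diff_cancel_right' of_real_1 of_real_diff)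
  have "L (s *\<^sub>R x + t *\<^sub>R y) = s *\<^sub>R L x + t *\<^sub>R L y"
   by (simp add: L_def matrix_scale_def vec_eq_iff) (simp add: scaleR_conv_of_real st algebra_simps)
  thus "s *\<^sub>R x + t *\<^sub>R y \<in> T"
   using convexD[OF convex_positive_cone, of "L x" "L y" s t] xy by (simp add: T_def)
 qed
 have L01: "L 0 = Z" "L 1 = W" by (simp_all add: L_def matrix_scale_def vec_eq_iff)
 have mem: "0 \<in> T" "1 \<in> T" using Z W siegel_subset_positive_cone by (auto simp: T_def L01)
 have siegel: "L t \<in> siegel" if "t \<in> T" for t
 proof (rule mem_siegel_if_positive_cone)
  show "transpose (L t) = L t"
   using Z(1) W(1) by (simp add: siegel_def L_def transpose_def vec_eq_iff matrix_scale_def)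
 qed (use that in \<open>simp add: T_def\<close>)
 have hol: "(%t. F (L t)) holomorphic_on T" if "slicewise_holomorphic matrix_scale positive_cone F" for F
  unfolding L_def by (rule mat.slice_holomorphic_on[OF open_positive_cone that]) (simp add: T_def L_def)
 define g where "g t = (\<Prod>i\<in>I. f i (L t))" for t
 have gh: "g holomorphic_on T" unfolding g_def
  by (rule hol, rule mat.slicewise_prod) (use insert.prems in auto)
 have "\<exists>t\<in>T. g t ~= 0 \<and> f i (L t) ~= 0"
 proof (rule ccontr)
  assume no: "\<not> (\<exists>t\<in>T. g t ~= 0 \<and> f i (L t) ~= 0)"
  define S where "S = T \<inter> g -` (- {0})"
  have "f i (L 1) = 0"
  proof (rule analytic_continuation_open[where f = "%t. f i (L t)" and s = S and s' = T and g = "%_. 0" and z = 1])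
   show "open S" unfolding S_def
    by (rule continuous_open_preimage[OF holomorphic_on_imp_continuous_on[OF gh] T]) auto
   show "S ~= {}" using mem(1) Z(2) by (auto simp: S_def g_def L01)
   show "(%t. f i (L t)) holomorphic_on T" by (rule hol) (use insert.prems in auto)
  qed (use T \<open>convex T\<close> mem no in \<open>auto simp: S_def convex_connected\<close>)
  thus False using W(2) by (simp add: L01)
 qed
 thus ?case using siegel insert.hyps by (auto simp: g_def)
qed auto

text \<open>Ws contains exactly one word from each class modulo scalars.\<close>

locale word_representatives =
 fixes d :: "'n::finite => nat" and \<kappa> :: "('n => int) => 'n set => 'n => int" and Ws :: "'n generator list set"
 assumes d: "\<And>i. 0 < d i" and Ws_finite: "finite Ws" and Ws_word: "\<And>w. w \<in> Ws ==> word d UNIV w"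
  and Ws_class: "\<And>w. word d UNIV w ==> \<exists>!v. v \<in> Ws \<and> proportional d v w"
begin

definition norm_form :: "(('n => int) => complex) => complex" where
 "norm_form c = (\<Prod>w\<in>Ws. minors d \<kappa> (grun d w c))"

abbreviation "norm_degree \<equiv> minors_degree d * card Ws"

lemma norm_form_scale: "norm_form (%u. l * c u) = l ^ norm_degree * norm_form c"
 by (simp add: norm_form_def grun_scale[where d = d, OF d] minors_scale prod.distrib flip: power_mult)

text \<open>Appending g permutes the classes of words, injectively because g is invertible; the
  factor \<zeta> collects the scalars of proportionality and does not depend on c.\<close>

lemma norm_form_generator:
 assumes g: "admissible d g"
 obtains \<zeta> where "\<And>c. dperiodic d c ==> norm_form (gop d g c) = \<zeta> * norm_form c"
proof -
 have ex: "\<exists>v \<mu>. v \<in> Ws \<and> \<mu> ~= 0 \<and> (\<forall>c. dperiodic d c --> grun d (w @ [g]) c = (%u. \<mu> * grun d v c u))" if "w \<in> Ws" for w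
  using Ws_class[of "w @ [g]"] Ws_word[OF that] g unfolding proportional_def[where d = d, OF d] by auto
 define r where "r w = (SOME v. v \<in> Ws \<and> (\<exists>\<mu>. \<mu> ~= 0 \<and> (\<forall>c. dperiodic d c --> grun d (w @ [g]) c = (%u. \<mu> * grun d v c u))))" for w
 have r: "r w \<in> Ws \<and> (\<exists>\<mu>. \<mu> ~= 0 \<and> (\<forall>c. dperiodic d c --> grun d (w @ [g]) c = (%u. \<mu> * grun d (r w) c u)))" if "w \<in> Ws" for w
  unfolding r_def by (rule someI_ex) (use ex[OF that] in blast)
 then obtain \<mu> where \<mu>: "\<And>w. w \<in> Ws ==> \<mu> w ~= 0"
  "\<And>w c. w \<in> Ws ==> dperiodic d c ==> grun d (w @ [g]) c = (%u. \<mu> w * grun d (r w) c u)" by metis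
 obtain vs where vs: "word d UNIV vs" "\<And>c. dperiodic d c ==> gop d g (grun d vs c) = c"
  using gop_inverse[where d = d, OF d g] by metis
 have "inj_on r Ws"
 proof
  fix w w' assume w: "w \<in> Ws" "w' \<in> Ws" "r w = r w'"
  have "grun d w' c = (%u. \<mu> w' / \<mu> w * grun d w c u)" if c: "dperiodic d c" for c
  proof -
   have c': "dperiodic d (grun d vs c)" by (rule dperiodic_grun[where d = d, OF d vs(1) c])
   have "grun d w c = (%u. \<mu> w * grun d (r w) (grun d vs c) u)" "grun d w' c = (%u. \<mu> w' * grun d (r w) (grun d vs c) u)"
    using \<mu>(2)[OF w(1) c'] \<mu>(2)[OF w(2) c'] vs(2)[OF c] w(3) by simp_all
   thus ?thesis using \<mu>(1)[OF w(1)] by simp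
  qed
  hence "proportional d w w'"
   unfolding proportional_def[where d = d, OF d] using \<mu>(1) w by (intro exI[of _ "\<mu> w' / \<mu> w"]) auto
  thus "w = w'" using Ws_class[OF Ws_word[OF w(2)]] w proportional_refl[where d = d, OF d] by blast
 qed
 moreover have "r ` Ws \<subseteq> Ws" using r by blast
 ultimately have bij: "bij_betw r Ws Ws" using Ws_finite by (simp add: bij_betw_def endo_inj_surj)
 have "norm_form (gop d g c) = (\<Prod>w\<in>Ws. \<mu> w ^ minors_degree d) * norm_form c" if c: "dperiodic d c" for c
 proof -
  have "norm_form (gop d g c) = (\<Prod>w\<in>Ws. \<mu> w ^ minors_degree d * minors d \<kappa> (grun d (r w) c))"
   unfolding norm_form_def using \<mu>(2)[OF _ c] by (intro prod.cong refl) (simp add: minors_scale)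
  also have "\<dots> = (\<Prod>w\<in>Ws. \<mu> w ^ minors_degree d) * (\<Prod>w\<in>Ws. minors d \<kappa> (grun d (r w) c))"
   by (rule prod.distrib)
  finally show ?thesis unfolding norm_form_def using prod.reindex_bij_betw[OF bij, of "%w. minors d \<kappa> (grun d w c)"] by simp
 qed
 thus ?thesis by (rule that)
qed

lemma gop_finite_order:
 obtains m where "m dvd 4 * (\<Prod>i\<in>UNIV. d i)" "\<And>c. dperiodic d c ==> (gop d g ^^ m) c = c"
proof (cases g)
 case (Shift i j k)
 have power: "(gop d g ^^ m) c u = expi (of_int (k * (if i = j then 1 else 2) * u i * u j) / of_nat (4 * d i)) ^ m * c u" for m c u
  by (induction m arbitrary: u) (simp_all only: funpow.simps o_apply id_apply Shift gop.simps power_Suc power_0 mult_1 mult.assoc)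
 have root: "expi (of_int l / of_nat (4 * d i)) ^ (4 * d i) = 1" for l
  using d[of i] unfolding expi_power by simp
 have "(gop d g ^^ (4 * d i)) c = c" for c by (rule ext) (simp only: power root mult_1)
 moreover have "4 * d i dvd 4 * (\<Prod>i\<in>UNIV. d i)" by (intro mult_dvd_mono dvd_prodI) auto
 ultimately show ?thesis using that by blast
next
 case (Inversion i)
 have "(gop d g ^^ 4) c = gop d g (gop d g (gop d g (gop d g c)))" for c by (simp add: numeral_eq_Suc)
 thus ?thesis using inversion_four_times[where d = d, OF d] that[of 4] by (simp add: Inversion del: gop.simps)
qed

text \<open>Some power of the generator acts as the identity, so evaluating along the orbit of a
  point where the norm form is nonzero shows that \<zeta> is a root of unity.\<close>

lemma norm_form_root:
 assumes g: "admissible d g" and \<zeta>: "\<And>c. dperiodic d c ==> norm_form (gop d g c) = \<zeta> * norm_form c"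
  and c0: "dperiodic d c0" "norm_form c0 ~= 0"
 shows "\<zeta> ^ (4 * (\<Prod>i\<in>UNIV. d i)) = 1"
proof -
 obtain m where m: "m dvd 4 * (\<Prod>i\<in>UNIV. d i)" "\<And>c. dperiodic d c ==> (gop d g ^^ m) c = c"
  using gop_finite_order by blast
 have "dperiodic d ((gop d g ^^ k) c0) \<and> norm_form ((gop d g ^^ k) c0) = \<zeta> ^ k * norm_form c0" for k
  by (induction k) (use c0 \<zeta> dperiodic_gop[where d = d, OF d g] in auto)
 from this[of m] have "\<zeta> ^ m = 1" using m(2)[OF c0(1)] c0(2) by simp
 thus ?thesis using m(1) by (metis dvdE power_mult power_one)
qed

lemma function_algebra_norm_form:
 assumes A: "function_algebra \<A>" and c: "\<And>u. (%x. c x u) \<in> \<A>"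
 shows "(%x. norm_form (c x)) \<in> \<A>"
 unfolding norm_form_def minors_def
 by (intro function_algebra_prod function_algebra_minor function_algebra_grun A c)

text \<open>The representative of the empty word acts by a scalar, so the minors themselves are a
  factor of the norm form.\<close>

lemma minors_nonzero_if_norm_form:
 assumes c: "dperiodic d c" and "norm_form c ~= 0"
 shows "minors d \<kappa> c ~= 0"
proof -
 obtain w \<mu> where w: "w \<in> Ws" "\<mu> ~= 0" "c = (%u. \<mu> * grun d w c u)"
  using Ws_class[of "[]"] c unfolding proportional_def[where d = d, OF d] by auto
 have "minors d \<kappa> (grun d w c) ~= 0" using assms(2) w(1) Ws_finite by (auto simp: norm_form_def)
 thus ?thesis using w(2) by (subst w(3)) (simp add: minors_scale)
qed

end

theorem modular_form_exists:
 fixes d :: "'n::{finite,linorder} => nat"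
 assumes d: "\<And>i. 0 < d i" and dv: "\<And>i j. i <= j ==> d i dvd d j"
  and Z0: "Z0 \<in> siegel" "\<And>p. p \<in> residues d 2 ==> minor d (theta_null d Z0) p (\<kappa> p) ~= 0"
 obtains F k where "modular_form d k F" "\<exists>Z\<in>siegel. F Z ~= 0"
  "\<And>Z p. Z \<in> siegel ==> F Z ~= 0 ==> \<exists>\<kappa>. minor d (theta_null d Z) p \<kappa> ~= 0"
proof -
 obtain Ws where Ws: "finite Ws \<and> (\<forall>w\<in>Ws. word d UNIV w) \<and> (\<forall>w. word d UNIV w --> (\<exists>!v. v \<in> Ws \<and> proportional d v w))"
  using finite_word_classes[where d = d, OF d] by blast
 interpret word_representatives d \<kappa> Ws by unfold_locales (use d Ws in simp_all)
 define f where "f = norm_form"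
 define n where "n = minors_degree d * card Ws"
 define K where "K = 4 * (\<Prod>i\<in>UNIV. d i)"
 \<comment> \<open>The exponent 8 turns the multiplier j into a power of the automorphy factor, and
   K removes the root of unity \<zeta>.\<close>
 define F where "F Z = f (theta_null d Z) ^ (8 * K)" for Z
 have per: "dperiodic d (theta_null d Z)" for Z by (rule dperiodic_theta_null)
 have alg: "(%x. f (c x)) \<in> \<A>" if "function_algebra \<A>" "\<And>u. (%x. c x u) \<in> \<A>" for \<A> :: "('x => complex) set" and c
  unfolding f_def by (rule function_algebra_norm_form[OF that])
 have "Ws ~= {}" using Ws_class[of "[]"] by auto
 have "\<exists>Z\<in>siegel. (\<Prod>w\<in>Ws. minors d \<kappa> (grun d w (theta_null d Z))) ~= 0"
 proof (rule siegel_common_nonzero[OF Ws_finite \<open>Ws ~= {}\<close>])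
  fix w assume w: "w \<in> Ws"
  have "(%Z. minors d \<kappa> (grun d w (theta_null d Z))) \<in> {g. slicewise_holomorphic matrix_scale positive_cone g}"
   unfolding minors_def
   by (intro function_algebra_prod function_algebra_minor function_algebra_grun function_algebra_slicewise)
     (simp add: slicewise_theta_null[where d = d, OF d])
  thus "slicewise_holomorphic matrix_scale positive_cone (%Z. minors d \<kappa> (grun d w (theta_null d Z)))" by simp
  obtain Y l where Y: "Y \<in> siegel" "l ~= 0" "grun d w (theta_null d Y) = (%u. l * theta_null d Z0 u)"
   using theta_null_reach[where d = d, OF d Ws_word[OF w] Z0(1)] by blast
  have "minors d \<kappa> (theta_null d Z0) ~= 0" using Z0(2) by (simp add: minors_def)
  thus "\<exists>Z\<in>siegel. minors d \<kappa> (grun d w (theta_null d Z)) ~= 0"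
   using Y by (intro bexI[of _ Y]) (simp_all add: minors_scale)
 qed
 then obtain Z1 where Z1: "Z1 \<in> siegel" "f (theta_null d Z1) ~= 0" by (auto simp: f_def norm_form_def)
 have gen: "F (gact d g Z) = gden d g Z ^ (4 * K * n) * F Z" if g: "admissible d g" and Z: "Z \<in> siegel" for g Z
 proof -
  obtain j where j: "j ^ 8 = gden d g Z ^ 4" "\<And>u. theta_null d (gact d g Z) u = j * gop d g (theta_null d Z) u"
   using theta_null_generator[where d = d, OF Z d g] by blast
  obtain \<zeta> where \<zeta>: "\<And>c. dperiodic d c ==> f (gop d g c) = \<zeta> * f c"
   unfolding f_def using norm_form_generator[OF g] by blast
  have "\<zeta> ^ K = 1"
   unfolding K_def by (rule norm_form_root[OF g _ per, of \<zeta> Z1]) (use \<zeta> Z1 in \<open>simp_all add: f_def\<close>)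
  hence \<zeta>1: "\<zeta> ^ (8 * K) = 1" by (metis mult.commute power_mult power_one)
  have "f (theta_null d (gact d g Z)) = j ^ n * (\<zeta> * f (theta_null d Z))"
  proof -
   have "theta_null d (gact d g Z) = (%u. j * gop d g (theta_null d Z) u)" using j(2) by auto
   thus ?thesis using norm_form_scale[of j "gop d g (theta_null d Z)"] \<zeta>[OF per] by (simp add: f_def n_def)
  qed
  hence "F (gact d g Z) = (j ^ n) ^ (8 * K) * F Z"
   by (simp add: F_def power_mult_distrib \<zeta>1)
  also have "(j ^ n) ^ (8 * K) = (j ^ 8) ^ (K * n)" by (simp add: mult_ac flip: power_mult)
  also have "\<dots> = gden d g Z ^ (4 * K * n)" unfolding j(1) by (simp add: mult_ac flip: power_mult)
  finally show ?thesis .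
 qed
 have hol: "holomorphic_wrt matrix_scale siegel F"
 proof -
  have "(%Z. f (theta_null d Z)) \<in> {g. slicewise_holomorphic matrix_scale positive_cone g}"
   by (rule alg[OF function_algebra_slicewise]) (simp add: slicewise_theta_null[where d = d, OF d])
  hence "slicewise_holomorphic matrix_scale positive_cone F"
   unfolding F_def[abs_def] by (intro mat.slicewise_power) simp
  thus ?thesis
   unfolding holomorphic_wrt_def using mat.slicewise_imp_has_derivative[OF open_positive_cone]
    siegel_subset_positive_cone has_derivative_at_withinI by (metis subsetD)
 qed
 have bnd: "bounded (F ` {Z \<in> siegel. \<forall>i. 1 <= Im (Z $ i $ i)})" if one: "CARD('n) = 1"
 proof -
  obtain i where U: "(UNIV :: 'n set) = {i}" using one by (auto simp: card_1_singleton_iff)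
  define R where "R = {Z :: (complex, 'n) vec ^ 'n::{finite,linorder}. \<forall>i. 1 <= Im (Z $ i $ i)}"
  \<comment> \<open>With a single index the region at the cusp has a uniform positivity bound, so
    all theta constants are bounded on it.\<close>
  have R: "positive_bound 1 Z" if "Z \<in> R" for Z
   unfolding positive_bound_def
  proof
   fix q :: "(real, 'n) vec"
   have "1 * (q $ i)\<^sup>2 <= Im (Z $ i $ i) * (q $ i)\<^sup>2" using that by (intro mult_right_mono) (auto simp: R_def)
   thus "1 * (norm q)\<^sup>2 <= q \<bullet> ((\<chi> i j. Im (Z $ i $ j)) *v q)"
    by (simp add: norm_vec_def L2_set_def inner_vec_def matrix_vector_mult_def U power2_eq_square mult_ac)
  qed
  define \<A> where "\<A> = {g. \<exists>B. \<forall>Z\<in>R. cmod (g Z) <= B}"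
  have "function_algebra \<A>"
   unfolding function_algebra_def
  proof (intro conjI allI ballI)
   show "(%x. a) \<in> \<A>" for a by (auto simp: \<A>_def)
   fix g h assume "g \<in> \<A>" "h \<in> \<A>"
   then obtain B C where B: "\<And>Z. Z \<in> R ==> cmod (g Z) <= B" and C: "\<And>Z. Z \<in> R ==> cmod (h Z) <= C" by (auto simp: \<A>_def)
   have "cmod (g Z + h Z) <= B + C" if "Z \<in> R" for Z by (rule order.trans[OF norm_triangle_ineq add_mono[OF B[OF that] C[OF that]]])
   thus "(%x. g x + h x) \<in> \<A>" by (auto simp: \<A>_def)
   have "cmod (g Z * h Z) <= B * C" if "Z \<in> R" for Z
    unfolding norm_mult by (intro mult_mono B[OF that] C[OF that] order.trans[OF norm_ge_zero B[OF that]] norm_ge_zero)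
   thus "(%x. g x * h x) \<in> \<A>" by (auto simp: \<A>_def)
  qed
  moreover have "(%Z. theta_null d Z u) \<in> \<A>" for u
   using theta_null_bounded[where d = d and c = 1 and u = u, OF d] R by (auto simp: \<A>_def) (metis zero_less_one)
  ultimately have "(%Z. f (theta_null d Z)) \<in> \<A>" by (rule alg)
  then obtain B where B: "\<And>Z. Z \<in> R ==> cmod (f (theta_null d Z)) <= B" by (auto simp: \<A>_def)
  have "cmod (F Z) <= B ^ (8 * K)" if "Z \<in> R" for Z
   unfolding F_def norm_power by (intro power_mono B[OF that]) simp
  thus ?thesis unfolding bounded_iff by (auto simp: R_def)
 qed
 show ?thesis
 proof (rule that)
  have "F (siegel_action d R Z) = det (denominator d R Z) ^ (4 * K * n) * F Z" if "R \<in> paramodular_group d" "Z \<in> siegel" for R Z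
   using automorphic_if_generators[where d = d and F = F, OF d dv gen that(1)] that(2) by (auto simp: automorphic_at_def)
  thus "modular_form d (4 * K * n) F" using hol bnd by (simp add: modular_form_def)
  show "\<exists>Z\<in>siegel. F Z ~= 0" using Z1 by (auto simp: F_def)
  fix Z p assume Z: "Z \<in> siegel" "F Z ~= 0"
  have "K > 0" using d by (simp add: K_def prod_pos)
  hence "f (theta_null d Z) ~= 0" using Z(2) by (auto simp: F_def)
  hence "minors d \<kappa> (theta_null d Z) ~= 0"
   unfolding f_def by (rule minors_nonzero_if_norm_form[OF per])
  moreover have "residue_of d 2 p \<in> residues d 2" by (rule residue_of_mem) (simp_all add: d)
  ultimately have "minor d (theta_null d Z) (residue_of d 2 p) (\<kappa> (residue_of d 2 p)) ~= 0"
   by (auto simp: minors_def)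
  thus "\<exists>\<kappa>. minor d (theta_null d Z) p \<kappa> ~= 0"
   using minor_dcong[where d = d, OF per dcong_residue_of] by metis
 qed
qed

section \<open>A period matrix with nonvanishing minors\<close>

text \<open>The contribution of one coordinate to a theta constant of a shear matrix: Gaussians
  centred along x + 2 Z.\<close>

definition decay :: "real => real => real" where
 "decay T x = (\<Sum>\<^sub>\<infinity>k::int. exp (- (pi * T / 2 * (x + 2 * of_int k)\<^sup>2)))"

lemma decay_summable:
 assumes "T > 0"
 shows "(%k::int. exp (- (pi * T / 2 * (x + 2 * of_int k)\<^sup>2))) summable_on UNIV"
proof -
 have "Im (2 * \<i> * of_real T) > 0" using assms by simp
 from summable_on_cmult_right[OF jtheta_summable[OF this, of "\<i> * of_real (T * x)"], of "exp (- (pi * T / 2 * x\<^sup>2))"]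
 show ?thesis
  by (rule back_subst[of "%f. f summable_on UNIV"])
    (auto simp: norm_expi power2_eq_square algebra_simps simp flip: exp_add of_int_power)
qed

lemma decay_shift: "decay T (x + 2 * of_int m) = decay T x"
proof -
 have bij: "bij_betw (%k::int. k + m) UNIV UNIV"
  by (rule bij_betwI[where g = "%k. k - m"]) auto
 show ?thesis
  using infsum_reindex_bij_betw[OF bij, of "%k. exp (- (pi * T / 2 * (x + 2 * of_int k)\<^sup>2))"]
  by (simp add: decay_def algebra_simps)
qed

lemma decay_ge:
 assumes "T > 0"
 shows "exp (- (pi * T / 2 * x\<^sup>2)) <= decay T x"
 using finite_sum_le_infsum[OF decay_summable[OF assms, of x], of "{0}"] by (simp add: decay_def)

lemma decay_pos: "T > 0 ==> decay T x > 0"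
 using decay_ge[of T x] by (smt (verit) exp_gt_zero)

text \<open>For \<open>\<bar>x\<bar> < 1 / 2\<close> the point of x + 2 Z nearest to 0 is x, whereas
  every point of x + 1 + 2 Z is farther away; the gap in the exponents grows linearly with
  T.\<close>

lemma decay_ratio:
 fixes e :: int
 assumes x: "\<bar>x\<bar> < 1 / 2" and e: "odd e"
 shows "((%T. decay T (x + of_int e) / decay T x) \<longlongrightarrow> 0) at_top"
proof -
 define g where "g = pi / 2 * (1 - 2 * \<bar>x\<bar>)"
 have g: "g > 0" using x by (simp add: g_def)
 define C where "C = (\<Sum>\<^sub>\<infinity>k::int. exp (- \<bar>real_of_int k\<bar>))"
 from e obtain m where "e = 2 * m + 1" by (auto elim: oddE)
 hence xe: "decay T (x + of_int e) = decay T (x + 1)" for T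
  using decay_shift[of T "x + 1" m] by (simp add: algebra_simps)
 have bound: "decay T (x + of_int e) / decay T x <= C * exp (1 - T * g)" if T: "T >= 1 / g" for T
 proof -
  have T0: "T > 0" using T g by (meson less_le_trans zero_less_divide_1_iff)
  have Tg: "T * g >= 1" using T g by (simp add: field_simps)
  have summand: "exp (- (pi * T / 2 * (x + 1 + 2 * of_int k)\<^sup>2)) <=
    exp (- (pi * T / 2 * x\<^sup>2)) * exp (1 - T * g) * exp (- \<bar>real_of_int k\<bar>)" for k :: int
  proof -
   \<comment> \<open>The exponents differ by at least T g N with N = \<bar>2 k + 1\<bar>, and T g N
     >= T g - 1 + N. This separates a factor tending to 0 uniformly in k from a summable
     one.\<close>
   define N where "N = \<bar>2 * real_of_int k + 1\<bar>"
   have "1 <= \<bar>2 * k + 1\<bar>" "\<bar>k\<bar> <= \<bar>2 * k + 1\<bar>" by presburger+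
   hence "real_of_int 1 <= of_int \<bar>2 * k + 1\<bar>" "real_of_int \<bar>k\<bar> <= of_int \<bar>2 * k + 1\<bar>" by linarith+
   hence N: "1 <= N" "\<bar>real_of_int k\<bar> <= N" by (simp_all add: N_def)
   have "N * (1 - 2 * \<bar>x\<bar>) <= N * (N - 2 * \<bar>x\<bar>)" using N by (intro mult_left_mono) auto
   also have "\<dots> <= (x + 1 + 2 * of_int k)\<^sup>2 - x\<^sup>2"
   proof -
    have "N * N = (2 * real_of_int k + 1)\<^sup>2" by (simp add: N_def power2_eq_square)
    moreover have "- (N * \<bar>x\<bar>) <= (2 * real_of_int k + 1) * x" unfolding N_def abs_mult[symmetric] by linarith
    ultimately show ?thesis by (simp add: power2_eq_square algebra_simps)
   qed
   finally have "T * (pi / 2 * (N * (1 - 2 * \<bar>x\<bar>))) <= T * (pi / 2 * ((x + 1 + 2 * of_int k)\<^sup>2 - x\<^sup>2))"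
    using T0 by (intro mult_left_mono) auto
   hence 1: "(T * g) * N <= pi * T / 2 * (x + 1 + 2 * of_int k)\<^sup>2 - pi * T / 2 * x\<^sup>2"
    by (simp add: g_def algebra_simps)
   have "0 <= (T * g - 1) * (N - 1)" using Tg N by (intro mult_nonneg_nonneg) auto
   hence "T * g - 1 + \<bar>real_of_int k\<bar> <= (T * g) * N" using N(2) by (simp add: algebra_simps)
   with 1 show ?thesis by (simp flip: exp_add)
  qed
  have "decay T (x + 1) <= (\<Sum>\<^sub>\<infinity>k::int. exp (- (pi * T / 2 * x\<^sup>2)) * exp (1 - T * g) * exp (- \<bar>real_of_int k\<bar>))"
   unfolding decay_def
   by (rule infsum_mono[OF decay_summable[OF T0] summable_on_cmult_right[OF summable_exp_abs] summand])
  also have "\<dots> = exp (- (pi * T / 2 * x\<^sup>2)) * exp (1 - T * g) * C"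
   unfolding C_def by (rule infsum_cmult_right')
  also have "\<dots> <= decay T x * (C * exp (1 - T * g))"
  proof -
   have "C >= 0" unfolding C_def by (rule infsum_nonneg) simp
   thus ?thesis using mult_right_mono[OF decay_ge[OF T0, of x], of "C * exp (1 - T * g)"] by (simp add: mult_ac)
  qed
  finally show ?thesis using decay_pos[OF T0, of x] by (simp add: xe field_simps)
 qed
 have lim: "((%T. C * exp (1 - T * g)) \<longlongrightarrow> 0) at_top"
  using g by real_asymp
 show ?thesis
 proof (rule tendsto_sandwich[OF _ _ tendsto_const lim])
  show "\<forall>\<^sub>F T in at_top. decay T (x + of_int e) / decay T x <= C * exp (1 - T * g)"
   using eventually_ge_at_top[of "1 / g"] by eventually_elim (rule bound)
  show "\<forall>\<^sub>F T in at_top. 0 <= decay T (x + of_int e) / decay T x"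
   using eventually_gt_at_top[of 0] by eventually_elim (simp add: decay_pos less_imp_le)
 qed
qed

section \<open>Unipotent shears\<close>

text \<open>The unipotent matrix P: besides the diagonal, row i has the single entry r i, in column
  h i. It is polymorphic because it acts on integral, real and complex vectors.\<close>

definition shear :: "('n => nat) => ('n => 'n) => ('n => 'a::comm_ring_1) => 'n => 'a" where
 "shear r h q i = q i + of_nat (r i) * q (h i)"

definition shear_entry :: "('n => nat) => ('n => 'n) => 'n => 'n => complex" where
 "shear_entry r h i a = (if a = i then 1 else 0) + (if a = h i then of_nat (r i) else 0)"

definition shear_matrix :: "('n::finite => nat) => ('n => 'n) => real => complex^'n^'n" where
 "shear_matrix r h T = (\<chi> a b. \<i> * of_real T * (\<Sum>i\<in>UNIV. shear_entry r h i a * shear_entry r h i b))"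

lemma cform_shear_matrix: "cform (shear_matrix r h T) v w = \<i> * of_real T * (\<Sum>i\<in>UNIV. shear r h v i * shear r h w i)"
proof -
 have s: "shear r h v i = (\<Sum>a\<in>UNIV. shear_entry r h i a * v a)" for v i
 proof -
  have "(\<Sum>a\<in>UNIV. shear_entry r h i a * v a) =
    (\<Sum>a\<in>UNIV. (if a = i then v i else 0) + (if a = h i then of_nat (r i) * v (h i) else 0))"
   by (intro sum.cong refl) (auto simp: shear_entry_def algebra_simps)
  thus ?thesis by (simp add: shear_def sum.distrib)
 qed
 define g where "g i a b = shear_entry r h i a * v a * (shear_entry r h i b * w b)" for i a b
 have "(\<Sum>i\<in>UNIV. shear r h v i * shear r h w i) = (\<Sum>i\<in>UNIV. \<Sum>a\<in>UNIV. \<Sum>b\<in>UNIV. g i a b)"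
  unfolding s sum_product g_def ..
 also have "\<dots> = (\<Sum>a\<in>UNIV. \<Sum>i\<in>UNIV. \<Sum>b\<in>UNIV. g i a b)" by (rule sum.swap)
 also have "\<dots> = (\<Sum>a\<in>UNIV. \<Sum>b\<in>UNIV. \<Sum>i\<in>UNIV. g i a b)" by (rule sum.cong[OF refl]) (rule sum.swap)
 finally show ?thesis
  by (simp add: g_def cform_def shear_matrix_def sum_distrib_left sum_distrib_right mult_ac)
qed

text \<open>A row that uses column h i refers to a row without off-diagonal entry, so (P - 1)^2 = 0
  and P has the integral inverse \<open>unshear\<close>.\<close>

locale unipotent =
 fixes d :: "'n::finite => nat" and r :: "'n => nat" and h :: "'n => 'n"
 assumes d: "0 < d i" and r: "r i ~= 0 ==> r (h i) = 0"
begin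

abbreviation "L \<equiv> shear r h"

definition unshear :: "('n => int) => 'n => int" where
 "unshear k i = k i - int (r i) * k (h i)"

lemma L_unshear: "L (unshear k) i = k i"
 using r[of i] by (cases "r i = 0") (auto simp: shear_def unshear_def)

lemma unshear_L: "unshear (L k) i = k i"
 using r[of i] by (cases "r i = 0") (auto simp: shear_def unshear_def)

lemma L_of_real: "L (%i. of_real (x i)) i = (of_real (L x i) :: complex)"
 by (simp add: shear_def)

lemma L_of_int: "L (%i. of_int (x i)) i = (of_int (L x i) :: real)"
 by (simp add: shear_def)

lemma shear_matrix_siegel:
 assumes T: "T > 0"
 shows "shear_matrix r h T \<in> siegel"
 unfolding siegel_iff
proof (intro conjI allI impI)
 show "transpose (shear_matrix r h T) = shear_matrix r h T"
  by (simp add: transpose_def shear_matrix_def vec_eq_iff mult.commute)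
 fix x :: "'n => real" assume "\<exists>i. x i ~= 0"
 then obtain j where j: "x j ~= 0" by blast
 have "\<exists>i. L x i ~= 0"
 proof (rule ccontr)
  assume "\<not> (\<exists>i. L x i ~= 0)"
  hence 0: "x i + real (r i) * x (h i) = 0" for i by (simp add: shear_def)
  have "x i = 0" if "r i = 0" for i using 0[of i] that by simp
  hence "x i = 0" for i using 0[of i] r[of i] by (cases "r i = 0") auto
  thus False using j by blast
 qed
 then obtain i where i: "L x i ~= 0" by blast
 have "0 < (\<Sum>i\<in>UNIV. (L x i)\<^sup>2)"
  by (rule sum_pos2[of _ i]) (use i in auto)
 hence "0 < T * (\<Sum>i\<in>UNIV. (L x i)\<^sup>2)" using T by simp
 moreover have "cform (shear_matrix r h T) (%i. of_real (x i)) (%i. of_real (x i)) = \<i> * of_real (T * (\<Sum>i\<in>UNIV. (L x i)\<^sup>2))"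
  unfolding cform_shear_matrix L_of_real by (simp add: power2_eq_square)
 ultimately show "0 < Im (cform (shear_matrix r h T) (%i. of_real (x i)) (%i. of_real (x i)))" by simp
qed

text \<open>Since P is unimodular, the coset may be parametrised through its inverse. The quadratic
  form becomes a sum of squares of independent coordinates, and the series factors.\<close>

lemma theta_null_shear_matrix:
 assumes T: "T > 0"
 shows "theta_null d (shear_matrix r h T) u = of_real (\<Prod>i\<in>UNIV. decay T (L (%i. of_int (u i) / of_nat (d i)) i))"
proof -
 define y where "y = L (%i. real_of_int (u i) / of_nat (d i))"
 define \<phi> where "\<phi> k i = u i + int (2 * d i) * unshear k i" for k i
 have bij: "bij_betw \<phi> UNIV {m. dcong d 2 m u}"
 proof (rule bij_betwI[where g = "%m. L (%i. (m i - u i) div int (2 * d i))"])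
  show "\<phi> \<in> UNIV \<rightarrow> {m. dcong d 2 m u}" by (simp add: \<phi>_def dcong_def)
  show "L (%i. (\<phi> k i - u i) div int (2 * d i)) = k" for k
   using d by (auto simp: \<phi>_def L_unshear simp del: of_nat_mult)
  show "\<phi> (L (%i. (m i - u i) div int (2 * d i))) = m" if "m \<in> {m. dcong d 2 m u}" for m
   using that by (auto simp: \<phi>_def unshear_L dcong_def fun_eq_iff simp del: of_nat_mult)
 qed auto
 have decay_sum: "(\<Sum>\<^sub>\<infinity>k::int. of_real (exp (- (pi * T / 2 * (x + 2 * of_int k)\<^sup>2)))) = complex_of_real (decay T x)" for x
  unfolding decay_def by (rule infsumI, rule has_sum_of_real, rule has_sum_infsum[OF decay_summable[OF T]])
 have val: "expi (qf (scaled d (shear_matrix r h T)) (\<phi> k) / 4) = (\<Prod>i\<in>UNIV. of_real (exp (- (pi * T / 2 * (y i + 2 * of_int (k i))\<^sup>2))))" for k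
 proof -
  have Lk: "L (%i. real_of_int (\<phi> k i) / of_nat (d i)) i = y i + 2 * of_int (k i)" for i
  proof -
   have "real_of_int (\<phi> k i) / of_nat (d i) = real_of_int (u i) / of_nat (d i) + 2 * of_int (unshear k i)" for i
    using d[of i] by (simp add: \<phi>_def field_simps)
   hence "L (%i. real_of_int (\<phi> k i) / of_nat (d i)) i = y i + 2 * L (%i. of_int (unshear k i)) i"
    by (simp add: y_def shear_def algebra_simps)
   thus ?thesis unfolding L_of_int L_unshear .
  qed
  have "qf (scaled d (shear_matrix r h T)) (\<phi> k) = \<i> * of_real (T * (\<Sum>i\<in>UNIV. (y i + 2 * of_int (k i))\<^sup>2))"
   using cform_shear_matrix[of r h T "%i. of_real (real_of_int (\<phi> k i) / of_nat (d i))" "%i. of_real (real_of_int (\<phi> k i) / of_nat (d i))"]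
   unfolding L_of_real Lk by (simp add: qf_eq_cform scaled_scale power2_eq_square)
  moreover have "2 * of_real pi * \<i> * (\<i> * of_real (T * X) / 4) = complex_of_real (- (pi * T / 2 * X))" for X
   by (simp add: complex_eq_iff)
  ultimately have "expi (qf (scaled d (shear_matrix r h T)) (\<phi> k) / 4) = exp (of_real (- (pi * T / 2 * (\<Sum>i\<in>UNIV. (y i + 2 * of_int (k i))\<^sup>2))))"
   by (simp only: expi_def)
  also have "- (pi * T / 2 * (\<Sum>i\<in>UNIV. (y i + 2 * of_int (k i))\<^sup>2)) = (\<Sum>i\<in>UNIV. - (pi * T / 2 * (y i + 2 * of_int (k i))\<^sup>2))"
   by (simp only: sum_distrib_left sum_negf)
  finally show ?thesis by (simp only: exp_of_real exp_sum[OF finite] of_real_prod)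
 qed
 have "theta_null d (shear_matrix r h T) u = (\<Sum>\<^sub>\<infinity>m\<in>{m. dcong d 2 m u}. expi (qf (scaled d (shear_matrix r h T)) m / 4))"
  unfolding theta_null_eq by (rule infsum_cong_neutral) auto
 also have "\<dots> = (\<Sum>\<^sub>\<infinity>k. \<Prod>i\<in>UNIV. of_real (exp (- (pi * T / 2 * (y i + 2 * of_int (k i))\<^sup>2))))"
  unfolding val[symmetric] by (rule infsum_reindex_bij_betw[OF bij, symmetric])
 also have "\<dots> = (\<Prod>i\<in>UNIV. \<Sum>\<^sub>\<infinity>k::int. of_real (exp (- (pi * T / 2 * (y i + 2 * of_int k)\<^sup>2))))"
  using infsum_prod_PiE_abs[of UNIV "%i k. of_real (exp (- (pi * T / 2 * (y i + 2 * of_int k)\<^sup>2))) :: complex" "%_. UNIV :: int set"]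
   decay_summable[OF T] by (simp add: PiE_UNIV_domain)
 finally show ?thesis unfolding decay_sum by (simp add: y_def)
qed

text \<open>The permutation of subsets induced by P modulo 2; the limit of the rescaled minor is its
  permutation matrix.\<close>

definition parity :: "'n set => 'n set" where
 "parity \<eta> = {i. odd (L (%i. if i \<in> \<eta> then 1 else 0 :: int) i)}"

lemma bij_parity: "bij parity"
proof -
 have "inj parity"
 proof (rule injI)
  fix \<eta> \<eta>' assume e: "parity \<eta> = parity \<eta>'"
  have *: "odd (L (%i. if i \<in> \<eta> then 1 else 0 :: int) i) \<longleftrightarrow> odd (L (%i. if i \<in> \<eta>' then 1 else 0 :: int) i)" for i
   using e by (auto simp: parity_def set_eq_iff)
  have 0: "i \<in> \<eta> \<longleftrightarrow> i \<in> \<eta>'" if "r i = 0" for i using *[of i] that by (simp add: shear_def split: if_splits)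
  have "i \<in> \<eta> \<longleftrightarrow> i \<in> \<eta>'" for i
  proof (cases "r i = 0")
   case False
   hence "h i \<in> \<eta> \<longleftrightarrow> h i \<in> \<eta>'" using r 0 by blast
   thus ?thesis using *[of i] by (simp add: shear_def split: if_splits)
  qed (rule 0)
  thus "\<eta> = \<eta>'" by blast
 qed
 thus ?thesis by (simp add: bij_def finite_UNIV_inj_surj)
qed

text \<open>By the choice of \<kappa> the argument of each entry is an integral vector plus \<delta>
  with components below 1/2 in modulus. After division of row \<eta> by the product of
  \<open>decay T (\<delta> \<eta> i)\<close>, an entry tends to 1 if its integral vector is even and
  to 0 otherwise.\<close>

lemma eventually_minor_nonzero:
 assumes \<kappa>: "\<And>\<eta> i. \<bar>L (%i. of_int (\<kappa> \<eta> i) / real (d i)) i - (L (%i. of_int (p i) / real (d i)) i + (if i \<in> \<eta> then 1 else 0)) / 2\<bar> < 1 / 4"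
 shows "\<forall>\<^sub>F T in at_top. minor d (theta_null d (shear_matrix r h T)) p \<kappa> ~= 0"
proof -
 define \<delta> where "\<delta> \<eta> i = 2 * L (%i. of_int (\<kappa> \<eta> i) / of_nat (d i)) i - L (%i. of_int (p i) / of_nat (d i)) i - (if i \<in> \<eta> then 1 else 0 :: real)" for \<eta> i
 have "\<bar>2 * x - y - b\<bar> < 1 / 2" if "\<bar>x - (y + b) / 2\<bar> < 1 / 4" for x y b :: real using that by argo
 from this[OF \<kappa>] have \<delta>: "\<bar>\<delta> \<eta> i\<bar> < 1 / 2" for \<eta> i unfolding \<delta>_def .
 define e where "e \<eta> \<eta>' i = (if i \<in> \<eta> then 1 else 0) - L (%i. if i \<in> \<eta>' then 1 else 0 :: int) i" for \<eta> \<eta>' i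
 define q where "q T \<eta> \<eta>' = (\<Prod>i\<in>UNIV. decay T (\<delta> \<eta> i + of_int (e \<eta> \<eta>' i)) / decay T (\<delta> \<eta> i))" for T \<eta> \<eta>'
 define A where "A T = (\<chi> \<eta> \<eta>'. complex_of_real (q T \<eta> \<eta>'))" for T
 define P where "P = (\<chi> \<eta> \<eta>'. if \<eta> = parity \<eta>' then 1 else (0 :: complex))"
 have entry: "theta_null d (shear_matrix r h T) (%i. 2 * \<kappa> \<eta> i - p i - subset_shift d \<eta>' i) =
   of_real ((\<Prod>i\<in>UNIV. decay T (\<delta> \<eta> i)) * q T \<eta> \<eta>')" if T: "T > 0" for T \<eta> \<eta>'
 proof -
  have "L (%i. real_of_int (2 * \<kappa> \<eta> i - p i - subset_shift d \<eta>' i) / of_nat (d i)) i = \<delta> \<eta> i + of_int (e \<eta> \<eta>' i)" for i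
  proof -
   have frac: "real_of_int (2 * \<kappa> \<eta> i - p i - subset_shift d \<eta>' i) / of_nat (d i) =
     2 * (of_int (\<kappa> \<eta> i) / of_nat (d i)) - of_int (p i) / of_nat (d i) - of_int (if i \<in> \<eta>' then 1 else 0)" for i
    using d[of i] by (simp add: subset_shift_def diff_divide_distrib)
   have "L (%i. real_of_int (2 * \<kappa> \<eta> i - p i - subset_shift d \<eta>' i) / of_nat (d i)) i =
     2 * L (%i. of_int (\<kappa> \<eta> i) / of_nat (d i)) i - L (%i. of_int (p i) / of_nat (d i)) i - L (%i. of_int (if i \<in> \<eta>' then 1 else 0)) i"
    unfolding shear_def frac by (simp add: algebra_simps)
   thus ?thesis unfolding L_of_int by (simp add: \<delta>_def e_def)
  qed
  thus ?thesis
   unfolding theta_null_shear_matrix[OF T] q_def prod.distrib[symmetric]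
   using decay_pos[OF T] by (simp add: less_imp_neq[symmetric])
 qed
 have "((%T. q T \<eta> \<eta>') \<longlongrightarrow> (if \<eta> = parity \<eta>' then 1 else 0)) at_top" for \<eta> \<eta>'
 proof -
  have "((%T. decay T (\<delta> \<eta> i + of_int (e \<eta> \<eta>' i)) / decay T (\<delta> \<eta> i)) \<longlongrightarrow> (if even (e \<eta> \<eta>' i) then 1 else 0)) at_top" for i
  proof (cases "even (e \<eta> \<eta>' i)")
   case True
   then obtain m where "e \<eta> \<eta>' i = 2 * m" by (auto elim: evenE)
   hence shift: "decay T (\<delta> \<eta> i + of_int (e \<eta> \<eta>' i)) = decay T (\<delta> \<eta> i)" for T using decay_shift[of T "\<delta> \<eta> i" m] by simp
   have "\<forall>\<^sub>F T in at_top. decay T (\<delta> \<eta> i + of_int (e \<eta> \<eta>' i)) / decay T (\<delta> \<eta> i) = 1"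
    using eventually_gt_at_top[of 0] by eventually_elim (simp add: shift less_imp_neq[OF decay_pos, symmetric])
   thus ?thesis using True by (simp add: tendsto_eventually)
  next
   case False
   thus ?thesis using decay_ratio[OF \<delta> False] by simp
  qed
  note factor = this
  have "((%T. q T \<eta> \<eta>') \<longlongrightarrow> (\<Prod>i\<in>UNIV. if even (e \<eta> \<eta>' i) then 1 else 0)) at_top"
   unfolding q_def by (intro tendsto_prod factor)
  moreover have "(\<Prod>i\<in>UNIV. if even (e \<eta> \<eta>' i) then 1 else 0 :: real) = (if \<eta> = parity \<eta>' then 1 else 0)"
  proof -
   have "even (e \<eta> \<eta>' i) \<longleftrightarrow> (i \<in> \<eta> \<longleftrightarrow> i \<in> parity \<eta>')" for i by (simp add: e_def parity_def)
   hence "(\<forall>i. even (e \<eta> \<eta>' i)) \<longleftrightarrow> \<eta> = parity \<eta>'" by blast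
   thus ?thesis by (auto simp: prod_zero_iff)
  qed
  ultimately show ?thesis by simp
 qed
 from tendsto_of_real[OF this, where ?'a = complex] have lim: "((%T. A T $ \<eta> $ \<eta>') \<longlongrightarrow> P $ \<eta> $ \<eta>') at_top" for \<eta> \<eta>'
  unfolding A_def P_def vec_lambda_beta if_distrib[of complex_of_real] of_real_0 of_real_1 .
 have "((%T. det (A T)) \<longlongrightarrow> det P) at_top"
  unfolding det_def by (intro tendsto_intros lim)
 moreover have "det P ~= 0"
 proof -
  have "(\<Sum>\<eta>'\<in>UNIV. P $ \<eta> $ \<eta>' * transpose P $ \<eta>' $ \<eta>'') = (\<Sum>\<eta>'\<in>UNIV. if \<eta>' = inv parity \<eta> then (if \<eta> = \<eta>'' then 1 else 0) else 0)" for \<eta> \<eta>''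
   by (intro sum.cong refl) (use bij_parity in \<open>auto simp: P_def transpose_def bij_def surj_f_inv_f\<close>)
  hence "P ** transpose P = mat 1"
   by (simp add: vec_eq_iff matrix_matrix_mult_def mat_def)
  hence "det P * det (transpose P) = 1" by (metis det_I det_mul)
  thus ?thesis by auto
 qed
 ultimately have "\<forall>\<^sub>F T in at_top. det (A T) ~= 0" by (rule tendsto_imp_eventually_ne)
 thus ?thesis
  using eventually_gt_at_top[of 0]
 proof eventually_elim
  case (elim T)
  define D where "D \<eta> = complex_of_real (\<Prod>i\<in>UNIV. decay T (\<delta> \<eta> i))" for \<eta>
  have "minor d (theta_null d (shear_matrix r h T)) p \<kappa> = det (\<chi> \<eta>. D \<eta> *s A T $ \<eta>)"
   unfolding minor_def entry[OF elim(2)] by (rule arg_cong[where f = det]) (simp add: vec_eq_iff D_def A_def)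
  also have "\<dots> = prod D UNIV * det (A T)" using det_rows_mul[of D "%\<eta>. A T $ \<eta>"] by simp
  finally show ?case
   using elim decay_pos[OF elim(2)] by (simp add: D_def prod_zero_iff less_imp_neq[symmetric])
 qed
qed

lemma minors_nonzero_somewhere:
 assumes round: "\<And>c :: 'n => real. \<exists>\<kappa> :: 'n => int. \<forall>i. \<bar>L (%i. of_int (\<kappa> i) / of_nat (d i)) i - c i\<bar> < 1 / 4"
 shows "\<exists>Z\<in>siegel. \<exists>\<kappa>. \<forall>p\<in>residues d 2. minor d (theta_null d Z) p (\<kappa> p) ~= 0"
proof -
 define \<kappa> where "\<kappa> p \<eta> = (SOME k :: 'n => int. \<forall>i. \<bar>L (%i. of_int (k i) / real (d i)) i -
   (L (%i. of_int (p i) / real (d i)) i + (if i \<in> \<eta> then 1 else 0)) / 2\<bar> < 1 / 4)" for p \<eta>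
 have "\<forall>\<^sub>F T in at_top. minor d (theta_null d (shear_matrix r h T)) p (\<kappa> p) ~= 0" for p
 proof (rule eventually_minor_nonzero)
  fix \<eta> i
  show "\<bar>L (%i. of_int (\<kappa> p \<eta> i) / real (d i)) i - (L (%i. of_int (p i) / real (d i)) i + (if i \<in> \<eta> then 1 else 0)) / 2\<bar> < 1 / 4"
   using someI_ex[OF round[of "%i. (L (%i. of_int (p i) / of_nat (d i)) i + (if i \<in> \<eta> then 1 else 0)) / 2"]]
   unfolding \<kappa>_def by blast
 qed
 hence "\<forall>\<^sub>F T in at_top. \<forall>p\<in>residues d 2. minor d (theta_null d (shear_matrix r h T)) p (\<kappa> p) ~= 0"
  by (intro eventually_ball_finite) auto
 from eventually_conj[OF this eventually_gt_at_top[of 0]] obtain T where "T > 0"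
  "\<forall>p\<in>residues d 2. minor d (theta_null d (shear_matrix r h T)) p (\<kappa> p) ~= 0"
  using eventually_happens'[OF trivial_limit_at_top_linorder] by blast
 thus ?thesis using shear_matrix_siegel by blast
qed

end

section \<open>Simultaneous approximation by ternary digits\<close>

lemma round_to_multiple:
 fixes y t :: real
 assumes "0 < m"
 obtains k :: int where "\<bar>(t + of_int k) / m - y\<bar> <= 1 / (2 * m)"
proof -
 define k where "k = round (m * y - t)"
 have "\<bar>of_int k - (m * y - t)\<bar> <= 1 / 2" unfolding k_def by (rule of_int_round_abs_le)
 hence "\<bar>t + of_int k - m * y\<bar> <= 1 / 2" by linarith
 hence "\<bar>t + of_int k - m * y\<bar> / m <= (1 / 2) / m" using assms by (intro divide_right_mono) auto
 moreover have "(t + of_int k) / m - y = (t + of_int k - m * y) / m" using assms by (simp add: field_simps)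
 hence "\<bar>(t + of_int k) / m - y\<bar> = \<bar>t + of_int k - m * y\<bar> / m" using assms by (simp add: abs_divide)
 ultimately show ?thesis using that[of k] by simp
qed

text \<open>The digits \<open>t p\<close> are realised one after the other; later corrections form a geometric series of sum less than \<open>1/4\<close>.\<close>

lemma ternary_approximation:
 fixes t :: "nat => real" and m :: nat
 assumes m: "3 ^ f <= m"
 obtains k :: int where "\<And>p. p < f ==> \<exists>l::int. \<bar>3 ^ p * (of_int k / of_nat m) - t p - of_int l\<bar> < 1 / 4"
proof -
 \<comment> \<open>The next y realises digit n exactly and moves by at most 1 / (2 * 3 ^ n). With u
   = 3 ^ p / 3 ^ n the error at p grows from (1 - 3 u) / 4 to at most (1 - 3 u) / 4 + u / 2 = (1 -
   u) / 4, which is the bound for n + 1.\<close>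
 have "\<exists>y. \<forall>p<n. \<exists>l::int. \<bar>3 ^ p * y - t p - of_int l\<bar> <= 1 / 4 * (1 - 3 ^ (p + 1) / 3 ^ n)" for n
 proof (induction n)
  case (Suc n)
  then obtain y where y: "\<And>p. p < n ==> \<exists>l::int. \<bar>3 ^ p * y - t p - of_int l\<bar> <= 1 / 4 * (1 - 3 ^ (p + 1) / 3 ^ n)" by blast
  obtain k :: int where k: "\<bar>(t n + of_int k) / 3 ^ n - y\<bar> <= 1 / (2 * 3 ^ n)"
   using round_to_multiple[of "3 ^ n" "t n" y] by auto
  define z where "z = (t n + of_int k) / 3 ^ n"
  have "\<exists>l::int. \<bar>3 ^ p * z - t p - of_int l\<bar> <= 1 / 4 * (1 - 3 ^ (p + 1) / 3 ^ Suc n)" if p: "p < Suc n" for p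
  proof (cases "p = n")
   case True
   have "3 ^ n * z - t n - of_int k = 0" by (simp add: z_def)
   thus ?thesis using True by (intro exI[of _ k]) simp
  next
   case False
   then obtain l :: int where l: "\<bar>3 ^ p * y - t p - of_int l\<bar> <= 1 / 4 * (1 - 3 ^ (p + 1) / 3 ^ n)" using y[of p] p by auto
   have "\<bar>3 ^ p * z - 3 ^ p * y\<bar> = 3 ^ p * \<bar>z - y\<bar>" by (simp add: abs_mult flip: right_diff_distrib)
   also have "\<dots> <= 3 ^ p * (1 / (2 * 3 ^ n))" using k by (intro mult_left_mono) (simp_all add: z_def)
   finally have zy: "\<bar>3 ^ p * z - 3 ^ p * y\<bar> <= 3 ^ p / 3 ^ n / 2" by simp
   define u where "u = (3 ^ p / 3 ^ n :: real)"
   have u: "3 ^ (p + 1) / 3 ^ n = 3 * u" "3 ^ (p + 1) / 3 ^ Suc n = u" by (simp_all add: u_def)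
   have "\<bar>3 ^ p * z - t p - of_int l\<bar> <= 1 / 4 * (1 - u)" using l[unfolded u] zy[folded u_def] by argo
   thus ?thesis unfolding u by blast
  qed
  thus ?case by blast
 qed simp
 from this[of f] obtain y where y: "\<And>p. p < f ==> \<exists>l::int. \<bar>3 ^ p * y - t p - of_int l\<bar> <= 1 / 4 * (1 - 3 ^ (p + 1) / 3 ^ f)" by blast
 have m0: "0 < real m" using m by (metis less_le_trans of_nat_0_less_iff zero_less_numeral zero_less_power)
 \<comment> \<open>Rounding y to a multiple of 1 / m costs at most half of 3 ^ - f, as much as one
   more step of the induction; strictness comes from u > 0.\<close>
 obtain k :: int where k: "\<bar>of_int k / real m - y\<bar> <= 1 / (2 * real m)"
  using round_to_multiple[OF m0, of 0 y] by auto
 show ?thesis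
 proof (rule that[of k])
  fix p assume p: "p < f"
  obtain l :: int where l: "\<bar>3 ^ p * y - t p - of_int l\<bar> <= 1 / 4 * (1 - 3 ^ (p + 1) / 3 ^ f)" using y[OF p] by blast
  have "3 ^ f <= real m" using m by (metis of_nat_le_iff of_nat_numeral of_nat_power)
  hence "1 / (2 * real m) <= 1 / (2 * 3 ^ f)" using m0 by (intro divide_left_mono) auto
  define a where "a = of_int k / real m"
  have k': "\<bar>a - y\<bar> <= 1 / (2 * 3 ^ f)" using k \<open>1 / (2 * real m) <= 1 / (2 * 3 ^ f)\<close> unfolding a_def by linarith
  have "\<bar>3 ^ p * a - 3 ^ p * y\<bar> = 3 ^ p * \<bar>a - y\<bar>" by (simp add: abs_mult flip: right_diff_distrib)
  also have "\<dots> <= 3 ^ p * (1 / (2 * 3 ^ f))" using k' by (intro mult_left_mono) auto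
  finally have ay: "\<bar>3 ^ p * a - 3 ^ p * y\<bar> <= 3 ^ p / 3 ^ f / 2" by simp
  define u where "u = (3 ^ p / 3 ^ f :: real)"
  have u: "3 ^ (p + 1) / 3 ^ f = 3 * u" "0 < u" by (simp_all add: u_def)
  have "\<bar>3 ^ p * a - t p - of_int l\<bar> < 1 / 4" using l[unfolded u(1)] ay[folded u_def] u(2) by argo
  thus "\<exists>l::int. \<bar>3 ^ p * (of_int k / of_nat m) - t p - of_int l\<bar> < 1 / 4" unfolding a_def by blast
 qed
qed

text \<open>For the largest k with \<open>3 ^ k <= m\<close> one has
  \<open>m <= 3 ^ (k + 1) - 1\<close>, and this is at most \<open>2 * 4 ^ k\<close>, with equality
  for k = 0 and k = 1. The constant 8 = 2 * 4 of the theorem originates here.\<close>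

lemma ternary_logarithm:
 fixes m :: nat
 assumes "m >= 1"
 obtains k where "3 ^ k <= m" "m <= 2 * 4 ^ k"
proof -
 obtain k where k: "3 ^ k <= m" "m < 3 ^ (k + 1)" using ex_power_ivl1[of 3 m] assms by auto
 have "(3::nat) ^ (k + 1) <= 2 * 4 ^ k + 1"
 proof (induction k)
  case (Suc k)
  show ?case
  proof (cases "k = 0")
   case False
   hence "(4::nat) ^ 1 <= 4 ^ k" by (intro power_increasing) auto
   thus ?thesis using Suc by simp
  qed simp
 qed simp
 thus ?thesis using that k by simp
qed

text \<open>
 The indices with \<open>d i < 3\<close> are too small to round on their own. Each of them is paired with a
 ternary digit of some \<open>d (h i)\<close>; the lower bound on \<open>\<Prod>i. d i\<close> provides enough digits.
\<close>

lemma unipotent_rounding: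
 fixes d :: "'n::finite => nat"
 assumes d: "\<And>i. 0 < d i" and big: "8 ^ CARD('n) <= 2 * (\<Prod>i\<in>UNIV. d i)"
 obtains r h where "unipotent d r h"
  "\<And>c :: 'n => real. \<exists>\<kappa> :: 'n => int. \<forall>i. \<bar>shear r h (%i. of_int (\<kappa> i) / of_nat (d i)) i - c i\<bar> < 1 / 4"
proof -
 have "\<forall>i. \<exists>k. 3 ^ k <= d i \<and> d i <= 2 * 4 ^ k" using ternary_logarithm d by (metis Suc_leI One_nat_def)
 then obtain f where f: "\<And>i. 3 ^ f i <= d i" "\<And>i. d i <= 2 * 4 ^ f i" by metis
 define S where "S = {i. f i = 0}"
 \<comment> \<open>The digits 1, ..., f h - 1 of each large index h are spare; digit 0 is reserved
   for the coordinate h itself.\<close>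
 define slots where "slots = (SIGMA h:- S. {1..<f h})"
 \<comment> \<open>Taking logarithms to base 4, the factor 2 costs less than one unit, so the
   integer inequality n <= sum of f survives. Subtracting one digit for each large index leaves at
   least as many slots as small indices.\<close>
 have "8 ^ CARD('n) <= 2 * (\<Prod>i\<in>(UNIV :: 'n set). 2 * 4 ^ f i :: nat)"
  using big prod_mono[of UNIV d "%i. 2 * 4 ^ f i"] f(2) by (meson le_trans mult_le_mono2 zero_le)
 also have "(\<Prod>i\<in>(UNIV :: 'n set). 2 * 4 ^ f i :: nat) = 2 ^ CARD('n) * 4 ^ (\<Sum>i\<in>UNIV. f i)"
  by (simp add: prod.distrib power_sum)
 finally have "2 ^ CARD('n) * (4 :: nat) ^ CARD('n) <= 2 ^ CARD('n) * (2 * 4 ^ (\<Sum>i\<in>UNIV. f i))"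
  by (simp flip: power_mult_distrib)
 hence "(4 :: nat) ^ CARD('n) <= 2 * 4 ^ (\<Sum>i\<in>UNIV. f i)" by (simp only: mult_le_cancel1) simp
 moreover have "0 < (4 :: nat) ^ (\<Sum>i\<in>UNIV. f i)" by simp
 ultimately have "(4 :: nat) ^ CARD('n) < 4 ^ Suc (\<Sum>i\<in>UNIV. f i)" unfolding power_Suc by linarith
 hence "CARD('n) < Suc (\<Sum>i\<in>UNIV. f i)" by (rule power_less_imp_less_exp[rotated]) simp
 hence "CARD('n) <= (\<Sum>i\<in>UNIV. f i)" by simp
 also have "(\<Sum>i\<in>UNIV. f i) = (\<Sum>i\<in>- S. f i)" by (rule sum.mono_neutral_right) (auto simp: S_def)
 also have "\<dots> = (\<Sum>i\<in>- S. (f i - 1) + 1)" by (rule sum.cong) (auto simp: S_def)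
 also have "\<dots> = card slots + card (- S)"
 proof -
  have "card slots = (\<Sum>i\<in>- S. f i - 1)" by (simp add: slots_def)
  thus ?thesis unfolding sum.distrib by simp
 qed
 finally have "card S <= card slots"
  using card_Diff_subset[of S UNIV] card_mono[of UNIV S] by (simp add: Compl_eq_Diff_UNIV)
 then obtain g where g: "g ` S \<subseteq> slots" "inj_on g S" using card_le_inj[of S slots] by (auto simp: slots_def)
 define h where "h i = (if i \<in> S then fst (g i) else i)" for i
 define r where "r i = (if i \<in> S then 3 ^ snd (g i) else 0 :: nat)" for i
 have gi: "h i \<notin> S" "1 <= snd (g i)" "snd (g i) < f (h i)" if "i \<in> S" for i
  using g(1) that by (force simp: slots_def h_def)+
 show ?thesis
 proof (rule that[of r h])
  show "unipotent d r h" by unfold_locales (use d gi in \<open>auto simp: r_def split: if_splits\<close>)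
  fix c :: "'n => real"
  \<comment> \<open>Digit 0 of j aims at the target c j, and a spare digit aims at the target of the
    small index paired with it.\<close>
  define t where "t j p = (if p = 0 then c j else if \<exists>i\<in>S. g i = (j, p) then c (inv_into S g (j, p)) else 0)" for j p
  have "\<forall>j. \<exists>k::int. \<forall>p<f j. \<exists>l::int. \<bar>3 ^ p * (of_int k / of_nat (d j)) - t j p - of_int l\<bar> < 1 / 4"
   using ternary_approximation[OF f(1)] by metis
  then obtain k :: "'n => int" where k: "\<And>j p. p < f j ==> \<exists>l::int. \<bar>3 ^ p * (of_int (k j) / of_nat (d j)) - t j p - of_int l\<bar> < 1 / 4"
   by metis
  have "\<exists>l::int. \<bar>of_int (k j) / of_nat (d j) - c j - of_int l\<bar> < 1 / 4" if "j \<notin> S" for j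
   using k[of 0 j] that by (simp add: S_def t_def)
  then obtain l :: "'n => int" where l: "\<And>j. j \<notin> S ==> \<bar>of_int (k j) / of_nat (d j) - c j - of_int (l j)\<bar> < 1 / 4" by metis
  have "\<exists>m::int. \<bar>3 ^ snd (g i) * (of_int (k (h i)) / of_nat (d (h i))) - c i - of_int m\<bar> < 1 / 4" if i: "i \<in> S" for i
  proof -
   have "g i = (h i, snd (g i))" using i by (simp add: h_def)
   hence "t (h i) (snd (g i)) = c i" using i gi(2)[OF i] inv_into_f_f[OF g(2) i] by (auto simp: t_def)
   thus ?thesis using k[OF gi(3)[OF i]] by simp
  qed
  then obtain m :: "'n => int" where m: "\<And>i. i \<in> S ==> \<bar>3 ^ snd (g i) * (of_int (k (h i)) / of_nat (d (h i))) - c i - of_int (m i)\<bar> < 1 / 4" by metis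
  \<comment> \<open>The digits were approximated modulo integers only. At large indices l is
    subtracted; at small ones an integral multiple of d i compensates both m and the effect of l (h
    i) through the shear.\<close>
  define \<kappa> where "\<kappa> i = (if i \<in> S then int (d i) * (3 ^ snd (g i) * l (h i) - m i) else k i - int (d i) * l i)" for i
  have \<kappa>B: "of_int (\<kappa> i) / real (d i) = of_int (k i) / of_nat (d i) - of_int (l i)" if "i \<notin> S" for i
   using that d[of i] by (simp add: \<kappa>_def field_simps)
  have \<kappa>S: "of_int (\<kappa> i) / real (d i) = 3 ^ snd (g i) * of_int (l (h i)) - of_int (m i)" if "i \<in> S" for i
   using that d[of i] by (simp add: \<kappa>_def)
  have "\<bar>shear r h (%i. of_int (\<kappa> i) / of_nat (d i)) i - c i\<bar> < 1 / 4" for i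
  proof (cases "i \<in> S")
   case True
   hence "shear r h (%i. of_int (\<kappa> i) / real (d i)) i = 3 ^ snd (g i) * (of_int (k (h i)) / of_nat (d (h i))) - of_int (m i)"
    unfolding shear_def \<kappa>S[OF True] \<kappa>B[OF gi(1)[OF True]] by (simp add: r_def algebra_simps)
   hence "shear r h (%i. of_int (\<kappa> i) / real (d i)) i - c i =
     3 ^ snd (g i) * (of_int (k (h i)) / of_nat (d (h i))) - c i - of_int (m i)" by simp
   thus ?thesis using m[OF True] by (simp only:)
  next
   case False
   thus ?thesis using l[OF False] by (simp add: shear_def r_def \<kappa>B algebra_simps)
  qed
  thus "\<exists>\<kappa> :: 'n => int. \<forall>i. \<bar>shear r h (%i. of_int (\<kappa> i) / of_nat (d i)) i - c i\<bar> < 1 / 4" by blast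
 qed
qed

section \<open>The theorem\<close>

lemma siegel_action_one:
 fixes d :: "'n::finite => nat"
 assumes d: "\<And>i. 0 < d i"
 shows "(mat 1, 0, 0, mat 1) \<in> paramodular_group d" "siegel_action d (mat 1, 0, 0, mat 1) Z = Z"
proof -
 have "transpose (0 :: complex^'n^'n) = 0" by (simp add: transpose_def vec_eq_iff)
 thus "(mat 1, 0, 0, mat 1) \<in> paramodular_group d"
  by (auto simp: paramodular_group_def integral_matrix_def mat_def transpose_mat)
    (auto simp flip: mat_def simp: transpose_mat)
 show "siegel_action d (mat 1, 0, 0, mat 1) Z = Z"
 proof -
  have "0 ** M = (0 :: complex^'n^'n)" for M :: "complex^'n^'n" by (simp add: matrix_matrix_mult_def vec_eq_iff)
  thus ?thesis using diag_matrix_inv[where d = d, OF d] by (simp add: siegel_action_def denominator_def matrix_inv_one)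
 qed
qed

theorem theorem1p3:
  fixes d :: "'n::{finite,linorder} \<Rightarrow> nat"
  assumes "\<And>i. 0 < d i"
    and "\<And>i j. i \<le> j \<Longrightarrow> d i dvd d j"
    and "real (\<Prod>i\<in>UNIV. d i)
           \<ge> 8 ^ CARD('n) / 2 * (real CARD('n) ^ CARD('n) / fact CARD('n))"
  shows "holds_for_general d projectively_normal"
proof -
  note d = assms(1) and dv = assms(2)
  \<comment> \<open>From n! <= n^n.\<close>
  have "8 ^ CARD('n) / 2 * 1 \<le> 8 ^ CARD('n) / 2 * (real CARD('n) ^ CARD('n) / fact CARD('n))"
    using fact_le_power[of "CARD('n)", where ?'a = real] by (intro mult_left_mono) (simp_all add: field_simps)
  hence "real (8 ^ CARD('n)) \<le> real (2 * (\<Prod>i\<in>UNIV. d i))" using assms(3) by simp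
  hence "8 ^ CARD('n) \<le> 2 * (\<Prod>i\<in>UNIV. d i)" by (simp only: of_nat_le_iff)
  from unipotent_rounding[where d = d, OF d this] obtain r h where "unipotent d r h"
    "\<And>c :: 'n \<Rightarrow> real. \<exists>\<kappa> :: 'n \<Rightarrow> int. \<forall>i. \<bar>shear r h (\<lambda>i. of_int (\<kappa> i) / of_nat (d i)) i - c i\<bar> < 1 / 4"
    by metis
  from unipotent.minors_nonzero_somewhere[OF this] obtain Z0 \<kappa> where
    Z0: "Z0 \<in> siegel" "\<And>p. p \<in> residues d 2 \<Longrightarrow> minor d (theta_null d Z0) p (\<kappa> p) \<noteq> 0" by blast
  obtain F k where F: "modular_form d k F" "\<exists>Z\<in>siegel. F Z \<noteq> 0"
    "\<And>Z p. Z \<in> siegel \<Longrightarrow> F Z \<noteq> 0 \<Longrightarrow> \<exists>\<kappa>. minor d (theta_null d Z) p \<kappa> \<noteq> 0"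
    using modular_form_exists[where d = d and \<kappa> = \<kappa>, OF d dv Z0] by metis
  \<comment> \<open>The locus where the modular form F does not vanish.\<close>
  define U where "U = {x \<in> moduli_space d. \<exists>Z\<in>x. F Z \<noteq> 0}"
  have "zariski_open d U"
    unfolding zariski_open_def zariski_closed_def
  proof (intro conjI exI[of _ "{F}"])
    show "moduli_space d - U = {x \<in> moduli_space d. \<forall>Z\<in>x. \<forall>f\<in>{F}. f Z = 0}" by (auto simp: U_def)
  qed (use F(1) in \<open>auto simp: U_def\<close>)
  moreover have "U \<noteq> {}"
  proof -
    obtain Z where Z: "Z \<in> siegel" "F Z \<noteq> 0" using F(2) by blast
    define E where "E = {(Z, W). Z \<in> siegel \<and> W \<in> siegel \<and> (\<exists>R\<in>paramodular_group d. W = siegel_action d R Z)}"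
    have "Z \<in> E `` {Z}"
      using Z(1) siegel_action_one(1)[where d = d, OF d] siegel_action_one(2)[where d = d and Z = Z, OF d, symmetric]
      unfolding E_def by blast
    moreover have "E `` {Z} \<in> moduli_space d"
      unfolding moduli_space_def E_def[symmetric] by (rule quotientI[OF Z(1)])
    ultimately show ?thesis using Z(2) by (auto simp: U_def)
  qed
  moreover have "projectively_normal \<Lambda> e"
    if A: "polarized_abelian_variety \<Lambda> e \<and> polarization_type d \<Lambda> e \<and> moduli_point d \<Lambda> e \<in> U" for \<Lambda> e
  proof -
    obtain Z where Z: "Z \<in> moduli_point d \<Lambda> e" "F Z \<noteq> 0" and m: "moduli_point d \<Lambda> e \<in> moduli_space d"
      using A by (auto simp: U_def)
    \<comment> \<open>A moduli point in U is an orbit, and orbits consist of elements of the Siegel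
      space.\<close>
    have "Z \<in> siegel" using m Z(1) by (auto simp: moduli_space_def elim!: quotientE)
    obtain a b where ab: "symplectic_basis d \<Lambda> e a b" "\<And>i. a i = (\<Sum>j\<in>UNIV. (Z $ j $ i / of_nat (d j)) *s b j)"
      using Z(1) by (auto simp: moduli_point_def)
    show ?thesis
    proof (rule projectively_normal_if_minors_nonzero[where d = d, OF _ _ ab(1) \<open>Z \<in> siegel\<close> d ab(2)])
      show "\<exists>\<kappa>. minor d (\<lambda>u. theta d (scaled d Z) 2 u 0) p \<kappa> \<noteq> 0" for p
        using F(3)[OF \<open>Z \<in> siegel\<close> Z(2), of p] by (simp add: theta_null_def[abs_def])
    qed (use A in \<open>auto simp: polarized_abelian_variety_def\<close>)
  qed
  ultimately show ?thesis unfolding holds_for_general_def by blast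
qed

end
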